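(* Assume that $X$ is complete and supports a $(1,p)$-Poincar\'e inequality, that $\mu$ is doubling and that $p>1$. Let $E\subset X$ be a bounded measurable set such that $C_p(X\setminus E)>0$. Let $E_0$ be a $p$-path almost open measurable set such that $\operatorname{fine-int}E\subset E_0\subset E$, and let $f\in D^p(E)$ and $\psi_j:E\to[-\infty,\infty]$, $j=1,2$, be such that $\mathcal{K}_{\psi_1,\psi_2,f}(E)\ne\varnothing$. Then the solutions of the $\mathcal{K}_{\psi_1,\psi_2,f}(E)$-problem coincide with the solutions of the $\mathcal{K}_{\psi_1,\psi_2,f}(E_0)$-problem. Moreover, if $\mu(E\setminus E_0)=0$ then also the $p$-energies associated with these two problems coincide, i.e. $\int_E g_{u,E}^p\,d\mu=\int_{E_0}g_{u,E_0}^p\,d\mu$ for $u\in\mathcal{K}_{\psi_1,\psi_2,f}(E)$. In particular, this holds if $\mu(\partial E)=0$. If $f\in D^p(\Omega)$ for some open set $\Omega\supset E$, then the solutions of the $\mathcal{K}_{\psi_1,\psi_2,f}(E)$-problem (equivalently, of the $\mathcal{K}_{\psi_1,\psi_2,f}(E_0)$-problem) coincide with the solutions of the $\mathcal{K}'_{\psi_1,\psi_2,f}(E)$-problem.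
   Context: $1\le p<\infty$ and $X=(X,d,\mu)$ is a metric space with a Borel regular measure $\mu$ (defined on the completion of the Borel $\sigma$-algebra) such that $0<\mu(B)<\infty$ for all balls $B=B(x,r)=\{y:d(x,y)<r\}$; $\lambda B=B(x,\lambda r)$. $\mu$ is doubling if $\mu(2B)\le C\mu(B)$ for all balls $B$ with a fixed $C$. Curves are nonconstant, compact and rectifiable, parameterized by arc length as $\gamma:[0,l_\gamma]\to X$. A property holds for $p$-almost every curve if the family $\Gamma$ of curves for which it fails has zero $p$-modulus, i.e. there is a nonnegative Borel $\rho\in L^p(X)$ with $\int_\gamma\rho\,ds=\infty$ for every $\gamma\in\Gamma$. A nonnegative Borel function $g$ is an upper gradient of $u:X\to[-\infty,\infty]$ if $|u(\gamma(0))-u(\gamma(l_\gamma))|\le\int_\gamma g\,ds$ for all curves $\gamma$ (the left-hand side is $\infty$ whenever both terms are infinite); a nonnegative measurable $g$ is a $p$-weak upper gradient if this holds for $p$-almost every curve. If $u$ has an upper gradient in $L^p_{\rm loc}(X)$ (local: each point has a ball on which the property holds), its minimal $p$-weak upper gradient $g_u\in L^p_{\rm loc}(X)$ is the (a.e. unique) $p$-weak upper gradient satisfying $g_u\le g$ a.e. for every $p$-weak upper gradient $g\in L^p_{\rm loc}(X)$ of $u$. $N^{1,p}(X)$ is the set of everywhere defined measurable $u:X\to[-\infty,\infty]$ having an upper gradient in $L^p_{\rm loc}(X)$ with $\|u\|_{N^{1,p}(X)}=(\int_X|u|^p\,d\mu+\int_X g_u^p\,d\mu)^{1/p}<\infty$.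 $D^p(X)$ is the set of everywhere defined measurable functions having an upper gradient in $L^p(X)$; $D^p_{\rm loc}(X)$ is the local version (on some ball around each point). For measurable $A\subset X$, $N^{1,p}(A)$, $D^p(A)$ and the minimal $p$-weak upper gradient $g_{u,A}$ are defined by regarding $A$ as a metric space on its own (with $d$, $\mu$ restricted to $A$, and only curves in $A$); $g_u:=g_{u,X}$, and for open $\Omega$, $g_{u,\Omega}$ is also denoted $g_u$. $X$ supports a $(1,p)$-Poincar\'e inequality if there are $C>0$, $\lambda\ge1$ such that for all balls $B$ and all integrable $u\in D^p_{\rm loc}(X)$, $\frac1{\mu(B)}\int_B|u-u_B|\,d\mu\le C(\mathrm{diam}\,B)\bigl(\frac1{\mu(\lambda B)}\int_{\lambda B}g_u^p\,d\mu\bigr)^{1/p}$, where $u_B=\frac1{\mu(B)}\int_B u\,d\mu$. The capacity of $A\subset X$ is $C_p(A)=\inf\|u\|_{N^{1,p}(X)}^p$ over all $u\in N^{1,p}(X)$ with $u=1$ on $A$; q.e. means outside a set of $C_p$-capacity zero (always with respect to $X$). For any $A\subset X$, $N^{1,p}_0(A)=\{h|_A: h\in N^{1,p}(X),\ h=0 \text{ on } X\setminus A\}$; such functions are regarded as extended by $0$ outside $A$ when needed. For bounded measurable $A\subset X$ with $C_p(X\setminus A)>0$ and $f\in D^p(A)$, $\mathcal{K}_{\psi_1,\psi_2,f}(A)=\{v\in D^p(A): v-f\in N^{1,p}_0(A)\text{ and }\psi_1\le v\le\psi_2\text{ q.e. in }A\}$, and $u\in\mathcal{K}_{\psi_1,\psi_2,f}(A)$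 is a solution of the $\mathcal{K}_{\psi_1,\psi_2,f}(A)$-(obstacle) problem if $\int_A g_{u,A}^p\,d\mu\le\int_A g_{v,A}^p\,d\mu$ for all $v\in\mathcal{K}_{\psi_1,\psi_2,f}(A)$. If $f\in D^p(\Omega)$ with $\Omega\supset E$ open, $\mathcal{K}'_{\psi_1,\psi_2,f}(E)=\{v\in D^p(\Omega): v-f\in N^{1,p}_0(E)\text{ and }\psi_1\le v\le\psi_2\text{ q.e. in }E\}$, and a solution of the $\mathcal{K}'_{\psi_1,\psi_2,f}(E)$-problem is a minimizer of $\int_E g_v^p\,d\mu$ (with $g_v$ taken with respect to $\Omega$, equivalently $X$) among all $v\in\mathcal{K}'_{\psi_1,\psi_2,f}(E)$. When comparing the problems, functions on $E_0$ or $E$ are identified with functions on the larger set $E$ or $\Omega$ by extending them by $f$, and functions which are equal q.e. are identified. A set $G\subset X$ is $p$-path almost open (in $X$) if for $p$-almost every curve $\gamma:[0,l_\gamma]\to X$, $\gamma^{-1}(G)$ is the union of a (relatively) open subset of $[0,l_\gamma]$ and a set with zero one-dimensional Lebesgue measure. For a nonempty bounded $G\subset X$ and $A\subset G$, the variational capacity is $\mathrm{cap}_p(A,G)=\inf\int_X g_u^p\,d\mu$ over all $u\in N^{1,p}_0(G)$ (extended by $0$) with $u\ge1$ on $A$. A set $A$ is thin at $x$ if $$\int_0^1\Bigl(\frac{\mathrm{cap}_p(A\cap B(x,r),B(x,2r))}{\mathrm{cap}_p(B(x,r),B(x,2r))}\Bigr)^{1/(p-1)}\frac{dr}{r}<\infty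 ,$$ where the integrand is $1$ (by convention) whenever $\mathrm{cap}_p(B(x,r),B(x,2r))=0$. A set $U$ is finely open if $X\setminus U$ is thin at every $x\in U$; finely open sets form a topology. $\operatorname{fine-int}E$ is the largest finely open set contained in $E$. *)

theory Defs
  imports "HOL-Analysis.Analysis"
begin

text \<open>
  The metric space \<open>X\<close> is a type of class \<^class>\<open>metric_space\<close>. Every notion that is also used on
  a subset \<open>A\<close>, regarded as a metric space of its own, takes \<open>A\<close> as an argument. Functions on \<open>A\<close>
  are total functions whose values outside \<open>A\<close> play no role.
\<close>

section \<open>Powers and the standing assumptions on the measure\<close>

definition epowr :: "ennreal \<Rightarrow> real \<Rightarrow> ennreal" where
  "epowr x a = (if x = \<infinity> then \<infinity> else ennreal (enn2real x powr a))"  \<comment> \<open>only used for \<open>a > 0\<close>\<close>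

text \<open>
  A Borel regular measure defined on the completion of the Borel sigma-algebra is the completion of
  a Borel measure (and conversely).
\<close>

definition metric_measure :: "'a::metric_space measure \<Rightarrow> bool" where
  "metric_measure \<mu> \<longleftrightarrow>
     (\<exists>N. sets N = sets borel \<and> \<mu> = completion N) \<and>
     (\<forall>x r. 0 < r \<longrightarrow> 0 < emeasure \<mu> (ball x r) \<and> emeasure \<mu> (ball x r) < \<infinity>)"

definition doubling :: "'a::metric_space measure \<Rightarrow> bool" where
  "doubling \<mu> \<longleftrightarrow>
     (\<exists>C::real. \<forall>x r. 0 < r \<longrightarrow> emeasure \<mu> (ball x (2 * r)) \<le> ennreal C * emeasure \<mu> (ball x r))"

section \<open>Curves and modulus\<close>

definition curve_length :: "(real \<Rightarrow> 'a::metric_space) \<Rightarrow> real \<Rightarrow> real \<Rightarrow> ennreal" where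
  "curve_length \<gamma> a b =
     (SUP (n, t) \<in> {(n, t). mono_on {..n} t \<and> t ` {..n} \<subseteq> {a..b}}.
        \<Sum>i<n::nat. ennreal (dist (\<gamma> (t i)) (\<gamma> (t (Suc i)))))"

text \<open>
  A nonconstant rectifiable curve in \<open>A\<close> is given by its length \<open>l > 0\<close> and its arc length
  parameterization on \<open>{0..l}\<close>, which is automatically 1-Lipschitz, hence continuous.
\<close>

definition curves :: "'a::metric_space set \<Rightarrow> (real \<times> (real \<Rightarrow> 'a)) set" where
  "curves A = {(l, \<gamma>). 0 < l \<and> \<gamma> ` {0..l} \<subseteq> A \<and>
     (\<forall>s t. 0 \<le> s \<and> s \<le> t \<and> t \<le> l \<longrightarrow> curve_length \<gamma> s t = ennreal (t - s))}"

definition line_integral :: "('a \<Rightarrow> ennreal) \<Rightarrow> real \<times> (real \<Rightarrow> 'a) \<Rightarrow> ennreal" where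
  "line_integral \<rho> c = (\<integral>\<^sup>+t\<in>{0..fst c}. \<rho> (snd c t) \<partial>lebesgue)"

definition zero_modulus ::
    "real \<Rightarrow> 'a::metric_space measure \<Rightarrow> 'a set \<Rightarrow> (real \<times> (real \<Rightarrow> 'a)) set \<Rightarrow> bool" where
  "zero_modulus p \<mu> A \<Gamma> \<longleftrightarrow>
     (\<exists>\<rho> \<in> borel_measurable (restrict_space borel A).
        (\<integral>\<^sup>+x\<in>A. epowr (\<rho> x) p \<partial>\<mu>) < \<infinity> \<and> (\<forall>c\<in>\<Gamma>. line_integral \<rho> c = \<infinity>))"

definition ae_curve ::
    "real \<Rightarrow> 'a::metric_space measure \<Rightarrow> 'a set \<Rightarrow> (real \<times> (real \<Rightarrow> 'a) \<Rightarrow> bool) \<Rightarrow> bool" where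
  "ae_curve p \<mu> A P \<longleftrightarrow> zero_modulus p \<mu> A {c \<in> curves A. \<not> P c}"

definition path_almost_open :: "real \<Rightarrow> 'a::metric_space measure \<Rightarrow> 'a set \<Rightarrow> bool" where
  "path_almost_open p \<mu> G \<longleftrightarrow>
     ae_curve p \<mu> UNIV (\<lambda>(l, \<gamma>). \<exists>U N. openin (top_of_set {0..l}) U \<and> N \<in> null_sets lebesgue \<and>
       {t \<in> {0..l}. \<gamma> t \<in> G} = U \<union> N)"

section \<open>Upper gradients\<close>

definition jump :: "ereal \<Rightarrow> ereal \<Rightarrow> ennreal" where
  "jump a b = (if \<bar>a\<bar> = \<infinity> \<and> \<bar>b\<bar> = \<infinity> then \<infinity> else e2ennreal \<bar>a - b\<bar>)"

definition gradient_inequality ::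
    "('a \<Rightarrow> ereal) \<Rightarrow> ('a \<Rightarrow> ennreal) \<Rightarrow> real \<times> (real \<Rightarrow> 'a) \<Rightarrow> bool" where
  "gradient_inequality u g c \<longleftrightarrow> jump (u (snd c 0)) (u (snd c (fst c))) \<le> line_integral g c"

definition upper_gradient ::
    "'a::metric_space set \<Rightarrow> ('a \<Rightarrow> ereal) \<Rightarrow> ('a \<Rightarrow> ennreal) \<Rightarrow> bool" where
  "upper_gradient A u g \<longleftrightarrow>
     g \<in> borel_measurable (restrict_space borel A) \<and> (\<forall>c\<in>curves A. gradient_inequality u g c)"

text \<open>
  A function \<open>g\<close> measurable with respect to the completion agrees a.e. with a Borel function, and
  then the two agree along almost all of almost every curve; hence the line integral below makes
  sense for almost every curve.
\<close>

definition weak_upper_gradient ::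
    "real \<Rightarrow> 'a::metric_space measure \<Rightarrow> 'a set \<Rightarrow> ('a \<Rightarrow> ereal) \<Rightarrow> ('a \<Rightarrow> ennreal) \<Rightarrow> bool" where
  "weak_upper_gradient p \<mu> A u g \<longleftrightarrow>
     g \<in> borel_measurable (restrict_space \<mu> A) \<and> ae_curve p \<mu> A (gradient_inequality u g)"

definition Lp_fin :: "real \<Rightarrow> 'a measure \<Rightarrow> 'a set \<Rightarrow> ('a \<Rightarrow> ennreal) \<Rightarrow> bool" where
  "Lp_fin p \<mu> A g \<longleftrightarrow> (\<integral>\<^sup>+x\<in>A. epowr (g x) p \<partial>\<mu>) < \<infinity>"

definition Lp_loc :: "real \<Rightarrow> 'a::metric_space measure \<Rightarrow> 'a set \<Rightarrow> ('a \<Rightarrow> ennreal) \<Rightarrow> bool" where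
  "Lp_loc p \<mu> A g \<longleftrightarrow> (\<forall>x\<in>A. \<exists>r>0. Lp_fin p \<mu> (A \<inter> ball x r) g)"

definition is_min_weak_upper_gradient ::
    "real \<Rightarrow> 'a::metric_space measure \<Rightarrow> 'a set \<Rightarrow> ('a \<Rightarrow> ereal) \<Rightarrow> ('a \<Rightarrow> ennreal) \<Rightarrow> bool" where
  "is_min_weak_upper_gradient p \<mu> A u g \<longleftrightarrow>
     weak_upper_gradient p \<mu> A u g \<and> Lp_loc p \<mu> A g \<and>
     (\<forall>g'. weak_upper_gradient p \<mu> A u g' \<and> Lp_loc p \<mu> A g' \<longrightarrow>
        (AE x in \<mu>. x \<in> A \<longrightarrow> g x \<le> g' x))"

text \<open>The minimal p-weak upper gradient \<open>g\<^bsub>u,A\<^esub>\<close>, unique up to null sets.\<close>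

definition min_gradient ::
    "real \<Rightarrow> 'a::metric_space measure \<Rightarrow> 'a set \<Rightarrow> ('a \<Rightarrow> ereal) \<Rightarrow> 'a \<Rightarrow> ennreal" where
  "min_gradient p \<mu> A u = (SOME g. is_min_weak_upper_gradient p \<mu> A u g)"

section \<open>Function spaces\<close>

definition newton_norm ::
    "real \<Rightarrow> 'a::metric_space measure \<Rightarrow> 'a set \<Rightarrow> ('a \<Rightarrow> ereal) \<Rightarrow> ennreal" where
  "newton_norm p \<mu> A u =
     epowr ((\<integral>\<^sup>+x\<in>A. epowr (e2ennreal \<bar>u x\<bar>) p \<partial>\<mu>) +
            (\<integral>\<^sup>+x\<in>A. epowr (min_gradient p \<mu> A u x) p \<partial>\<mu>)) (1 / p)"

definition newton_space ::
    "real \<Rightarrow> 'a::metric_space measure \<Rightarrow> 'a set \<Rightarrow> ('a \<Rightarrow> ereal) set" where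
  "newton_space p \<mu> A = {u \<in> borel_measurable (restrict_space \<mu> A).
     (\<exists>g. upper_gradient A u g \<and> Lp_loc p \<mu> A g) \<and> newton_norm p \<mu> A u < \<infinity>}"

definition dirichlet_space ::
    "real \<Rightarrow> 'a::metric_space measure \<Rightarrow> 'a set \<Rightarrow> ('a \<Rightarrow> ereal) set" where
  "dirichlet_space p \<mu> A = {u \<in> borel_measurable (restrict_space \<mu> A).
     \<exists>g. upper_gradient A u g \<and> Lp_fin p \<mu> A g}"

definition dirichlet_space_loc ::
    "real \<Rightarrow> 'a::metric_space measure \<Rightarrow> 'a set \<Rightarrow> ('a \<Rightarrow> ereal) set" where
  "dirichlet_space_loc p \<mu> A = {u. \<forall>x\<in>A. \<exists>r>0. u \<in> dirichlet_space p \<mu> (A \<inter> ball x r)}"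

text \<open>
  Here \<open>w\<close> is a function on \<open>A\<close>; its extension by 0 outside \<open>A\<close> is the function \<open>h\<close>.
\<close>

definition newton_space0 ::
    "real \<Rightarrow> 'a::metric_space measure \<Rightarrow> 'a set \<Rightarrow> ('a \<Rightarrow> ereal) set" where
  "newton_space0 p \<mu> A =
     {w. \<exists>h \<in> newton_space p \<mu> UNIV. (\<forall>x. x \<notin> A \<longrightarrow> h x = 0) \<and> (\<forall>x\<in>A. w x = h x)}"

text \<open>
  An integrable extended real function is finite a.e., so its mean value may be computed with
  \<^const>\<open>real_of_ereal\<close>, which sends the infinite values to 0.
\<close>

definition mean_value :: "'a measure \<Rightarrow> 'a set \<Rightarrow> ('a \<Rightarrow> ereal) \<Rightarrow> real" where
  "mean_value \<mu> B u = (LINT y:B|\<mu>. real_of_ereal (u y)) / measure \<mu> B"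

definition poincare_inequality :: "real \<Rightarrow> 'a::metric_space measure \<Rightarrow> bool" where
  "poincare_inequality p \<mu> \<longleftrightarrow>
     (\<exists>C>0. \<exists>\<Lambda>\<ge>1. \<forall>x r. \<forall>u \<in> dirichlet_space_loc p \<mu> UNIV.
        0 < r \<and> u \<in> borel_measurable \<mu> \<and> (\<integral>\<^sup>+y. e2ennreal \<bar>u y\<bar> \<partial>\<mu>) < \<infinity> \<longrightarrow>
        (\<integral>\<^sup>+y\<in>ball x r. e2ennreal \<bar>u y - ereal (mean_value \<mu> (ball x r) u)\<bar> \<partial>\<mu>)
            / emeasure \<mu> (ball x r)
        \<le> ennreal (C * diameter (ball x r)) *
           epowr ((\<integral>\<^sup>+y\<in>ball x (\<Lambda> * r). epowr (min_gradient p \<mu> UNIV u y) p \<partial>\<mu>)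
              / emeasure \<mu> (ball x (\<Lambda> * r))) (1 / p))"

section \<open>Capacities and the fine topology\<close>

definition sobolev_capacity :: "real \<Rightarrow> 'a::metric_space measure \<Rightarrow> 'a set \<Rightarrow> ennreal" where
  "sobolev_capacity p \<mu> A =
     (INF u \<in> {u \<in> newton_space p \<mu> UNIV. \<forall>x\<in>A. u x = 1}. epowr (newton_norm p \<mu> UNIV u) p)"

definition qe_in :: "real \<Rightarrow> 'a::metric_space measure \<Rightarrow> 'a set \<Rightarrow> ('a \<Rightarrow> bool) \<Rightarrow> bool" where
  "qe_in p \<mu> A P \<longleftrightarrow> (\<exists>Z. sobolev_capacity p \<mu> Z = 0 \<and> (\<forall>x \<in> A - Z. P x))"

definition variational_capacity ::
    "real \<Rightarrow> 'a::metric_space measure \<Rightarrow> 'a set \<Rightarrow> 'a set \<Rightarrow> ennreal" where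
  "variational_capacity p \<mu> A G =
     (INF u \<in> {u \<in> newton_space0 p \<mu> G. (\<forall>x. x \<notin> G \<longrightarrow> u x = 0) \<and> (\<forall>x\<in>A. 1 \<le> u x)}.
        \<integral>\<^sup>+x. epowr (min_gradient p \<mu> UNIV u x) p \<partial>\<mu>)"

text \<open>The integrand that is 1 by convention is the one integrated against \<open>dr/r\<close>.\<close>

definition thin_at :: "real \<Rightarrow> 'a::metric_space measure \<Rightarrow> 'a set \<Rightarrow> 'a \<Rightarrow> bool" where
  "thin_at p \<mu> A x \<longleftrightarrow>
     (\<integral>\<^sup>+r\<in>{0<..<1}.
        (if variational_capacity p \<mu> (ball x r) (ball x (2 * r)) = 0 then 1
         else epowr (variational_capacity p \<mu> (A \<inter> ball x r) (ball x (2 * r))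
                / variational_capacity p \<mu> (ball x r) (ball x (2 * r))) (1 / (p - 1)))
        * ennreal (1 / r) \<partial>lebesgue) < \<infinity>"

definition finely_open :: "real \<Rightarrow> 'a::metric_space measure \<Rightarrow> 'a set \<Rightarrow> bool" where
  "finely_open p \<mu> U \<longleftrightarrow> (\<forall>x\<in>U. thin_at p \<mu> (- U) x)"

definition fine_interior :: "real \<Rightarrow> 'a::metric_space measure \<Rightarrow> 'a set \<Rightarrow> 'a set" where
  "fine_interior p \<mu> E = \<Union>{U. finely_open p \<mu> U \<and> U \<subseteq> E}"

section \<open>Obstacle problems\<close>

text \<open>
  In \<open>v - f\<close> below the difference of two infinite values of the same sign is \<open>\<infinity>\<close>, as it is for
  \<^typ>\<open>ereal\<close>. As functions in the Newtonian space are finite q.e. and may be changed arbitrarily on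
  sets of zero capacity, membership of \<open>v - f\<close> says in particular that \<open>v\<close> and \<open>f\<close> are finite q.e.
  in \<open>A\<close>, and the value chosen on the exceptional set is irrelevant.
\<close>

definition obstacle_class ::
    "real \<Rightarrow> 'a::metric_space measure \<Rightarrow> ('a \<Rightarrow> ereal) \<Rightarrow> ('a \<Rightarrow> ereal) \<Rightarrow> ('a \<Rightarrow> ereal) \<Rightarrow> 'a set
      \<Rightarrow> ('a \<Rightarrow> ereal) set" where
  "obstacle_class p \<mu> \<psi>1 \<psi>2 f A =
     {v \<in> dirichlet_space p \<mu> A. (\<lambda>x. v x - f x) \<in> newton_space0 p \<mu> A \<and>
        qe_in p \<mu> A (\<lambda>x. \<psi>1 x \<le> v x \<and> v x \<le> \<psi>2 x)}"

definition p_energy ::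
    "real \<Rightarrow> 'a::metric_space measure \<Rightarrow> 'a set \<Rightarrow> ('a \<Rightarrow> ereal) \<Rightarrow> ennreal" where
  "p_energy p \<mu> A u = (\<integral>\<^sup>+x\<in>A. epowr (min_gradient p \<mu> A u x) p \<partial>\<mu>)"

definition obstacle_solutions ::
    "real \<Rightarrow> 'a::metric_space measure \<Rightarrow> ('a \<Rightarrow> ereal) \<Rightarrow> ('a \<Rightarrow> ereal) \<Rightarrow> ('a \<Rightarrow> ereal) \<Rightarrow> 'a set
      \<Rightarrow> ('a \<Rightarrow> ereal) set" where
  "obstacle_solutions p \<mu> \<psi>1 \<psi>2 f A =
     {u \<in> obstacle_class p \<mu> \<psi>1 \<psi>2 f A.
        \<forall>v \<in> obstacle_class p \<mu> \<psi>1 \<psi>2 f A. p_energy p \<mu> A u \<le> p_energy p \<mu> A v}"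

text \<open>
  For functions \<open>v\<close> and \<open>f\<close> on \<open>\<Omega>\<close>, that \<open>v - f\<close> belongs to the Newtonian space with zero boundary
  values on \<open>E\<close> includes that \<open>v = f\<close> in \<open>\<Omega> - E\<close>; in this form it is also meaningful at points where
  \<open>f\<close> is infinite.
\<close>

definition obstacle_class' ::
    "real \<Rightarrow> 'a::metric_space measure \<Rightarrow> ('a \<Rightarrow> ereal) \<Rightarrow> ('a \<Rightarrow> ereal) \<Rightarrow> ('a \<Rightarrow> ereal) \<Rightarrow> 'a set
      \<Rightarrow> 'a set \<Rightarrow> ('a \<Rightarrow> ereal) set" where
  "obstacle_class' p \<mu> \<psi>1 \<psi>2 f \<Omega> E =
     {v \<in> dirichlet_space p \<mu> \<Omega>.
        (\<forall>x \<in> \<Omega> - E. v x = f x) \<and> (\<lambda>x. v x - f x) \<in> newton_space0 p \<mu> E \<and>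
        qe_in p \<mu> E (\<lambda>x. \<psi>1 x \<le> v x \<and> v x \<le> \<psi>2 x)}"

definition obstacle_solutions' ::
    "real \<Rightarrow> 'a::metric_space measure \<Rightarrow> ('a \<Rightarrow> ereal) \<Rightarrow> ('a \<Rightarrow> ereal) \<Rightarrow> ('a \<Rightarrow> ereal) \<Rightarrow> 'a set
      \<Rightarrow> 'a set \<Rightarrow> ('a \<Rightarrow> ereal) set" where
  "obstacle_solutions' p \<mu> \<psi>1 \<psi>2 f \<Omega> E =
     {u \<in> obstacle_class' p \<mu> \<psi>1 \<psi>2 f \<Omega> E.
        \<forall>v \<in> obstacle_class' p \<mu> \<psi>1 \<psi>2 f \<Omega> E.
          (\<integral>\<^sup>+x\<in>E. epowr (min_gradient p \<mu> \<Omega> u x) p \<partial>\<mu>)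
          \<le> (\<integral>\<^sup>+x\<in>E. epowr (min_gradient p \<mu> \<Omega> v x) p \<partial>\<mu>)}"

definition extend_by :: "('a \<Rightarrow> ereal) \<Rightarrow> 'a set \<Rightarrow> ('a \<Rightarrow> ereal) \<Rightarrow> 'a \<Rightarrow> ereal" where
  "extend_by f A u = (\<lambda>x. if x \<in> A then u x else f x)"

text \<open>Equality of two sets of functions on \<open>G\<close> when functions equal q.e. in \<open>G\<close> are identified.\<close>

definition coincide_qe ::
    "real \<Rightarrow> 'a::metric_space measure \<Rightarrow> 'a set \<Rightarrow> ('a \<Rightarrow> ereal) set \<Rightarrow> ('a \<Rightarrow> ereal) set \<Rightarrow> bool" where
  "coincide_qe p \<mu> G S T \<longleftrightarrow>
     (\<forall>u\<in>S. \<exists>v\<in>T. qe_in p \<mu> G (\<lambda>x. u x = v x)) \<and> (\<forall>v\<in>T. \<exists>u\<in>S. qe_in p \<mu> G (\<lambda>x. u x = v x))"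

end

theory Submission
 imports Defs
begin

text \<open>
 The three problems have the same admissible functions, up to sets of zero capacity, as soon as every
 \<open>h\<close> in the Newtonian space that vanishes outside \<open>E\<close> vanishes q.e. outside the fine interior of \<open>E\<close>;
 their energies then differ by a constant, because minimal gradients are local and restrict well to
 path almost open sets.

 For the vanishing let \<open>w = min (k |h|) 1\<close> with minimal gradient \<open>g\<close>. Q.e. the Wolff potential
 \<open>\<Sum>j. (r\<^sub>j\<^sup>p \<nu>(B\<^sub>j) / \<mu>(B\<^sub>j)) powr (1 / (p - 1))\<close> of \<open>\<nu> = g\<^sup>p \<mu>\<close> over the balls \<open>B\<^sub>j\<close> of radius
 \<open>r\<^sub>j = K powr (-j)\<close> is finite, and q.e. where \<open>w = 1\<close> the averages of \<open>w\<close> over \<open>B\<^sub>j\<close> are at least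
 \<open>1 / 2\<close> for large \<open>j\<close>. At such a point a weak type estimate for \<open>w\<close> bounds the capacity of
 \<open>{w = 0} \<inter> B\<^sub>j\<close>, tested with a cutoff of \<open>max 0 (1 - 4 w)\<close>, by a multiple of \<open>\<nu>(B\<^sub>j\<^sub>-\<^sub>2)\<close>. Hence the
 integral in the definition of thinness is controlled by the Wolff potential.
\<close>

section \<open>Extended nonnegative powers\<close>

text \<open>The difficulty is the passage from almost everywhere to quasi everywhere. A set has
  capacity zero exactly when it is null and almost every curve misses it, and each q.e. statement is
  reduced to one test, \<open>exceptional_criterion\<close>: functions at least 1 on the set,
  tending to 0 a.e., with slopes tending to 0 in L^p. Three sets are treated in this way. Where the
  Wolff sum diverges, a Lipschitz version of it truncated at height t has energy at most linear in
  t; division by t leaves the order t^(1-p), and this is where p > 1 enters. Averages of w converge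
  along a fast subsequence at every point of almost every curve, since their slopes are at most a
  multiple of g plus an L^p-small error. The skipped scales need another argument: if averages near
  1 recur while others fall below 1/2, then at some scale a ball and its enlargement have comparable
  nu-mass, and cutoffs on disjoint balls of this kind cost at most a multiple of the nu-mass of a
  small neighbourhood of a null set. Gradients are treated throughout as integral bounds along
  curves; no derivatives are formed.\<close>

abbreviation lint :: "real \<Rightarrow> real \<Rightarrow> (real \<Rightarrow> ennreal) \<Rightarrow> ennreal" where
 "lint s t f \<equiv> \<integral>\<^sup>+x\<in>{s..t}. f x \<partial>lborel"

abbreviation borel_fun :: "('a::topological_space \<Rightarrow> 'b::topological_space) \<Rightarrow> bool" where
 "borel_fun f \<equiv> f \<in> borel_measurable borel"

declare infinity_ennreal_def [simp]

lemma epowr_top [simp]: "epowr top a = top" by (simp add: epowr_def)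

lemma epowr_ennreal: "0 \<le> r \<Longrightarrow> epowr (ennreal r) a = ennreal (r powr a)" by (simp add: epowr_def)

lemma epowr_0 [simp]: "epowr 0 a = 0" by (simp add: epowr_def)

lemma epowr_1 [simp]: "epowr 1 a = 1" by (simp add: epowr_def)

lemma epowr_1_right [simp]: "epowr x 1 = x" by (cases x) (auto simp: epowr_def)

lemma epowr_mono: "0 \<le> a \<Longrightarrow> x \<le> y \<Longrightarrow> epowr x a \<le> epowr y a"
 by (cases x; cases y) (auto simp: epowr_ennreal powr_mono2 ennreal_leI top_unique)

lemma epowr_mult: "0 < a \<Longrightarrow> epowr (x * y) a = epowr x a * epowr y a"
proof (cases "x = 0 \<or> y = 0")
 case False
 assume "0 < a"
 with False show ?thesis by (cases x; cases y)
   (auto simp: epowr_ennreal ennreal_mult[symmetric] powr_mult ennreal_top_mult ennreal_mult_top)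
qed auto

lemma epowr_epowr: "epowr (epowr x a) b = epowr x (a * b)" by (cases x) (auto simp: epowr_ennreal powr_powr)

lemma epowr_eq_0_iff: "0 < a \<Longrightarrow> epowr x a = 0 \<longleftrightarrow> x = 0" by (cases x) (auto simp: epowr_ennreal)

lemma epowr_less_top_iff: "epowr x a < \<infinity> \<longleftrightarrow> x < \<infinity>" by (cases x) (auto simp: epowr_ennreal)

lemma epowr_le_iff: "0 < a \<Longrightarrow> epowr x a \<le> epowr y a \<longleftrightarrow> x \<le> y"
proof
 assume a: "0 < a" and "epowr x a \<le> epowr y a"
 then have "epowr (epowr x a) (1/a) \<le> epowr (epowr y a) (1/a)" using a by (simp add: epowr_mono)
 moreover have "a * (1 / a) = 1" using a by simp
 ultimately show "x \<le> y" by (simp only: epowr_epowr epowr_1_right)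
qed (simp add: epowr_mono)

text \<open>Exponents on both sides of 1 occur below (\<open>p\<close> and \<open>1 / p\<close>), so
  the bound passes through \<open>x + y <= 2 * max x y\<close> instead of convexity.\<close>

lemma epowr_add_le: "0 < a \<Longrightarrow> epowr (x + y) a \<le> ennreal (2 powr a) * (epowr x a + epowr y a)"
proof -
 assume a: "0 < a"
 have "epowr (x + y) a \<le> epowr (2 * max x y) a" using a by (intro epowr_mono) (auto simp: mult_2 intro: add_mono)
 also have "\<dots> = ennreal (2 powr a) * epowr (max x y) a" using a epowr_ennreal[of 2 a] by (simp add: epowr_mult)
 also have "epowr (max x y) a \<le> epowr x a + epowr y a" by (auto simp: max_def add_increasing add_increasing2)
 finally show ?thesis by (simp add: mult_left_mono)
qed

lemma epowr_measurable [measurable]: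
 assumes [measurable]: "f \<in> borel_measurable M"
 shows "(\<lambda>x. epowr (f x) a) \<in> borel_measurable M" unfolding epowr_def by measurable

section \<open>Jumps of extended real functions\<close>

lemma jump_real [simp]: "jump (ereal a) (ereal b) = ennreal \<bar>a - b\<bar>" by (simp add: jump_def)

lemma jump_less_top:
 assumes "jump a b < \<infinity>" obtains r s where "a = ereal r" "b = ereal s"
 using assms by (cases a; cases b) (auto simp: jump_def)

section \<open>Curves\<close>

lemma curve_length_shift_le:
 "curve_length (\<lambda>\<tau>. \<gamma> (s + \<tau>)) a b \<le> curve_length \<gamma> (s + a) (s + b)" unfolding curve_length_def
proof (rule SUP_least, unfold split_paired_all, simp only: mem_Collect_eq prod.case)
 fix n :: nat and t :: "nat \<Rightarrow> real"
 assume "mono_on {..n} t \<and> t ` {..n} \<subseteq> {a..b}"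
 then have "mono_on {..n} (\<lambda>i. s + t i) \<and> (\<lambda>i. s + t i) ` {..n} \<subseteq> {s + a..s + b}"
  by (auto simp: mono_on_def image_subset_iff)
 then show "(\<Sum>i<n. ennreal (dist (\<gamma> (s + t i)) (\<gamma> (s + t (Suc i)))))
  \<le> (SUP (n, t) \<in> {(n, t). mono_on {..n} t \<and> t ` {..n} \<subseteq> {s + a..s + b}}.
    \<Sum>i<n. ennreal (dist (\<gamma> (t i)) (\<gamma> (t (Suc i)))))" by (intro SUP_upper2[of "(n, \<lambda>i. s + t i)"]) auto
qed

lemma curve_length_shift:
 "curve_length (\<lambda>\<tau>. \<gamma> (s + \<tau>)) a b = curve_length \<gamma> (s + a) (s + b)"
proof (rule antisym[OF curve_length_shift_le])
 show "curve_length \<gamma> (s + a) (s + b) \<le> curve_length (\<lambda>\<tau>. \<gamma> (s + \<tau>)) a b"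
  using curve_length_shift_le[of "\<lambda>\<tau>. \<gamma> (s + \<tau>)" "-s" "s + a" "s + b"] by simp
qed

lemma curves_pos: "c \<in> curves A \<Longrightarrow> 0 < fst c" by (auto simp: curves_def)

lemma curves_in: "c \<in> curves A \<Longrightarrow> 0 \<le> t \<Longrightarrow> t \<le> fst c \<Longrightarrow> snd c t \<in> A" by (auto simp: curves_def)

lemma curves_mono: "A \<subseteq> B \<Longrightarrow> curves A \<subseteq> curves B" unfolding curves_def by blast

lemma curves_UNIV: "c \<in> curves A \<Longrightarrow> c \<in> curves UNIV" using curves_mono[of A UNIV] by auto

lemma curves_dist:
 assumes c: "c \<in> curves A" and st: "0 \<le> s" "s \<le> t" "t \<le> fst c"
 shows "dist (snd c s) (snd c t) \<le> t - s"
proof -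
 let ?t = "\<lambda>i::nat. if i = 0 then s else t"
 have "mono_on {..1} ?t \<and> ?t ` {..1} \<subseteq> {s..t}" using st by (auto simp: mono_on_def)
 then have "(\<Sum>i<1. ennreal (dist (snd c (?t i)) (snd c (?t (Suc i))))) \<le> curve_length (snd c) s t"
  unfolding curve_length_def by (intro SUP_upper2[of "(1, ?t)"]) auto
 also have "\<dots> = ennreal (t - s)" using c st by (auto simp: curves_def)
 finally show ?thesis using st by (simp add: ennreal_le_iff)
qed

lemma curves_lipschitz:
 assumes "c \<in> curves A" "s \<in> {0..fst c}" "t \<in> {0..fst c}"
 shows "dist (snd c s) (snd c t) \<le> \<bar>s - t\<bar>"
 using assms curves_dist[OF assms(1), of s t] curves_dist[OF assms(1), of t s]
 by (cases "s \<le> t") (auto simp: dist_commute)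

lemma curves_continuous: "c \<in> curves A \<Longrightarrow> continuous_on {0..fst c} (snd c)"
 by (rule lipschitz_on_continuous_on[of 1]) (auto simp: lipschitz_on_def dist_real_def curves_lipschitz)

definition subcurve :: "real \<times> (real \<Rightarrow> 'a) \<Rightarrow> real \<Rightarrow> real \<Rightarrow> real \<times> (real \<Rightarrow> 'a)" where
 "subcurve c s t = (t - s, \<lambda>\<tau>. snd c (s + \<tau>))"

lemma subcurve_in:
 assumes c: "c \<in> curves A" and st: "0 \<le> s" "s < t" "t \<le> fst c"
  and B: "\<And>\<tau>. s \<le> \<tau> \<Longrightarrow> \<tau> \<le> t \<Longrightarrow> snd c \<tau> \<in> B"
 shows "subcurve c s t \<in> curves B" using assms by (auto simp: subcurve_def curves_def curve_length_shift intro!: B)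

text \<open>Continues the curve by its end points to the whole line, since \<open>snd c\<close> is
  arbitrary outside \<open>{0..fst c}\<close>; compositions with Borel functions are then Borel on
  the line.\<close>

definition clamped :: "real \<times> (real \<Rightarrow> 'a) \<Rightarrow> real \<Rightarrow> 'a" where
 "clamped c t = snd c (max 0 (min (fst c) t))"

lemma clamped_eq: "0 \<le> t \<Longrightarrow> t \<le> fst c \<Longrightarrow> clamped c t = snd c t" by (simp add: clamped_def)

lemma clamped_continuous: "c \<in> curves A \<Longrightarrow> continuous_on UNIV (clamped c)" unfolding clamped_def
 by (rule continuous_on_compose2[OF curves_continuous])
   (auto intro!: continuous_intros dest: curves_pos)

lemma clamped_measurable:
 assumes "c \<in> curves A" shows "clamped c \<in> borel \<rightarrow>\<^sub>M borel"
 by (rule borel_measurable_continuous_onI[OF clamped_continuous[OF assms]])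

lemma curve_measurable:
 assumes c: "c \<in> curves A" and \<rho>: "borel_fun \<rho>"
  and st: "0 \<le> s" "t \<le> fst c"
 shows "borel_fun (\<lambda>\<tau>. (\<rho> (snd c \<tau>) :: ennreal) * indicator {s..t} \<tau>)"
proof -
 note clamped_measurable[OF c, measurable] \<rho>[measurable]
 have "(\<lambda>\<tau>. \<rho> (snd c \<tau>) * indicator {s..t} \<tau>) = (\<lambda>\<tau>. \<rho> (clamped c \<tau>) * indicator {s..t} \<tau>)"
  using st by (auto simp: clamped_eq indicator_def fun_eq_iff)
 then show ?thesis by simp
qed

lemma line_integral_lborel: "line_integral \<rho> c = lint 0 (fst c) (\<lambda>\<tau>. \<rho> (snd c \<tau>))"
 by (simp add: line_integral_def nn_integral_completion)

lemma line_integral_subcurve: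
 assumes c: "c \<in> curves A" and \<rho>: "borel_fun \<rho>"
  and st: "0 \<le> s" "s < t" "t \<le> fst c"
 shows "line_integral \<rho> (subcurve c s t) = lint s t (\<lambda>\<tau>. \<rho> (snd c \<tau>))"
proof -
 have sub: "subcurve c s t \<in> curves UNIV" by (rule subcurve_in[OF c st]) auto
 have "line_integral \<rho> (subcurve c s t) =
   (\<integral>\<^sup>+\<tau>. \<rho> (snd c (s + \<tau>)) * indicator {s..t} (s + \<tau>) \<partial>lborel)" unfolding line_integral_lborel
  by (intro nn_integral_cong) (auto simp: subcurve_def indicator_def)
 also have "\<dots> = lint s t (\<lambda>\<tau>. \<rho> (snd c \<tau>))"
  using nn_integral_real_affine[OF curve_measurable[OF c \<rho>], of s t 1 s] st by simp
 finally show ?thesis .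
qed

lemma line_integral_subcurve_le:
 assumes c: "c \<in> curves A" and \<rho>: "borel_fun \<rho>"
  and st: "0 \<le> s" "s < t" "t \<le> fst c"
 shows "line_integral \<rho> (subcurve c s t) \<le> line_integral \<rho> c"
 unfolding line_integral_subcurve[OF assms] unfolding line_integral_lborel
 using st by (intro nn_integral_mono) (auto simp: indicator_def)

lemma line_integral_mono:
 "(\<And>x. f x \<le> g x) \<Longrightarrow> line_integral f c \<le> line_integral g c"
 unfolding line_integral_def by (intro nn_integral_mono mult_right_mono) auto

lemma line_integral_cmult:
 assumes c: "c \<in> curves A" and "borel_fun \<rho>"
 shows "line_integral (\<lambda>x. a * \<rho> x) c = a * line_integral \<rho> c"
 by (simp add: line_integral_lborel mult.assoc nn_integral_cmult curve_measurable[OF assms])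

lemma line_integral_add:
 assumes c: "c \<in> curves A" and [measurable]: "borel_fun f" "borel_fun g"
 shows "line_integral (\<lambda>x. f x + g x) c = line_integral f c + line_integral g c"
 by (simp add: line_integral_lborel distrib_right nn_integral_add curve_measurable[OF c])

lemma line_integral_cong: "c \<in> curves A \<Longrightarrow> (\<And>x. x \<in> A \<Longrightarrow> f x = g x) \<Longrightarrow> line_integral f c = line_integral g c"
 unfolding line_integral_lborel by (intro nn_integral_cong) (auto simp: indicator_def curves_in)

abbreviation ae_along :: "real \<times> (real \<Rightarrow> 'a) \<Rightarrow> ('a \<Rightarrow> bool) \<Rightarrow> bool" where
 "ae_along c P \<equiv> AE t in lborel. t \<in> {0..fst c} \<longrightarrow> P (snd c t)"

lemma line_integral_cong_AE:
 "ae_along c (\<lambda>x. f x = g x) \<Longrightarrow> line_integral f c = line_integral g c" unfolding line_integral_lborel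
 by (intro nn_integral_cong_AE) (auto elim!: eventually_mono simp: indicator_def)

section \<open>Metric measure spaces and exceptional families of curves\<close>

text \<open>The Borel measure \<open>N\<close> is kept as a parameter because densities, product
  measures and regularity are taken on the Borel sigma-algebra; integrals over \<open>N\<close> and
  over its completion agree.\<close>

locale metric_measure_space =
 fixes \<mu> N :: "'a::metric_space measure" and p :: real
 assumes sets_N: "sets N = sets borel" and mu_eq: "\<mu> = completion N"
  and ball_pos: "\<And>x r. 0 < r \<Longrightarrow> 0 < emeasure \<mu> (ball x r)"
  and ball_finite: "\<And>x r. 0 < r \<Longrightarrow> emeasure \<mu> (ball x r) < \<infinity>"
  and p_gt_1: "1 < p"
begin

abbreviation "min_grad \<equiv> min_gradient p \<mu>"
abbreviation "vcap \<equiv> variational_capacity p \<mu>"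
abbreviation "dirichlet \<equiv> dirichlet_space p \<mu>"
abbreviation "newton \<equiv> newton_space p \<mu>"
abbreviation "loc_Lp \<equiv> Lp_loc p \<mu>"
abbreviation "qe \<equiv> qe_in p \<mu>"

abbreviation muint :: "('a \<Rightarrow> ennreal) \<Rightarrow> ennreal" where
 "muint f \<equiv> \<integral>\<^sup>+x. f x \<partial>\<mu>"

abbreviation muint_on :: "'a set \<Rightarrow> ('a \<Rightarrow> ennreal) \<Rightarrow> ennreal" where
 "muint_on A f \<equiv> \<integral>\<^sup>+x\<in>A. f x \<partial>\<mu>"

abbreviation pint :: "('a \<Rightarrow> ennreal) \<Rightarrow> ennreal" where
 "pint f \<equiv> \<integral>\<^sup>+x. epowr (f x) p \<partial>\<mu>"

abbreviation pint_on :: "'a set \<Rightarrow> ('a \<Rightarrow> ennreal) \<Rightarrow> ennreal" where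
 "pint_on A f \<equiv> \<integral>\<^sup>+x\<in>A. epowr (f x) p \<partial>\<mu>"

lemma p_pos [simp]: "0 < p" "0 \<le> p" "p \<noteq> 0" using p_gt_1 by auto

lemma space_N [simp]: "space N = UNIV" using sets_eq_imp_space_eq[OF sets_N] by simp

lemma space_mu [simp]: "space \<mu> = UNIV" by (simp add: mu_eq)

lemma sets_mu_borel: "A \<in> sets borel \<Longrightarrow> A \<in> sets \<mu>" by (simp add: mu_eq sets_N)

lemma UNIV_mu [simp]: "UNIV \<in> sets \<mu>" by (simp add: sets_mu_borel)

lemma measurable_mu_borel: "borel_fun f \<Longrightarrow> f \<in> borel_measurable \<mu>"
 unfolding mu_eq by (rule measurable_completion) (simp add: measurable_cong_sets[OF sets_N refl])

lemma measurable_N: "f \<in> borel_measurable N \<longleftrightarrow> f \<in> borel_measurable borel"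
 by (simp add: measurable_cong_sets[OF sets_N refl])

lemma emeasure_N: "A \<in> sets borel \<Longrightarrow> emeasure N A = emeasure \<mu> A" by (simp add: mu_eq sets_N)

lemma nn_integral_N: "nn_integral N f = nn_integral \<mu> f" by (simp add: mu_eq nn_integral_completion)

lemma AE_N: "(AE x in N. P x) \<longleftrightarrow> (AE x in \<mu>. P x)" unfolding mu_eq by (simp only: AE_completion_iff)

lemma null_mu_subset: "A \<subseteq> B \<Longrightarrow> B \<in> null_sets \<mu> \<Longrightarrow> A \<in> null_sets \<mu>"
 unfolding mu_eq by (meson null_sets_completion_iff2 order_trans)

lemma null_mu_borel:
 assumes "A \<in> null_sets \<mu>"
 obtains B where "B \<in> sets borel" "A \<subseteq> B" "emeasure \<mu> B = 0"
proof -
 obtain B where "B \<in> null_sets N" "A \<subseteq> B" using assms unfolding mu_eq null_sets_completion_iff2 by blast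
 then show thesis using that[of B] emeasure_N[of B] by (auto simp: null_sets_def sets_N)
qed

lemma null_mu_AE: "(AE x in \<mu>. P x) \<longleftrightarrow> {x. \<not> P x} \<in> null_sets \<mu>"
proof
 assume "AE x in \<mu>. P x"
 then obtain B where "{x. \<not> P x} \<subseteq> B" "B \<in> null_sets \<mu>" unfolding eventually_ae_filter by auto
 then show "{x. \<not> P x} \<in> null_sets \<mu>" by (rule null_mu_subset)
qed (auto simp: eventually_ae_filter)

lemma measurable_mu_AE_borel:
 assumes "f \<in> borel_measurable \<mu>"
 obtains g where "borel_fun g" "AE x in \<mu>. (f x :: ennreal) = g x"
proof -
 obtain g where "g \<in> borel_measurable N" "AE x in N. f x = g x"
  using completion_ex_borel_measurable[of f N] assms by (auto simp: mu_eq)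
 then show thesis using that[of g] by (simp add: measurable_N AE_N)
qed

lemma borel_hull:
 assumes "A \<in> sets \<mu>"
 obtains B where "B \<in> sets borel" "A \<subseteq> B" "B - A \<in> null_sets \<mu>"
proof -
 obtain S M N' where A: "A = S \<union> M" "M \<subseteq> N'" "N' \<in> null_sets N" "S \<in> sets N"
  using assms unfolding mu_eq by (auto elim: sets_completionE)
 then have "S \<union> N' \<in> sets borel" "A \<subseteq> S \<union> N'" by (auto simp: null_sets_def simp flip: sets_N)
 moreover have "(S \<union> N') - A \<in> null_sets \<mu>"
  using A by (auto simp: mu_eq null_sets_completion_iff2 intro!: bexI[of _ N'])
 ultimately show ?thesis using that by blast
qed

lemma sets_mu_cong:
 assumes "A \<in> sets \<mu>" "B - A \<in> null_sets \<mu>" "A - B \<in> null_sets \<mu>" shows "B \<in> sets \<mu>"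
proof -
 have "B = (A - (A - B)) \<union> (B - A)" by auto
 then show ?thesis using assms null_setsD2 by (metis sets.Diff sets.Un)
qed

lemma borel_hull_restrict:
 assumes "A \<in> sets \<mu>" "f \<in> borel_measurable (restrict_space \<mu> A)"
 obtains g where "borel_fun g" "AE x in \<mu>. x \<in> A \<longrightarrow> (f x :: ennreal) = g x"
proof -
 have "(\<lambda>x. f x * indicator A x) \<in> borel_measurable \<mu>"
  using assms by (subst borel_measurable_restrict_space_iff_ennreal[symmetric]) auto
 then obtain g where "borel_fun g" "AE x in \<mu>. f x * indicator A x = g x" by (rule measurable_mu_AE_borel)
 then show ?thesis by (intro that[of g]) (auto elim!: eventually_mono)
qed

text \<open>In a fixed ball of finite measure only finitely many of the disjoint balls can have
  measure above \<open>1 / real (Suc k)\<close>. Every ball has positive measure, so countably many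
  choices of the fixed ball and of \<open>k\<close> exhaust \<open>S\<close>.\<close>

lemma countable_disjoint_balls:
 fixes S :: "'a set"
 assumes r: "0 < r" and disj: "\<And>x y. x \<in> S \<Longrightarrow> y \<in> S \<Longrightarrow> x \<noteq> y \<Longrightarrow> ball x r \<inter> ball y r = {}"
 shows "countable S"
proof -
 let ?S = "\<lambda>z n k. {x \<in> S \<inter> ball z (real n). 1 / real (Suc k) < emeasure \<mu> (ball x r)}"
 fix z :: 'a
 have fin: "finite (?S z n k)" for n k
 proof (rule ccontr)
  assume inf: "infinite (?S z n k)"
  let ?B = "ball z (real n + r)"
  have pos: "0 < real n + r" using r by simp
  obtain m :: nat where m: "emeasure \<mu> ?B < of_nat m * ennreal (1 / real (Suc k))"
  proof -
   obtain b where b: "emeasure \<mu> ?B = ennreal b" "0 \<le> b"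
    using ball_finite[OF pos, of z] by (cases "emeasure \<mu> ?B") auto
   obtain m :: nat where "b * real (Suc k) < real m" using reals_Archimedean2 by blast
   then have "b < real m * (1 / real (Suc k))" by (simp add: field_simps)
   then have "ennreal b < ennreal (real m * (1 / real (Suc k)))" using b by (simp add: ennreal_less_iff)
   then show ?thesis using that[of m] b
    unfolding ennreal_of_nat_eq_real_of_nat by (simp only: ennreal_mult of_nat_0_le_iff zero_le_divide_1_iff)
  qed
  obtain F where F: "F \<subseteq> ?S z n k" "card F = m" "finite F" using infinite_arbitrarily_large[OF inf] by blast
  have "of_nat m * ennreal (1 / real (Suc k)) = (\<Sum>x\<in>F. ennreal (1 / real (Suc k)))"
   unfolding sum_constant using F by simp
  also have "\<dots> \<le> (\<Sum>x\<in>F. emeasure \<mu> (ball x r))" using F by (intro sum_mono) auto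
  also have "\<dots> = emeasure \<mu> (\<Union>x\<in>F. ball x r)"
   using F disj by (intro sum_emeasure) (auto simp: disjoint_family_on_def sets_mu_borel)
  also have "\<dots> \<le> emeasure \<mu> ?B"
  proof (rule emeasure_mono)
   show "(\<Union>x\<in>F. ball x r) \<subseteq> ?B"
   proof clarify
    fix x y assume "x \<in> F" "y \<in> ball x r"
    then have "dist z x < n" "dist x y < r" using F by auto
    then show "y \<in> ?B" using dist_triangle[of z y x] by simp
   qed
  qed (simp add: sets_mu_borel)
  finally show False using m by simp
 qed
 have "S \<subseteq> (\<Union>n k. ?S z n k)"
 proof
  fix x assume "x \<in> S"
  obtain n where n: "dist z x < real n" using reals_Archimedean2 by blast
  obtain b where b: "emeasure \<mu> (ball x r) = ennreal b" "0 < b"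
   using ball_finite[OF r, of x] ball_pos[OF r, of x] by (cases "emeasure \<mu> (ball x r)") auto
  obtain k where "1 / real (Suc k) < b" using b nat_approx_posE by blast
  then have "x \<in> ?S z n k" using n b \<open>x \<in> S\<close> by (simp add: ennreal_less_iff)
  then show "x \<in> (\<Union>n k. ?S z n k)" by blast
 qed
 moreover have "countable (\<Union>n k. ?S z n k)" using countable_finite[OF fin] by (simp add: countable_UN)
 ultimately show ?thesis by (rule countable_subset)
qed

text \<open>A maximal \<open>\<epsilon>\<close>-separated set is an \<open>\<epsilon>\<close>-net,
  and it is countable because the balls of half that radius around its points are disjoint. The
  union over \<open>\<epsilon> = 1 / real (Suc n)\<close> is dense.\<close>

lemma separable:
 obtains D :: "'a set" where "countable D" "\<And>x r. 0 < r \<Longrightarrow> \<exists>d\<in>D. dist x d < r"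
proof -
 have \<epsilon>net: "\<exists>S::'a set. countable S \<and> (\<forall>x. \<exists>d\<in>S. dist x d < \<epsilon>)" if "0 < \<epsilon>" for \<epsilon>
 proof -
  let ?F = "{S::'a set. \<forall>x\<in>S. \<forall>y\<in>S. x \<noteq> y \<longrightarrow> \<epsilon> \<le> dist x y}"
  have "\<exists>M\<in>?F. \<forall>X\<in>?F. M \<subseteq> X \<longrightarrow> X = M"
  proof (rule subset_Zorn)
   fix C assume C: "subset.chain ?F C"
   have "\<Union>C \<in> ?F"
   proof clarify
    fix x y X Y assume *: "x \<in> X" "X \<in> C" "y \<in> Y" "Y \<in> C" "x \<noteq> y"
    have "X \<subseteq> Y \<or> Y \<subseteq> X" "X \<in> ?F" "Y \<in> ?F" using C * unfolding subset_chain_def by auto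
    then show "\<epsilon> \<le> dist x y" using * by auto
   qed
   then show "\<exists>U\<in>?F. \<forall>X\<in>C. X \<subseteq> U" by (intro bexI[of _ "\<Union>C"]) auto
  qed
  then obtain S where S: "S \<in> ?F" and max: "\<forall>X\<in>?F. S \<subseteq> X \<longrightarrow> X = S" by (rule bexE)
  have "countable S"
  proof (rule countable_disjoint_balls[of "\<epsilon>/2"])
   fix x y assume "x \<in> S" "y \<in> S" "x \<noteq> y"
   then have d: "\<epsilon> \<le> dist x y" using S by auto
   show "ball x (\<epsilon>/2) \<inter> ball y (\<epsilon>/2) = {}"
   proof (intro equals0I)
    fix z assume "z \<in> ball x (\<epsilon>/2) \<inter> ball y (\<epsilon>/2)"
    then have "dist x z < \<epsilon>/2" "dist y z < \<epsilon>/2" by auto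
    then show False using d dist_triangle3[of x y z] by (simp add: dist_commute)
   qed
  qed (use that in simp)
  moreover have "\<exists>d\<in>S. dist x d < \<epsilon>" for x
  proof (rule ccontr)
   assume "\<not> (\<exists>d\<in>S. dist x d < \<epsilon>)"
   then have far: "\<forall>d\<in>S. \<epsilon> \<le> dist x d" by auto
   then have "insert x S \<in> ?F" using S by (auto simp: dist_commute)
   then have "insert x S = S" by (rule max[rule_format]) auto
   then have "x \<in> S" by auto
   then have "\<epsilon> \<le> dist x x" using far by blast
   then show False using that by simp
  qed
  ultimately show ?thesis by (intro exI[of _ S]) auto
 qed
 have "\<exists>S::'a set. countable S \<and> (\<forall>x. \<exists>d\<in>S. dist x d < 1 / real (Suc n))" for n by (rule \<epsilon>net) simp
 then have "\<forall>n. \<exists>S::'a set. countable S \<and> (\<forall>x. \<exists>d\<in>S. dist x d < 1 / real (Suc n))" by (rule allI)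
 from choice[OF this] obtain S :: "nat \<Rightarrow> 'a set"
  where S: "\<forall>n. countable (S n) \<and> (\<forall>x. \<exists>d\<in>S n. dist x d < 1 / real (Suc n))" by (rule exE)
 show ?thesis
 proof (rule that[of "\<Union>n. S n"])
  fix x :: 'a and r :: real assume "0 < r"
  then obtain n where "1 / real (Suc n) < r" using nat_approx_posE by blast
  moreover obtain d where "d \<in> S n" "dist x d < 1 / real (Suc n)" using S by blast
  ultimately show "\<exists>d\<in>\<Union>n. S n. dist x d < r" by (intro bexI[of _ d]) auto
 next
  show "countable (\<Union>n. S n)" using S by (intro countable_UN) auto
 qed
qed

text \<open>Each point \<open>x\<close> lies in a ball with centre in the countable dense set and
  rational radius that is contained in \<open>ball x (r x)\<close>. For each such small ball one
  admissible \<open>x\<close> is kept.\<close>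

lemma lindelof_balls:
 fixes r :: "'a \<Rightarrow> real" and A :: "'a set"
 assumes r: "\<And>x. x \<in> A \<Longrightarrow> 0 < r x"
 obtains C where "countable C" "C \<subseteq> A" "A \<subseteq> (\<Union>x\<in>C. ball x (r x))"
proof -
 obtain D :: "'a set" where D: "countable D" "\<And>x r. 0 < r \<Longrightarrow> \<exists>d\<in>D. dist x d < r" by (rule separable) blast
 let ?P = "\<lambda>(d, q::rat) x. x \<in> A \<and> dist d x < real_of_rat q \<and> ball d (real_of_rat q) \<subseteq> ball x (r x)"
 let ?I = "{i \<in> D \<times> UNIV. \<exists>x. ?P i x}"
 let ?C = "(\<lambda>i. SOME x. ?P i x) ` ?I"
 have I: "?P i (SOME x. ?P i x)" if "i \<in> ?I" for i using that by (intro someI_ex[of "?P i"]) auto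
 show ?thesis
 proof (rule that[of ?C])
  have "countable (D \<times> (UNIV :: rat set))" using D by auto
  then have "countable ?I" by (rule countable_subset[rotated]) auto
  then show "countable ?C" by auto
  show "?C \<subseteq> A" using I by force
  show "A \<subseteq> (\<Union>x\<in>?C. ball x (r x))"
  proof
   fix x assume x: "x \<in> A"
   obtain d where d: "d \<in> D" "dist x d < r x / 3" using D(2)[of "r x / 3" x] r[OF x] by auto
   \<comment> \<open>A radius above \<open>r x / 3\<close> contains \<open>x\<close>, and one below
     \<open>r x / 2\<close> keeps the small ball inside \<open>ball x (r x)\<close>.\<close>
   obtain q where q: "r x / 3 < real_of_rat q" "real_of_rat q < r x / 2"
    using of_rat_dense[of "r x / 3" "r x / 2"] r[OF x] by auto
   have "?P (d, q) x"
   proof -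
    have "ball d (real_of_rat q) \<subseteq> ball x (r x)"
    proof
     fix y assume "y \<in> ball d (real_of_rat q)"
     then have "dist d y < r x / 2" using q by auto
     then show "y \<in> ball x (r x)" using d dist_triangle[of x y d] r[OF x] by simp
    qed
    then show ?thesis using x d q by (auto simp: dist_commute)
   qed
   then have i: "(d, q) \<in> ?I" using d by auto
   have dx: "x \<in> ball d (real_of_rat q)" using d q by (simp add: dist_commute)
   from I[OF i] have "ball d (real_of_rat q) \<subseteq> ball (SOME x. ?P (d, q) x) (r (SOME x. ?P (d, q) x))" by simp
   with dx have "x \<in> ball (SOME x. ?P (d, q) x) (r (SOME x. ?P (d, q) x))" by blast
   with i show "x \<in> (\<Union>x\<in>?C. ball x (r x))" by blast
  qed
 qed
qed

lemma sigma_finite_N: "sigma_finite_measure N"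
proof
 let ?z = "undefined :: 'a"
 show "\<exists>A. countable A \<and> A \<subseteq> sets N \<and> \<Union>A = space N \<and> (\<forall>a\<in>A. emeasure N a \<noteq> \<infinity>)"
 proof (intro exI[of _ "range (\<lambda>n. ball ?z (real (Suc n)))"] conjI)
  show "\<Union> (range (\<lambda>n. ball ?z (real (Suc n)))) = space N"
  proof -
   have "\<exists>n. dist ?z x < real (Suc n)" for x
    using reals_Archimedean2[of "dist ?z x"] by (meson less_trans lessI of_nat_less_iff)
   then show ?thesis by auto
  qed
  show "\<forall>a\<in>range (\<lambda>n. ball ?z (real (Suc n))). emeasure N a \<noteq> \<infinity>"
  proof clarify
   fix n assume "emeasure N (ball ?z (real (Suc n))) = \<infinity>"
   then show False using ball_finite[of "real (Suc n)" ?z] by (simp add: emeasure_N)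
  qed
 qed (auto simp: sets_N)
qed

section \<open>Families of curves of zero modulus\<close>

definition Lp :: "('a \<Rightarrow> ennreal) \<Rightarrow> bool" where
 "Lp f \<longleftrightarrow> f \<in> borel_measurable borel \<and> pint f < \<infinity>"

definition exc :: "(real \<times> (real \<Rightarrow> 'a)) set \<Rightarrow> bool" where
 "exc \<Gamma> \<longleftrightarrow> (\<exists>\<rho>. Lp \<rho> \<and> (\<forall>c\<in>\<Gamma>. line_integral \<rho> c = \<infinity>))"

lemma Lp_measurable: "Lp f \<Longrightarrow> borel_fun f" by (simp add: Lp_def)

lemma Lp_zero: "Lp (\<lambda>x. 0)" by (simp add: Lp_def)

lemma Lp_mono:
 assumes "Lp g" "borel_fun f" "AE x in \<mu>. f x \<le> g x" shows "Lp f"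
proof -
 have "pint f \<le> pint g" using assms(3) by (intro nn_integral_mono_AE) (auto elim!: eventually_mono intro: epowr_mono)
 then show ?thesis using assms by (auto simp: Lp_def)
qed

lemma Lp_cmult: "Lp f \<Longrightarrow> a < \<infinity> \<Longrightarrow> Lp (\<lambda>x. a * f x)"
 by (auto simp: Lp_def epowr_mult nn_integral_cmult measurable_mu_borel ennreal_mult_less_top
   epowr_less_top_iff[simplified])

lemma Lp_add:
 assumes "Lp f" "Lp g" shows "Lp (\<lambda>x. f x + g x)"
proof -
 have [measurable]: "borel_fun f" "borel_fun g"
  "f \<in> borel_measurable \<mu>" "g \<in> borel_measurable \<mu>" using assms by (auto simp: Lp_def measurable_mu_borel)
 have "pint (\<lambda>x. f x + g x) \<le> muint (\<lambda>x. ennreal (2 powr p) * (epowr (f x) p + epowr (g x) p))"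
  by (intro nn_integral_mono epowr_add_le) simp
 also have "\<dots> = ennreal (2 powr p) * ((pint f) + pint g)" by (subst nn_integral_cmult) (auto simp: nn_integral_add)
 also have "\<dots> < \<infinity>" using assms by (auto simp: Lp_def ennreal_mult_less_top)
 finally show ?thesis using assms by (auto simp: Lp_def)
qed

text \<open>The common majorant is the p-th root of the sum of the p-th powers.\<close>

lemma Lp_countable_bound:
 fixes f :: "nat \<Rightarrow> 'a \<Rightarrow> ennreal"
 assumes [measurable]: "\<And>n. borel_fun (f n)"
  and fin: "(\<Sum>n. \<integral>\<^sup>+x. epowr (f n x) p \<partial>\<mu>) < \<infinity>"
 obtains \<rho> where "Lp \<rho>" "\<And>n x. f n x \<le> \<rho> x"
proof
 define \<rho> where "\<rho> x = epowr (\<Sum>n. epowr (f n x) p) (1 / p)" for x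
 have m[measurable]: "f n \<in> borel_measurable \<mu>" for n by (simp add: measurable_mu_borel)
 have pw: "epowr (\<rho> x) p = (\<Sum>n. epowr (f n x) p)" for x by (simp add: \<rho>_def epowr_epowr)
 show "Lp \<rho>" unfolding Lp_def pw
 proof
  show "borel_fun \<rho>" unfolding \<rho>_def by measurable
  show "muint (\<lambda>x. \<Sum>n. epowr (f n x) p) < \<infinity>" using fin by (subst nn_integral_suminf) auto
 qed
 fix n x
 have "epowr (f n x) p \<le> (\<Sum>n. epowr (f n x) p)" using sum_le_suminf[of "\<lambda>n. epowr (f n x) p" "{n}"] by simp
 then show "f n x \<le> \<rho> x" using epowr_le_iff[of p "f n x" "\<rho> x"] by (simp add: pw)
qed

lemma exc_subset: "exc \<Gamma> \<Longrightarrow> \<Gamma>' \<subseteq> \<Gamma> \<Longrightarrow> exc \<Gamma>'" unfolding exc_def by blast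

text \<open>Multiplying a density by a positive constant keeps its infinite line integrals, so the
  densities may be scaled until their p-energies are summable; a common majorant then serves all the
  families.\<close>

lemma exc_UN:
 fixes \<Gamma> :: "nat \<Rightarrow> _" assumes "\<And>n. exc (\<Gamma> n)" "\<And>n. \<Gamma> n \<subseteq> curves UNIV" shows "exc (\<Union>n. \<Gamma> n)"
proof -
 from assms(1) obtain \<rho> where \<rho>: "\<And>n. Lp (\<rho> n)" "\<And>n c. c \<in> \<Gamma> n \<Longrightarrow> line_integral (\<rho> n) c = \<infinity>"
  unfolding exc_def by metis
 have [measurable]: "borel_fun (\<rho> n)" "\<rho> n \<in> borel_measurable \<mu>" for n
  using \<rho>(1) by (auto simp: Lp_def measurable_mu_borel)
 define I where "I n = pint (\<lambda>x. \<rho> n x)" for n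
 have I: "I n < top" for n using \<rho>(1) by (simp add: Lp_def I_def)
 \<comment> \<open>Chosen so that \<open>epowr (a n) p * I n\<close> is at most
   \<open>(1/2)^n\<close>; the summand 1 avoids a division by 0.\<close>
 define a where "a n = epowr (ennreal ((1/2)^n) / (1 + I n)) (1 / p)" for n
 have a0: "a n \<noteq> 0" for n
  using I[of n] by (simp add: a_def epowr_eq_0_iff ennreal_divide_eq_0_iff less_top[symmetric])
 have aI: "epowr (a n) p * I n \<le> ennreal ((1/2)^n)" for n
 proof -
  have "epowr (a n) p = ennreal ((1/2)^n) / (1 + I n)" by (simp add: a_def epowr_epowr)
  then have "epowr (a n) p * I n \<le> ennreal ((1/2)^n) / (1 + I n) * (1 + I n)" by (simp add: mult_left_mono)
  also have "\<dots> = ennreal ((1/2)^n)" using I[of n] by (simp add: ennreal_divide_times ennreal_mult_divide_eq)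
  finally show ?thesis .
 qed
 obtain \<sigma> where \<sigma>: "Lp \<sigma>" "\<And>n x. a n * \<rho> n x \<le> \<sigma> x"
 proof (rule Lp_countable_bound[of "\<lambda>n x. a n * \<rho> n x"])
  have "(\<Sum>n. \<integral>\<^sup>+x. epowr (a n * \<rho> n x) p \<partial>\<mu>) = (\<Sum>n. epowr (a n) p * I n)"
   by (simp add: epowr_mult nn_integral_cmult I_def)
  also have "\<dots> \<le> (\<Sum>n. ennreal ((1/2)^n))" by (intro suminf_le aI) auto
  also have "\<dots> = ennreal 2" using suminf_geometric[of "1/2::real"]
   by (subst suminf_ennreal2) (auto simp: summable_geometric)
  finally show "(\<Sum>n. \<integral>\<^sup>+x. epowr (a n * \<rho> n x) p \<partial>\<mu>) < \<infinity>" by (simp add: order_le_less_trans)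
 qed (auto)
 show ?thesis unfolding exc_def
 proof (intro exI[of _ \<sigma>] conjI ballI)
  fix c assume "c \<in> (\<Union>n. \<Gamma> n)"
  then obtain n where n: "c \<in> \<Gamma> n" by auto
  have "a n * line_integral (\<rho> n) c = line_integral (\<lambda>x. a n * \<rho> n x) c"
   using n assms(2) by (subst line_integral_cmult[of c UNIV]) auto
  also have "\<dots> \<le> line_integral \<sigma> c" by (intro line_integral_mono \<sigma>)
  finally show "line_integral \<sigma> c = \<infinity>" using \<rho>(2)[OF n] a0[of n] by (simp add: ennreal_mult_top top_unique)
 qed (rule \<sigma>)
qed

lemma exc_Un:
 assumes "exc \<Gamma>" "exc \<Gamma>'" "\<Gamma> \<subseteq> curves UNIV" "\<Gamma>' \<subseteq> curves UNIV" shows "exc (\<Gamma> \<union> \<Gamma>')"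
proof -
 have "exc (\<Union>n::nat. if n = 0 then \<Gamma> else \<Gamma>')" using assms by (intro exc_UN) auto
 moreover have "(\<Union>n::nat. if n = 0 then \<Gamma> else \<Gamma>') = \<Gamma> \<union> \<Gamma>'" by (auto split: if_splits)
 ultimately show ?thesis by simp
qed

lemma exc_Lp: "Lp \<rho> \<Longrightarrow> exc {c \<in> curves A. line_integral \<rho> c = \<infinity>}" unfolding exc_def by blast

text \<open>The density that is infinite on a Borel null set containing \<open>S\<close> has zero
  p-energy, and a curve with finite integral of it spends zero length in that set.\<close>

lemma exc_null:
 assumes "S \<in> null_sets \<mu>"
 shows "exc {c \<in> curves A. \<not> (ae_along c (\<lambda>x. x \<notin> S))}"
proof -
 obtain B where B: "B \<in> sets borel" "S \<subseteq> B" "emeasure \<mu> B = 0" using null_mu_borel[OF assms] by blast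
 define \<rho> where "\<rho> x = (top * indicator B x :: ennreal)" for x :: 'a
 have [measurable]: "borel_fun \<rho>" using B unfolding \<rho>_def by measurable
 have "Lp \<rho>"
 proof -
  have "epowr (\<rho> x) p = top * indicator B x" for x by (auto simp: \<rho>_def indicator_def)
  then show ?thesis using B by (simp add: Lp_def nn_integral_cmult_indicator sets_mu_borel)
 qed
 moreover have "line_integral \<rho> c = \<infinity>"
  if c: "c \<in> curves A" and n: "\<not> (ae_along c (\<lambda>x. x \<notin> S))" for c
 proof (rule ccontr)
  assume "line_integral \<rho> c \<noteq> \<infinity>"
  then have "(\<integral>\<^sup>+\<tau>. \<rho> (snd c \<tau>) * indicator {0..fst c} \<tau> \<partial>lborel) \<noteq> \<infinity>" by (simp add: line_integral_lborel)
  from nn_integral_PInf_AE[OF _ this]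
  have "AE t in lborel. \<rho> (snd c t) * indicator {0..fst c} t \<noteq> top"
   using curve_measurable[OF c, of \<rho> 0 "fst c"] by simp
  then have "ae_along c (\<lambda>x. x \<notin> S)" by eventually_elim (use B in \<open>auto simp: \<rho>_def\<close>)
  then show False using n by simp
 qed
 ultimately show ?thesis unfolding exc_def by blast
qed

lemma exc_AE:
 assumes "AE x in \<mu>. P x"
 shows "exc {c \<in> curves A. \<not> (ae_along c P)}" using exc_null[of "{x. \<not> P x}" A] assms by (simp add: null_mu_AE)

text \<open>
 A relatively Borel function on \<open>A\<close> extends to a Borel function, and the extension may be cut off
 outside a Borel hull of \<open>A\<close>; hence zero modulus does not depend on the ambient set.
\<close>

lemma borel_extension:
 fixes \<rho> :: "'a \<Rightarrow> ennreal"
 assumes "\<rho> \<in> borel_measurable (restrict_space borel A)"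
 obtains \<sigma> where "borel_fun \<sigma>" "\<And>x. x \<in> A \<Longrightarrow> \<sigma> x = \<rho> x"
proof -
 have "\<exists>S. S \<in> sets borel \<and> {x \<in> A. ennreal (real_of_rat q) < \<rho> x} = A \<inter> S" for q
 proof -
  have "{x \<in> space (restrict_space borel A). ennreal (real_of_rat q) < \<rho> x} \<in> sets (restrict_space borel A)"
   using assms by measurable
  then show ?thesis by (auto simp: space_restrict_space sets_restrict_space)
 qed
 then obtain S where S: "\<And>q. S q \<in> sets borel" "\<And>q. {x \<in> A. ennreal (real_of_rat q) < \<rho> x} = A \<inter> S q" by metis
 define \<sigma> where "\<sigma> x = (SUP q. ennreal (real_of_rat q) * indicator (S q) x)" for x
 show ?thesis
 proof (rule that[of \<sigma>])
  show "borel_fun \<sigma>" unfolding \<sigma>_def using S by (intro borel_measurable_SUP) auto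
  fix x assume x: "x \<in> A"
  have eq: "indicator (S q) x = (if ennreal (real_of_rat q) < \<rho> x then 1 else 0 :: ennreal)" for q
   using S(2)[of q] x by (auto simp: indicator_def)
  show "\<sigma> x = \<rho> x"
  proof (rule antisym)
   show "\<sigma> x \<le> \<rho> x" unfolding \<sigma>_def eq by (intro SUP_least) auto
   show "\<rho> x \<le> \<sigma> x"
   proof (rule dense_le)
    fix y assume "y < \<rho> x"
    obtain q where q: "y \<le> ennreal (real_of_rat q)" "ennreal (real_of_rat q) < \<rho> x"
    proof -
     obtain z where z: "y < z" "z < \<rho> x" using dense[OF \<open>y < \<rho> x\<close>] by blast
     then obtain a b where ab: "y = ennreal a" "0 \<le> a" "z = ennreal b" "0 \<le> b"
      by (cases y; cases z) (auto simp: less_top[symmetric])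
     then have "a < b" using z by (simp add: ennreal_less_iff)
     then obtain q where "a < real_of_rat q" "real_of_rat q < b" using of_rat_dense by blast
     then show ?thesis using that[of q] ab z by (meson ennreal_leI less_imp_le order_le_less_trans)
    qed
    then have "y \<le> ennreal (real_of_rat q) * indicator (S q) x" by (simp add: eq)
    also have "\<dots> \<le> \<sigma> x" unfolding \<sigma>_def by (intro SUP_upper) simp
    finally show "y \<le> \<sigma> x" .
   qed
  qed
 qed
qed

lemma Lp_extension:
 assumes A: "A \<in> sets \<mu>" and \<rho>: "\<rho> \<in> borel_measurable (restrict_space borel A)"
  and fin: "pint_on A \<rho> < \<infinity>"
 obtains \<sigma> where "Lp \<sigma>" "\<And>x. x \<in> A \<Longrightarrow> \<sigma> x = \<rho> x"
proof -
 obtain \<sigma> where \<sigma>: "borel_fun \<sigma>" "\<And>x. x \<in> A \<Longrightarrow> \<sigma> x = \<rho> x" using borel_extension[OF \<rho>] by blast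
 obtain B where B: "B \<in> sets borel" "A \<subseteq> B" "B - A \<in> null_sets \<mu>" using borel_hull[OF A] by blast
 have "pint (\<lambda>x. \<sigma> x * indicator B x) = pint_on A \<rho>" using AE_not_in[OF B(3)] B(2)
  by (intro nn_integral_cong_AE) (auto elim!: eventually_mono simp: indicator_def \<sigma>(2))
 then have "Lp (\<lambda>x. \<sigma> x * indicator B x)" using fin B \<sigma> unfolding Lp_def by auto
 then show ?thesis using that[of "\<lambda>x. \<sigma> x * indicator B x"] \<sigma>(2) B(2) by (auto simp: indicator_def subset_iff)
qed

lemma ae_curve_iff:
 assumes A: "A \<in> sets \<mu>"
 shows "ae_curve p \<mu> A P \<longleftrightarrow> exc {c \<in> curves A. \<not> P c}"
proof
 assume "ae_curve p \<mu> A P"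
 then obtain \<rho> where \<rho>: "\<rho> \<in> borel_measurable (restrict_space borel A)"
   "pint_on A \<rho> < \<infinity>" "\<And>c. c \<in> curves A \<Longrightarrow> \<not> P c \<Longrightarrow> line_integral \<rho> c = \<infinity>"
  unfolding ae_curve_def zero_modulus_def by blast
 obtain \<sigma> where "Lp \<sigma>" "\<And>x. x \<in> A \<Longrightarrow> \<sigma> x = \<rho> x" using Lp_extension[OF A \<rho>(1,2)] by blast
 then show "exc {c \<in> curves A. \<not> P c}"
  unfolding exc_def using \<rho>(3) line_integral_cong[of _ A \<sigma> \<rho>] by (intro exI[of _ \<sigma>]) auto
next
 assume "exc {c \<in> curves A. \<not> P c}"
 then obtain \<rho> where \<rho>: "Lp \<rho>" "\<And>c. c \<in> curves A \<Longrightarrow> \<not> P c \<Longrightarrow> line_integral \<rho> c = \<infinity>" unfolding exc_def by blast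
 have "pint_on A \<rho> \<le> pint \<rho>" by (intro nn_integral_mono) (auto simp: indicator_def)
 then show "ae_curve p \<mu> A P" unfolding ae_curve_def zero_modulus_def using \<rho>
  by (intro bexI[of _ \<rho>]) (auto simp: Lp_def measurable_restrict_space1)
qed

end

section \<open>Oscillation bounds on intervals\<close>

text \<open>For integrable \<open>F\<close> this is the statement that \<open>f\<close> is
  absolutely continuous with derivative at most \<open>F\<close> in absolute value a.e. In integral
  form it passes to limits and needs no differentiation theorem.\<close>

definition osc_le :: "(real \<Rightarrow> real) \<Rightarrow> (real \<Rightarrow> ennreal) \<Rightarrow> real \<Rightarrow> real \<Rightarrow> bool" where
 "osc_le f F a b \<longleftrightarrow> (\<forall>s t. a \<le> s \<longrightarrow> s \<le> t \<longrightarrow> t \<le> b \<longrightarrow>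
   ennreal \<bar>f s - f t\<bar> \<le> lint s t F)"

lemma osc_leD:
 "osc_le f F a b \<Longrightarrow> a \<le> s \<Longrightarrow> s \<le> t \<Longrightarrow> t \<le> b \<Longrightarrow>
  ennreal \<bar>f s - f t\<bar> \<le> lint s t F" by (simp add: osc_le_def)

lemma osc_le_contraction:
 assumes "osc_le f F a b" "\<And>s t. a \<le> s \<Longrightarrow> s \<le> t \<Longrightarrow> t \<le> b \<Longrightarrow> \<bar>g s - g t\<bar> \<le> \<bar>f s - f t\<bar>"
 shows "osc_le g F a b" unfolding osc_le_def
proof (intro allI impI)
 fix s t assume st: "a \<le> s" "s \<le> t" "t \<le> b"
 have "ennreal \<bar>g s - g t\<bar> \<le> ennreal \<bar>f s - f t\<bar>" by (rule ennreal_leI) (rule assms(2)[OF st])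
 also have "\<dots> \<le> lint s t F" by (rule osc_leD[OF assms(1) st])
 finally show "ennreal \<bar>g s - g t\<bar> \<le> lint s t F" .
qed

lemma AE_lborel_neq: "AE x in lborel. x \<noteq> (c::real)"
proof -
 have "{c} \<in> null_sets lborel" by (simp add: null_sets_def)
 from AE_not_in[OF this] show ?thesis by simp
qed

lemma nn_integral_Icc_split:
 fixes F :: "real \<Rightarrow> ennreal"
 assumes [measurable]: "borel_fun F" and "a \<le> b" "b \<le> c"
 shows "lint a c F = lint a b F + lint b c F"
proof -
 have "lint a c F = (\<integral>\<^sup>+x. F x * indicator {a..b} x + F x * indicator {b..c} x \<partial>lborel)"
  using AE_lborel_neq[of b] assms(2,3)
  by (intro nn_integral_cong_AE) (auto elim!: eventually_mono simp: indicator_def)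
 also have "\<dots> = lint a b F + lint b c F" by (intro nn_integral_add) auto
 finally show ?thesis .
qed

lemma ennreal_abs_triangle: "ennreal \<bar>x - z\<bar> \<le> ennreal \<bar>x - y\<bar> + ennreal \<bar>y - z\<bar>"
proof -
 have "ennreal \<bar>x - z\<bar> \<le> ennreal (\<bar>x - y\<bar> + \<bar>y - z\<bar>)" by (rule ennreal_leI) linarith
 then show ?thesis by simp
qed

text \<open>The points \<open>max s c\<close> and \<open>min t d\<close> split \<open>{s..t}\<close>
  into a middle piece inside \<open>{c..d}\<close>, where \<open>F\<close> is available, and two
  outer pieces that are left to \<open>G\<close>.\<close>

lemma osc_le_replace_interval:
 assumes m[measurable]: "borel_fun F" "borel_fun G"
  and G: "osc_le f G a b"
  and F: "\<And>s t. a \<le> s \<Longrightarrow> s \<le> t \<Longrightarrow> t \<le> b \<Longrightarrow> {s..t} \<subseteq> {c..d} \<Longrightarrow>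
   ennreal \<bar>f s - f t\<bar> \<le> lint s t F"
 shows "osc_le f (\<lambda>x. if x \<in> {c..d} then F x else G x) a b" unfolding osc_le_def
proof (intro allI impI)
 fix s t assume st: "a \<le> s" "s \<le> t" "t \<le> b"
 let ?H = "\<lambda>x. if x \<in> {c..d} then F x else G x"
 let ?s = "max s c" and ?t = "min t d"
 show "ennreal \<bar>f s - f t\<bar> \<le> lint s t ?H"
 proof (cases "?s \<le> ?t")
  case True
  have "ennreal \<bar>f s - f t\<bar> \<le> ennreal \<bar>f s - f ?s\<bar> + (ennreal \<bar>f ?s - f ?t\<bar> + ennreal \<bar>f ?t - f t\<bar>)"
   using ennreal_abs_triangle[of "f s" "f t" "f ?s"] ennreal_abs_triangle[of "f ?s" "f t" "f ?t"]
   by (meson add_left_mono order_trans)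
  also have "\<dots> \<le> lint s ?s G + ((lint ?s ?t F) + lint ?t t G)"
   using st True by (intro add_mono osc_leD[OF G] F) auto
  also have "lint s ?s G = lint s ?s ?H" using AE_lborel_neq[of c] AE_lborel_neq[of s]
   by (intro nn_integral_cong_AE, eventually_elim) (use True in \<open>auto simp: indicator_def max_def split: if_splits\<close>)
  also have "lint ?s ?t F = lint ?s ?t ?H" by (intro nn_integral_cong) (auto simp: indicator_def)
  also have "lint ?t t G = lint ?t t ?H" using AE_lborel_neq[of d] AE_lborel_neq[of t]
   by (intro nn_integral_cong_AE, eventually_elim) (use True in \<open>auto simp: indicator_def min_def split: if_splits\<close>)
  also have "lint ?s ?t ?H + lint ?t t ?H = lint ?s t ?H"
   using True by (intro nn_integral_Icc_split[symmetric]) auto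
  also have "lint s ?s ?H + lint ?s t ?H = lint s t ?H" using True by (intro nn_integral_Icc_split[symmetric]) auto
  finally show ?thesis .
 next
  case False
  have "ennreal \<bar>f s - f t\<bar> \<le> lint s t G" by (rule osc_leD[OF G st])
  also have "\<dots> = lint s t ?H" using False st by (intro nn_integral_cong) (auto simp: indicator_def)
  finally show ?thesis .
 qed
qed

text \<open>An open set is a countable union of compact intervals, which are replaced one after the
  other. The bounds for finitely many intervals pass to the limit by monotone convergence, because
  \<open>G\<close> is integrable.\<close>

lemma osc_le_replace_open:
 assumes m[measurable]: "borel_fun F" "borel_fun G"
  and U: "open U" and G: "osc_le f G a b" and fin: "lint a b G < \<infinity>"
  and F: "\<And>s t. a \<le> s \<Longrightarrow> s \<le> t \<Longrightarrow> t \<le> b \<Longrightarrow> {s..t} \<subseteq> U \<Longrightarrow>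
   ennreal \<bar>f s - f t\<bar> \<le> lint s t F"
  and ab: "a \<le> b"
 shows "ennreal \<bar>f a - f b\<bar> \<le> lint a b (\<lambda>x. if x \<in> U then F x else G x)"
proof -
 obtain \<D> where \<D>: "countable \<D>" "\<D> \<subseteq> Pow U" "\<And>X. X \<in> \<D> \<Longrightarrow> \<exists>c d. X = cbox c d" "\<Union>\<D> = U"
  using open_countable_Union_open_cbox[OF U] by blast
 have "\<exists>c d::nat \<Rightarrow> real. (\<Union>n. {c n..d n}) = U" if "\<D> \<noteq> {}"
 proof -
  have "\<forall>n. \<exists>p. from_nat_into \<D> n = {fst p..snd p}"
   using \<D>(3) from_nat_into[OF that] by (metis cbox_interval fst_conv snd_conv)
  from choice[OF this] obtain p :: "nat \<Rightarrow> real \<times> real"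
   where p: "\<And>n. from_nat_into \<D> n = {fst (p n)..snd (p n)}" by blast
  have "(\<Union>n. {fst (p n)..snd (p n)}) = \<Union>\<D>" using range_from_nat_into[OF that \<D>(1)] by (simp flip: p)
  then show ?thesis using \<D>(4) by (intro exI[of _ "\<lambda>n. fst (p n)"] exI[of _ "\<lambda>n. snd (p n)"]) simp
 qed
 moreover have "\<exists>c d::nat \<Rightarrow> real. (\<Union>n. {c n..d n}) = U" if "\<D> = {}"
  using that \<D>(4) by (intro exI[of _ "\<lambda>n. 1"] exI[of _ "\<lambda>n. 0"]) auto
 ultimately obtain c d :: "nat \<Rightarrow> real" where cd2: "(\<Union>n. {c n..d n}) = U" by (cases "\<D> = {}") auto
 then have cd: "{c n..d n} \<subseteq> U" for n by auto
 define V where "V n = (\<Union>i<n. {c i..d i})" for n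
 have V_borel[measurable]: "V n \<in> sets borel" for n by (auto simp: V_def)
 have [measurable]: "U \<in> sets borel" using U by simp
 have VU: "V n \<subseteq> U" for n unfolding V_def using cd by (intro UN_least)
 have osc: "osc_le f (\<lambda>x. if x \<in> V n then F x else G x) a b" for n
 proof (induction n)
  case 0 then show ?case using G by (simp add: V_def)
 next
  case (Suc n)
  have "osc_le f (\<lambda>x. if x \<in> {c n..d n} then F x else (if x \<in> V n then F x else G x)) a b"
  proof (rule osc_le_replace_interval[OF _ _ Suc.IH])
   fix s t assume "a \<le> s" "s \<le> t" "t \<le> b" "{s..t} \<subseteq> {c n..d n}"
   then show "ennreal \<bar>f s - f t\<bar> \<le> lint s t F" using F[of s t] cd[of n] by blast
  qed auto
  also have "(\<lambda>x. if x \<in> {c n..d n} then F x else (if x \<in> V n then F x else G x)) =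
    (\<lambda>x. if x \<in> V (Suc n) then F x else G x)" by (auto simp: V_def lessThan_Suc fun_eq_iff)
  finally show ?case .
 qed
 let ?X = "\<integral>\<^sup>+x. F x * indicator ({a..b} \<inter> U) x \<partial>lborel"
 let ?Y = "\<lambda>n. \<integral>\<^sup>+x. G x * indicator ({a..b} - V n) x \<partial>lborel"
 have "ennreal \<bar>f a - f b\<bar> \<le> ?X + ?Y n" for n
 proof -
  have "ennreal \<bar>f a - f b\<bar> \<le> lint a b (\<lambda>x. if x \<in> V n then F x else G x)" using osc_leD[OF osc] ab by simp
  also have "\<dots> \<le> (\<integral>\<^sup>+x. F x * indicator ({a..b} \<inter> U) x + G x * indicator ({a..b} - V n) x \<partial>lborel)"
   using VU[of n] by (intro nn_integral_mono) (auto simp: indicator_def)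
  also have "\<dots> = ?X + ?Y n" by (intro nn_integral_add) auto
  finally show ?thesis .
 qed
 then have "ennreal \<bar>f a - f b\<bar> - ?X \<le> (INF n. ?Y n)" by (intro INF_greatest) (simp add: ennreal_minus_le_iff)
 also have "(INF n. ?Y n) = (\<integral>\<^sup>+x. (INF n. G x * indicator ({a..b} - V n) x) \<partial>lborel)"
 proof (rule nn_integral_monotone_convergence_INF_decseq[symmetric])
  show "decseq (\<lambda>n x. G x * indicator ({a..b} - V n) x)"
   by (intro decseq_SucI le_funI mult_left_mono) (auto simp: V_def lessThan_Suc indicator_def)
  show "(\<integral>\<^sup>+x. G x * indicator ({a..b} - V 0) x \<partial>lborel) < \<infinity>" using fin by (simp add: V_def)
 qed auto
 also have "\<dots> \<le> (\<integral>\<^sup>+x. G x * indicator ({a..b} - U) x \<partial>lborel)"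
 proof (intro nn_integral_mono)
  fix x
  show "(INF n. G x * indicator ({a..b} - V n) x) \<le> G x * indicator ({a..b} - U) x"
  proof (cases "x \<in> U")
   case True
   then obtain n where "x \<in> {c n..d n}" using cd2 by blast
   then have "x \<in> V (Suc n)" by (auto simp: V_def)
   then show ?thesis by (intro INF_lower2[of "Suc n"]) auto
  next
   case False
   show ?thesis by (rule INF_lower2[of 0]) (use False in \<open>auto simp: indicator_def\<close>)
  qed
 qed
 finally have "ennreal \<bar>f a - f b\<bar> \<le> ?X + (\<integral>\<^sup>+x. G x * indicator ({a..b} - U) x \<partial>lborel)"
  by (simp add: ennreal_minus_le_iff)
 also have "\<dots> = (\<integral>\<^sup>+x. F x * indicator ({a..b} \<inter> U) x + G x * indicator ({a..b} - U) x \<partial>lborel)"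
  by (intro nn_integral_add[symmetric]) auto
 also have "\<dots> = lint a b (\<lambda>x. if x \<in> U then F x else G x)" by (intro nn_integral_cong) (auto simp: indicator_def)
 finally show ?thesis .
qed

text \<open>By outer regularity of Lebesgue measure \<open>S\<close> is, up to a null set, a
  decreasing limit of open sets. Replacing \<open>G\<close> by \<open>F\<close> on those costs the
  integral of \<open>F\<close> over the excess, which tends to 0.\<close>

lemma osc_le_replace_borel:
 assumes m[measurable]: "borel_fun F" "borel_fun G" "S \<in> sets borel"
  and F: "osc_le f F a b" "lint a b F < \<infinity>"
  and G: "osc_le f G a b" "lint a b G < \<infinity>"
  and ab: "a \<le> b"
 shows "ennreal \<bar>f a - f b\<bar> \<le> lint a b (\<lambda>x. if x \<in> S then F x else G x)"
proof -
 have "\<exists>U. open U \<and> S \<subseteq> U \<and> emeasure lborel (U - S) \<le> ennreal (1 / real (Suc n))" for n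
 proof -
  obtain U where "open U" "S \<subseteq> U" "emeasure lborel (U - S) \<le> ennreal (1 / real (Suc n))"
   by (rule outer_regular_lborel_le[OF m(3), of "1 / real (Suc n)"]) simp
  then show ?thesis by blast
 qed
 from choice[OF allI[OF this]] obtain U where "\<forall>n. open (U n) \<and> S \<subseteq> U n \<and>
   emeasure lborel (U n - S) \<le> ennreal (1 / real (Suc n))" by (rule exE)
 then have U: "open (U n)" "S \<subseteq> U n" "emeasure lborel (U n - S) \<le> ennreal (1 / real (Suc n))" for n by simp_all
 \<comment> \<open>Finite intersections make the approximating open sets decreasing.\<close>
 define T where "T n = (\<Inter>i\<le>n. U i)" for n
 have T: "open (T n)" "S \<subseteq> T n" "T n \<subseteq> U n" for n
  using U(1,2) unfolding T_def by (auto intro!: open_INT INT_greatest INT_lower)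
 have [measurable]: "T n \<in> sets borel" for n using T(1) by simp
 let ?D = "(\<Inter>n. T n) - S"
 have le: "emeasure lborel ?D \<le> ennreal (1 / real (Suc n))" for n
 proof -
  have "emeasure lborel ?D \<le> emeasure lborel (U n - S)"
  proof (rule emeasure_mono)
   show "?D \<subseteq> U n - S" using T(3)[of n] by blast
   show "U n - S \<in> sets lborel" using U(1)[of n] by auto
  qed
  then show ?thesis using U(3)[of n] by (rule order_trans)
 qed
 have "emeasure lborel ?D = 0"
 proof -
  have "(\<lambda>n. ennreal (1 / real (Suc n))) \<longlonglongrightarrow> ennreal 0" by (intro tendsto_ennrealI) (rule LIMSEQ_Suc[OF lim_1_over_n])
  then have "emeasure lborel ?D \<le> ennreal 0" by (rule LIMSEQ_le_const) (use le in blast)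
  then show ?thesis by simp
 qed
 then have null: "AE x in lborel. x \<notin> ?D" by (intro AE_not_in) (auto simp: null_sets_def)
 let ?X = "\<integral>\<^sup>+x. G x * indicator ({a..b} - S) x \<partial>lborel"
 let ?Y = "\<lambda>n. \<integral>\<^sup>+x. F x * indicator ({a..b} \<inter> T n) x \<partial>lborel"
 have "ennreal \<bar>f a - f b\<bar> \<le> ?X + ?Y n" for n
 proof -
  have "ennreal \<bar>f a - f b\<bar> \<le> lint a b (\<lambda>x. if x \<in> T n then F x else G x)"
   using osc_leD[OF F(1)] by (intro osc_le_replace_open T G ab) auto
  also have "\<dots> \<le> (\<integral>\<^sup>+x. G x * indicator ({a..b} - S) x + F x * indicator ({a..b} \<inter> T n) x \<partial>lborel)"
   using T(2)[of n] by (intro nn_integral_mono) (auto simp: indicator_def)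
  also have "\<dots> = ?X + ?Y n" by (intro nn_integral_add) auto
  finally show ?thesis .
 qed
 then have "ennreal \<bar>f a - f b\<bar> - ?X \<le> (INF n. ?Y n)" by (intro INF_greatest) (simp add: ennreal_minus_le_iff)
 also have "(INF n. ?Y n) = (\<integral>\<^sup>+x. (INF n. F x * indicator ({a..b} \<inter> T n) x) \<partial>lborel)"
 proof (rule nn_integral_monotone_convergence_INF_decseq[symmetric])
  show "decseq (\<lambda>n x. F x * indicator ({a..b} \<inter> T n) x)"
   by (intro decseq_SucI le_funI mult_left_mono) (auto simp: T_def atMost_Suc indicator_def)
  have "(\<integral>\<^sup>+x. F x * indicator ({a..b} \<inter> T 0) x \<partial>lborel) \<le> lint a b F"
   by (intro nn_integral_mono) (auto simp: indicator_def)
  then show "(\<integral>\<^sup>+x. F x * indicator ({a..b} \<inter> T 0) x \<partial>lborel) < \<infinity>" using F(2) by (rule order_le_less_trans)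
 qed auto
 also have "\<dots> \<le> (\<integral>\<^sup>+x. F x * indicator ({a..b} \<inter> S) x \<partial>lborel)"
 proof (intro nn_integral_mono_AE, use null in eventually_elim)
  fix x assume x: "x \<notin> ?D"
  show "(INF n. F x * indicator ({a..b} \<inter> T n) x) \<le> F x * indicator ({a..b} \<inter> S) x"
  proof (cases "x \<in> S")
   case True
   show ?thesis by (rule INF_lower2[of 0]) (use True in \<open>auto simp: indicator_def\<close>)
  next
   case False
   then obtain n where "x \<notin> T n" using x by blast
   then show ?thesis by (intro INF_lower2[of n]) auto
  qed
 qed
 finally have "ennreal \<bar>f a - f b\<bar> \<le> ?X + (\<integral>\<^sup>+x. F x * indicator ({a..b} \<inter> S) x \<partial>lborel)"
  by (simp add: ennreal_minus_le_iff)
 also have "\<dots> = (\<integral>\<^sup>+x. G x * indicator ({a..b} - S) x + F x * indicator ({a..b} \<inter> S) x \<partial>lborel)"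
  by (intro nn_integral_add[symmetric]) auto
 also have "\<dots> = lint a b (\<lambda>x. if x \<in> S then F x else G x)" by (intro nn_integral_cong) (auto simp: indicator_def)
 finally show ?thesis .
qed

text \<open>The smaller of two integrals over an interval can exceed the integral of the minimum, so
  the majorants have to be exchanged on the Borel set \<open>{x. F x <= G x}\<close>.\<close>

lemma osc_le_min:
 assumes m[measurable]: "borel_fun F" "borel_fun G"
  and "osc_le f F a b" "lint a b F < \<infinity>"
  and "osc_le f G a b" "lint a b G < \<infinity>"
  and ab: "a \<le> b"
 shows "ennreal \<bar>f a - f b\<bar> \<le> lint a b (\<lambda>x. min (F x) (G x))"
proof -
 have [measurable]: "{x. F x \<le> G x} \<in> sets borel" by measurable
 then show ?thesis using osc_le_replace_borel[of F G "{x. F x \<le> G x}" f a b] assms by (simp add: min_def)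
qed

text \<open>The finite measure with density \<open>G\<close> gives no mass to a point, so its mass
  on shrinking intervals around that point tends to 0.\<close>

lemma osc_le_continuous:
 assumes m[measurable]: "borel_fun G"
  and G: "osc_le f G a b" and fin: "lint a b G < \<infinity>"
 shows "continuous_on {a..b} f" unfolding continuous_on_iff
proof (intro ballI allI impI)
 fix x e assume x: "x \<in> {a..b}" and e: "0 < (e::real)"
 define I where "I n = {x - 1 / real (Suc n)<..<x + 1 / real (Suc n)}" for n
 let ?H = "\<lambda>y. G y * indicator {a..b} y"
 let ?M = "density lborel ?H"
 have int: "(\<Inter>n. I n) = {x}"
 proof -
  have "y = x" if "y \<in> (\<Inter>n. I n)" for y
  proof (rule ccontr)
   assume "y \<noteq> x"
   then obtain n where "1 / real (Suc n) < \<bar>y - x\<bar>" by (metis nat_approx_posE zero_less_abs_iff right_minus_eq)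
   moreover have "y \<in> I n" using that by auto
   ultimately show False by (auto simp: I_def)
  qed
  then show ?thesis by (auto simp: I_def)
 qed
 have dec: "decseq I" unfolding decseq_def I_def
 proof (intro allI impI subsetI)
  fix m n y assume "m \<le> n" and y: "y \<in> {x - 1 / real (Suc n)<..<x + 1 / real (Suc n)}"
  then have "1 / real (Suc n) \<le> 1 / real (Suc m)" by (intro divide_left_mono) auto
  then show "y \<in> {x - 1 / real (Suc m)<..<x + 1 / real (Suc m)}" using y by auto
 qed
 have "(\<lambda>n. emeasure ?M (I n)) \<longlonglongrightarrow> emeasure ?M (\<Inter>n. I n)"
 proof (rule Lim_emeasure_decseq)
  show "range I \<subseteq> sets ?M" by (auto simp: I_def)
  fix n
  have "emeasure ?M (I n) \<le> lint a b G"
   by (subst emeasure_density) (auto simp: I_def indicator_def intro!: nn_integral_mono)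
  then show "emeasure ?M (I n) \<noteq> \<infinity>" using fin by (auto simp: top_unique)
 qed (rule dec)
 moreover have "emeasure ?M (\<Inter>n. I n) = 0"
 proof -
  have "emeasure ?M {x} = (\<integral>\<^sup>+y. 0 \<partial>lborel)" using AE_lborel_neq[of x]
   by (subst emeasure_density) (auto intro!: nn_integral_cong_AE elim!: eventually_mono)
  then show ?thesis unfolding int by simp
 qed
 ultimately have "eventually (\<lambda>n. emeasure ?M (I n) < ennreal e) sequentially"
  using e by (intro order_tendstoD(2)[of _ 0]) auto
 then obtain n where n: "emeasure ?M (I n) < ennreal e" by (auto simp: eventually_sequentially)
 show "\<exists>d>0. \<forall>y\<in>{a..b}. dist y x < d \<longrightarrow> dist (f y) (f x) < e"
 proof (intro exI[of _ "1 / real (Suc n)"] conjI ballI impI)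
  fix y assume y: "y \<in> {a..b}" "dist y x < 1 / real (Suc n)"
  let ?s = "min x y" and ?t = "max x y"
  have "ennreal \<bar>f ?s - f ?t\<bar> \<le> lint ?s ?t G" using x y by (intro osc_leD[OF G]) auto
  also have "\<dots> \<le> (\<integral>\<^sup>+z. ?H z * indicator (I n) z \<partial>lborel)"
   using x y by (intro nn_integral_mono) (auto simp: indicator_def I_def dist_real_def)
  also have "\<dots> = emeasure ?M (I n)" by (subst emeasure_density) (auto simp: I_def)
  finally have "ennreal \<bar>f ?s - f ?t\<bar> < ennreal e" using n by (rule order_le_less_trans)
  then have "\<bar>f ?s - f ?t\<bar> < e" by (simp add: ennreal_less_iff)
  then show "dist (f y) (f x) < e" by (auto simp: dist_real_def min_def max_def split: if_splits)
 qed simp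
qed

text \<open>Soft thresholding makes the function constant where it is small.\<close>

lemma osc_le_nonzero:
 assumes m[measurable]: "borel_fun G"
  and G: "osc_le f G a b" and fin: "lint a b G < \<infinity>" and ab: "a \<le> b"
 shows "ennreal \<bar>f a - f b\<bar> \<le> lint a b (\<lambda>x. if f x = 0 then 0 else G x)" (is "_ \<le> ?R")
proof -
 have "ennreal \<bar>f a - f b\<bar> \<le> ?R + ennreal e" if e: "0 < e" for e
 proof -
  let ?e = "e / 2"
  define h where "h x = f x - max (- ?e) (min ?e (f x))" for x
  \<comment> \<open>Clamping the argument to \<open>{a..b}\<close> makes \<open>U\<close> open in
    the whole line. On \<open>U\<close> the thresholded function \<open>h\<close> is 0.\<close>
  define U where "U = {x. \<bar>f (max a (min b x))\<bar> < ?e}"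
  have h: "osc_le h G a b" using G by (rule osc_le_contraction) (auto simp: h_def)
  have "continuous_on UNIV (\<lambda>x. f (max a (min b x)))"
   using ab by (intro continuous_on_compose2[OF osc_le_continuous[OF m G fin]] continuous_intros) auto
  then have "open U" unfolding U_def by (intro open_Collect_less continuous_intros)
  then have "ennreal \<bar>h a - h b\<bar> \<le> lint a b (\<lambda>x. if x \<in> U then 0 else G x)"
  proof (intro osc_le_replace_open h fin ab)
   fix s t assume st: "a \<le> s" "s \<le> t" "t \<le> b" "{s..t} \<subseteq> U"
   then have "s \<in> U" "t \<in> U" by auto
   then have "h s = 0" "h t = 0" using st by (auto simp: U_def h_def)
   then show "ennreal \<bar>h s - h t\<bar> \<le> lint s t (\<lambda>x. 0)" by simp
  qed auto
  also have "\<dots> \<le> ?R" using e by (intro nn_integral_mono) (auto simp: indicator_def U_def)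
  finally have "ennreal \<bar>h a - h b\<bar> + ennreal e \<le> ?R + ennreal e" by (simp add: add_right_mono)
  moreover have "ennreal \<bar>f a - f b\<bar> \<le> ennreal \<bar>h a - h b\<bar> + ennreal e"
  proof -
   have "\<bar>f a - f b\<bar> \<le> \<bar>h a - h b\<bar> + e" using e unfolding h_def max_def min_def by (simp split: if_splits) linarith
   then have "ennreal \<bar>f a - f b\<bar> \<le> ennreal (\<bar>h a - h b\<bar> + e)" by (rule ennreal_leI)
   then show ?thesis using e by simp
  qed
  ultimately show ?thesis by (rule order_trans[rotated])
 qed
 then show ?thesis by (rule ennreal_le_epsilon)
qed

text \<open>On a step of length between \<open>d / 2\<close> and \<open>d\<close> the difference
  quotient of \<open>f\<close> is at most every value of \<open>G\<close> there, hence at most its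
  mean. Only steps of this size are assumed controlled, since averages over balls of a fixed radius
  have no usable bound at shorter distances.\<close>

lemma chain_bound:
 assumes m[measurable]: "borel_fun G"
  and d: "0 < d" "s + d \<le> t"
  and step: "\<And>x y \<tau>. s \<le> x \<Longrightarrow> x \<le> \<tau> \<Longrightarrow> \<tau> \<le> y \<Longrightarrow> y \<le> t \<Longrightarrow> d / 2 \<le> y - x \<Longrightarrow> y - x \<le> d \<Longrightarrow>
   ennreal \<bar>f x - f y\<bar> \<le> ennreal (y - x) * G \<tau>"
 shows "ennreal \<bar>f s - f t\<bar> \<le> lint s t G"
proof -
 have one: "ennreal \<bar>f x - f y\<bar> \<le> lint x y G"
  if xy: "s \<le> x" "y \<le> t" "d / 2 \<le> y - x" "y - x \<le> d" for x y
 proof -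
  have pos: "0 < y - x" using xy d by linarith
  have le: "ennreal (\<bar>f x - f y\<bar> / (y - x)) \<le> G \<tau>" if "\<tau> \<in> {x..y}" for \<tau>
  proof (cases "G \<tau>")
   case (real r)
   then have "ennreal \<bar>f x - f y\<bar> \<le> ennreal ((y - x) * r)"
    using step[of x \<tau> y] that xy pos by (simp add: ennreal_mult)
   then have "\<bar>f x - f y\<bar> \<le> (y - x) * r" using real pos by (simp add: ennreal_le_iff)
   then show ?thesis using real pos by (simp add: ennreal_leI divide_le_eq mult.commute)
  qed simp
  have "ennreal \<bar>f x - f y\<bar> = ennreal (\<bar>f x - f y\<bar> / (y - x)) * emeasure lborel {x..y}"
   using pos by (simp add: ennreal_mult[symmetric])
  also have "\<dots> = lint x y (\<lambda>\<tau>. ennreal (\<bar>f x - f y\<bar> / (y - x)))" by (simp add: nn_integral_cmult_indicator)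
  also have "\<dots> \<le> lint x y G" using le by (intro nn_integral_mono) (auto simp: indicator_def)
  finally show ?thesis .
 qed
 \<comment> \<open>Because \<open>(t - s) / d\<close> is at least 1, rounding up at most doubles it,
   and the \<open>n\<close> equal steps have length between \<open>d / 2\<close> and
   \<open>d\<close>.\<close>
 define n where "n = nat \<lceil>(t - s) / d\<rceil>"
 define h where "h = (t - s) / real n"
 have q: "1 \<le> (t - s) / d" using d by (simp add: field_simps)
 have n: "(t - s) / d \<le> real n" "real n < (t - s) / d + 1" using q unfolding n_def by linarith+
 then have n0: "0 < real n" using q by linarith
 have "t - s \<le> real n * d" using n(1) d by (simp add: divide_le_eq)
 then have hd: "h \<le> d" using n0 by (simp add: h_def divide_le_eq mult.commute)
 have "real n \<le> 2 * ((t - s) / d)" using n(2) q by linarith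
 then have "real n * d \<le> 2 * (t - s)" using d by (simp add: field_simps)
 then have hd2: "d / 2 \<le> h" using n0 by (simp add: h_def field_simps)
 have h0: "0 < h" using hd2 d by linarith
 have hn: "s + real n * h = t" using n0 by (simp add: h_def)
 have "ennreal \<bar>f s - f (s + real i * h)\<bar> \<le> lint s (s + real i * h) G" if "i \<le> n" for i using that
 proof (induction i)
  case (Suc i)
  let ?x = "s + real i * h" and ?y = "s + real (Suc i) * h"
  have y: "?y \<le> t" using Suc.prems h0 hn by (metis add_left_mono less_imp_le mult_right_mono of_nat_le_iff)
  have xy: "?y - ?x = h" by (simp add: algebra_simps)
  have sx: "s \<le> ?x" using h0 by simp
  have "ennreal \<bar>f s - f ?y\<bar> \<le> ennreal \<bar>f s - f ?x\<bar> + ennreal \<bar>f ?x - f ?y\<bar>" by (rule ennreal_abs_triangle)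
  also have "\<dots> \<le> lint s ?x G + lint ?x ?y G" using Suc y hd hd2 sx xy by (intro add_mono Suc.IH one) auto
  also have "\<dots> = lint s ?y G" using sx xy h0 by (intro nn_integral_Icc_split[symmetric]) auto
  finally show ?case .
 qed simp
 from this[of n] show ?thesis by (simp add: hn)
qed

section \<open>Absolute continuity along curves\<close>

text \<open>Stronger than the gradient inequality for \<open>c\<close> alone: it controls all
  subcurves and makes \<open>u\<close> finite on the curve. By passing to subcurves the weak form
  implies it for almost every curve, provided that almost every line integral of \<open>g\<close> is
  finite.\<close>

definition ac_along :: "('a::metric_space \<Rightarrow> ereal) \<Rightarrow> ('a \<Rightarrow> ennreal) \<Rightarrow> real \<times> (real \<Rightarrow> 'a) \<Rightarrow> bool" where
 "ac_along u g c \<longleftrightarrow> line_integral g c < \<infinity> \<and>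
   (\<exists>f. (\<forall>t\<in>{0..fst c}. u (snd c t) = ereal (f t)) \<and> osc_le f (\<lambda>t. g (clamped c t)) 0 (fst c))"

lemma clamped_integral:
 assumes "0 \<le> s" "t \<le> fst c"
 shows "lint s t (\<lambda>x. g (clamped c x)) = lint s t (\<lambda>x. g (snd c x))"
 using assms by (intro nn_integral_cong) (auto simp: indicator_def clamped_eq)

lemma clamped_line_integral:
 "lint 0 (fst c) (\<lambda>x. g (clamped c x)) = line_integral g c" by (simp add: clamped_integral line_integral_lborel)

lemma clamped_comp_measurable:
 "c \<in> curves A \<Longrightarrow> borel_fun g \<Longrightarrow> borel_fun (\<lambda>t. g (clamped c t))"
 using measurable_compose[OF clamped_measurable] by blast

lemma osc_le_subset: "osc_le f F a b \<Longrightarrow> a \<le> s \<Longrightarrow> t \<le> b \<Longrightarrow> osc_le f F s t" unfolding osc_le_def by simp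

lemma osc_le_cong:
 assumes "osc_le f F a b" "\<And>t. a \<le> t \<Longrightarrow> t \<le> b \<Longrightarrow> f t = h t" shows "osc_le h F a b"
 using assms(1) by (rule osc_le_contraction) (use assms(2) in auto)

lemma osc_le_cong_AE:
 assumes "osc_le f F a b" "AE t in lborel. t \<in> {a..b} \<longrightarrow> F t = G t" shows "osc_le f G a b" unfolding osc_le_def
proof (intro allI impI)
 fix s t assume st: "a \<le> s" "s \<le> t" "t \<le> b"
 have "lint s t F = lint s t G"
  using assms(2) st by (intro nn_integral_cong_AE) (auto elim!: eventually_mono simp: indicator_def)
 then show "ennreal \<bar>f s - f t\<bar> \<le> lint s t G" using osc_leD[OF assms(1) st] by simp
qed

lemma ac_alongE:
 assumes "ac_along u g c"
 obtains f where "\<And>t. 0 \<le> t \<Longrightarrow> t \<le> fst c \<Longrightarrow> u (snd c t) = ereal (f t)"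
  "osc_le f (\<lambda>t. g (clamped c t)) 0 (fst c)" "line_integral g c < \<infinity>" using assms unfolding ac_along_def by auto

lemma ac_alongI:
 assumes "line_integral g c < \<infinity>" "\<And>t. 0 \<le> t \<Longrightarrow> t \<le> fst c \<Longrightarrow> u (snd c t) = ereal (f t)"
  "osc_le f (\<lambda>t. g (clamped c t)) 0 (fst c)"
 shows "ac_along u g c" using assms unfolding ac_along_def by auto

lemma ac_along_gradient: "0 < fst c \<Longrightarrow> ac_along u g c \<Longrightarrow> gradient_inequality u g c" unfolding gradient_inequality_def
 by (elim ac_alongE) (use osc_leD[of _ _ 0 "fst c" 0 "fst c"] in \<open>fastforce simp: clamped_line_integral\<close>)

text \<open>A finite \<open>jump\<close> excludes infinite values at both of its ends. Comparing
  each parameter with an end of the curve therefore makes \<open>u\<close> real along the whole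
  curve.\<close>

lemma ac_along_of_subcurves:
 assumes c: "c \<in> curves A" and g: "borel_fun g" and fin: "line_integral g c < \<infinity>"
  and sub: "\<And>s t. 0 \<le> s \<Longrightarrow> s < t \<Longrightarrow> t \<le> fst c \<Longrightarrow> gradient_inequality u g (subcurve c s t)"
 shows "ac_along u g c"
proof (rule ac_alongI[OF fin])
 have j: "jump (u (snd c s)) (u (snd c t)) \<le> lint s t (\<lambda>x. g (snd c x))"
   "jump (u (snd c s)) (u (snd c t)) < \<infinity>" if st: "0 \<le> s" "s < t" "t \<le> fst c" for s t
 proof -
  have "jump (u (snd c s)) (u (snd c t)) \<le> line_integral g (subcurve c s t)"
   using sub[OF st] by (simp add: gradient_inequality_def subcurve_def)
  then show "jump (u (snd c s)) (u (snd c t)) \<le> lint s t (\<lambda>x. g (snd c x))"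
   by (simp add: line_integral_subcurve[OF c g st])
  show "jump (u (snd c s)) (u (snd c t)) < \<infinity>"
   using \<open>jump _ _ \<le> line_integral g (subcurve c s t)\<close> line_integral_subcurve_le[OF c g st] fin
   by (meson order_le_less_trans)
 qed
 have l: "0 < fst c" using c by (rule curves_pos)
 show u: "u (snd c t) = ereal (real_of_ereal (u (snd c t)))" if t: "0 \<le> t" "t \<le> fst c" for t
 proof (cases "t = 0")
  case True
  show ?thesis by (rule jump_less_top[OF j(2)[of 0 "fst c"]]) (use l True in auto)
 next
  case False
  show ?thesis by (rule jump_less_top[OF j(2)[of 0 t]]) (use t False in auto)
 qed
 show "osc_le (\<lambda>t. real_of_ereal (u (snd c t))) (\<lambda>t. g (clamped c t)) 0 (fst c)" unfolding osc_le_def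
 proof (intro allI impI)
  fix s t assume st: "0 \<le> s" "s \<le> t" "t \<le> fst c"
  show "ennreal \<bar>real_of_ereal (u (snd c s)) - real_of_ereal (u (snd c t))\<bar>
   \<le> lint s t (\<lambda>x. g (clamped c x))"
  proof (cases "s = t")
   case False
   have "jump (u (snd c s)) (u (snd c t)) = ennreal \<bar>real_of_ereal (u (snd c s)) - real_of_ereal (u (snd c t))\<bar>"
    using st by (subst u, simp, simp, subst (2) u) simp_all
   then show ?thesis using j(1)[of s t] False st by (simp add: clamped_integral)
  qed simp
 qed
qed

lemma ac_along_change_gradient:
 assumes u: "ac_along u g c" and ae: "ae_along c (\<lambda>x. g x = h x)"
 shows "ac_along u h c"
proof -
 from u obtain f where f: "\<And>t. 0 \<le> t \<Longrightarrow> t \<le> fst c \<Longrightarrow> u (snd c t) = ereal (f t)"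
  "osc_le f (\<lambda>t. g (clamped c t)) 0 (fst c)" "line_integral g c < \<infinity>" by (rule ac_alongE) blast
 have "AE t in lborel. t \<in> {0..fst c} \<longrightarrow> g (clamped c t) = h (clamped c t)"
  using ae by eventually_elim (auto simp: clamped_eq)
 then show ?thesis using f line_integral_cong_AE[OF ae] by (intro ac_alongI[of h c u f] osc_le_cong_AE[OF f(2)]) auto
qed

lemma ac_along_unique:
 assumes "ac_along u g c" "ac_along u h c"
 obtains f where "\<And>t. 0 \<le> t \<Longrightarrow> t \<le> fst c \<Longrightarrow> u (snd c t) = ereal (f t)"
  "osc_le f (\<lambda>t. g (clamped c t)) 0 (fst c)" "osc_le f (\<lambda>t. h (clamped c t)) 0 (fst c)"
proof -
 from assms(1) obtain f where f: "\<And>t. 0 \<le> t \<Longrightarrow> t \<le> fst c \<Longrightarrow> u (snd c t) = ereal (f t)"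
  "osc_le f (\<lambda>t. g (clamped c t)) 0 (fst c)" "line_integral g c < \<infinity>" by (rule ac_alongE) blast
 from assms(2) obtain f' where f': "\<And>t. 0 \<le> t \<Longrightarrow> t \<le> fst c \<Longrightarrow> u (snd c t) = ereal (f' t)"
  "osc_le f' (\<lambda>t. h (clamped c t)) 0 (fst c)" "line_integral h c < \<infinity>" by (rule ac_alongE) blast
 have "osc_le f (\<lambda>t. h (clamped c t)) 0 (fst c)" using f'(2) by (rule osc_le_cong) (use f(1) f'(1) in force)
 then show ?thesis using f that by blast
qed

lemma ac_along_min:
 assumes c: "c \<in> curves A" and m: "borel_fun g" "borel_fun h"
  and g: "ac_along u g c" and h: "ac_along u h c"
 shows "ac_along u (\<lambda>x. min (g x) (h x)) c"
proof -
 obtain f where f: "\<And>t. 0 \<le> t \<Longrightarrow> t \<le> fst c \<Longrightarrow> u (snd c t) = ereal (f t)"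
  "osc_le f (\<lambda>t. g (clamped c t)) 0 (fst c)" "osc_le f (\<lambda>t. h (clamped c t)) 0 (fst c)"
  using ac_along_unique[OF g h] by blast
 note mc = m[THEN clamped_comp_measurable[OF c]]
 have fin: "line_integral g c < \<infinity>" "line_integral h c < \<infinity>" using g h by (auto simp: ac_along_def)
 have fin': "lint s t (\<lambda>x. k (clamped c x)) < \<infinity>"
  if "line_integral k c < \<infinity>" "0 \<le> s" "t \<le> fst c" for s t k
 proof -
  have "lint s t (\<lambda>x. k (clamped c x)) \<le> lint 0 (fst c) (\<lambda>x. k (clamped c x))"
   using that by (intro nn_integral_mono) (auto simp: indicator_def)
  then show ?thesis using that(1) by (auto simp: clamped_line_integral)
 qed
 have "osc_le f (\<lambda>t. min (g (clamped c t)) (h (clamped c t))) 0 (fst c)" unfolding osc_le_def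
 proof (intro allI impI)
  fix s t assume st: "0 \<le> s" "s \<le> t" "t \<le> fst c"
  show "ennreal \<bar>f s - f t\<bar> \<le> lint s t (\<lambda>x. min (g (clamped c x)) (h (clamped c x)))"
   using st by (intro osc_le_min mc osc_le_subset[OF f(2)] osc_le_subset[OF f(3)] fin' fin) auto
 qed
 moreover have "line_integral (\<lambda>x. min (g x) (h x)) c \<le> line_integral g c" by (intro line_integral_mono) simp
 ultimately show ?thesis using f(1) fin(1) by (intro ac_alongI[of _ c u f]) (auto elim: order_le_less_trans)
qed

lemma nn_integral_lincomb:
 assumes [measurable]: "borel_fun F" "borel_fun G"
 shows "lint s t (\<lambda>x. a * F x + b * G x) =
  a * lint s t F + b * lint s t G"
proof -
 have "lint s t (\<lambda>x. a * F x + b * G x) =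
   (\<integral>\<^sup>+x. a * (F x * indicator {s..t} x) + b * (G x * indicator {s..t} x) \<partial>lborel)"
  by (intro nn_integral_cong) (auto simp: indicator_def)
 then show ?thesis by (simp add: nn_integral_add nn_integral_cmult)
qed

text \<open>The hypothesis on \<open>w\<close> is a pointwise two-variable Lipschitz bound on the
  trace of the curve, so that sums, differences, Lipschitz truncations and products of bounded
  functions are all instances.\<close>

lemma ac_along_combine:
 fixes a b :: real
 assumes c: "c \<in> curves A" and m: "borel_fun g" "borel_fun h"
  and ac: "ac_along u g c" "ac_along v h c" and ab: "0 \<le> a" "0 \<le> b"
  and w: "\<And>P Q x x' y y'. P \<in> snd c ` {0..fst c} \<Longrightarrow> Q \<in> snd c ` {0..fst c} \<Longrightarrow>
   u P = ereal x \<Longrightarrow> u Q = ereal x' \<Longrightarrow> v P = ereal y \<Longrightarrow> v Q = ereal y' \<Longrightarrow>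
   \<exists>r r'. w P = ereal r \<and> w Q = ereal r' \<and> \<bar>r - r'\<bar> \<le> a * \<bar>x - x'\<bar> + b * \<bar>y - y'\<bar>"
 shows "ac_along w (\<lambda>x. ennreal a * g x + ennreal b * h x) c"
proof -
 from ac(1) obtain f where f: "\<And>t. 0 \<le> t \<Longrightarrow> t \<le> fst c \<Longrightarrow> u (snd c t) = ereal (f t)"
  "osc_le f (\<lambda>t. g (clamped c t)) 0 (fst c)" "line_integral g c < \<infinity>" by (rule ac_alongE) blast
 from ac(2) obtain k where k: "\<And>t. 0 \<le> t \<Longrightarrow> t \<le> fst c \<Longrightarrow> v (snd c t) = ereal (k t)"
  "osc_le k (\<lambda>t. h (clamped c t)) 0 (fst c)" "line_integral h c < \<infinity>" by (rule ac_alongE) blast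
 note mc = m[THEN clamped_comp_measurable[OF c]]
 define q where "q t = real_of_ereal (w (snd c t))" for t
 have q: "w (snd c t) = ereal (q t)" if "0 \<le> t" "t \<le> fst c" for t
 proof -
  have "snd c t \<in> snd c ` {0..fst c}" using that by auto
  from w[OF this this f(1) f(1) k(1) k(1)] that show ?thesis by (auto simp: q_def)
 qed
 have osc: "osc_le q (\<lambda>t. ennreal a * g (clamped c t) + ennreal b * h (clamped c t)) 0 (fst c)" unfolding osc_le_def
 proof (intro allI impI)
  fix s t assume st: "0 \<le> s" "s \<le> t" "t \<le> fst c"
  have "snd c t \<in> snd c ` {0..fst c}" "snd c s \<in> snd c ` {0..fst c}" using st by auto
  from w[OF this(2,1) f(1) f(1) k(1) k(1)] q[of s] q[of t] st
  have "\<bar>q s - q t\<bar> \<le> a * \<bar>f s - f t\<bar> + b * \<bar>k s - k t\<bar>" by auto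
  then have "ennreal \<bar>q s - q t\<bar> \<le> ennreal a * ennreal \<bar>f s - f t\<bar> + ennreal b * ennreal \<bar>k s - k t\<bar>"
   using ab by (simp add: ennreal_mult[symmetric] ennreal_plus[symmetric] ennreal_leI del: ennreal_plus)
  also have "\<dots> \<le> ennreal a * lint s t (\<lambda>x. g (clamped c x)) +
    ennreal b * lint s t (\<lambda>x. h (clamped c x))"
   by (intro add_mono mult_left_mono osc_leD[OF f(2)] osc_leD[OF k(2)] st) auto
  also have "\<dots> = lint s t (\<lambda>x. ennreal a * g (clamped c x) + ennreal b * h (clamped c x))"
   by (rule nn_integral_lincomb[OF mc, symmetric])
  finally show "ennreal \<bar>q s - q t\<bar> \<le>
   (lint s t (\<lambda>x. ennreal a * g (clamped c x) + ennreal b * h (clamped c x)))" .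
 qed
 have "line_integral (\<lambda>x. ennreal a * g x + ennreal b * h x) c =
   ennreal a * line_integral g c + ennreal b * line_integral h c"
  unfolding clamped_line_integral[symmetric] by (rule nn_integral_lincomb[OF mc])
 also have "\<dots> < \<infinity>" using f(3) k(3) by (simp add: ennreal_mult_less_top)
 finally show ?thesis by (rule ac_alongI[OF _ q osc])
qed

lemma ac_along_nonzero:
 assumes c: "c \<in> curves A" and m[measurable]: "borel_fun g" and S[measurable]: "S \<in> sets borel"
  and g: "ac_along u g c"
  and ae: "ae_along c (\<lambda>x. (u x = 0 \<longleftrightarrow> x \<in> S))"
 shows "ac_along u (\<lambda>x. if x \<in> S then 0 else g x) c"
proof -
 from g obtain f where f: "\<And>t. 0 \<le> t \<Longrightarrow> t \<le> fst c \<Longrightarrow> u (snd c t) = ereal (f t)"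
  "osc_le f (\<lambda>t. g (clamped c t)) 0 (fst c)" "line_integral g c < \<infinity>" by (rule ac_alongE) blast
 have "osc_le f (\<lambda>t. if clamped c t \<in> S then 0 else g (clamped c t)) 0 (fst c)" unfolding osc_le_def
 proof (intro allI impI)
  fix s t assume st: "0 \<le> s" "s \<le> t" "t \<le> fst c"
  have "lint s t (\<lambda>x. g (clamped c x)) \<le> lint 0 (fst c) (\<lambda>x. g (clamped c x))"
   using st by (intro nn_integral_mono) (auto simp: indicator_def)
  then have "lint s t (\<lambda>x. g (clamped c x)) < \<infinity>"
   using f(3) unfolding clamped_line_integral by (rule order_le_less_trans)
  then have "ennreal \<bar>f s - f t\<bar> \<le> lint s t (\<lambda>x. if f x = 0 then 0 else g (clamped c x))"
   using st by (intro osc_le_nonzero clamped_comp_measurable[OF c m] osc_le_subset[OF f(2)]) auto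
  also have "\<dots> = lint s t (\<lambda>x. if clamped c x \<in> S then 0 else g (clamped c x))"
   using ae by (intro nn_integral_cong_AE, eventually_elim)
    (use f(1) st in \<open>auto simp: indicator_def clamped_eq\<close>)
  finally show "ennreal \<bar>f s - f t\<bar> \<le> lint s t (\<lambda>x. if clamped c x \<in> S then 0 else g (clamped c x))" .
 qed
 moreover have "line_integral (\<lambda>x. if x \<in> S then 0 else g x) c < \<infinity>"
  by (rule order_le_less_trans[OF line_integral_mono f(3)]) simp
 ultimately show ?thesis using f(1) by (intro ac_alongI[of _ c u f]) auto
qed

lemma ac_along_subcurve_osc:
 assumes st: "0 \<le> s" "s < t" "t \<le> fst c" and "ac_along u h (subcurve c s t)"
  and f: "\<And>t. 0 \<le> t \<Longrightarrow> t \<le> fst c \<Longrightarrow> u (snd c t) = ereal (f t)"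
  and c: "c \<in> curves A" and h: "borel_fun h"
 shows "ennreal \<bar>f s - f t\<bar> \<le> lint s t (\<lambda>x. h (clamped c x))"
proof -
 have "gradient_inequality u h (subcurve c s t)"
  using assms(4) st by (intro ac_along_gradient) (auto simp: subcurve_def)
 then have "jump (u (snd c s)) (u (snd c t)) \<le> line_integral h (subcurve c s t)"
  by (simp add: gradient_inequality_def subcurve_def)
 then show ?thesis using f[of s] f[of t] st by (simp add: line_integral_subcurve[OF c h st] clamped_integral)
qed

text \<open>The parameters that are sent to \<open>G\<close> form, up to a null set, an open set
  \<open>U\<close>. Compact intervals in \<open>U\<close> give subcurves on which \<open>h\<close>
  is admissible too; there both bounds merge into the minimum, which spreads to all of
  \<open>U\<close> by exhausting it with intervals.\<close>

lemma ac_along_glue: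
 assumes c: "c \<in> curves A" and m[measurable]: "borel_fun g" "borel_fun h"
  and B[measurable]: "B \<in> sets borel"
  and g: "ac_along u g c"
  and U: "openin (top_of_set {0..fst c}) U" "Z \<in> null_sets lebesgue" "{t \<in> {0..fst c}. snd c t \<in> G} = U \<union> Z"
  and sub: "\<And>s t. 0 \<le> s \<Longrightarrow> s < t \<Longrightarrow> t \<le> fst c \<Longrightarrow> {s..t} \<subseteq> U \<Longrightarrow> ac_along u h (subcurve c s t)"
  and ae: "ae_along c (\<lambda>x. (x \<in> G \<longleftrightarrow> x \<in> B))"
 shows "ac_along u (\<lambda>x. if x \<in> B then min (g x) (h x) else g x) c"
proof -
 from g obtain f where f: "\<And>t. 0 \<le> t \<Longrightarrow> t \<le> fst c \<Longrightarrow> u (snd c t) = ereal (f t)"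
  "osc_le f (\<lambda>t. g (clamped c t)) 0 (fst c)" "line_integral g c < \<infinity>" by (rule ac_alongE) blast
 note mc[measurable] = m[THEN clamped_comp_measurable[OF c]]
 obtain W where W: "open W" "U = {0..fst c} \<inter> W" using U(1) by (auto simp: openin_open)
 have fin: "lint s t (\<lambda>x. g (clamped c x)) < \<infinity>" if "0 \<le> s" "t \<le> fst c" for s t
 proof -
  have "lint s t (\<lambda>x. g (clamped c x)) \<le> lint 0 (fst c) (\<lambda>x. g (clamped c x))"
   using that by (intro nn_integral_mono) (auto simp: indicator_def)
  then show ?thesis using f(3) by (auto simp: clamped_line_integral)
 qed
 have hle: "ennreal \<bar>f s - f t\<bar> \<le> lint s t (\<lambda>x. h (clamped c x))"
  if "0 \<le> s" "s \<le> t" "t \<le> fst c" "{s..t} \<subseteq> U" for s t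
 proof (cases "s = t")
  case False
  then show ?thesis using that by (intro ac_along_subcurve_osc[OF _ _ _ sub f(1) c m(2)]) auto
 qed simp
 have mle: "ennreal \<bar>f s - f t\<bar> \<le> lint s t (\<lambda>x. min (g (clamped c x)) (h (clamped c x)))"
  if st: "0 \<le> s" "s \<le> t" "t \<le> fst c" "{s..t} \<subseteq> U" for s t
 proof (cases "s = t")
  case False
  have "lint s t (\<lambda>x. h (clamped c x)) < \<infinity>"
  proof -
   have "ac_along u h (subcurve c s t)" using False st by (intro sub) auto
   then have "line_integral h (subcurve c s t) < \<infinity>" by (simp add: ac_along_def)
   then show ?thesis using False st by (simp add: line_integral_subcurve[OF c m(2)] clamped_integral)
  qed
  moreover have "osc_le f (\<lambda>x. h (clamped c x)) s t" unfolding osc_le_def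
  proof (intro allI impI)
   fix s' t' assume "s \<le> s'" "s' \<le> t'" "t' \<le> t"
   moreover from this have "{s'..t'} \<subseteq> U" using st(4) by (meson atLeastatMost_subset_iff order_trans)
   ultimately show "ennreal \<bar>f s' - f t'\<bar> \<le> lint s' t' (\<lambda>x. h (clamped c x))" using st by (intro hle) auto
  qed
  ultimately show ?thesis using st by (intro osc_le_min mc osc_le_subset[OF f(2)] fin) auto
 qed simp
 have Z0: "AE t in lborel. t \<notin> Z"
 proof -
  obtain Z' where "Z' \<in> null_sets lborel" "Z \<subseteq> Z'" using U(2) by (auto simp: null_sets_completion_iff2)
  then show ?thesis using AE_not_in[of Z' lborel] by (auto elim!: eventually_mono)
 qed
 have "osc_le f (\<lambda>t. if clamped c t \<in> B then min (g (clamped c t)) (h (clamped c t)) else g (clamped c t)) 0 (fst c)"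
  unfolding osc_le_def
 proof (intro allI impI)
  fix s t assume st: "0 \<le> s" "s \<le> t" "t \<le> fst c"
  have "ennreal \<bar>f s - f t\<bar> \<le> lint s t (\<lambda>x. if x \<in> W then min (g (clamped c x)) (h (clamped c x)) else g (clamped c x))"
  proof (rule osc_le_replace_open)
   fix s' t' assume "s \<le> s'" "s' \<le> t'" "t' \<le> t" "{s'..t'} \<subseteq> W"
   then show "ennreal \<bar>f s' - f t'\<bar> \<le> lint s' t' (\<lambda>x. min (g (clamped c x)) (h (clamped c x)))"
    using st W(2) by (intro mle) auto
  qed (use st f W in \<open>auto intro: osc_le_subset fin[simplified]\<close>)
  also have "\<dots> = lint s t (\<lambda>x. if clamped c x \<in> B then min (g (clamped c x)) (h (clamped c x)) else g (clamped c x))"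
  proof (intro nn_integral_cong_AE, use ae Z0 in eventually_elim)
   fix x assume x: "x \<in> {0..fst c} \<longrightarrow> (snd c x \<in> G \<longleftrightarrow> snd c x \<in> B)" "x \<notin> Z"
   have "x \<in> W \<longleftrightarrow> clamped c x \<in> B" if "x \<in> {s..t}"
   proof -
    have "x \<in> {0..fst c}" using that st by auto
    moreover have "snd c x \<in> G \<longleftrightarrow> x \<in> W" using U(3) W(2) x(2) \<open>x \<in> {0..fst c}\<close> by blast
    ultimately show ?thesis using x(1) by (simp add: clamped_eq)
   qed
   then show "(if x \<in> W then min (g (clamped c x)) (h (clamped c x)) else g (clamped c x)) * indicator {s..t} x =
    (if clamped c x \<in> B then min (g (clamped c x)) (h (clamped c x)) else g (clamped c x)) * indicator {s..t} x"
    by (auto simp: indicator_def)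
  qed
  finally show "ennreal \<bar>f s - f t\<bar> \<le> lint s t (\<lambda>x. if clamped c x \<in> B then min (g (clamped c x)) (h (clamped c x)) else g (clamped c x))" .
 qed
 moreover have "line_integral (\<lambda>x. if x \<in> B then min (g x) (h x) else g x) c \<le> line_integral g c"
  by (intro line_integral_mono) auto
 ultimately show ?thesis using f(1,3) by (intro ac_alongI[of _ c u f]) (auto elim: order_le_less_trans)
qed

text \<open>Convergence from above of the integrals over each subinterval, available because the
  line integral of \<open>g 0\<close> is finite.\<close>

lemma ac_along_INF:
 assumes c: "c \<in> curves A" and m: "\<And>n. borel_fun (g n)"
  and dec: "\<And>n x. g (Suc n) x \<le> g n x" and ac: "\<And>n. ac_along u (g n) c"
 shows "ac_along u (\<lambda>x. INF n. g n x) c"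
proof -
 note mc = clamped_comp_measurable[OF c m]
 from ac[of 0] obtain f where f: "\<And>t. 0 \<le> t \<Longrightarrow> t \<le> fst c \<Longrightarrow> u (snd c t) = ereal (f t)"
  "osc_le f (\<lambda>t. g 0 (clamped c t)) 0 (fst c)" "line_integral (g 0) c < \<infinity>" by (rule ac_alongE) blast
 have osc: "osc_le f (\<lambda>t. g n (clamped c t)) 0 (fst c)" for n
 proof -
  from ac[of n] obtain f' where f': "\<And>t. 0 \<le> t \<Longrightarrow> t \<le> fst c \<Longrightarrow> u (snd c t) = ereal (f' t)"
   "osc_le f' (\<lambda>t. g n (clamped c t)) 0 (fst c)" by (rule ac_alongE) blast
  show ?thesis using f'(2) by (rule osc_le_cong) (use f(1) f'(1) in force)
 qed
 have "osc_le f (\<lambda>t. INF n. g n (clamped c t)) 0 (fst c)" unfolding osc_le_def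
 proof (intro allI impI)
  fix s t assume st: "0 \<le> s" "s \<le> t" "t \<le> fst c"
  have "ennreal \<bar>f s - f t\<bar> \<le> (INF n. \<integral>\<^sup>+x\<in>{s..t}. g n (clamped c x) \<partial>lborel)"
   by (intro INF_greatest osc_leD[OF osc] st)
  also have "\<dots> = (\<integral>\<^sup>+x. (INF n. g n (clamped c x) * indicator {s..t} x) \<partial>lborel)"
  proof (rule nn_integral_monotone_convergence_INF_decseq[symmetric])
   show "decseq (\<lambda>n x. g n (clamped c x) * indicator {s..t} x)"
    by (intro decseq_SucI le_funI mult_right_mono dec) auto
   show "(\<lambda>x. g n (clamped c x) * indicator {s..t} x) \<in> borel_measurable lborel" for n using mc[of n] by measurable
   have "lint s t (\<lambda>x. g 0 (clamped c x)) \<le> lint 0 (fst c) (\<lambda>x. g 0 (clamped c x))"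
    using st by (intro nn_integral_mono) (auto simp: indicator_def)
   then show "lint s t (\<lambda>x. g 0 (clamped c x)) < \<infinity>"
    using f(3) unfolding clamped_line_integral by (rule order_le_less_trans)
  qed
  also have "\<dots> = lint s t (\<lambda>x. INF n. g n (clamped c x))" by (intro nn_integral_cong) (auto simp: indicator_def)
  finally show "ennreal \<bar>f s - f t\<bar> \<le> lint s t (\<lambda>x. INF n. g n (clamped c x))" .
 qed
 moreover have "line_integral (\<lambda>x. INF n. g n x) c \<le> line_integral (g 0) c"
  by (intro line_integral_mono INF_lower) simp
 ultimately show ?thesis using f(1,3) by (intro ac_alongI[of _ c u f]) (auto elim: order_le_less_trans)
qed

section \<open>Weak upper gradients\<close>

lemma AE_Icc_ex:
 assumes "AE t in lborel. t \<in> {a..b} \<longrightarrow> P t" "a < (b::real)"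
 obtains t where "t \<in> {a..b}" "P t"
proof (rule ccontr)
 assume "\<not> thesis"
 then have "AE t in lborel. t \<notin> {a..b}" using assms(1) that by (auto elim!: eventually_mono)
 then have "emeasure lborel {a..b} = 0" by (subst (asm) AE_iff_null_sets[symmetric]) (auto simp: null_sets_def)
 then show False using assms(2) by simp
qed

lemma fast_subseq:
 fixes f :: "nat \<Rightarrow> ennreal" and e :: "nat \<Rightarrow> ennreal"
 assumes f: "f \<longlonglongrightarrow> 0" and e: "\<And>n. 0 < e n"
 obtains r where "strict_mono r" "\<And>n. f (r n) \<le> e n"
proof -
 have "\<forall>n. \<exists>N. \<forall>m\<ge>N. f m \<le> e n"
 proof
  fix n
  from order_tendstoD(2)[OF f e[of n]] show "\<exists>N. \<forall>m\<ge>N. f m \<le> e n"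
   by (auto simp: eventually_sequentially intro: less_imp_le)
 qed
 from choice[OF this] obtain M where M: "\<And>n m. m \<ge> M n \<Longrightarrow> f m \<le> e n" by auto
 define r where "r = rec_nat (M 0) (\<lambda>n k. max (M (Suc n)) (Suc k))"
 have "strict_mono r" by (rule strict_mono_Suc_iff[THEN iffD2]) (simp add: r_def less_max_iff_disj)
 moreover have "M n \<le> r n" for n by (cases n) (auto simp: r_def)
 ultimately show ?thesis using M that by blast
qed

section \<open>Properties of almost every curve and exceptional sets\<close>

context metric_measure_space
begin

definition aec :: "'a set \<Rightarrow> (real \<times> (real \<Rightarrow> 'a) \<Rightarrow> bool) \<Rightarrow> bool" where
 "aec A P \<longleftrightarrow> exc {c \<in> curves A. \<not> P c}"

abbreviation ae_slope_le :: "('a \<Rightarrow> real) \<Rightarrow> ('a \<Rightarrow> ennreal) \<Rightarrow> bool" where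
 "ae_slope_le V G \<equiv> aec UNIV (\<lambda>c. \<forall>s\<in>{0..fst c}. \<forall>t\<in>{0..fst c}.
   ennreal \<bar>V (snd c s) - V (snd c t)\<bar> \<le> line_integral G c)"

lemma aec_mp:
 assumes "aec A P" "\<And>c. c \<in> curves A \<Longrightarrow> P c \<Longrightarrow> R c" shows "aec A R"
 using assms unfolding aec_def by (auto elim!: exc_subset)

lemma aec_mp2:
 assumes "aec A P" "aec A Q" "\<And>c. c \<in> curves A \<Longrightarrow> P c \<Longrightarrow> Q c \<Longrightarrow> R c" shows "aec A R"
proof -
 have "exc ({c \<in> curves A. \<not> P c} \<union> {c \<in> curves A. \<not> Q c})"
  using assms(1,2) unfolding aec_def by (rule exc_Un) (auto dest: curves_UNIV)
 then show ?thesis unfolding aec_def by (rule exc_subset) (use assms(3) in auto)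
qed

lemma aec_conj: "aec A P \<Longrightarrow> aec A Q \<Longrightarrow> aec A (\<lambda>c. P c \<and> Q c)" by (rule aec_mp2[of A P Q]) auto

lemma aec_all:
 fixes P :: "nat \<Rightarrow> _" assumes "\<And>n. aec A (P n)" shows "aec A (\<lambda>c. \<forall>n. P n c)"
proof -
 have "exc (\<Union>n. {c \<in> curves A. \<not> P n c})" using assms unfolding aec_def by (rule exc_UN) (auto dest: curves_UNIV)
 then show ?thesis unfolding aec_def by (rule exc_subset) auto
qed

lemma aec_subset: "aec A P \<Longrightarrow> A' \<subseteq> A \<Longrightarrow> aec A' P"
 unfolding aec_def using curves_mono[of A' A] by (auto elim!: exc_subset)

lemma aec_True: "(\<And>c. c \<in> curves A \<Longrightarrow> P c) \<Longrightarrow> aec A P" unfolding aec_def exc_def using Lp_zero by blast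

lemma aec_AE: "AE x in \<mu>. P x \<Longrightarrow> aec A (\<lambda>c. ae_along c P)" unfolding aec_def by (rule exc_AE)

lemma aec_Lp: "Lp \<rho> \<Longrightarrow> aec A (\<lambda>c. line_integral \<rho> c < \<infinity>)"
 unfolding aec_def using exc_Lp[of \<rho> A] by (simp add: not_less top_unique)

text \<open>A density with infinite integral over a subcurve has infinite integral over the whole
  curve, so the curves with a bad subcurve are themselves exceptional.\<close>

lemma aec_subcurves:
 assumes "aec B P"
 shows "aec A (\<lambda>c. \<forall>s t. 0 \<le> s \<longrightarrow> s < t \<longrightarrow> t \<le> fst c \<longrightarrow> subcurve c s t \<in> curves B \<longrightarrow> P (subcurve c s t))"
proof -
 from assms obtain \<rho> where \<rho>: "Lp \<rho>" "\<And>c. c \<in> curves B \<Longrightarrow> \<not> P c \<Longrightarrow> line_integral \<rho> c = \<infinity>"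
  unfolding aec_def exc_def by blast
 show ?thesis
 proof (rule aec_mp[OF aec_Lp[OF \<rho>(1)]], intro allI impI)
  fix c s t assume c: "c \<in> curves A" "line_integral \<rho> c < \<infinity>" and st: "0 \<le> s" "s < t" "t \<le> fst c"
   and B: "subcurve c s t \<in> curves B"
  have "line_integral \<rho> (subcurve c s t) < \<infinity>"
   using line_integral_subcurve_le[OF c(1) Lp_measurable[OF \<rho>(1)] st] c(2) by (rule order_le_less_trans)
  then show "P (subcurve c s t)" using \<rho>(2)[OF B] by (cases "P (subcurve c s t)") simp_all
 qed
qed

text \<open>The working form of a p-weak upper gradient: Borel, and with the inequality on all
  subcurves of almost every curve. It is stable under minima, decreasing limits and gluing.\<close>

definition ACC :: "'a set \<Rightarrow> ('a \<Rightarrow> ereal) \<Rightarrow> ('a \<Rightarrow> ennreal) \<Rightarrow> bool" where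
 "ACC A u g \<longleftrightarrow> g \<in> borel_measurable borel \<and> aec A (ac_along u g)"

text \<open>These are the sets of capacity zero, see \<open>sobolev_capacity_0_iff\<close>. In terms
  of curves it is immediate that they are closed under subsets and countable unions.\<close>

definition exceptional :: "'a set \<Rightarrow> bool" where
 "exceptional Z \<longleftrightarrow> Z \<in> null_sets \<mu> \<and> aec UNIV (\<lambda>c. \<forall>t\<in>{0..fst c}. snd c t \<notin> Z)"

lemma exceptional_empty [simp]: "exceptional {}" unfolding exceptional_def by (auto intro: aec_True)

lemma exceptional_null: "exceptional Z \<Longrightarrow> Z \<in> null_sets \<mu>" by (simp add: exceptional_def)

lemma exceptional_AE: "exceptional Z \<Longrightarrow> AE x in \<mu>. x \<notin> Z" by (rule AE_not_in[OF exceptional_null])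

lemma exceptional_avoid: "exceptional Z \<Longrightarrow> aec A (\<lambda>c. \<forall>t\<in>{0..fst c}. snd c t \<notin> Z)"
 unfolding exceptional_def by (auto intro: aec_subset)

lemma exceptional_subset: "exceptional Z \<Longrightarrow> Z' \<subseteq> Z \<Longrightarrow> exceptional Z'"
 unfolding exceptional_def by (blast intro: null_mu_subset aec_mp)

lemma exceptional_UN:
 fixes Z :: "nat \<Rightarrow> 'a set" assumes "\<And>n. exceptional (Z n)" shows "exceptional (\<Union>n. Z n)"
proof -
 have "aec UNIV (\<lambda>c. \<forall>n. \<forall>t\<in>{0..fst c}. snd c t \<notin> Z n)" by (rule aec_all) (rule exceptional_avoid[OF assms])
 then have "aec UNIV (\<lambda>c. \<forall>t\<in>{0..fst c}. snd c t \<notin> (\<Union>n. Z n))" by (rule aec_mp) auto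
 moreover have "(\<Union>n. Z n) \<in> null_sets \<mu>" using assms by (intro null_sets_UN exceptional_null)
 ultimately show ?thesis by (simp add: exceptional_def)
qed

lemma exceptional_Un: "exceptional Z \<Longrightarrow> exceptional Z' \<Longrightarrow> exceptional (Z \<union> Z')"
 using exceptional_UN[of "\<lambda>n. if n = 0 then Z else Z'"] by (rule exceptional_subset) (auto split: if_splits)

text \<open>Along a subsequence, one \<open>Lp\<close> density dominates all \<open>2^n * G\<close>.
  On a curve where its integral is finite the oscillation of \<open>V\<close> is at most a multiple
  of \<open>2^-n\<close>, and almost every point of the curve has \<open>V\<close> tending to 0.
  Hence \<open>V\<close> tends to 0 on the whole curve, which therefore cannot meet
  \<open>Z\<close>.\<close>

lemma exceptional_criterion:
 fixes V :: "nat \<Rightarrow> 'a \<Rightarrow> real" and G :: "nat \<Rightarrow> 'a \<Rightarrow> ennreal"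
 assumes G[measurable]: "\<And>n. borel_fun (G n)"
  and V0: "AE x in \<mu>. (\<lambda>n. V n x) \<longlonglongrightarrow> 0" and VZ: "\<And>n x. x \<in> Z \<Longrightarrow> 1 \<le> V n x"
  and VG: "\<And>n. ae_slope_le (V n) (G n)"
  and G0: "(\<lambda>n. \<integral>\<^sup>+x. epowr (G n x) p \<partial>\<mu>) \<longlonglongrightarrow> 0"
 shows "exceptional Z"
proof -
 have [measurable]: "\<And>n. G n \<in> borel_measurable \<mu>" using measurable_mu_borel[OF G] by simp
 \<comment> \<open>The factor \<open>(2^n) powr p\<close> in the denominator pays for the
   multiplication of the slopes by \<open>2^n\<close>; what remains is a summable geometric
   sequence.\<close>
 obtain r where r: "strict_mono r"
  and Gr: "\<And>n. (pint (\<lambda>x. G (r n) x)) \<le> ennreal ((1/2)^n / (2^n) powr p)"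
  using fast_subseq[OF G0, of "\<lambda>n. ennreal ((1/2)^n / (2^n) powr p)"] by auto
 obtain \<rho> where \<rho>: "Lp \<rho>" "\<And>n x. ennreal (2^n) * G (r n) x \<le> \<rho> x"
 proof (rule Lp_countable_bound[of "\<lambda>n x. ennreal (2^n) * G (r n) x"])
  have "(\<Sum>n. \<integral>\<^sup>+x. epowr (ennreal (2^n) * G (r n) x) p \<partial>\<mu>) \<le> (\<Sum>n. ennreal ((1/2)^n))"
  proof (intro suminf_le)
   fix n
   have "pint (\<lambda>x. ennreal (2^n) * G (r n) x) =
     ennreal ((2^n) powr p) * pint (\<lambda>x. G (r n) x)" by (simp add: epowr_mult epowr_ennreal nn_integral_cmult)
   also have "\<dots> \<le> ennreal ((2^n) powr p) * ennreal ((1/2)^n / (2^n) powr p)" by (intro mult_left_mono Gr) simp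
   also have "\<dots> = ennreal ((1/2)^n)" by (simp add: ennreal_mult[symmetric])
   finally show "pint (\<lambda>x. ennreal (2^n) * G (r n) x) \<le> ennreal ((1/2)^n)" .
  qed auto
  also have "\<dots> = ennreal 2"
   using suminf_geometric[of "1/2::real"] by (subst suminf_ennreal2) (auto simp: summable_geometric)
  finally show "(\<Sum>n. \<integral>\<^sup>+x. epowr (ennreal (2^n) * G (r n) x) p \<partial>\<mu>) < \<infinity>" by (simp add: order_le_less_trans)
 qed auto
 have "aec UNIV (\<lambda>c. \<forall>t\<in>{0..fst c}. snd c t \<notin> Z)"
 proof (rule aec_mp2[OF aec_conj[OF aec_Lp[OF \<rho>(1)] aec_AE[OF V0]] aec_all[OF VG]], elim conjE, intro ballI notI)
  fix c t assume c: "c \<in> curves UNIV" and fin: "line_integral \<rho> c < \<infinity>"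
   and ae: "ae_along c (\<lambda>x. (\<lambda>n. V n x) \<longlonglongrightarrow> 0)"
   and grad: "\<forall>n. \<forall>s\<in>{0..fst c}. \<forall>t\<in>{0..fst c}. ennreal \<bar>V n (snd c s) - V n (snd c t)\<bar> \<le> line_integral (G n) c"
   and t: "t \<in> {0..fst c}" "snd c t \<in> Z"
  obtain s where s: "s \<in> {0..fst c}" "(\<lambda>n. V n (snd c s)) \<longlonglongrightarrow> 0" using AE_Icc_ex[OF ae curves_pos[OF c]] by blast
  obtain b where b: "line_integral \<rho> c = ennreal b" "0 \<le> b" using fin by (cases "line_integral \<rho> c") auto
  have "1 \<le> V (r n) (snd c s) + b * (1/2)^n" for n
  proof -
   have "ennreal (2^n) * ennreal \<bar>V (r n) (snd c t) - V (r n) (snd c s)\<bar>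
     \<le> ennreal (2^n) * line_integral (G (r n)) c" using grad s t by (intro mult_left_mono) auto
   also have "\<dots> = line_integral (\<lambda>x. ennreal (2^n) * G (r n) x) c" by (simp add: line_integral_cmult[OF c])
   also have "\<dots> \<le> ennreal b" unfolding b(1)[symmetric] by (intro line_integral_mono \<rho>)
   finally have "2^n * \<bar>V (r n) (snd c t) - V (r n) (snd c s)\<bar> \<le> b"
    using b(2) by (simp add: ennreal_mult[symmetric] ennreal_le_iff)
   then have "\<bar>V (r n) (snd c t) - V (r n) (snd c s)\<bar> \<le> b * (1/2)^n" by (simp add: power_divide field_simps)
   then show ?thesis using VZ[OF t(2), of "r n"] by linarith
  qed
  moreover have "(\<lambda>n. V (r n) (snd c s) + b * (1/2)^n) \<longlonglongrightarrow> 0 + b * 0" using LIMSEQ_subseq_LIMSEQ[OF s(2) r]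
   by (intro tendsto_add tendsto_mult LIMSEQ_power_zero) (auto simp: o_def)
  ultimately have "1 \<le> (0::real) + b * 0" by (intro LIMSEQ_le_const) auto
  then show False by simp
 qed
 moreover have "Z \<in> null_sets \<mu>"
 proof (rule null_mu_subset)
  show "{x. \<not> (\<lambda>n. V n x) \<longlonglongrightarrow> 0} \<in> null_sets \<mu>" using V0 by (simp add: null_mu_AE)
  show "Z \<subseteq> {x. \<not> (\<lambda>n. V n x) \<longlonglongrightarrow> 0}"
  proof safe
   fix x assume x: "x \<in> Z" "(\<lambda>n. V n x) \<longlonglongrightarrow> 0"
   have "1 \<le> (0::real)" by (rule LIMSEQ_le_const[OF x(2)]) (use VZ[OF x(1)] in auto)
   then show False by simp
  qed
 qed
 ultimately show ?thesis by (simp add: exceptional_def)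
qed

lemma ACC_measurable: "ACC A u g \<Longrightarrow> borel_fun g" by (simp add: ACC_def)

lemma ACC_subset: "ACC A u g \<Longrightarrow> A' \<subseteq> A \<Longrightarrow> ACC A' u g" unfolding ACC_def by (auto intro: aec_subset)

lemma ACC_I:
 assumes g: "borel_fun g" and 1: "aec A (gradient_inequality u g)"
  and 2: "aec A (\<lambda>c. line_integral g c < \<infinity>)"
 shows "ACC A u g" unfolding ACC_def
proof (intro conjI g, rule aec_mp2[OF 2 aec_subcurves[OF 1, of A]])
 fix c assume c: "c \<in> curves A" "line_integral g c < \<infinity>"
  and sub: "\<forall>s t. 0 \<le> s \<longrightarrow> s < t \<longrightarrow> t \<le> fst c \<longrightarrow> subcurve c s t \<in> curves A \<longrightarrow> gradient_inequality u g (subcurve c s t)"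
 show "ac_along u g c"
 proof (rule ac_along_of_subcurves[OF c(1) g c(2)])
  fix s t assume st: "0 \<le> s" "s < t" "t \<le> fst c"
  have "subcurve c s t \<in> curves A" by (rule subcurve_in[OF c(1) st]) (use curves_in[OF c(1)] st in auto)
  then show "gradient_inequality u g (subcurve c s t)" using sub st by blast
 qed
qed

lemma ACC_gradient: "ACC A u g \<Longrightarrow> aec A (gradient_inequality u g)"
 unfolding ACC_def by (auto intro: aec_mp ac_along_gradient curves_pos)

lemma ACC_change_gradient:
 assumes "ACC A u g" "borel_fun h" "AE x in \<mu>. x \<in> A \<longrightarrow> g x = h x"
 shows "ACC A u h" unfolding ACC_def
proof (intro conjI assms(2), rule aec_mp2[OF _ aec_AE[OF assms(3)]])
 show "aec A (ac_along u g)" using assms(1) by (simp add: ACC_def)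
 fix c assume c: "c \<in> curves A" "ac_along u g c" and ae: "ae_along c (\<lambda>x. x \<in> A \<longrightarrow> g x = h x)"
 show "ac_along u h c"
  by (rule ac_along_change_gradient[OF c(2)]) (use ae curves_in[OF c(1)] in \<open>auto elim!: eventually_mono\<close>)
qed

lemma ac_along_cong:
 assumes "ac_along u g c" "\<And>t. 0 \<le> t \<Longrightarrow> t \<le> fst c \<Longrightarrow> u (snd c t) = v (snd c t)" shows "ac_along v g c"
 using assms by (elim ac_alongE) (rule ac_alongI, auto)

lemma ACC_cong:
 assumes "ACC A u g" "exceptional Z" "\<And>x. x \<in> A \<Longrightarrow> x \<notin> Z \<Longrightarrow> u x = v x" shows "ACC A v g"
proof -
 have "aec A (ac_along u g)" using assms(1) by (simp add: ACC_def)
 from this exceptional_avoid[OF assms(2), of A] have "aec A (ac_along v g)"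
 proof (rule aec_mp2)
  fix c assume c: "c \<in> curves A" "ac_along u g c" "\<forall>t\<in>{0..fst c}. snd c t \<notin> Z"
  show "ac_along v g c" using c(2) by (rule ac_along_cong) (use c(3) curves_in[OF c(1)] assms(3) in auto)
 qed
 then show ?thesis using assms(1) by (simp add: ACC_def)
qed

lemma ACC_min:
 assumes "ACC A u g" "ACC A u h" shows "ACC A u (\<lambda>x. min (g x) (h x))"
proof -
 have [measurable]: "borel_fun g" "borel_fun h" using assms by (auto simp: ACC_def)
 have "aec A (ac_along u g)" "aec A (ac_along u h)" using assms by (auto simp: ACC_def)
 then have "aec A (ac_along u (\<lambda>x. min (g x) (h x)))" by (rule aec_mp2) (rule ac_along_min, auto)
 then show ?thesis by (simp add: ACC_def)
qed

lemma ACC_combine: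
 fixes a b :: real
 assumes "ACC A u g" "ACC A v h" and ab: "0 \<le> a" "0 \<le> b" and Z: "exceptional Z"
  and w: "\<And>P Q x x' y y'. P \<in> A - Z \<Longrightarrow> Q \<in> A - Z \<Longrightarrow>
   u P = ereal x \<Longrightarrow> u Q = ereal x' \<Longrightarrow> v P = ereal y \<Longrightarrow> v Q = ereal y' \<Longrightarrow>
   \<exists>r r'. w P = ereal r \<and> w Q = ereal r' \<and> \<bar>r - r'\<bar> \<le> a * \<bar>x - x'\<bar> + b * \<bar>y - y'\<bar>"
 shows "ACC A w (\<lambda>x. ennreal a * g x + ennreal b * h x)"
proof -
 have m[measurable]: "borel_fun g" "borel_fun h" using assms(1,2) by (auto simp: ACC_def)
 have "aec A (ac_along u g)" "aec A (ac_along v h)" using assms(1,2) by (auto simp: ACC_def)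
 from aec_conj[OF this] exceptional_avoid[OF Z, of A]
 have "aec A (ac_along w (\<lambda>x. ennreal a * g x + ennreal b * h x))"
 proof (rule aec_mp2, elim conjE)
  fix c assume c: "c \<in> curves A" "ac_along u g c" "ac_along v h c" and av: "\<forall>t\<in>{0..fst c}. snd c t \<notin> Z"
  have "snd c ` {0..fst c} \<subseteq> A - Z" using av curves_in[OF c(1)] by auto
  then show "ac_along w (\<lambda>x. ennreal a * g x + ennreal b * h x) c"
   by (intro ac_along_combine[OF c(1) m c(2,3) ab] w) auto
 qed
 then show ?thesis by (simp add: ACC_def)
qed

lemma ACC_zero: "ACC A (\<lambda>x. 0) (\<lambda>x. 0)"
proof -
 have "aec A (ac_along (\<lambda>x. 0) (\<lambda>x. 0 :: ennreal))"
  by (intro aec_True ac_alongI[where f="\<lambda>t. 0"]) (auto simp: osc_le_def line_integral_lborel zero_ereal_def)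
 then show ?thesis by (simp add: ACC_def)
qed

lemma ACC_lipschitz_comp:
 assumes "ACC A u g" and a: "0 \<le> a" and Z: "exceptional Z"
  and w: "\<And>P Q x x'. P \<in> A - Z \<Longrightarrow> Q \<in> A - Z \<Longrightarrow> u P = ereal x \<Longrightarrow> u Q = ereal x' \<Longrightarrow>
   \<exists>r r'. w P = ereal r \<and> w Q = ereal r' \<and> \<bar>r - r'\<bar> \<le> a * \<bar>x - x'\<bar>"
 shows "ACC A w (\<lambda>x. ennreal a * g x)"
proof -
 have "ACC A w (\<lambda>x. ennreal a * g x + ennreal 0 * 0)"
 proof (rule ACC_combine[OF assms(1) ACC_zero a _ Z])
  fix P Q x x' y y' assume *: "P \<in> A - Z" "Q \<in> A - Z" "u P = ereal x" "u Q = ereal x'"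
  from w[OF this] show "\<exists>r r'. w P = ereal r \<and> w Q = ereal r' \<and> \<bar>r - r'\<bar> \<le> a * \<bar>x - x'\<bar> + 0 * \<bar>y - y'\<bar>" by simp
 qed simp
 then show ?thesis by simp
qed

text \<open>The zero set of \<open>u\<close> is only measurable for the completion. A Borel hull
  agrees with it along almost all of almost every curve and keeps the new gradient Borel.\<close>

lemma ACC_nonzero:
 assumes A: "A \<in> sets \<mu>" and u: "u \<in> borel_measurable (restrict_space \<mu> A)" and g: "ACC A u g"
 obtains S where "S \<in> sets borel" "AE x in \<mu>. x \<in> A \<longrightarrow> (u x = 0 \<longleftrightarrow> x \<in> S)"
  "ACC A u (\<lambda>x. if x \<in> S then 0 else g x)"
proof -
 have m[measurable]: "borel_fun g" using g by (simp add: ACC_def)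
 have "{x \<in> space (restrict_space \<mu> A). u x = 0} \<in> sets (restrict_space \<mu> A)" using u by measurable
 then have "{x \<in> A. u x = 0} \<in> sets \<mu>" using A by (auto simp: sets_restrict_space space_restrict_space)
 then obtain S where S: "S \<in> sets borel" "{x \<in> A. u x = 0} \<subseteq> S" "S - {x \<in> A. u x = 0} \<in> null_sets \<mu>"
  using borel_hull by blast
 have ae: "AE x in \<mu>. x \<in> A \<longrightarrow> (u x = 0 \<longleftrightarrow> x \<in> S)" using AE_not_in[OF S(3)] by eventually_elim (use S(2) in auto)
 have "aec A (ac_along u g)" using g by (simp add: ACC_def)
 from this aec_AE[OF ae, of A] have "aec A (ac_along u (\<lambda>x. if x \<in> S then 0 else g x))"
 proof (rule aec_mp2)
  fix c assume c: "c \<in> curves A" "ac_along u g c"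
   and "ae_along c (\<lambda>x. x \<in> A \<longrightarrow> (u x = 0) = (x \<in> S))"
  then have "ae_along c (\<lambda>x. (u x = 0) = (x \<in> S))" using curves_in[OF c(1)] by (auto elim!: eventually_mono)
  then show "ac_along u (\<lambda>x. if x \<in> S then 0 else g x) c" by (rule ac_along_nonzero[OF c(1) m S(1) c(2)])
 qed
 then show ?thesis using that[OF S(1) ae] S(1) by (simp add: ACC_def)
qed

lemma ACC_glue:
 assumes E: "E \<in> sets \<mu>" "E \<subseteq> A" and po: "path_almost_open p \<mu> E"
  and g: "ACC A u g" and h: "ACC E u h"
 obtains B where "B \<in> sets borel" "AE x in \<mu>. x \<in> E \<longleftrightarrow> x \<in> B"
  "ACC A u (\<lambda>x. if x \<in> B then min (g x) (h x) else g x)"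
proof -
 have m[measurable]: "borel_fun g" "borel_fun h" using g h by (auto simp: ACC_def)
 obtain B where B[measurable]: "B \<in> sets borel" and EB: "E \<subseteq> B" "B - E \<in> null_sets \<mu>"
  using borel_hull[OF E(1)] by blast
 have ae: "AE x in \<mu>. x \<in> E \<longleftrightarrow> x \<in> B" using AE_not_in[OF EB(2)] by eventually_elim (use EB(1) in auto)
 let ?po = "\<lambda>c. \<exists>U N. openin (top_of_set {0..fst c}) U \<and> N \<in> null_sets lebesgue \<and> {t \<in> {0..fst c}. snd c t \<in> E} = U \<union> N"
 have "aec UNIV ?po"
  using po unfolding path_almost_open_def ae_curve_iff[OF UNIV_mu] aec_def by (simp add: case_prod_beta')
 then have "aec A ?po" by (rule aec_subset) simp
 moreover have "aec A (ac_along u g)" using g by (simp add: ACC_def)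
 moreover have "aec A (\<lambda>c. \<forall>s t. 0 \<le> s \<longrightarrow> s < t \<longrightarrow> t \<le> fst c \<longrightarrow> subcurve c s t \<in> curves E \<longrightarrow> ac_along u h (subcurve c s t))"
  using h by (intro aec_subcurves) (simp add: ACC_def)
 ultimately have "aec A (ac_along u (\<lambda>x. if x \<in> B then min (g x) (h x) else g x))"
 proof (rule aec_mp2[OF aec_conj aec_conj[OF _ aec_AE[OF ae]]], elim conjE exE)
  fix c U N assume c: "c \<in> curves A" "ac_along u g c"
   and U: "openin (top_of_set {0..fst c}) U" "N \<in> null_sets lebesgue" "{t \<in> {0..fst c}. snd c t \<in> E} = U \<union> N"
   and sub: "\<forall>s t. 0 \<le> s \<longrightarrow> s < t \<longrightarrow> t \<le> fst c \<longrightarrow> subcurve c s t \<in> curves E \<longrightarrow> ac_along u h (subcurve c s t)"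
   and aec: "ae_along c (\<lambda>x. (x \<in> E) = (x \<in> B))"
  show "ac_along u (\<lambda>x. if x \<in> B then min (g x) (h x) else g x) c"
  proof (rule ac_along_glue[OF c(1) m B c(2) U _ aec])
   fix s t assume st: "0 \<le> s" "s < t" "t \<le> fst c" "{s..t} \<subseteq> U"
   have "subcurve c s t \<in> curves E" by (rule subcurve_in[OF c(1) st(1-3)]) (use st(4) U(3) in force)
   then show "ac_along u h (subcurve c s t)" using sub st by blast
  qed
 qed
 then show ?thesis using that[OF B ae] by (simp add: ACC_def)
qed

lemma ACC_INF:
 assumes "\<And>n. ACC A u (g n)" "\<And>n x. g (Suc n) x \<le> g n x"
 shows "ACC A u (\<lambda>x. INF n. g n x)"
proof -
 have [measurable]: "borel_fun (g n)" for n using assms(1) by (simp add: ACC_def)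
 have "aec A (\<lambda>c. \<forall>n. ac_along u (g n) c)" using assms(1) by (intro aec_all) (simp add: ACC_def)
 then have "aec A (ac_along u (\<lambda>x. INF n. g n x))"
  by (rule aec_mp) (rule ac_along_INF[where g=g], auto intro: assms(2))
 then show ?thesis by (simp add: ACC_def)
qed

section \<open>From the gradients of the definitions to \<open>ACC\<close> and back\<close>

lemma Lp_loc_Lp: "Lp g \<Longrightarrow> loc_Lp A g"
proof -
 assume "Lp g"
 then have fin: "pint g < \<infinity>" by (simp add: Lp_def)
 have "pint_on S g \<le> pint g" for S by (intro nn_integral_mono) (auto simp: indicator_def)
 then show ?thesis unfolding Lp_loc_def Lp_fin_def using fin by (meson order_le_less_trans zero_less_one)
qed

lemma Lp_fin_mono:
 assumes "Lp_fin p \<mu> A g" "AE x in \<mu>. x \<in> A \<longrightarrow> h x \<le> g x" "A' \<subseteq> A" shows "Lp_fin p \<mu> A' h"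
proof -
 have "pint_on A' h \<le> pint_on A g"
  using assms(2,3) by (intro nn_integral_mono_AE) (auto elim!: eventually_mono simp: indicator_def intro: epowr_mono)
 then show ?thesis using assms(1) unfolding Lp_fin_def by (rule order_le_less_trans)
qed

lemma Lp_loc_mono:
 assumes "loc_Lp A g" "AE x in \<mu>. x \<in> A \<longrightarrow> h x \<le> g x" shows "loc_Lp A h" unfolding Lp_loc_def
proof
 fix x assume "x \<in> A"
 then obtain r where r: "0 < r" "Lp_fin p \<mu> (A \<inter> ball x r) g" using assms(1) by (auto simp: Lp_loc_def)
 have "Lp_fin p \<mu> (A \<inter> ball x r) h" by (rule Lp_fin_mono[OF r(2)]) (use assms(2) in \<open>auto elim!: eventually_mono\<close>)
 then show "\<exists>r>0. Lp_fin p \<mu> (A \<inter> ball x r) h" using r(1) by blast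
qed

text \<open>Countably many balls on which \<open>g\<close> is p-integrable cover \<open>A\<close>.
  Almost every curve has finite integrals over all of them, and by compactness finitely many already
  cover the curve.\<close>

lemma aec_Lp_loc:
 assumes A: "A \<in> sets \<mu>" and g[measurable]: "borel_fun g" and loc: "loc_Lp A g"
 shows "aec A (\<lambda>c. line_integral g c < \<infinity>)"
proof (cases "A = {}")
 case True then show ?thesis by (intro aec_True) (auto simp: curves_def)
next
 case False
 have "\<forall>x. \<exists>r. x \<in> A \<longrightarrow> 0 < r \<and> Lp_fin p \<mu> (A \<inter> ball x r) g" using loc by (auto simp: Lp_loc_def)
 from choice[OF this] obtain r where r: "\<And>x. x \<in> A \<Longrightarrow> 0 < r x" "\<And>x. x \<in> A \<Longrightarrow> Lp_fin p \<mu> (A \<inter> ball x (r x)) g" by auto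
 obtain C where C: "countable C" "C \<subseteq> A" "A \<subseteq> (\<Union>x\<in>C. ball x (r x))" using lindelof_balls[of A r, OF r(1)] by blast
 have C0: "C \<noteq> {}" using C False by auto
 define q where "q = from_nat_into C"
 have q: "q n \<in> A" for n using from_nat_into[OF C0] C(2) by (auto simp: q_def)
 have qC: "range q = C" unfolding q_def by (rule range_from_nat_into[OF C0 C(1)])
 have cov: "A \<subseteq> (\<Union>n. ball (q n) (r (q n)))" using C(3) unfolding qC[symmetric] by auto
 obtain B where B[measurable]: "B \<in> sets borel" and AB: "A \<subseteq> B" "B - A \<in> null_sets \<mu>" using borel_hull[OF A] by blast
 define f where "f n x = g x * indicator (B \<inter> ball (q n) (r (q n))) x" for n x
 have f: "Lp (f n)" for n unfolding Lp_def
 proof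
  have [measurable]: "B \<inter> ball (q n) (r (q n)) \<in> sets borel" by auto
  show "borel_fun (f n)" unfolding f_def by measurable
  have "pint (\<lambda>x. f n x) = pint_on (A \<inter> ball (q n) (r (q n))) g" using AE_not_in[OF AB(2)] AB(1)
   by (intro nn_integral_cong_AE) (auto elim!: eventually_mono simp: f_def indicator_def)
  then show "pint (\<lambda>x. f n x) < \<infinity>" using r(2)[OF q[of n]] by (simp add: Lp_fin_def)
 qed
 show ?thesis
 proof (rule aec_mp[OF aec_all[OF aec_Lp[OF f]]])
  fix c assume c: "c \<in> curves A" and fin: "\<forall>n. line_integral (f n) c < \<infinity>"
  have "compact (snd c ` {0..fst c})" by (intro compact_continuous_image curves_continuous[OF c]) simp
  moreover have sub: "snd c ` {0..fst c} \<subseteq> A" using curves_in[OF c] by auto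
  ultimately obtain F where F: "finite F" "snd c ` {0..fst c} \<subseteq> (\<Union>n\<in>F. ball (q n) (r (q n)))"
   using compactE_image[of "snd c ` {0..fst c}" UNIV "\<lambda>n. ball (q n) (r (q n))"] cov
   by (metis (no_types, lifting) open_ball order_trans)
  have "line_integral g c \<le> (\<integral>\<^sup>+t. (\<Sum>n\<in>F. f n (snd c t) * indicator {0..fst c} t) \<partial>lborel)"
   unfolding line_integral_lborel
  proof (intro nn_integral_mono)
   fix t
   show "g (snd c t) * indicator {0..fst c} t \<le> (\<Sum>n\<in>F. f n (snd c t) * indicator {0..fst c} t)"
   proof (cases "t \<in> {0..fst c}")
    case True
    then obtain n where n: "n \<in> F" "snd c t \<in> ball (q n) (r (q n))" using F(2) by blast
    have "snd c t \<in> B" using True curves_in[OF c, of t] AB(1) by auto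
    then have "g (snd c t) * indicator {0..fst c} t = f n (snd c t) * indicator {0..fst c} t"
     using n by (simp add: f_def)
    also have "\<dots> \<le> (\<Sum>n\<in>F. f n (snd c t) * indicator {0..fst c} t)"
     by (rule member_le_sum[OF n(1)]) (auto simp: F(1))
    finally show ?thesis .
   qed simp
  qed
  also have "\<dots> = (\<Sum>n\<in>F. line_integral (f n) c)" unfolding line_integral_lborel
   using curve_measurable[OF c Lp_measurable[OF f]] by (intro nn_integral_sum) auto
  also have "\<dots> < \<infinity>" using F(1) fin by (simp add: ennreal_sum_less_top)
  finally show "line_integral g c < \<infinity>" .
 qed
qed

text \<open>A Borel representative changes the line integral only on an exceptional family of
  curves; local integrability supplies the finite line integrals that \<open>ACC_I\<close> asks
  for.\<close>

lemma weak_upper_gradient_ACC: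
 assumes A: "A \<in> sets \<mu>" and w: "weak_upper_gradient p \<mu> A u g" and loc: "loc_Lp A g"
 obtains h where "ACC A u h" "AE x in \<mu>. x \<in> A \<longrightarrow> g x = h x" "loc_Lp A h"
proof -
 have g: "g \<in> borel_measurable (restrict_space \<mu> A)" "aec A (gradient_inequality u g)"
  using w unfolding weak_upper_gradient_def ae_curve_iff[OF A] aec_def by auto
 obtain h where h: "borel_fun h" "AE x in \<mu>. x \<in> A \<longrightarrow> g x = h x" using borel_hull_restrict[OF A g(1)] by blast
 have loch: "loc_Lp A h" by (rule Lp_loc_mono[OF loc]) (use h(2) in \<open>auto elim!: eventually_mono\<close>)
 from g(2) aec_AE[OF h(2), of A] have "aec A (gradient_inequality u h)"
 proof (rule aec_mp2)
  fix c assume c: "c \<in> curves A" "gradient_inequality u g c" "ae_along c (\<lambda>x. x \<in> A \<longrightarrow> g x = h x)"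
  then have "line_integral g c = line_integral h c"
   using curves_in[OF c(1)] by (intro line_integral_cong_AE) (auto elim!: eventually_mono)
  then show "gradient_inequality u h c" using c(2) by (simp add: gradient_inequality_def)
 qed
 then have "ACC A u h" by (rule ACC_I[OF h(1) _ aec_Lp_loc[OF A h(1) loch]])
 then show ?thesis using that h(2) loch by blast
qed

lemma ACC_weak_upper_gradient:
 assumes A: "A \<in> sets \<mu>" and "ACC A u g" shows "weak_upper_gradient p \<mu> A u g"
 using ACC_gradient[OF assms(2)] ACC_measurable[OF assms(2)]
 unfolding weak_upper_gradient_def ae_curve_iff[OF A] aec_def
 by (auto intro: measurable_restrict_space1 measurable_mu_borel)

lemma upper_gradient_ACC:
 assumes A: "A \<in> sets \<mu>" and g: "upper_gradient A u g" and fin: "Lp_fin p \<mu> A g"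
 obtains h where "ACC A u h" "Lp h"
proof -
 obtain h where h: "Lp h" "\<And>x. x \<in> A \<Longrightarrow> h x = g x"
  using Lp_extension[OF A, of g] g fin by (auto simp: upper_gradient_def Lp_fin_def)
 have "aec A (gradient_inequality u h)" using g h(2) line_integral_cong[of _ A h g]
  by (intro aec_True) (auto simp: upper_gradient_def gradient_inequality_def)
 then show ?thesis using ACC_I[OF Lp_measurable[OF h(1)] _ aec_Lp[OF h(1)]] h(1) that by blast
qed

text \<open>Adding a p-integrable density that is infinite along the exceptional curves repairs the
  inequality on these and keeps it on all others.\<close>

lemma ACC_upper_gradient:
 assumes "ACC A u g" "Lp g"
 obtains h where "upper_gradient A u h" "Lp h"
proof -
 obtain \<rho> where \<rho>: "Lp \<rho>" "\<And>c. c \<in> curves A \<Longrightarrow> \<not> gradient_inequality u g c \<Longrightarrow> line_integral \<rho> c = \<infinity>"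
  using ACC_gradient[OF assms(1)] unfolding aec_def exc_def by blast
 have m: "borel_fun g" "borel_fun \<rho>" using assms(2) \<rho>(1) by (auto simp: Lp_def)
 have "gradient_inequality u (\<lambda>x. g x + \<rho> x) c" if c: "c \<in> curves A" for c
 proof (cases "gradient_inequality u g c")
  case True then show ?thesis
   unfolding gradient_inequality_def line_integral_add[OF c m] by (simp add: add_increasing2)
 next
  case False then show ?thesis using \<rho>(2)[OF c] unfolding gradient_inequality_def line_integral_add[OF c m] by simp
 qed
 then have "upper_gradient A u (\<lambda>x. g x + \<rho> x)"
  unfolding upper_gradient_def using m by (auto intro!: measurable_restrict_space1)
 then show ?thesis using that Lp_add[OF assms(2) \<rho>(1)] by blast
qed

lemma dirichlet_space_iff:
 assumes A: "A \<in> sets \<mu>"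
 shows "u \<in> dirichlet A \<longleftrightarrow> u \<in> borel_measurable (restrict_space \<mu> A) \<and> (\<exists>g. Lp g \<and> ACC A u g)"
proof -
 have "Lp_fin p \<mu> A h" if "Lp h" for h using Lp_fin_mono[of UNIV h h A] that by (auto simp: Lp_fin_def Lp_def)
 then have "(\<exists>g. upper_gradient A u g \<and> Lp_fin p \<mu> A g) \<longleftrightarrow> (\<exists>g. Lp g \<and> ACC A u g)"
  by (meson ACC_upper_gradient upper_gradient_ACC[OF A])
 then show ?thesis unfolding dirichlet_space_def by blast
qed

end

section \<open>Minimal weak upper gradients and Newtonian functions\<close>

lemma inverse_one_plus_le:
 assumes "inverse (1 + a) \<le> inverse (1 + b)" shows "b \<le> (a::ennreal)"
proof (cases a)
 case (real r)
 then have a: "inverse (1 + a) = ennreal (1 / (1 + r))"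
  by (metis add_pos_nonneg ennreal_1 ennreal_plus inverse_ennreal inverse_eq_divide zero_le_one zero_less_one)
 show ?thesis
 proof (cases b)
  case (real s)
  then have "inverse (1 + b) = ennreal (1 / (1 + s))"
   by (metis add_pos_nonneg ennreal_1 ennreal_plus inverse_ennreal inverse_eq_divide zero_le_one zero_less_one)
  then have "1 / (1 + r) \<le> 1 / (1 + s)" using assms a real by (simp add: ennreal_le_iff)
  then have "s \<le> r" using \<open>0 \<le> r\<close> \<open>0 \<le> s\<close> by (simp add: field_simps)
  then show ?thesis using real \<open>a = ennreal r\<close> by (simp add: ennreal_leI)
 next
  case top
  then show ?thesis using assms a \<open>0 \<le> r\<close> by simp
 qed
qed simp

lemma suminf_finite_tendsto_0:
 fixes f :: "nat \<Rightarrow> ennreal"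
 assumes "(\<Sum>n. f n) < \<infinity>"
 shows "\<exists>r. (\<forall>n. f n = ennreal (r n) \<and> 0 \<le> r n) \<and> r \<longlonglongrightarrow> 0"
proof -
 have f: "f n < top" for n using sum_le_suminf[of f "{n}"] assms by (auto intro: order_le_less_trans)
 define r where "r n = enn2real (f n)" for n
 have r: "f n = ennreal (r n)" "0 \<le> r n" for n using f[of n] by (auto simp: r_def)
 have "summable r" using assms r by (intro summable_suminf_not_top) auto
 then show ?thesis using r summable_LIMSEQ_zero by blast
qed

lemma measurable_restrict_UNIV: "measurable (restrict_space M UNIV) L = measurable M L"
 by (intro measurable_cong_sets) (auto simp: sets_restrict_space)

lemma ennreal_inverse_antimono: "a \<le> b \<Longrightarrow> inverse b \<le> inverse (a::ennreal)"
proof (cases b)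
 case (real s)
 assume "a \<le> b"
 with real obtain r where a: "a = ennreal r" "0 \<le> r" "r \<le> s" by (cases a) (auto simp: top_unique ennreal_le_iff)
 show ?thesis
 proof (cases "r = 0")
  case False
  then have "inverse a = ennreal (inverse r)" "inverse b = ennreal (inverse s)"
   using a real by (auto simp: inverse_ennreal)
  then show ?thesis using a False by (auto intro!: ennreal_leI le_imp_inverse_le)
 qed (use a in simp)
qed simp

context metric_measure_space
begin

text \<open>The admissible gradients are closed under minima and decreasing limits. A strictly
  decreasing functional of the gradient attains its supremum at the limit of a decreasing sequence,
  and strictness makes this limit smaller a.e. than every competitor.\<close>

lemma ex_minimal:
 assumes A: "A \<in> sets \<mu>" and g0: "ACC A u g0" "loc_Lp A g0"
 obtains g where "ACC A u g" "loc_Lp A g"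
  "\<And>h. ACC A u h \<Longrightarrow> loc_Lp A h \<Longrightarrow> AE x in \<mu>. x \<in> A \<longrightarrow> g x \<le> h x"
proof -
 obtain w where w: "w \<in> borel_measurable N" "integral\<^sup>N N w \<noteq> \<infinity>" "\<And>x. 0 < w x \<and> w x < \<infinity>"
  using sigma_finite_measure.Ex_finite_integrable_function[OF sigma_finite_N] by auto
 have wm[measurable]: "w \<in> borel_measurable \<mu>" using w(1) measurable_mu_borel by (simp add: measurable_N)
 \<comment> \<open>With a strictly positive integrable weight \<open>w\<close> this is finite for
   every \<open>h\<close>, even if \<open>h\<close> is only locally p-integrable, and it detects
   every decrease of \<open>h\<close> on a set of positive measure.\<close>
 define \<Psi> where "\<Psi> h = muint_on A (\<lambda>x. inverse (1 + h x) * w x)" for h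
 let ?G = "{h. ACC A u h \<and> loc_Lp A h}"
 have mG: "h \<in> borel_measurable \<mu>" if "h \<in> ?G" for h using that ACC_measurable measurable_mu_borel by blast
 have minG: "(\<lambda>x. min (h x) (k x)) \<in> ?G" if "h \<in> ?G" "k \<in> ?G" for h k
 proof -
  have "loc_Lp A (\<lambda>x. min (h x) (k x))" by (rule Lp_loc_mono[of A h]) (use that in auto)
  then show ?thesis using that ACC_min by auto
 qed
 have \<Psi>_mono: "\<Psi> h \<le> \<Psi> k" if "\<And>x. k x \<le> h x" for h k
  unfolding \<Psi>_def using that by (intro nn_integral_mono mult_right_mono) (auto intro!: ennreal_inverse_antimono add_left_mono)
 have \<Psi>_fin: "\<Psi> h < \<infinity>" for h
 proof -
  have "\<Psi> h \<le> integral\<^sup>N \<mu> w" unfolding \<Psi>_def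
  proof (intro nn_integral_mono)
   fix x
   have "inverse (1 + h x) \<le> inverse 1" by (rule ennreal_inverse_antimono) auto
   then have "inverse (1 + h x) * w x \<le> 1 * w x" by (intro mult_right_mono) auto
   then show "inverse (1 + h x) * w x * indicator A x \<le> w x" by (auto simp: indicator_def)
  qed
  then show ?thesis using w(2) by (simp add: nn_integral_N less_top[symmetric] top.extremum_strict top_unique)
    (metis less_top order_le_less_trans top.not_eq_extremum)
 qed
 have "?G \<noteq> {}" using g0 by auto
 from ennreal_SUP_countable_SUP[OF this, of \<Psi>]
 obtain v :: "nat \<Rightarrow> ennreal" where v: "range v \<subseteq> \<Psi> ` ?G" "Sup (\<Psi> ` ?G) = Sup (range v)" by blast
 have "\<forall>n. \<exists>h. h \<in> ?G \<and> v n = \<Psi> h" using v(1) by blast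
 from choice[OF this] obtain h where h0: "\<forall>n. h n \<in> ?G \<and> v n = \<Psi> (h n)" by (rule exE)
 then have h: "h n \<in> ?G" "v n = \<Psi> (h n)" for n by blast+
 define k where "k = rec_nat (h 0) (\<lambda>n k x. min (k x) (h (Suc n) x))"
 have k0: "k 0 = h 0" and kS: "k (Suc n) = (\<lambda>x. min (k n x) (h (Suc n) x))" for n by (auto simp: k_def)
 have kG: "k n \<in> ?G" for n by (induction n) (use k0 kS h(1) minG in auto)
 have kh: "k n x \<le> h n x" for n x by (cases n) (auto simp: k0 kS)
 define g where "g x = (INF n. k n x)" for x
 have g: "g \<in> ?G"
 proof -
  have "ACC A u g" unfolding g_def using kG by (intro ACC_INF) (auto simp: kS)
  moreover have "loc_Lp A g" by (rule Lp_loc_mono[of A "k 0"]) (use kG in \<open>auto simp: g_def intro: INF_lower\<close>)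
  ultimately show ?thesis by simp
 qed
 have top: "\<Psi> m \<le> \<Psi> g" if "m \<in> ?G" for m
 proof -
  have "\<Psi> m \<le> Sup (range v)" unfolding v(2)[symmetric] using that by (intro SUP_upper)
  also have "\<dots> \<le> \<Psi> g" by (intro SUP_least, simp add: h(2), intro \<Psi>_mono) (auto simp: g_def intro: INF_lower2 kh)
  finally show ?thesis .
 qed
 show ?thesis
 proof (rule that)
  show "ACC A u g" "loc_Lp A g" using g by auto
  fix h assume "ACC A u h" "loc_Lp A h"
  then have hG: "h \<in> ?G" by simp
  let ?m = "\<lambda>x. min (g x) (h x)"
  let ?I = "\<lambda>h x. inverse (1 + h x) * w x * indicator A x"
  have [measurable]: "g \<in> borel_measurable \<mu>" "h \<in> borel_measurable \<mu>" "A \<in> sets \<mu>" using mG g hG A by auto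
  have le: "?I g x \<le> ?I ?m x" for x by (intro mult_right_mono ennreal_inverse_antimono add_left_mono) auto
  have "muint (\<lambda>x. ?I ?m x - ?I g x) = \<Psi> ?m - \<Psi> g"
   unfolding \<Psi>_def using \<Psi>_fin[of g] le by (intro nn_integral_diff) (auto simp: \<Psi>_def)
  \<comment> \<open>Since \<open>g\<close> maximizes the functional, taking the minimum with a
    competitor cannot raise it.\<close>
  also have "\<dots> = 0" using top[OF minG[OF g hG]] by (simp add: diff_eq_0_iff_ennreal \<Psi>_fin[simplified])
  finally have "AE x in \<mu>. ?I ?m x - ?I g x = 0" by (subst (asm) nn_integral_0_iff_AE) auto
  then show "AE x in \<mu>. x \<in> A \<longrightarrow> g x \<le> h x"
  proof eventually_elim
   fix x assume *: "?I ?m x - ?I g x = 0"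
   show "x \<in> A \<longrightarrow> g x \<le> h x"
   proof
    assume x: "x \<in> A"
    have wx: "0 < w x" "w x < top" using w(3)[of x] by auto
    have inv1: "inverse (1 + y) < top" for y :: ennreal
    proof -
     have "inverse (1 + y) \<le> inverse 1" by (rule ennreal_inverse_antimono) auto
     then show ?thesis by (rule order_le_less_trans) simp
    qed
    have fin: "inverse (1 + g x) * w x < top" "inverse (1 + ?m x) * w x < top"
     using wx(2) inv1[of "g x"] inv1[of "?m x"] by (auto simp: ennreal_mult_less_top)
    have "inverse (1 + ?m x) * w x \<le> inverse (1 + g x) * w x" using * x fin by (auto simp: diff_eq_0_iff_ennreal)
    then have "inverse (1 + ?m x) \<le> inverse (1 + g x)"
     using wx by (subst (asm) (1 2) mult.commute, subst (asm) ennreal_mult_le_mult_iff) auto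
    then have "g x \<le> ?m x" by (rule inverse_one_plus_le)
    then show "g x \<le> h x" by simp
   qed
  qed
 qed
qed

lemma min_gradient_is_min:
 assumes A: "A \<in> sets \<mu>" and g0: "ACC A u g0" "loc_Lp A g0"
 shows "is_min_weak_upper_gradient p \<mu> A u (min_grad A u)"
proof -
 obtain g where g: "ACC A u g" "loc_Lp A g"
  "\<And>h. ACC A u h \<Longrightarrow> loc_Lp A h \<Longrightarrow> AE x in \<mu>. x \<in> A \<longrightarrow> g x \<le> h x" using ex_minimal[OF A g0] by blast
 have "AE x in \<mu>. x \<in> A \<longrightarrow> g x \<le> g' x" if w: "weak_upper_gradient p \<mu> A u g'" "loc_Lp A g'" for g'
 proof -
  obtain h where h: "ACC A u h" "AE x in \<mu>. x \<in> A \<longrightarrow> g' x = h x" "loc_Lp A h"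
   using weak_upper_gradient_ACC[OF A w] by blast
  from g(3)[OF h(1,3)] h(2) show ?thesis by eventually_elim auto
 qed
 then have "is_min_weak_upper_gradient p \<mu> A u g"
  unfolding is_min_weak_upper_gradient_def using ACC_weak_upper_gradient[OF A g(1)] g(2) by blast
 then show ?thesis unfolding min_gradient_def by (rule someI[of "is_min_weak_upper_gradient p \<mu> A u"])
qed

lemma min_gradient_le_loc:
 assumes A: "A \<in> sets \<mu>" and g: "ACC A u g" "loc_Lp A g"
 shows "AE x in \<mu>. x \<in> A \<longrightarrow> min_grad A u x \<le> g x"
 using min_gradient_is_min[OF A g] ACC_weak_upper_gradient[OF A g(1)] g(2)
 unfolding is_min_weak_upper_gradient_def by blast

lemma min_gradient_le:
 "A \<in> sets \<mu> \<Longrightarrow> ACC A u g \<Longrightarrow> Lp g \<Longrightarrow> AE x in \<mu>. x \<in> A \<longrightarrow> min_grad A u x \<le> g x"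
 by (rule min_gradient_le_loc) (auto intro: Lp_loc_Lp)

text \<open>The chosen minimal gradient is known only to be measurable for the completion and
  locally integrable. The minimum of a Borel version with \<open>g0\<close> is Borel, globally
  p-integrable and equal to it a.e.\<close>

lemma min_gradient_rep:
 assumes A: "A \<in> sets \<mu>" and g0: "ACC A u g0" "Lp g0"
 obtains g where "ACC A u g" "Lp g" "AE x in \<mu>. x \<in> A \<longrightarrow> min_grad A u x = g x"
proof -
 have m: "is_min_weak_upper_gradient p \<mu> A u (min_grad A u)"
  by (rule min_gradient_is_min[OF A g0(1) Lp_loc_Lp[OF g0(2)]])
 obtain h where h: "ACC A u h" "AE x in \<mu>. x \<in> A \<longrightarrow> min_grad A u x = h x"
  using weak_upper_gradient_ACC[OF A, of u "min_grad A u"] m unfolding is_min_weak_upper_gradient_def by blast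
 have acc: "ACC A u (\<lambda>x. min (h x) (g0 x))" by (rule ACC_min[OF h(1) g0(1)])
 moreover have "Lp (\<lambda>x. min (h x) (g0 x))" by (rule Lp_mono[OF g0(2) ACC_measurable[OF acc]]) simp
 moreover have "AE x in \<mu>. x \<in> A \<longrightarrow> min_grad A u x = min (h x) (g0 x)"
  using h(2) min_gradient_le[OF A g0] by eventually_elim (auto simp: min_def)
 ultimately show ?thesis using that by blast
qed

lemma gradient_inequality_cong:
 "u (snd c 0) = v (snd c 0) \<Longrightarrow> u (snd c (fst c)) = v (snd c (fst c)) \<Longrightarrow>
  gradient_inequality u g c = gradient_inequality v g c" by (simp add: gradient_inequality_def)

text \<open>Functions that agree off an exceptional set have the same weak upper gradients. The
  choice operator is thus applied to the same predicate, which gives equality of functions and not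
  only equality a.e.\<close>

lemma min_gradient_cong:
 assumes A: "A \<in> sets \<mu>" and Z: "exceptional Z" and uv: "\<And>x. x \<in> A \<Longrightarrow> x \<notin> Z \<Longrightarrow> u x = v x"
 shows "min_grad A u = min_grad A v"
proof -
 have imp: "weak_upper_gradient p \<mu> A v g"
  if "weak_upper_gradient p \<mu> A u g" and uv: "\<And>x. x \<in> A \<Longrightarrow> x \<notin> Z \<Longrightarrow> u x = v x" for u v g
 proof -
  have "aec A (gradient_inequality u g)"
   using that(1) unfolding weak_upper_gradient_def ae_curve_iff[OF A] aec_def by simp
  from this exceptional_avoid[OF Z, of A] have "aec A (gradient_inequality v g)"
  proof (rule aec_mp2)
   fix c assume c: "c \<in> curves A" "gradient_inequality u g c" "\<forall>t\<in>{0..fst c}. snd c t \<notin> Z"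
   have "0 < fst c" using c(1) by (rule curves_pos)
   then show "gradient_inequality v g c"
    using c(2,3) curves_in[OF c(1)] gradient_inequality_cong[of u c v g] uv by auto
  qed
  then show ?thesis using that(1) unfolding weak_upper_gradient_def ae_curve_iff[OF A] aec_def by simp
 qed
 have "weak_upper_gradient p \<mu> A u = weak_upper_gradient p \<mu> A v"
  using imp[of u _ v] imp[of v _ u] uv by (intro ext iffI) auto
 then show ?thesis unfolding min_gradient_def is_min_weak_upper_gradient_def by simp
qed

text \<open>Rests on the completeness of \<open>\<mu>\<close>: preimages under the two functions
  differ by subsets of a null set.\<close>

lemma measurable_mu_cong:
 assumes f: "f \<in> \<mu> \<rightarrow>\<^sub>M M" and Z: "Z \<in> null_sets \<mu>" and eq: "\<And>x. x \<notin> Z \<Longrightarrow> f x = h x"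
  and h: "\<And>x. h x \<in> space M"
 shows "h \<in> \<mu> \<rightarrow>\<^sub>M M"
proof (rule measurableI)
 fix S assume S: "S \<in> sets M"
 have "f -` S \<inter> space \<mu> \<in> sets \<mu>" using f S by (rule measurable_sets)
 then show "h -` S \<inter> space \<mu> \<in> sets \<mu>"
 proof (rule sets_mu_cong)
  show "h -` S \<inter> space \<mu> - f -` S \<inter> space \<mu> \<in> null_sets \<mu>" using eq by (intro null_mu_subset[OF _ Z]) auto
  show "f -` S \<inter> space \<mu> - h -` S \<inter> space \<mu> \<in> null_sets \<mu>" using eq by (intro null_mu_subset[OF _ Z]) auto
 qed
qed (use h in auto)

text \<open>The definition asks for a locally p-integrable upper gradient and a finite norm. The
  finite norm puts the minimal gradient itself into L^p, so one global gradient suffices.\<close>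

lemma newton_space_iff:
 "u \<in> newton UNIV \<longleftrightarrow> u \<in> borel_measurable \<mu> \<and>
  (pint (\<lambda>x. e2ennreal \<bar>u x\<bar>)) < \<infinity> \<and> (\<exists>g. Lp g \<and> ACC UNIV u g)" (is "?L \<longleftrightarrow> ?R")
proof
 assume ?L
 then obtain g where u: "u \<in> borel_measurable \<mu>" and g: "upper_gradient UNIV u g" "loc_Lp UNIV g"
  and n: "newton_norm p \<mu> UNIV u < \<infinity>" by (auto simp: newton_space_def measurable_restrict_UNIV)
 have fin: "pint (\<lambda>x. e2ennreal \<bar>u x\<bar>) < \<infinity>"
   "pint (\<lambda>x. min_grad UNIV u x) < \<infinity>"
  using n unfolding newton_norm_def by (auto simp: epowr_less_top_iff[simplified])
 have gm: "borel_fun g" using g(1) by (auto simp: upper_gradient_def measurable_restrict_UNIV)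
 have acc: "ACC UNIV u g"
  by (rule ACC_I[OF gm aec_True aec_Lp_loc[OF UNIV_mu gm g(2)]]) (use g(1) in \<open>auto simp: upper_gradient_def\<close>)
 have m: "is_min_weak_upper_gradient p \<mu> UNIV u (min_grad UNIV u)" by (rule min_gradient_is_min[OF UNIV_mu acc g(2)])
 obtain h where h: "ACC UNIV u h" "AE x in \<mu>. x \<in> UNIV \<longrightarrow> min_grad UNIV u x = h x"
  using weak_upper_gradient_ACC[OF UNIV_mu, of u "min_grad UNIV u"] m
  unfolding is_min_weak_upper_gradient_def by blast
 have "pint h = pint (\<lambda>x. min_grad UNIV u x)" using h(2) by (intro nn_integral_cong_AE) (auto elim!: eventually_mono)
 then have "Lp h" using fin(2) ACC_measurable[OF h(1)] by (simp add: Lp_def)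
 then show ?R using u fin(1) h(1) by blast
next
 assume ?R
 then obtain g where u: "u \<in> borel_measurable \<mu>" "pint (\<lambda>x. e2ennreal \<bar>u x\<bar>) < \<infinity>"
  and g: "Lp g" "ACC UNIV u g" by blast
 obtain h where h: "upper_gradient UNIV u h" "Lp h" using ACC_upper_gradient[OF g(2,1)] by blast
 have "pint (\<lambda>x. min_grad UNIV u x) \<le> pint g" using min_gradient_le[OF UNIV_mu g(2,1)]
  by (intro nn_integral_mono_AE) (auto elim!: eventually_mono intro: epowr_mono)
 also have "\<dots> < \<infinity>" using g(1) by (simp add: Lp_def)
 finally show ?L using u h Lp_loc_Lp[OF h(2)]
  by (auto simp: newton_space_def newton_norm_def measurable_restrict_UNIV epowr_less_top_iff[simplified])
qed

lemma newton_norm_power: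
 "epowr (newton_norm p \<mu> UNIV u) p =
  (pint (\<lambda>x. e2ennreal \<bar>u x\<bar>)) + pint (\<lambda>x. min_grad UNIV u x)" by (simp add: newton_norm_def epowr_epowr)

lemma newton_space_cong:
 assumes u: "u \<in> newton UNIV" and Z: "exceptional Z" and uv: "\<And>x. x \<notin> Z \<Longrightarrow> u x = v x"
 shows "v \<in> newton UNIV"
proof -
 obtain g where g: "u \<in> borel_measurable \<mu>" "pint (\<lambda>x. e2ennreal \<bar>u x\<bar>) < \<infinity>"
   "Lp g" "ACC UNIV u g" using u unfolding newton_space_iff by blast
 have "v \<in> borel_measurable \<mu>" by (rule measurable_mu_cong[OF g(1) exceptional_null[OF Z] uv]) auto
 moreover have "pint (\<lambda>x. e2ennreal \<bar>v x\<bar>) = pint (\<lambda>x. e2ennreal \<bar>u x\<bar>)"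
  using exceptional_AE[OF Z] uv by (intro nn_integral_cong_AE) (auto elim!: eventually_mono)
 moreover have "ACC UNIV v g" by (rule ACC_cong[OF g(4) Z]) (use uv in auto)
 ultimately show ?thesis unfolding newton_space_iff using g by auto
qed

lemma e2ennreal_abs_finite:
 assumes "epowr (e2ennreal \<bar>u\<bar>) p = ennreal r" "0 \<le> r"
 shows "\<bar>real_of_ereal u\<bar> = r powr (1 / p)" "u = ereal (real_of_ereal u)"
proof -
 obtain v where u: "u = ereal v" using assms by (cases u) auto
 then have "ennreal (\<bar>v\<bar> powr p) = ennreal r" using assms(1) by (simp add: epowr_ennreal)
 then have "\<bar>v\<bar> powr p = r" using assms(2) by (simp add: ennreal_inj)
 then have "r powr (1 / p) = \<bar>v\<bar>" by (auto simp: powr_powr)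
 then show "\<bar>real_of_ereal u\<bar> = r powr (1 / p)" "u = ereal (real_of_ereal u)" using u by auto
qed

text \<open>The indicator of an exceptional set has 0 as a weak gradient. Conversely, functions
  equal to 1 on \<open>Z\<close> with p-th powers of their norms below \<open>(1/2)^n\<close> tend
  to 0 a.e. and meet \<open>exceptional_criterion\<close>.\<close>

lemma sobolev_capacity_0_iff: "sobolev_capacity p \<mu> Z = 0 \<longleftrightarrow> exceptional Z"
proof
 assume Z: "exceptional Z"
 define u where "u x = (if x \<in> Z then 1 else 0 :: ereal)" for x
 have acc: "ACC UNIV u (\<lambda>x. 0)" by (rule ACC_cong[OF ACC_zero Z]) (simp add: u_def)
 have "pint (\<lambda>x. e2ennreal \<bar>u x\<bar>) = muint (\<lambda>x. 0)"
  using exceptional_AE[OF Z] by (intro nn_integral_cong_AE, eventually_elim) (simp add: u_def e2ennreal_neg)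
 then have int: "pint (\<lambda>x. e2ennreal \<bar>u x\<bar>) = 0" by simp
 have um: "u \<in> borel_measurable \<mu>"
  by (rule measurable_mu_cong[of "\<lambda>x. 0" _ Z]) (use exceptional_null[OF Z] in \<open>auto simp: u_def\<close>)
 have u: "u \<in> newton UNIV" unfolding newton_space_iff using um int acc Lp_zero by auto
 have "pint (\<lambda>x. min_grad UNIV u x) = muint (\<lambda>x. 0)" using min_gradient_le[OF UNIV_mu acc Lp_zero]
  by (intro nn_integral_cong_AE) (auto elim!: eventually_mono)
 then have "epowr (newton_norm p \<mu> UNIV u) p = 0" by (simp add: newton_norm_power int)
 moreover have "sobolev_capacity p \<mu> Z \<le> epowr (newton_norm p \<mu> UNIV u) p"
  unfolding sobolev_capacity_def by (intro INF_lower) (use u in \<open>auto simp: u_def\<close>)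
 ultimately show "sobolev_capacity p \<mu> Z = 0" by simp
next
 assume cap: "sobolev_capacity p \<mu> Z = 0"
 let ?P = "\<lambda>n u. u \<in> newton UNIV \<and> (\<forall>x\<in>Z. u x = 1) \<and> epowr (newton_norm p \<mu> UNIV u) p < ennreal ((1/2)^n)"
 have "\<forall>n. \<exists>u. ?P n u"
 proof
  fix n
  have "sobolev_capacity p \<mu> Z < ennreal ((1/2)^n)" using cap by simp
  then show "\<exists>u. ?P n u" unfolding sobolev_capacity_def INF_less_iff by auto
 qed
 from choice[OF this] obtain u where u: "\<And>n. u n \<in> newton UNIV" "\<And>n x. x \<in> Z \<Longrightarrow> u n x = 1"
   "\<And>n. epowr (newton_norm p \<mu> UNIV (u n)) p < ennreal ((1/2)^n)" by auto
 let ?P = "\<lambda>n g. ACC UNIV (u n) g \<and> Lp g \<and> (AE x in \<mu>. min_grad UNIV (u n) x = g x)"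
 have "\<forall>n. \<exists>g. ?P n g"
 proof
  fix n
  obtain g0 where "ACC UNIV (u n) g0" "Lp g0" using u(1)[of n] unfolding newton_space_iff by blast
  from min_gradient_rep[OF UNIV_mu this]
  obtain g where "ACC UNIV (u n) g" "Lp g" "AE x in \<mu>. x \<in> UNIV \<longrightarrow> min_grad UNIV (u n) x = g x" by blast
  then show "\<exists>g. ?P n g" by auto
 qed
 from choice[OF this] obtain g where g: "\<And>n. ACC UNIV (u n) (g n)" "\<And>n. Lp (g n)"
   "\<And>n. AE x in \<mu>. min_grad UNIV (u n) x = g n x" by auto
 have [measurable]: "u n \<in> borel_measurable \<mu>" for n using u(1)[of n] unfolding newton_space_iff by blast
 let ?U = "\<lambda>n. \<integral>\<^sup>+x. epowr (e2ennreal \<bar>u n x\<bar>) p \<partial>\<mu>" and ?G = "\<lambda>n. \<integral>\<^sup>+x. epowr (g n x) p \<partial>\<mu>"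
 have sum: "?U n + ?G n \<le> ennreal ((1/2)^n)" for n
 proof -
  have "?G n = pint (\<lambda>x. min_grad UNIV (u n) x)"
   using g(3)[of n] by (intro nn_integral_cong_AE) (auto elim!: eventually_mono)
  then show ?thesis using u(3)[of n] by (simp add: newton_norm_power)
 qed
 have geo: "(\<Sum>n. ennreal ((1/2)^n)) < \<infinity>"
  using suminf_geometric[of "1/2::real"] by (subst suminf_ennreal2) (auto simp: summable_geometric)
 show "exceptional Z"
 proof (rule exceptional_criterion[of g "\<lambda>n x. real_of_ereal (u n x)"])
  show "borel_fun (g n)" for n using g(2) by (simp add: Lp_def)
  have "muint (\<lambda>x. \<Sum>n. epowr (e2ennreal \<bar>u n x\<bar>) p) = (\<Sum>n. ?U n)" by (rule nn_integral_suminf) measurable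
  also have "\<dots> \<le> (\<Sum>n. ennreal ((1/2)^n))" by (intro suminf_le) (auto intro: order_trans[OF _ sum])
  also note geo
  finally have "AE x in \<mu>. (\<Sum>n. epowr (e2ennreal \<bar>u n x\<bar>) p) \<noteq> \<infinity>" by (intro nn_integral_PInf_AE) auto
  then show "AE x in \<mu>. (\<lambda>n. real_of_ereal (u n x)) \<longlonglongrightarrow> 0"
  proof eventually_elim
   fix x assume "(\<Sum>n. epowr (e2ennreal \<bar>u n x\<bar>) p) \<noteq> \<infinity>"
   then obtain r where r: "\<And>n. epowr (e2ennreal \<bar>u n x\<bar>) p = ennreal (r n)" "\<And>n. 0 \<le> r n" "r \<longlonglongrightarrow> 0"
    using suminf_finite_tendsto_0[of "\<lambda>n. epowr (e2ennreal \<bar>u n x\<bar>) p"] by (auto simp: less_top[symmetric])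
   have "(\<lambda>n. r n powr (1 / p)) \<longlonglongrightarrow> 0" by (rule tendsto_zero_powrI[OF r(3) tendsto_const]) (use r(2) in auto)
   then have "(\<lambda>n. \<bar>real_of_ereal (u n x)\<bar>) \<longlonglongrightarrow> 0" using e2ennreal_abs_finite(1)[OF r(1,2)] by simp
   then show "(\<lambda>n. real_of_ereal (u n x)) \<longlonglongrightarrow> 0" by (rule tendsto_rabs_zero_cancel)
  qed
  show "1 \<le> real_of_ereal (u n x)" if "x \<in> Z" for n x using u(2)[OF that] by simp
  show "aec UNIV (\<lambda>c. \<forall>s\<in>{0..fst c}. \<forall>t\<in>{0..fst c}.
    ennreal \<bar>real_of_ereal (u n (snd c s)) - real_of_ereal (u n (snd c t))\<bar> \<le> line_integral (g n) c)" for n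
  proof -
   have "aec UNIV (ac_along (u n) (g n))" using g(1) by (simp add: ACC_def)
   then show ?thesis
   proof (rule aec_mp, intro ballI)
    fix c s t assume c: "c \<in> curves UNIV" "ac_along (u n) (g n) c" and st: "s \<in> {0..fst c}" "t \<in> {0..fst c}"
    from c(2) obtain f where f: "\<And>t. 0 \<le> t \<Longrightarrow> t \<le> fst c \<Longrightarrow> u n (snd c t) = ereal (f t)"
     "osc_le f (\<lambda>t. g n (clamped c t)) 0 (fst c)" "line_integral (g n) c < \<infinity>" by (rule ac_alongE) blast
    have "ennreal \<bar>f (min s t) - f (max s t)\<bar> \<le> lint (min s t) (max s t) (\<lambda>x. g n (clamped c x))"
     using st by (intro osc_leD[OF f(2)]) auto
    also have "\<dots> \<le> lint 0 (fst c) (\<lambda>x. g n (clamped c x))"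
     using st by (intro nn_integral_mono) (auto simp: indicator_def)
    finally show "ennreal \<bar>real_of_ereal (u n (snd c s)) - real_of_ereal (u n (snd c t))\<bar> \<le> line_integral (g n) c"
     using f(1)[of s] f(1)[of t] st
     by (auto simp: clamped_line_integral min_def max_def abs_minus_commute split: if_splits)
   qed
  qed
  show "(\<lambda>n. ?G n) \<longlonglongrightarrow> 0"
  proof (rule tendsto_sandwich[OF _ _ tendsto_const])
   show "(\<lambda>n. ennreal ((1/2)^n)) \<longlonglongrightarrow> 0" using tendsto_ennrealI[OF LIMSEQ_power_zero[of "1/2::real"]] by simp
   show "eventually (\<lambda>n. ?G n \<le> ennreal ((1/2)^n)) sequentially"
    using sum by (intro always_eventually allI order_trans[OF _ sum]) simp
  qed simp
 qed
qed

lemma qe_in_iff: "qe A P \<longleftrightarrow> (\<exists>Z. exceptional Z \<and> (\<forall>x\<in>A - Z. P x))" unfolding qe_in_def sobolev_capacity_0_iff by simp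

end

section \<open>Restriction to path almost open sets\<close>

context metric_measure_space
begin

lemma dirichlet_spaceE:
 assumes "A \<in> sets \<mu>" "u \<in> dirichlet A"
 obtains g where "ACC A u g" "Lp g" "AE x in \<mu>. x \<in> A \<longrightarrow> min_grad A u x = g x"
  "u \<in> borel_measurable (restrict_space \<mu> A)"
 using assms min_gradient_rep[OF assms(1)] unfolding dirichlet_space_iff[OF assms(1)] by metis

lemma dirichlet_space_subset:
 assumes "A \<in> sets \<mu>" "A' \<in> sets \<mu>" "A' \<subseteq> A" "u \<in> dirichlet A"
 shows "u \<in> dirichlet A'" using assms(4) measurable_restrict_mono[OF _ assms(3)] ACC_subset[OF _ assms(3)]
 unfolding dirichlet_space_iff[OF assms(1)] dirichlet_space_iff[OF assms(2)] by blast

text \<open>Restriction to \<open>E\<close> can only lower the minimal gradient. For the converse, a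
  gradient on \<open>A\<close> may be replaced on \<open>E\<close> by its minimum with the one found
  on \<open>E\<close>, because \<open>E\<close> is path almost open.\<close>

lemma min_gradient_path_almost_open:
 assumes A: "A \<in> sets \<mu>" and E: "E \<in> sets \<mu>" "E \<subseteq> A" and po: "path_almost_open p \<mu> E"
  and u: "u \<in> dirichlet A"
 shows "AE x in \<mu>. x \<in> E \<longrightarrow> min_grad E u x = min_grad A u x"
proof -
 obtain g where g: "ACC A u g" "Lp g" "AE x in \<mu>. x \<in> A \<longrightarrow> min_grad A u x = g x"
  using dirichlet_spaceE[OF A u] by blast
 obtain h where h: "ACC E u h" "Lp h" "AE x in \<mu>. x \<in> E \<longrightarrow> min_grad E u x = h x"
  using dirichlet_spaceE[OF E(1) dirichlet_space_subset[OF A E u]] by blast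
 obtain B where B: "B \<in> sets borel" "AE x in \<mu>. x \<in> E \<longleftrightarrow> x \<in> B"
  and acc: "ACC A u (\<lambda>x. if x \<in> B then min (g x) (h x) else g x)" using ACC_glue[OF E po g(1) h(1)] by blast
 have "Lp (\<lambda>x. if x \<in> B then min (g x) (h x) else g x)" by (rule Lp_mono[OF g(2) ACC_measurable[OF acc]]) simp
 from min_gradient_le[OF A acc this] min_gradient_le[OF E(1) ACC_subset[OF g(1) E(2)] g(2)] g(3) h(3) B(2)
 show ?thesis
 proof eventually_elim
  fix x assume 1: "x \<in> A \<longrightarrow> min_grad A u x \<le> (if x \<in> B then min (g x) (h x) else g x)"
   and 2: "x \<in> E \<longrightarrow> min_grad E u x \<le> g x" "x \<in> A \<longrightarrow> min_grad A u x = g x"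
    "x \<in> E \<longrightarrow> min_grad E u x = h x" "(x \<in> E) = (x \<in> B)"
  show "x \<in> E \<longrightarrow> min_grad E u x = min_grad A u x"
  proof
   assume x: "x \<in> E"
   then have "min_grad A u x \<le> h x" using 1 2 E(2) by auto
   then show "min_grad E u x = min_grad A u x" using 2 x E(2) by (intro antisym) auto
  qed
 qed
qed

text \<open>The difference is redefined as 0 where both functions take the same infinite value.\<close>

lemma min_gradient_le_on_eq:
 assumes A: "A \<in> sets \<mu>" and u: "u \<in> dirichlet A" and v: "v \<in> dirichlet A"
 shows "AE x in \<mu>. x \<in> A \<longrightarrow> u x = v x \<longrightarrow> min_grad A u x \<le> min_grad A v x"
proof -
 obtain g where g: "ACC A u g" "Lp g" and um[measurable]: "u \<in> borel_measurable (restrict_space \<mu> A)"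
  using dirichlet_spaceE[OF A u] by blast
 obtain h where h: "ACC A v h" "Lp h" "AE x in \<mu>. x \<in> A \<longrightarrow> min_grad A v x = h x"
  and vm[measurable]: "v \<in> borel_measurable (restrict_space \<mu> A)" using dirichlet_spaceE[OF A v] by blast
 define d where "d x = (if u x = v x then 0 else u x - v x)" for x
 have dm: "d \<in> borel_measurable (restrict_space \<mu> A)" unfolding d_def by measurable
 have "ACC A d (\<lambda>x. ennreal 1 * g x + ennreal 1 * h x)"
 proof (rule ACC_combine[OF g(1) h(1) _ _ exceptional_empty])
  fix P Q x x' y y' assume *: "u P = ereal x" "u Q = ereal x'" "v P = ereal y" "v Q = ereal y'"
  have "d P = ereal (x - y)" "d Q = ereal (x' - y')" using * by (auto simp: d_def zero_ereal_def)
  then show "\<exists>r r'. d P = ereal r \<and> d Q = ereal r' \<and> \<bar>r - r'\<bar> \<le> 1 * \<bar>x - x'\<bar> + 1 * \<bar>y - y'\<bar>"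
   by (intro exI[of _ "x - y"] exI[of _ "x' - y'"]) auto
 qed auto
 then have "ACC A d (\<lambda>x. g x + h x)" by simp
 from ACC_nonzero[OF A dm this] obtain S where S: "S \<in> sets borel" "AE x in \<mu>. x \<in> A \<longrightarrow> (d x = 0 \<longleftrightarrow> x \<in> S)"
  and d: "ACC A d (\<lambda>x. if x \<in> S then 0 else g x + h x)" by blast
 have "ACC A u (\<lambda>x. ennreal 1 * h x + ennreal 1 * (if x \<in> S then 0 else g x + h x))"
 proof (rule ACC_combine[OF h(1) d _ _ exceptional_empty])
  fix P Q x x' y y' assume *: "v P = ereal x" "v Q = ereal x'" "d P = ereal y" "d Q = ereal y'"
  have "u P = ereal (x + y)" using * by (cases "u P") (auto simp: d_def zero_ereal_def split: if_splits)
  moreover have "u Q = ereal (x' + y')" using * by (cases "u Q") (auto simp: d_def zero_ereal_def split: if_splits)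
  ultimately show "\<exists>r r'. u P = ereal r \<and> u Q = ereal r' \<and> \<bar>r - r'\<bar> \<le> 1 * \<bar>x - x'\<bar> + 1 * \<bar>y - y'\<bar>"
   by (intro exI[of _ "x + y"] exI[of _ "x' + y'"]) auto
 qed auto
 then have acc: "ACC A u (\<lambda>x. h x + (if x \<in> S then 0 else g x + h x))" by simp
 have "Lp (\<lambda>x. h x + (if x \<in> S then 0 else g x + h x))"
  by (rule Lp_mono[OF Lp_add[OF h(2) Lp_add[OF g(2) h(2)]] ACC_measurable[OF acc]]) (simp add: add_left_mono)
 from min_gradient_le[OF A acc this] h(3) S(2) show ?thesis by eventually_elim (auto simp: d_def)
qed

lemma min_gradient_eq_on_eq:
 assumes A: "A \<in> sets \<mu>" and u: "u \<in> dirichlet A" and v: "v \<in> dirichlet A"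
 shows "AE x in \<mu>. x \<in> A \<longrightarrow> u x = v x \<longrightarrow> min_grad A u x = min_grad A v x"
 using min_gradient_le_on_eq[OF A u v] min_gradient_le_on_eq[OF A v u] by eventually_elim (auto intro: antisym)

lemma p_energy_path_almost_open:
 assumes E: "E \<in> sets \<mu>" and E0: "E0 \<in> sets \<mu>" "E0 \<subseteq> E" and po: "path_almost_open p \<mu> E0"
  and null: "E - E0 \<in> null_sets \<mu>" and u: "u \<in> dirichlet E"
 shows "p_energy p \<mu> E u = p_energy p \<mu> E0 u" unfolding p_energy_def
 using min_gradient_path_almost_open[OF E E0 po u] AE_not_in[OF null]
 by (intro nn_integral_cong_AE, eventually_elim) (use E0(2) in \<open>auto simp: indicator_def\<close>)

section \<open>Comparison of the obstacle problems\<close>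

text \<open>Lets the comparison of \<open>E0\<close> with \<open>E\<close> be the case
  \<open>\<Omega> = E\<close> of the comparison with the primed problem.\<close>

lemma obstacle_class_self:
 "obstacle_class' p \<mu> \<psi>1 \<psi>2 f E E = obstacle_class p \<mu> \<psi>1 \<psi>2 f E"
 "obstacle_solutions' p \<mu> \<psi>1 \<psi>2 f E E = obstacle_solutions p \<mu> \<psi>1 \<psi>2 f E"
 unfolding obstacle_solutions'_def obstacle_solutions_def obstacle_class'_def obstacle_class_def p_energy_def by auto

lemma ereal_diff_eq_0: "a - b = (0::ereal) \<Longrightarrow> a = b \<and> \<bar>b\<bar> \<noteq> \<infinity>" by (cases a; cases b) (auto simp: zero_ereal_def)

text \<open>Restriction to \<open>E0\<close> and extension by \<open>f\<close> are mutually inverse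
  q.e. Admissible functions equal \<open>f\<close> q.e. in \<open>E - E0\<close>, and minimal
  gradients agree a.e. where functions agree, so the two energies differ by the energy
  \<open>C\<close> of \<open>f\<close> there. This constant is finite and does not affect
  minimizers.\<close>

lemma obstacle_correspondence:
 assumes E0: "E0 \<in> sets \<mu>" and E: "E \<in> sets \<mu>" and \<Omega>: "\<Omega> \<in> sets \<mu>" and sub: "E0 \<subseteq> E" "E \<subseteq> \<Omega>"
  and po: "path_almost_open p \<mu> E0"
  and vanish: "\<And>h. h \<in> newton UNIV \<Longrightarrow> (\<And>x. x \<notin> E \<Longrightarrow> h x = 0) \<Longrightarrow>
   \<exists>Z. exceptional Z \<and> (\<forall>x. x \<notin> E0 \<longrightarrow> x \<notin> Z \<longrightarrow> h x = 0)"
  and f: "f \<in> dirichlet \<Omega>" and ne: "obstacle_class p \<mu> \<psi>1 \<psi>2 f E \<noteq> {}"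
 shows "coincide_qe p \<mu> \<Omega> (extend_by f E0 ` obstacle_solutions p \<mu> \<psi>1 \<psi>2 f E0)
   (obstacle_solutions' p \<mu> \<psi>1 \<psi>2 f \<Omega> E)"
proof -
 let ?L = "obstacle_class p \<mu> \<psi>1 \<psi>2 f E0" and ?K = "obstacle_class' p \<mu> \<psi>1 \<psi>2 f \<Omega> E"
 let ?J = "\<lambda>v. \<integral>\<^sup>+x\<in>E. epowr (min_grad \<Omega> v x) p \<partial>\<mu>"
 have sub0: "E0 \<subseteq> \<Omega>" using sub by auto
 \<comment> \<open>One admissible function equals \<open>f\<close> q.e. in \<open>E - E0\<close>.
   Hence \<open>f\<close> is finite there and obeys both obstacles q.e., as the extension by
   \<open>f\<close> must.\<close>
 obtain Zf where Zf: "exceptional Zf" "\<And>x. x \<in> E - E0 \<Longrightarrow> x \<notin> Zf \<Longrightarrow> \<bar>f x\<bar> \<noteq> \<infinity> \<and> \<psi>1 x \<le> f x \<and> f x \<le> \<psi>2 x"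
 proof -
  obtain v where v: "(\<lambda>x. v x - f x) \<in> newton_space0 p \<mu> E" "qe E (\<lambda>x. \<psi>1 x \<le> v x \<and> v x \<le> \<psi>2 x)"
   using ne unfolding obstacle_class_def by blast
  obtain h where h: "h \<in> newton UNIV" "\<And>x. x \<notin> E \<Longrightarrow> h x = 0" "\<And>x. x \<in> E \<Longrightarrow> v x - f x = h x"
   using v(1) unfolding newton_space0_def by auto
  obtain Z where Z: "exceptional Z" "\<And>x. x \<notin> E0 \<Longrightarrow> x \<notin> Z \<Longrightarrow> h x = 0" using vanish[OF h(1,2)] by blast
  obtain Z' where Z': "exceptional Z'" "\<And>x. x \<in> E - Z' \<Longrightarrow> \<psi>1 x \<le> v x \<and> v x \<le> \<psi>2 x"
   using v(2) unfolding qe_in_iff by blast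
  show ?thesis
  proof (rule that[OF exceptional_Un[OF Z(1) Z'(1)]])
   fix x assume x: "x \<in> E - E0" "x \<notin> Z \<union> Z'"
   then have "v x - f x = 0" using h(3)[of x] Z(2)[of x] by auto
   then have "v x = f x \<and> \<bar>f x\<bar> \<noteq> \<infinity>" by (rule ereal_diff_eq_0)
   then show "\<bar>f x\<bar> \<noteq> \<infinity> \<and> \<psi>1 x \<le> f x \<and> f x \<le> \<psi>2 x" using Z'(2)[of x] x by auto
  qed
 qed
 obtain gf where gf: "ACC \<Omega> f gf" "Lp gf" "AE x in \<mu>. x \<in> \<Omega> \<longrightarrow> min_grad \<Omega> f x = gf x"
  and fm: "f \<in> borel_measurable (restrict_space \<mu> \<Omega>)" using dirichlet_spaceE[OF \<Omega> f] by blast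
 define C where "C = pint_on (E - E0) gf"
 have C: "C < \<infinity>"
 proof -
  have "C \<le> pint gf" unfolding C_def by (intro nn_integral_mono) (auto simp: indicator_def)
  then show ?thesis using gf(2) by (auto simp: Lp_def intro: order_le_less_trans)
 qed
 have restrict: "v \<in> ?L \<and> (\<exists>Z. exceptional Z \<and> (\<forall>x\<in>\<Omega> - Z. v x = extend_by f E0 v x)) \<and> ?J v = p_energy p \<mu> E0 v + C"
  if v: "v \<in> ?K" for v
 proof -
  have vD: "v \<in> dirichlet \<Omega>" and vf: "\<And>x. x \<in> \<Omega> - E \<Longrightarrow> v x = f x"
   and v0: "(\<lambda>x. v x - f x) \<in> newton_space0 p \<mu> E" and vq: "qe E (\<lambda>x. \<psi>1 x \<le> v x \<and> v x \<le> \<psi>2 x)"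
   using v unfolding obstacle_class'_def by auto
  obtain h where h: "h \<in> newton UNIV" "\<And>x. x \<notin> E \<Longrightarrow> h x = 0" "\<And>x. x \<in> E \<Longrightarrow> v x - f x = h x"
   using v0 unfolding newton_space0_def by auto
  obtain Z where Z: "exceptional Z" "\<And>x. x \<notin> E0 \<Longrightarrow> x \<notin> Z \<Longrightarrow> h x = 0" using vanish[OF h(1,2)] by blast
  have eq: "v x = f x" if "x \<in> \<Omega>" "x \<notin> E0" "x \<notin> Z" for x
  proof (cases "x \<in> E")
   case True
   then have "v x - f x = 0" using h(3) Z(2) that by simp
   then show ?thesis using ereal_diff_eq_0 by blast
  qed (use vf that in auto)
  have "(\<lambda>x. if x \<in> E0 then h x else 0) \<in> newton UNIV" by (rule newton_space_cong[OF h(1) Z(1)]) (use Z(2) in auto)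
  then have "(\<lambda>x. v x - f x) \<in> newton_space0 p \<mu> E0" unfolding newton_space0_def using h(3) sub(1)
   by (intro CollectI bexI[of _ "\<lambda>x. if x \<in> E0 then h x else 0"]) auto
  moreover have "qe E0 (\<lambda>x. \<psi>1 x \<le> v x \<and> v x \<le> \<psi>2 x)" using vq sub(1) unfolding qe_in_def by blast
  ultimately have K0: "v \<in> ?L" unfolding obstacle_class_def using dirichlet_space_subset[OF \<Omega> E0 sub0 vD] by simp
  have qe: "\<exists>Z. exceptional Z \<and> (\<forall>x\<in>\<Omega> - Z. v x = extend_by f E0 v x)" using Z(1) eq by (auto simp: extend_by_def)
  obtain gv where gv: "ACC \<Omega> v gv" "Lp gv" "AE x in \<mu>. x \<in> \<Omega> \<longrightarrow> min_grad \<Omega> v x = gv x"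
   using dirichlet_spaceE[OF \<Omega> vD] by blast
  have [measurable]: "gv \<in> borel_measurable \<mu>" "E0 \<in> sets \<mu>" "E \<in> sets \<mu>"
   using gv(2) E0 E by (auto simp: Lp_def measurable_mu_borel)
  have "?J v = muint (\<lambda>x. epowr (gv x) p * indicator E0 x + epowr (gv x) p * indicator (E - E0) x)"
   using gv(3) by (intro nn_integral_cong_AE, eventually_elim) (use sub in \<open>auto simp: indicator_def\<close>)
  also have "\<dots> = pint_on E0 gv + pint_on (E - E0) gv" by (intro nn_integral_add) auto
  also have "pint_on E0 gv = p_energy p \<mu> E0 v" unfolding p_energy_def
   using gv(3) min_gradient_path_almost_open[OF \<Omega> E0 sub0 po vD]
   by (intro nn_integral_cong_AE, eventually_elim) (use sub in \<open>auto simp: indicator_def\<close>)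
  also have "pint_on (E - E0) gv = C" unfolding C_def
   using gv(3) gf(3) min_gradient_eq_on_eq[OF \<Omega> vD f] exceptional_AE[OF Z(1)]
   by (intro nn_integral_cong_AE, eventually_elim) (use sub eq in \<open>auto simp: indicator_def\<close>)
  finally show ?thesis using K0 qe by blast
 qed
 have restrict_class: "v \<in> ?L" and restrict_J: "?J v = p_energy p \<mu> E0 v + C"
  and restrict_qe: "\<exists>Z. exceptional Z \<and> (\<forall>x\<in>\<Omega> - Z. v x = extend_by f E0 v x)" if "v \<in> ?K" for v
  using restrict[OF that] by blast+
 have extend: "extend_by f E0 w \<in> ?K" if w: "w \<in> ?L" for w
 proof -
  let ?w = "extend_by f E0 w"
  have wD: "w \<in> dirichlet E0"
   and w0: "(\<lambda>x. w x - f x) \<in> newton_space0 p \<mu> E0" and wq: "qe E0 (\<lambda>x. \<psi>1 x \<le> w x \<and> w x \<le> \<psi>2 x)"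
   using w unfolding obstacle_class_def by auto
  obtain h where h: "h \<in> newton UNIV" "\<And>x. x \<notin> E0 \<Longrightarrow> h x = 0" "\<And>x. x \<in> E0 \<Longrightarrow> w x - f x = h x"
   using w0 unfolding newton_space0_def by auto
  obtain gh where gh: "Lp gh" "ACC UNIV h gh" using h(1) unfolding newton_space_iff by blast
  have "?w \<in> borel_measurable (restrict_space \<mu> \<Omega>)"
  proof -
   have "w \<in> borel_measurable (restrict_space \<mu> E0)" using wD unfolding dirichlet_space_iff[OF E0] by simp
   moreover have "restrict_space (restrict_space \<mu> \<Omega>) {x. x \<in> E0} = restrict_space \<mu> E0"
    using \<Omega> E0 sub0 by (subst restrict_restrict_space) (auto simp: Int_absorb1)
   moreover have "f \<in> borel_measurable (restrict_space (restrict_space \<mu> \<Omega>) {x. x \<notin> E0})"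
    using fm by (rule measurable_restrict_space1)
   moreover have "{x \<in> space (restrict_space \<mu> \<Omega>). x \<in> E0} \<in> sets (restrict_space \<mu> \<Omega>)"
    using \<Omega> E0 by (auto simp: space_restrict_space sets_restrict_space)
   ultimately show ?thesis unfolding extend_by_def by (subst measurable_If_restrict_space_iff) auto
  qed
  \<comment> \<open>Where \<open>f\<close> and \<open>h\<close> are finite the extension is
    \<open>f + h\<close>, because \<open>h\<close> is 0 outside \<open>E0\<close>; so a sum of their
    gradients works.\<close>
  moreover have "ACC \<Omega> ?w (\<lambda>x. ennreal 1 * gf x + ennreal 1 * gh x)"
  proof (rule ACC_combine[OF gf(1) ACC_subset[OF gh(2)] _ _ exceptional_empty])
   fix P Q x x' y y' assume *: "f P = ereal x" "f Q = ereal x'" "h P = ereal y" "h Q = ereal y'"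
   have w: "?w R = ereal (a + b)" if "f R = ereal a" "h R = ereal b" for R a b
    using h(2,3)[of R] that by (cases "w R") (auto simp: extend_by_def zero_ereal_def)
   show "\<exists>r r'. ?w P = ereal r \<and> ?w Q = ereal r' \<and> \<bar>r - r'\<bar> \<le> 1 * \<bar>x - x'\<bar> + 1 * \<bar>y - y'\<bar>"
    using w[OF *(1,3)] w[OF *(2,4)] by auto
  qed auto
  ultimately have D: "?w \<in> dirichlet \<Omega>" unfolding dirichlet_space_iff[OF \<Omega>] using Lp_add[OF gf(2) gh(1)] by auto
  \<comment> \<open>This differs from \<open>h\<close> only where \<open>f\<close> is infinite in
    \<open>E - E0\<close>, since \<open>f x - f x\<close> is 0 only for finite \<open>f x\<close>;
    \<open>Zf\<close> contains those points.\<close>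
  let ?h = "\<lambda>x. if x \<in> E then ?w x - f x else 0"
  have "?h \<in> newton UNIV"
  proof (rule newton_space_cong[OF h(1) Zf(1)])
   fix x assume x: "x \<notin> Zf"
   show "h x = ?h x"
   proof (cases "x \<in> E0")
    case True then show ?thesis using h(3) sub by (auto simp: extend_by_def)
   next
    case False
    then show ?thesis using h(2)[of x] Zf(2)[of x] x by (cases "f x") (auto simp: extend_by_def zero_ereal_def)
   qed
  qed
  then have n0: "(\<lambda>x. ?w x - f x) \<in> newton_space0 p \<mu> E"
   unfolding newton_space0_def by (intro CollectI bexI[of _ ?h]) auto
  obtain Z where Z: "exceptional Z" "\<And>x. x \<in> E0 - Z \<Longrightarrow> \<psi>1 x \<le> w x \<and> w x \<le> \<psi>2 x" using wq unfolding qe_in_iff by blast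
  have "qe E (\<lambda>x. \<psi>1 x \<le> ?w x \<and> ?w x \<le> \<psi>2 x)" unfolding qe_in_iff using exceptional_Un[OF Z(1) Zf(1)] Z(2) Zf(2)
   by (intro exI[of _ "Z \<union> Zf"]) (auto simp: extend_by_def)
  then show ?thesis unfolding obstacle_class'_def using D n0 sub by (auto simp: extend_by_def)
 qed
 have J_ext: "?J (extend_by f E0 w) = p_energy p \<mu> E0 w + C" if w: "w \<in> ?L" for w
 proof -
  have "min_grad E0 (extend_by f E0 w) = min_grad E0 w"
   by (rule min_gradient_cong[OF E0 exceptional_empty]) (simp add: extend_by_def)
  then show ?thesis using restrict_J[OF extend[OF w]] by (simp add: p_energy_def)
 qed
 have cancel: "a \<le> b" if "a + C \<le> b + C" for a b
 proof -
  have "C \<noteq> top" using C by auto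
  then show ?thesis using that by (simp add: add.commute[of _ C] ennreal_add_left_cancel_le)
 qed
 show ?thesis unfolding coincide_qe_def
 proof (intro conjI ballI)
  fix v assume v: "v \<in> obstacle_solutions' p \<mu> \<psi>1 \<psi>2 f \<Omega> E"
  then have vK: "v \<in> ?K" and min: "\<And>w. w \<in> ?K \<Longrightarrow> ?J v \<le> ?J w" unfolding obstacle_solutions'_def by auto
  have "p_energy p \<mu> E0 v \<le> p_energy p \<mu> E0 w" if w: "w \<in> ?L" for w
  proof (rule cancel)
   show "p_energy p \<mu> E0 v + C \<le> p_energy p \<mu> E0 w + C"
    using min[OF extend[OF w]] J_ext[OF w] restrict_J[OF vK] by simp
  qed
  then have "v \<in> obstacle_solutions p \<mu> \<psi>1 \<psi>2 f E0"
   unfolding obstacle_solutions_def using restrict_class[OF vK] by auto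
  moreover have "qe \<Omega> (\<lambda>x. extend_by f E0 v x = v x)" using restrict_qe[OF vK] unfolding qe_in_iff by metis
  ultimately show "\<exists>u\<in>extend_by f E0 ` obstacle_solutions p \<mu> \<psi>1 \<psi>2 f E0. qe \<Omega> (\<lambda>x. u x = v x)" by blast
 next
  fix u assume "u \<in> extend_by f E0 ` obstacle_solutions p \<mu> \<psi>1 \<psi>2 f E0"
  then obtain w where u: "u = extend_by f E0 w" and w: "w \<in> ?L"
   and min: "\<And>v. v \<in> ?L \<Longrightarrow> p_energy p \<mu> E0 w \<le> p_energy p \<mu> E0 v" unfolding obstacle_solutions_def by auto
  have "?J u \<le> ?J v" if v: "v \<in> ?K" for v
   using min[OF restrict_class[OF v]] restrict_J[OF v] J_ext[OF w] u by (simp add: add_right_mono)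
  then have "u \<in> obstacle_solutions' p \<mu> \<psi>1 \<psi>2 f \<Omega> E" unfolding obstacle_solutions'_def using extend[OF w] u by auto
  then show "\<exists>v\<in>obstacle_solutions' p \<mu> \<psi>1 \<psi>2 f \<Omega> E. qe \<Omega> (\<lambda>x. u x = v x)"
   by (intro bexI[of _ u]) (auto simp: qe_in_iff intro: exI[of _ "{}"])
 qed
qed

lemma coincide_qe_sym: "coincide_qe p \<mu> G S T \<Longrightarrow> coincide_qe p \<mu> G T S"
 unfolding coincide_qe_def qe_in_def by (metis (mono_tags, lifting))

lemma coincide_qe_extend_trans:
 assumes 1: "coincide_qe p \<mu> E S (extend_by f E0 ` T)" and 2: "coincide_qe p \<mu> \<Omega> (extend_by f E0 ` T) R"
  and sub: "E0 \<subseteq> E" "E \<subseteq> \<Omega>"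
 shows "coincide_qe p \<mu> \<Omega> (extend_by f E ` S) R"
proof -
 have ext: "qe \<Omega> (\<lambda>x. extend_by f E u x = v x)"
  if uw: "qe E (\<lambda>x. u x = extend_by f E0 w x)" and wv: "qe \<Omega> (\<lambda>x. extend_by f E0 w x = v x)" for u v w
 proof -
  obtain Z where Z: "exceptional Z" "\<And>x. x \<in> E - Z \<Longrightarrow> u x = extend_by f E0 w x" using uw unfolding qe_in_iff by blast
  obtain Z' where Z': "exceptional Z'" "\<And>x. x \<in> \<Omega> - Z' \<Longrightarrow> extend_by f E0 w x = v x" using wv unfolding qe_in_iff by blast
  show ?thesis unfolding qe_in_iff
  proof (intro exI[of _ "Z \<union> Z'"] conjI exceptional_Un Z(1) Z'(1) ballI)
   fix x assume x: "x \<in> \<Omega> - (Z \<union> Z')"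
   show "extend_by f E u x = v x"
   proof (cases "x \<in> E")
    case True then show ?thesis using Z(2)[of x] Z'(2)[of x] x by (simp add: extend_by_def)
   next
    case False
    then have "x \<notin> E0" using sub(1) by blast
    then show ?thesis using Z'(2)[of x] x False by (simp add: extend_by_def)
   qed
  qed
 qed
 show ?thesis unfolding coincide_qe_def
 proof (intro conjI ballI)
  fix u' assume "u' \<in> extend_by f E ` S"
  then obtain u where u: "u \<in> S" "u' = extend_by f E u" by blast
  then obtain w where w: "w \<in> T" "qe E (\<lambda>x. u x = extend_by f E0 w x)" using 1 unfolding coincide_qe_def by blast
  obtain v where v: "v \<in> R" "qe \<Omega> (\<lambda>x. extend_by f E0 w x = v x)" using 2 w(1) unfolding coincide_qe_def by blast
  show "\<exists>v\<in>R. qe \<Omega> (\<lambda>x. u' x = v x)" using v ext[OF w(2) v(2)] u(2) by auto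
 next
  fix v assume "v \<in> R"
  then obtain w where w: "w \<in> T" "qe \<Omega> (\<lambda>x. extend_by f E0 w x = v x)" using 2 unfolding coincide_qe_def by blast
  obtain u where u: "u \<in> S" "qe E (\<lambda>x. u x = extend_by f E0 w x)" using 1 w(1) unfolding coincide_qe_def by blast
  show "\<exists>u'\<in>extend_by f E ` S. qe \<Omega> (\<lambda>x. u' x = v x)" using u ext[OF u(2) w(2)] by auto
 qed
qed

end

section \<open>Regularity, coverings and averages\<close>

lemma sum_half_powers: "(\<Sum>n. ennreal (e * (1/2) ^ Suc n)) = ennreal e" if "0 \<le> e"
proof -
 have "(\<lambda>n. e * (1/2) ^ Suc n) sums (e * 1)" using sums_mult[OF power_half_series] by simp
 then show ?thesis using that by (subst suminf_ennreal_eq[of _ e]) auto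
qed

text \<open>Inner closed and outer open approximations are carried through the induction together,
  since complementation exchanges them. Open sets are exhausted by the points at distance at least
  \<open>1 / real (Suc n)\<close> from the complement.\<close>

lemma closed_open_approx:
 fixes M :: "'a::metric_space measure"
 assumes M: "sets M = sets borel" and fin: "emeasure M UNIV < \<infinity>" and S: "S \<in> sets borel" and e: "0 < e"
 shows "\<exists>C U. closed C \<and> open U \<and> C \<subseteq> S \<and> S \<subseteq> U \<and> emeasure M (U - C) < ennreal e"
proof -
 have finA: "emeasure M A \<noteq> \<infinity>" for A
  using emeasure_space[of M A] fin sets_eq_imp_space_eq[OF M] by (auto simp: top_unique)
 have bm: "closed A \<Longrightarrow> A \<in> sets M" "open A \<Longrightarrow> A \<in> sets M" for A by (auto simp: M)
 have "S \<in> sigma_sets UNIV {S. open S}" using S by (simp add: sets_borel)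
 then have "\<forall>e>0. \<exists>C U. closed C \<and> open U \<and> C \<subseteq> S \<and> S \<subseteq> U \<and> emeasure M (U - C) < ennreal e"
 proof induction
  case (Basic S)
  then have S: "open S" by simp
  show ?case
  proof (intro allI impI)
   fix e :: real assume e: "0 < e"
   show "\<exists>C U. closed C \<and> open U \<and> C \<subseteq> S \<and> S \<subseteq> U \<and> emeasure M (U - C) < ennreal e"
   proof (cases "S = UNIV")
    \<comment> \<open>Treated apart because the distance to the empty complement is 0 by
      convention.\<close>
    case True then show ?thesis using e by (intro exI[of _ UNIV]) auto
   next
    case False
    define C where "C n = {x. 1 / real (Suc n) \<le> infdist x (- S)}" for n
    have C: "closed (C n)" for n unfolding C_def by (intro closed_Collect_le continuous_intros)
    have CS: "C n \<subseteq> S" for n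
    proof
     fix x assume "x \<in> C n"
     then have "infdist x (- S) \<noteq> 0" unfolding C_def by (smt (verit) mem_Collect_eq of_nat_0_less_iff zero_less_Suc zero_less_divide_1_iff)
     then show "x \<in> S" by (metis ComplI infdist_zero)
    qed
    have "(\<lambda>n. emeasure M (S - C n)) \<longlonglongrightarrow> emeasure M (\<Inter>n. S - C n)"
    proof (rule Lim_emeasure_decseq)
     show "range (\<lambda>n. S - C n) \<subseteq> sets M" using bm C S by auto
     show "decseq (\<lambda>n. S - C n)"
     proof (rule decseq_SucI)
      fix n
      have "1 / real (Suc (Suc n)) \<le> 1 / real (Suc n)" by (intro divide_left_mono) auto
      then show "S - C (Suc n) \<subseteq> S - C n" by (auto simp: C_def)
     qed
    qed (rule finA)
    moreover have "(\<Inter>n. S - C n) = {}"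
    proof -
     have "\<exists>n. x \<in> C n" if "x \<in> S" for x
     proof -
      have "infdist x (- S) \<noteq> 0"
       using S that False in_closed_iff_infdist_zero[of "- S" x] by (auto simp: closed_Compl)
      then have "0 < infdist x (- S)" using infdist_nonneg[of x "- S"] by linarith
      then obtain n where "1 / real (Suc n) < infdist x (- S)" by (rule nat_approx_posE)
      then show ?thesis by (auto simp: C_def intro!: exI[of _ n])
     qed
     then show ?thesis by auto
    qed
    ultimately have "(\<lambda>n. emeasure M (S - C n)) \<longlonglongrightarrow> 0" by (simp only: emeasure_empty)
    then have "eventually (\<lambda>n. emeasure M (S - C n) < ennreal e) sequentially"
     by (rule order_tendstoD(2)) (use e in simp)
    then obtain n where "emeasure M (S - C n) < ennreal e" by (auto simp: eventually_sequentially)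
    then show ?thesis using C CS S by blast
   qed
  qed
 next
  case Empty
  show ?case by (intro allI impI exI[of _ "{}"]) auto
 next
  case (Compl S)
  show ?case
  proof (intro allI impI)
   fix e :: real assume "0 < e"
   from Compl.IH[rule_format, OF this] obtain C U
    where "closed C" "open U" "C \<subseteq> S" "S \<subseteq> U" "emeasure M (U - C) < ennreal e" by (elim exE conjE)
   moreover have "(- C) - (- U) = U - C" by auto
   ultimately show "\<exists>C U. closed C \<and> open U \<and> C \<subseteq> UNIV - S \<and> UNIV - S \<subseteq> U \<and> emeasure M (U - C) < ennreal e"
    by (intro exI[of _ "- U"] exI[of _ "- C"]) (auto simp: closed_Compl open_Compl)
  qed
 next
  case (Union A)
  show ?case
  proof (intro allI impI)
   fix e :: real assume e: "0 < e"
   let ?P = "\<lambda>i CU. closed (fst CU) \<and> open (snd CU) \<and> fst CU \<subseteq> A i \<and> A i \<subseteq> snd CU \<and>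
     emeasure M (snd CU - fst CU) < ennreal (e / 2 * (1/2) ^ Suc i)"
   have "\<forall>i. \<exists>CU. ?P i CU"
   proof
    fix i
    have "0 < e / 2 * (1/2) ^ Suc i" using e by simp
    from Union.IH[of i, rule_format, OF this] obtain C U
     where "closed C" "open U" "C \<subseteq> A i" "A i \<subseteq> U" "emeasure M (U - C) < ennreal (e / 2 * (1/2) ^ Suc i)"
     by (elim exE conjE)
    then show "\<exists>CU. ?P i CU" by (intro exI[of _ "(C, U)"]) simp
   qed
   from choice[OF this] obtain CU where CU: "\<forall>i. ?P i (CU i)" by (rule exE)
   define C where "C i = fst (CU i)" for i
   define U where "U i = snd (CU i)" for i
   have CU: "closed (C i)" "open (U i)" "C i \<subseteq> A i" "A i \<subseteq> U i" "emeasure M (U i - C i) < ennreal (e / 2 * (1/2) ^ Suc i)" for i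
    using CU by (auto simp: C_def U_def)
   \<comment> \<open>Only finite unions of the closed sets are closed. Finiteness of the measure
     makes the loss from stopping at a finite \<open>n\<close> small.\<close>
   let ?U = "\<Union>i. U i" and ?C = "\<lambda>n. \<Union>i<n. C i"
   have "(\<lambda>n. emeasure M (?U - ?C n)) \<longlonglongrightarrow> emeasure M (\<Inter>n. ?U - ?C n)"
   proof (rule Lim_emeasure_decseq)
    show "range (\<lambda>n. ?U - ?C n) \<subseteq> sets M" using bm CU(1,2) by (auto intro!: sets.Diff)
    show "decseq (\<lambda>n. ?U - ?C n)" by (rule decseq_SucI) (auto simp: lessThan_Suc)
   qed (rule finA)
   moreover have "emeasure M (\<Inter>n. ?U - ?C n) < ennreal e"
   proof -
    have "emeasure M (\<Inter>n. ?U - ?C n) \<le> emeasure M (\<Union>i. U i - C i)"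
    proof (rule emeasure_mono)
     show "(\<Inter>n. ?U - ?C n) \<subseteq> (\<Union>i. U i - C i)"
     proof
      fix x assume x: "x \<in> (\<Inter>n. ?U - ?C n)"
      then obtain i where "x \<in> U i" by blast
      moreover have "x \<notin> ?C (Suc i)" using x by blast
      ultimately show "x \<in> (\<Union>i. U i - C i)" by auto
     qed
     show "(\<Union>i. U i - C i) \<in> sets M" using bm CU(1,2) by (intro sets.countable_UN) auto
    qed
    also have "\<dots> \<le> (\<Sum>i. emeasure M (U i - C i))" using bm CU(1,2) by (intro emeasure_subadditive_countably) auto
    also have "\<dots> \<le> (\<Sum>i. ennreal (e / 2 * (1/2) ^ Suc i))"
     using CU(5) by (intro suminf_le) (auto simp: less_imp_le)
    also have "\<dots> = ennreal (e / 2)" using e by (intro sum_half_powers) simp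
    also have "\<dots> < ennreal e" using e by (simp add: ennreal_less_iff)
    finally show ?thesis .
   qed
   ultimately have "eventually (\<lambda>n. emeasure M (?U - ?C n) < ennreal e) sequentially" by (rule order_tendstoD(2))
   then obtain n where "emeasure M (?U - ?C n) < ennreal e" by (auto simp: eventually_sequentially)
   moreover have "closed (?C n)" using CU(1) by (intro closed_UN) auto
   moreover have "open ?U" using CU(2) by auto
   moreover have "?C n \<subseteq> \<Union>(range A)" using CU(3) by blast
   moreover have "\<Union>(range A) \<subseteq> ?U" using CU(4) by blast
   ultimately show "\<exists>C U. closed C \<and> open U \<and> C \<subseteq> \<Union>(range A) \<and> \<Union>(range A) \<subseteq> U \<and> emeasure M (U - C) < ennreal e"
    by (intro exI[of _ "?C n"] exI[of _ ?U]) auto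
  qed
 qed
 then show ?thesis using e by blast
qed

text \<open>The finite case is applied inside each ball of radius \<open>n\<close> with error
  \<open>e * (1/2) ^ Suc n\<close>, and the resulting open sets are united.\<close>

lemma outer_open:
 fixes M :: "'a::metric_space measure"
 assumes M: "sets M = sets borel" and fin: "\<And>n::nat. emeasure M (ball z n) < \<infinity>" and S: "S \<in> sets borel" and e: "0 < e"
 obtains U where "open U" "S \<subseteq> U" "emeasure M (U - S) \<le> ennreal e"
proof -
 have "\<forall>n::nat. \<exists>U. open U \<and> S \<inter> ball z n \<subseteq> U \<and> U \<subseteq> ball z n \<and> emeasure M (U - S) \<le> ennreal (e * (1/2) ^ Suc n)"
 proof
  fix n :: nat
  let ?M = "density M (indicator (ball z n))"
  have em: "emeasure ?M A = emeasure M (A \<inter> ball z n)" if "A \<in> sets borel" for A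
  proof -
   have [measurable]: "A \<in> sets M" "ball z n \<in> sets M" using that M by auto
   have "emeasure ?M A = (\<integral>\<^sup>+x. indicator (ball z n) x * indicator A x \<partial>M)" by (rule emeasure_density) measurable
   also have "\<dots> = (\<integral>\<^sup>+x. indicator (A \<inter> ball z n) x \<partial>M)"
    by (intro nn_integral_cong) (simp add: indicator_inter_arith mult.commute)
   also have "\<dots> = emeasure M (A \<inter> ball z n)" by (rule nn_integral_indicator) measurable
   finally show ?thesis .
  qed
  have "0 < e * (1/2) ^ Suc n" using e by simp
  from closed_open_approx[of ?M "S \<inter> ball z n", OF _ _ _ this]
  obtain C U where CU: "closed C" "open U" "C \<subseteq> S \<inter> ball z n" "S \<inter> ball z n \<subseteq> U"
    "emeasure ?M (U - C) < ennreal (e * (1/2) ^ Suc n)" using M S fin[of n] by (auto simp: em)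
  have "emeasure M (U \<inter> ball z n - S) \<le> emeasure M ((U - C) \<inter> ball z n)" using CU M S by (intro emeasure_mono) auto
  also have "\<dots> \<le> ennreal (e * (1/2) ^ Suc n)" using CU(5) em[of "U - C"] CU(1,2) by auto
  finally show "\<exists>U. open U \<and> S \<inter> ball z n \<subseteq> U \<and> U \<subseteq> ball z n \<and> emeasure M (U - S) \<le> ennreal (e * (1/2) ^ Suc n)"
   using CU by (intro exI[of _ "U \<inter> ball z n"]) auto
 qed
 from choice[OF this] obtain U where U0: "\<forall>n::nat. open (U n) \<and> S \<inter> ball z n \<subseteq> U n \<and> U n \<subseteq> ball z n \<and> emeasure M (U n - S) \<le> ennreal (e * (1/2) ^ Suc n)"
  by (rule exE)
 then have U: "open (U n)" "S \<inter> ball z n \<subseteq> U n" "emeasure M (U n - S) \<le> ennreal (e * (1/2) ^ Suc n)" for n by auto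
 show ?thesis
 proof (rule that[of "\<Union>n. U n"])
  show "open (\<Union>n. U n)" using U(1) by auto
  show "S \<subseteq> (\<Union>n. U n)"
  proof
   fix x assume x: "x \<in> S"
   obtain n :: nat where "dist z x < real n" using reals_Archimedean2 by blast
   then show "x \<in> (\<Union>n. U n)" using U(2)[of n] x by auto
  qed
  have "emeasure M ((\<Union>n. U n) - S) = emeasure M (\<Union>n. U n - S)" by (rule arg_cong[of _ _ "emeasure M"]) auto
  also have "\<dots> \<le> (\<Sum>n. emeasure M (U n - S))" using U(1) S M by (intro emeasure_subadditive_countably) auto
  also have "\<dots> \<le> (\<Sum>n. ennreal (e * (1/2) ^ Suc n))" using U(3) by (intro suminf_le) auto
  also have "\<dots> = ennreal e" using e by (intro sum_half_powers) simp
  finally show "emeasure M ((\<Union>n. U n) - S) \<le> ennreal e" .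
 qed
qed

text \<open>The function is lower semicontinuous: a ball is the increasing union of slightly smaller
  concentric balls, and each of these lies in all balls of radius \<open>r\<close> with nearby
  centres.\<close>

lemma emeasure_ball_borel:
 fixes M :: "'a::metric_space measure"
 assumes M: "sets M = sets borel"
 shows "borel_fun (\<lambda>x. emeasure M (ball x r))"
proof (rule borel_measurableI_greater)
 fix a
 have "open {x. a < emeasure M (ball x r)}" unfolding open_dist
 proof (intro ballI)
  fix x assume "x \<in> {x. a < emeasure M (ball x r)}"
  then have a: "a < emeasure M (ball x r)" by simp
  let ?B = "\<lambda>n. ball x (r - 1 / real (Suc n))"
  have inc: "incseq ?B"
  proof (rule incseq_SucI)
   fix n
   have "1 / real (Suc (Suc n)) \<le> 1 / real (Suc n)" by (intro divide_left_mono) auto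
   then show "?B n \<subseteq> ?B (Suc n)" by (intro subset_ball) simp
  qed
  have un: "(\<Union>n. ?B n) = ball x r"
  proof safe
   fix y assume "y \<in> ball x r"
   then have "0 < r - dist x y" by simp
   then obtain n where "1 / real (Suc n) < r - dist x y" by (rule nat_approx_posE)
   then show "y \<in> (\<Union>n. ?B n)" by (auto intro!: exI[of _ n])
  next
   fix y n assume "y \<in> ?B n"
   then have "dist x y < r - 1 / real (Suc n)" by simp
   moreover have "0 < 1 / real (Suc n)" by simp
   ultimately have "dist x y < r" by linarith
   then show "y \<in> ball x r" by simp
  qed
  have sup: "(SUP n. emeasure M (?B n)) = emeasure M (ball x r)"
  proof -
   have "range ?B \<subseteq> sets M" unfolding M by (intro image_subsetI borel_open open_ball)
   then have "(SUP n. emeasure M (?B n)) = emeasure M (\<Union>n. ?B n)" by (rule SUP_emeasure_incseq[OF _ inc])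
   then show ?thesis unfolding un .
  qed
  obtain n where n: "a < emeasure M (?B n)" using a unfolding sup[symmetric] less_SUP_iff by (rule bexE)
  show "\<exists>e>0. \<forall>y. dist y x < e \<longrightarrow> y \<in> {x. a < emeasure M (ball x r)}"
  proof (intro exI[of _ "1 / real (Suc n)"] conjI allI impI)
   fix y assume y: "dist y x < 1 / real (Suc n)"
   have "?B n \<subseteq> ball y r"
   proof
    fix z assume "z \<in> ?B n"
    then have "dist x z < r - 1 / real (Suc n)" by simp
    then show "z \<in> ball y r" using y dist_triangle[of y z x] by simp
   qed
   then have "emeasure M (?B n) \<le> emeasure M (ball y r)" using M by (intro emeasure_mono) auto
   then show "y \<in> {x. a < emeasure M (ball x r)}" using n by simp
  qed simp
 qed
 then show "{x \<in> space borel. a < emeasure M (ball x r)} \<in> sets borel" by simp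
qed

section \<open>Doubling: comparison of balls, integrals over balls and a covering lemma\<close>

locale doubling_measure = metric_measure_space +
 assumes doubling: "doubling \<mu>"
begin

definition m :: "'a \<Rightarrow> real \<Rightarrow> real" where
 "m x r = measure \<mu> (ball x r)"

lemma emeasure_ball: "0 < r \<Longrightarrow> emeasure \<mu> (ball x r) = ennreal (m x r)"
 unfolding m_def using ball_finite[of r x] by (intro emeasure_eq_ennreal_measure) auto

lemma m_pos: "0 < r \<Longrightarrow> 0 < m x r" using ball_pos[of r x] by (simp add: emeasure_ball)

lemma m_mono: "0 < r \<Longrightarrow> ball x r \<subseteq> ball y s \<Longrightarrow> m x r \<le> m y s"
proof -
 assume r: "0 < r" and sub: "ball x r \<subseteq> ball y s"
 have "x \<in> ball x r" using r by simp
 then have s: "0 < s" using sub by (metis ball_eq_empty empty_iff not_le subsetD)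
 have "emeasure \<mu> (ball x r) \<le> emeasure \<mu> (ball y s)" using sub by (intro emeasure_mono sets_mu_borel) auto
 then show ?thesis using r s m_pos[of s y] by (simp add: emeasure_ball)
qed

lemma ball_subset_ball: "dist x y + r \<le> s \<Longrightarrow> ball x r \<subseteq> ball (y::'a) s"
proof
 fix z assume "dist x y + r \<le> s" "z \<in> ball x r"
 then show "z \<in> ball y s" using dist_triangle[of y z x] by (simp add: dist_commute)
qed

lemma ex_comparison:
 "\<exists>C\<ge>1. \<forall>x y r s. 0 < s \<longrightarrow> 0 < r \<longrightarrow> r \<le> L * s \<longrightarrow> dist x y \<le> L * s \<longrightarrow> m x r \<le> C * m y s"
proof -
 obtain C0 :: real where C0: "\<And>x r. 0 < r \<Longrightarrow> emeasure \<mu> (ball x (2 * r)) \<le> ennreal C0 * emeasure \<mu> (ball x r)"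
  using doubling unfolding doubling_def by blast
 define C where "C = max C0 1"
 have C: "m x (2 * r) \<le> C * m x r" "1 \<le> C" if "0 < r" for x r
 proof -
  have "ennreal (m x (2 * r)) \<le> ennreal C0 * ennreal (m x r)"
   using C0[OF that, of x] that by (simp add: emeasure_ball)
  also have "\<dots> \<le> ennreal C * ennreal (m x r)" by (intro mult_right_mono) (auto simp: C_def ennreal_leI)
  also have "\<dots> = ennreal (C * m x r)" using m_pos[OF that, of x] by (simp add: ennreal_mult C_def)
  finally show "m x (2 * r) \<le> C * m x r" using m_pos[OF that, of x] by (subst (asm) ennreal_le_iff) (auto simp: C_def)
 qed (simp add: C_def)
 have pow: "m x (2 ^ k * r) \<le> C ^ k * m x r" if "0 < r" for x r k
 proof (induction k)
  case (Suc k)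
  have "m x (2 * (2 ^ k * r)) \<le> C * m x (2 ^ k * r)" using that by (intro C) simp
  also have "\<dots> \<le> C * (C ^ k * m x r)" using Suc C(2)[of 1] by (intro mult_left_mono) auto
  finally show ?case by (simp add: mult.assoc)
 qed simp
 obtain k :: nat where k: "2 * L \<le> 2 ^ k" using real_arch_pow[of 2 "2 * L"] by (auto intro: less_imp_le)
 show ?thesis
 proof (intro exI[of _ "C ^ k"] conjI allI impI)
  show "1 \<le> C ^ k" using C(2)[of 1] by (simp add: one_le_power)
  fix x y :: 'a and r s assume rs: "0 < s" "0 < r" "r \<le> L * s" "dist x y \<le> L * s"
  have "(2 * L) * s \<le> 2 ^ k * s" using k rs(1) by (intro mult_right_mono) auto
  then have "dist x y + r \<le> 2 ^ k * s" using rs by linarith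
  then have "m x r \<le> m y (2 ^ k * s)" using rs(2) by (intro m_mono ball_subset_ball)
  also have "\<dots> \<le> C ^ k * m y s" by (rule pow[OF rs(1)])
  finally show "m x r \<le> C ^ k * m y s" .
 qed
qed

text \<open>One comparison constant for each ratio \<open>L\<close>, covering a change of centre and
  of radius at once; all doubling estimates below are stated through it.\<close>

definition D :: "real \<Rightarrow> real" where
 "D L = (SOME C. 1 \<le> C \<and> (\<forall>x y r s. 0 < s \<longrightarrow> 0 < r \<longrightarrow> r \<le> L * s \<longrightarrow> dist x y \<le> L * s \<longrightarrow> m x r \<le> C * m y s))"

lemma D_ge_1: "1 \<le> D L" and m_compare: "0 < s \<Longrightarrow> 0 < r \<Longrightarrow> r \<le> L * s \<Longrightarrow> dist x y \<le> L * s \<Longrightarrow> m x r \<le> D L * m y s"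
 using someI_ex[OF ex_comparison[of L]] unfolding D_def[symmetric] by blast+

lemma D_pos: "0 < D L" using D_ge_1[of L] by linarith

lemma m_borel [measurable]: "borel_fun (\<lambda>x. m x r)"
proof -
 have "m x r = enn2real (emeasure N (ball x r))" for x unfolding m_def measure_def by (simp add: emeasure_N)
 then show ?thesis using emeasure_ball_borel[OF sets_N, of r] by simp
qed

definition nu :: "('a \<Rightarrow> ennreal) \<Rightarrow> 'a \<Rightarrow> real \<Rightarrow> real" where
 "nu F x r = enn2real (muint_on (ball x r) F)"

definition L1 :: "('a \<Rightarrow> ennreal) \<Rightarrow> bool" where
 "L1 F \<longleftrightarrow> F \<in> borel_measurable borel \<and> muint F < \<infinity>"

lemma L1_ball: "L1 F \<Longrightarrow> muint_on (ball x r) F = ennreal (nu F x r)"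
proof -
 assume "L1 F"
 moreover have "muint_on (ball x r) F \<le> muint F" by (intro nn_integral_mono) (auto simp: indicator_def)
 ultimately have "muint_on (ball x r) F < top" unfolding L1_def by (auto intro: order_le_less_trans)
 then show ?thesis by (simp add: nu_def)
qed

lemma nu_nonneg: "0 \<le> nu F x r" by (simp add: nu_def)

lemma nu_mono: "L1 F \<Longrightarrow> ball x r \<subseteq> ball y s \<Longrightarrow> nu F x r \<le> nu F y s"
proof -
 assume F: "L1 F" and sub: "ball x r \<subseteq> ball y s"
 have "muint_on (ball x r) F \<le> muint_on (ball y s) F"
  using sub by (intro nn_integral_mono) (auto simp: indicator_def)
 then show ?thesis using nu_nonneg[of F] by (simp add: L1_ball[OF F])
qed

lemma emeasure_density_ball:
 assumes "borel_fun F" "A \<in> sets borel"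
 shows "emeasure (density N F) A = muint_on A F"
 using assms by (subst emeasure_density) (auto simp: measurable_N sets_N nn_integral_N)

lemma nu_borel: "borel_fun F \<Longrightarrow> borel_fun (\<lambda>x. nu F x r)"
 using emeasure_ball_borel[of "density N F" r] unfolding nu_def by (simp add: sets_N emeasure_density_ball)

text \<open>The set is written as a countable union of products of balls, which lie in the product
  sigma-algebra by construction.\<close>

lemma ball_relation_measurable: "{z :: 'a \<times> 'a. dist (fst z) (snd z) < r} \<in> sets (N \<Otimes>\<^sub>M N)"
proof -
 obtain Q :: "'a set" where Q: "countable Q" "\<And>x r. 0 < r \<Longrightarrow> \<exists>d\<in>Q. dist x d < r" by (rule separable) blast
 have "{z :: 'a \<times> 'a. dist (fst z) (snd z) < r} = (\<Union>(q, s)\<in>Q \<times> (UNIV :: rat set). ball q (real_of_rat s) \<times> ball q (r - real_of_rat s))"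
 proof safe
  fix x y :: 'a assume "dist (fst (x, y)) (snd (x, y)) < r"
  then have "dist x y < r" by simp
  then have e: "0 < (r - dist x y) / 3" by simp
  from Q(2)[OF e, of x] obtain q where q: "q \<in> Q" "dist x q < (r - dist x y) / 3" by blast
  \<comment> \<open>With \<open>q\<close> closer to \<open>x\<close> than a third of the gap
    \<open>r - dist x y\<close>, a radius between one and two thirds of the gap leaves room for both
    memberships.\<close>
  obtain s where s: "(r - dist x y) / 3 < real_of_rat s" "real_of_rat s < 2 * (r - dist x y) / 3"
   using of_rat_dense[of "(r - dist x y) / 3" "2 * (r - dist x y) / 3"] e by auto
  have "dist q y \<le> dist x q + dist x y" by (metis dist_commute dist_triangle)
  then have "(x, y) \<in> ball q (real_of_rat s) \<times> ball q (r - real_of_rat s)" using q s by (auto simp: dist_commute)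
  then show "(x, y) \<in> (\<Union>(q, s)\<in>Q \<times> (UNIV :: rat set). ball q (real_of_rat s) \<times> ball q (r - real_of_rat s))"
   using q by (intro UN_I[of "(q, s)"]) auto
 next
  fix x y q :: 'a and s assume "x \<in> ball q (real_of_rat s)" "y \<in> ball q (r - real_of_rat s)"
  then show "dist (fst (x, y)) (snd (x, y)) < r" using dist_triangle3[of x y q] by (auto simp: dist_commute)
 qed
 also have "\<dots> \<in> sets (N \<Otimes>\<^sub>M N)" using Q(1) by (intro sets.countable_UN') (auto simp: sets_N intro!: pair_measureI)
 finally show ?thesis .
qed

text \<open>Both sides integrate \<open>G x * F y\<close> over the symmetric relation
  \<open>dist x y < r\<close>.\<close>

lemma Tonelli_balls:
 assumes F: "borel_fun F" and G: "borel_fun G"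
 shows "muint (\<lambda>x. G x * muint_on (ball x r) F) = muint (\<lambda>y. F y * muint_on (ball y r) G)"
proof -
 interpret N: sigma_finite_measure N by (rule sigma_finite_N)
 interpret NN: pair_sigma_finite N N ..
 note [measurable] = F[folded measurable_N] G[folded measurable_N] ball_relation_measurable
 let ?h = "\<lambda>x y. G x * F y * indicator {z. dist (fst z) (snd z) < r} (x, y)"
 have b[measurable]: "ball x r \<in> sets N" for x :: 'a by (simp add: sets_N)
 have "(\<integral>\<^sup>+y. (\<integral>\<^sup>+x. ?h x y \<partial>N) \<partial>N) = (\<integral>\<^sup>+x. (\<integral>\<^sup>+y. ?h x y \<partial>N) \<partial>N)" by (rule NN.Fubini') measurable
 moreover have "(\<integral>\<^sup>+y. ?h x y \<partial>N) = G x * (\<integral>\<^sup>+y\<in>ball x r. F y \<partial>N)" for x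
 proof -
  have "(\<integral>\<^sup>+y. ?h x y \<partial>N) = (\<integral>\<^sup>+y. G x * (F y * indicator (ball x r) y) \<partial>N)"
   by (intro nn_integral_cong) (auto simp: indicator_def)
  then show ?thesis by (simp add: nn_integral_cmult)
 qed
 moreover have "(\<integral>\<^sup>+x. ?h x y \<partial>N) = F y * (\<integral>\<^sup>+x\<in>ball y r. G x \<partial>N)" for y
 proof -
  have "(\<integral>\<^sup>+x. ?h x y \<partial>N) = (\<integral>\<^sup>+x. F y * (G x * indicator (ball y r) x) \<partial>N)"
   by (intro nn_integral_cong) (auto simp: indicator_def dist_commute mult.commute)
  then show ?thesis by (simp add: nn_integral_cmult)
 qed
 ultimately show ?thesis by (simp add: nn_integral_N)
qed

text \<open>Greedy selection: the chosen balls are, up to a factor 2, maximal among those they meet.\<close>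

lemma vitali:
 fixes S :: "'a set" and r :: "'a \<Rightarrow> real"
 assumes r: "\<And>x. x \<in> S \<Longrightarrow> 0 < r x" "\<And>x. x \<in> S \<Longrightarrow> r x \<le> R"
 obtains T where "T \<subseteq> S" "countable T" "\<And>x y. x \<in> T \<Longrightarrow> y \<in> T \<Longrightarrow> x \<noteq> y \<Longrightarrow> ball x (r x) \<inter> ball y (r y) = {}"
  "S \<subseteq> (\<Union>x\<in>T. ball x (3 * r x))"
proof -
 let ?o = "\<lambda>x y. ball x (r x) \<inter> ball y (r y) = {}"
 let ?disj = "\<lambda>T. \<forall>x\<in>T. \<forall>y\<in>T. x \<noteq> y \<longrightarrow> ?o x y"
 let ?meet = "\<lambda>x T. \<exists>y\<in>T. \<not> ?o x y"
 \<comment> \<open>The last clause is the invariant of the greedy choice: a ball that meets the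
   family meets a member of at least half its radius. It survives unions of chains, so Zorn's lemma
   applies.\<close>
 define good where "good T \<longleftrightarrow> T \<subseteq> S \<and> ?disj T \<and>
  (\<forall>x\<in>S. ?meet x T \<longrightarrow> (\<exists>y\<in>T. \<not> ?o x y \<and> r x \<le> 2 * r y))" for T
 have goodD: "T \<subseteq> S" "\<And>x y. x \<in> T \<Longrightarrow> y \<in> T \<Longrightarrow> x \<noteq> y \<Longrightarrow> ?o x y"
  "\<And>x. x \<in> S \<Longrightarrow> ?meet x T \<Longrightarrow> \<exists>y\<in>T. \<not> ?o x y \<and> r x \<le> 2 * r y" if "good T" for T using that unfolding good_def by blast+
 have "\<exists>M\<in>Collect good. \<forall>X\<in>Collect good. M \<subseteq> X \<longrightarrow> X = M"
 proof (rule subset_Zorn)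
  fix C assume C: "subset.chain (Collect good) C"
  have CG: "good X" if "X \<in> C" for X using C that unfolding subset_chain_def by blast
  have "good (\<Union>C)" unfolding good_def
  proof (intro conjI ballI impI)
   show "\<Union>C \<subseteq> S" using goodD(1)[OF CG] by blast
  next
   fix x y assume *: "x \<in> \<Union>C" "y \<in> \<Union>C" "x \<noteq> y"
   then obtain X Y where XY: "X \<in> C" "Y \<in> C" "x \<in> X" "y \<in> Y" by blast
   then have "X \<subseteq> Y \<or> Y \<subseteq> X" using C unfolding subset_chain_def by blast
   then obtain Z where "Z \<in> C" "x \<in> Z" "y \<in> Z" using XY by blast
   then show "?o x y" using goodD(2)[OF CG] *(3) by blast
  next
   fix x assume "x \<in> S" "?meet x (\<Union>C)"
   then obtain X where "X \<in> C" "?meet x X" by blast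
   then obtain y where "y \<in> X" "\<not> ?o x y \<and> r x \<le> 2 * r y" using goodD(3)[OF CG] \<open>x \<in> S\<close> by blast
   then show "\<exists>y\<in>\<Union>C. \<not> ?o x y \<and> r x \<le> 2 * r y" using \<open>X \<in> C\<close> by blast
  qed
  then show "\<exists>U\<in>Collect good. \<forall>X\<in>C. X \<subseteq> U" by (intro bexI[of _ "\<Union>C"]) auto
 qed
 then obtain T where "T \<in> Collect good" and max: "\<forall>X\<in>Collect good. T \<subseteq> X \<longrightarrow> X = T" by (rule bexE)
 then have gT: "good T" by simp
 have all: "?meet x T" if x: "x \<in> S" for x
 proof (rule ccontr)
  assume nx: "\<not> ?meet x T"
  let ?F = "{x \<in> S. \<not> ?meet x T}"
  have ne: "r ` ?F \<noteq> {}" and bd: "bdd_above (r ` ?F)" using x nx r(2) by (auto intro!: bdd_aboveI[of _ R])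
  have "0 < Sup (r ` ?F)" using r(1)[OF x] cSup_upper[OF _ bd, of "r x"] x nx by fastforce
  then have "Sup (r ` ?F) / 2 < Sup (r ` ?F)" by simp
  then obtain q where "q \<in> r ` ?F" "Sup (r ` ?F) / 2 < q" using less_cSup_iff[OF ne bd] by blast
  \<comment> \<open>A ball missing the family, with radius above half the supremum of all such
    radii, can be added without breaking the invariant. By maximality no ball misses the
    family.\<close>
  then obtain z where z: "z \<in> ?F" "Sup (r ` ?F) / 2 < r z" by blast
  have zs: "z \<in> S" "\<not> ?meet z T" using z(1) by auto
  have zz: "z \<in> ball z (r z)" using r(1)[OF zs(1)] by simp
  have "good (insert z T)" unfolding good_def
  proof (intro conjI ballI impI)
   show "insert z T \<subseteq> S" using zs goodD(1)[OF gT] by blast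
  next
   fix a b assume ab: "a \<in> insert z T" "b \<in> insert z T" "a \<noteq> b"
   have zT: "?o z y" if "y \<in> T" for y using zs(2) that by blast
   show "?o a b" using ab zT goodD(2)[OF gT] by (metis Int_commute insertE)
  next
   fix a assume a: "a \<in> S" "?meet a (insert z T)"
   show "\<exists>y\<in>insert z T. \<not> ?o a y \<and> r a \<le> 2 * r y"
   proof (cases "?meet a T")
    case True then show ?thesis using goodD(3)[OF gT a(1)] by blast
   next
    case False
    then have m: "\<not> ?o a z" using a(2) by blast
    have "r a \<le> Sup (r ` ?F)" using False a(1) by (intro cSup_upper bd) auto
    then have "r a \<le> 2 * r z" using z(2) by linarith
    then show ?thesis using m by blast
   qed
  qed
  then have "insert z T = T" by (intro max[rule_format]) auto
  then have "z \<in> T" by blast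
  then show False using zs(2) zz by blast
 qed
 show ?thesis
 proof (rule that[OF goodD(1)[OF gT]])
  show "countable T"
  proof -
   obtain D :: "'a set" where D: "countable D" "\<And>x r. 0 < r \<Longrightarrow> \<exists>d\<in>D. dist x d < r" by (rule separable) blast
   have "\<forall>x. \<exists>d. x \<in> T \<longrightarrow> d \<in> D \<and> d \<in> ball x (r x)" using D(2)[OF r(1)] goodD(1)[OF gT] by (metis mem_ball subsetD)
   from choice[OF this] obtain d where d: "\<forall>x. x \<in> T \<longrightarrow> d x \<in> D \<and> d x \<in> ball x (r x)" by (rule exE)
   have "inj_on d T"
   proof (rule inj_onI, rule ccontr)
    fix x y assume xy: "x \<in> T" "y \<in> T" "d x = d y" "x \<noteq> y"
    then have "d x \<in> ball x (r x)" "d x \<in> ball y (r y)" using d[rule_format, of x] d[rule_format, of y] by simp_all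
    then show False using goodD(2)[OF gT xy(1,2,4)] by blast
   qed
   moreover have "countable (d ` T)" using d by (intro countable_subset[OF _ D(1)]) blast
   ultimately show ?thesis by (rule countable_image_inj_on[rotated])
  qed
 show "?o x y" if "x \<in> T" "y \<in> T" "x \<noteq> y" for x y using goodD(2)[OF gT] that by blast
  show "S \<subseteq> (\<Union>x\<in>T. ball x (3 * r x))"
  proof
   fix x assume x: "x \<in> S"
   obtain y where y: "y \<in> T" "\<not> ?o x y" "r x \<le> 2 * r y" using goodD(3)[OF gT x all[OF x]] by blast
   then obtain z where "dist x z < r x" "dist y z < r y" by auto
   then have "dist y x < 3 * r y" using y(3) dist_triangle2[of y x z] by linarith
   then show "x \<in> (\<Union>x\<in>T. ball x (3 * r x))" using y(1) by auto
  qed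
 qed
qed

end

section \<open>Convergence of ball averages in L^1\<close>

definition ndist :: "ennreal \<Rightarrow> ennreal \<Rightarrow> ennreal" where
 "ndist a b = (a - b) + (b - a)"

lemma ndist_measurable [measurable (raw)]:
 assumes [measurable]: "f \<in> borel_measurable M" "g \<in> borel_measurable M"
 shows "(\<lambda>x. ndist (f x) (g x)) \<in> borel_measurable M" unfolding ndist_def by measurable

lemma le_add_ennreal_diff: "(a::ennreal) \<le> b + (a - b)" using ennreal_minus_le_iff[of a b "a - b"] by simp

lemma le_add_ndist: "a \<le> b + ndist a b"
 unfolding ndist_def using le_add_ennreal_diff[of a b] by (meson add_left_mono add_increasing2 order_trans order_refl zero_le)

lemma ndist_real: "0 \<le> x \<Longrightarrow> 0 \<le> y \<Longrightarrow> ndist (ennreal x) (ennreal y) = ennreal \<bar>x - y\<bar>"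
 unfolding ndist_def by (cases "x \<le> y") (auto simp: ennreal_minus ennreal_neg simp flip: ennreal_plus)

lemma ndist_add_le: "ndist (a + b) (c + d) \<le> ndist a c + (b + d)"
proof -
 have *: "(a + b) - (c + d) \<le> (a - c) + b" for a b c d :: ennreal
 proof -
  have "a + b \<le> (c + (a - c)) + b" by (intro add_right_mono le_add_ennreal_diff)
  also have "\<dots> \<le> (c + d) + ((a - c) + b)" by (simp add: ac_simps add_increasing)
  finally show ?thesis by (simp add: ennreal_minus_le_iff)
 qed
 have "ndist (a + b) (c + d) \<le> ((a - c) + b) + ((c - a) + d)" unfolding ndist_def by (intro add_mono *)
 then show ?thesis by (simp add: ndist_def ac_simps)
qed

lemma ndist_add_le2: "ndist (a + b) (c + d) \<le> ndist a c + ndist b d"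
proof -
 have *: "(a + b) - (c + d) \<le> (a - c) + (b - d)" for a b c d :: ennreal
 proof -
  have "a + b \<le> (c + (a - c)) + (d + (b - d))" by (intro add_mono le_add_ennreal_diff)
  then show ?thesis by (simp add: ennreal_minus_le_iff ac_simps)
 qed
 have "ndist (a + b) (c + d) \<le> ((a - c) + (b - d)) + ((c - a) + (d - b))" unfolding ndist_def by (intro add_mono *)
 then show ?thesis by (simp add: ndist_def ac_simps)
qed

lemma ndist_le_add: "ndist a c \<le> ndist (a + b) (c + d) + (b + d)"
proof -
 let ?x = "(a + b) - (c + d)" and ?y = "(c + d) - (a + b)"
 have "a \<le> a + b" "c \<le> c + d" by (simp_all add: add_increasing2)
 then have "a \<le> (c + d) + ?x" "c \<le> (a + b) + ?y" using le_add_ennreal_diff order_trans by blast+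
 then have "a - c \<le> d + ?x" "c - a \<le> b + ?y" by (simp_all add: ennreal_minus_le_iff ac_simps)
 then have "ndist a c \<le> (d + ?x) + (b + ?y)" unfolding ndist_def by (rule add_mono)
 then show ?thesis by (simp add: ndist_def ac_simps)
qed

lemma ndist_mult_le: "k < top \<Longrightarrow> ndist (k * a) (k * b) \<le> k * ndist a b"
proof -
 assume k: "k < top"
 have *: "k * a - k * b \<le> k * (a - b)" for a b
 proof -
  have "k * a \<le> k * (b + (a - b))" by (intro mult_left_mono le_add_ennreal_diff) simp
  then show ?thesis using k by (auto simp: ennreal_minus_le_iff distrib_left ennreal_mult_eq_top_iff)
 qed
 show ?thesis unfolding ndist_def distrib_left by (intro add_mono *)
qed

context doubling_measure
begin

definition av :: "('a \<Rightarrow> ennreal) \<Rightarrow> real \<Rightarrow> 'a \<Rightarrow> ennreal" where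
 "av F r x = muint_on (ball x r) F / ennreal (m x r)"

lemma av_borel: "borel_fun F \<Longrightarrow> borel_fun (av F r)"
 using emeasure_ball_borel[of "density N F" r] unfolding av_def[abs_def] by (simp add: sets_N emeasure_density_ball)

lemma av_L1: "L1 F \<Longrightarrow> 0 < r \<Longrightarrow> av F r x = ennreal (nu F x r / m x r)"
 unfolding av_def by (simp add: L1_ball divide_ennreal nu_nonneg m_pos)

text \<open>Interchanging the integrals moves the averaging from \<open>F\<close> to
  \<open>G\<close>. Replacing \<open>m x r\<close> by \<open>m y r\<close> costs \<open>D 1\<close>,
  and on the ball around \<open>y\<close> the weight is at most \<open>S y\<close>.\<close>

lemma av_weight:
 assumes F: "borel_fun F" and G: "borel_fun G" and r: "0 < r"
  and S: "\<And>x y. dist y x < r \<Longrightarrow> G x \<le> S y"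
 shows "muint (\<lambda>x. G x * av F r x) \<le> muint (\<lambda>y. F y * (ennreal (D 1) * S y))"
proof -
 let ?G = "\<lambda>x. G x * ennreal (1 / m x r)"
 have Gm: "?G \<in> borel_measurable borel" using G by measurable
 have "G x * av F r x = ?G x * muint_on (ball x r) F" for x using m_pos[OF r, of x]
  by (simp add: av_def divide_ennreal_def inverse_ennreal inverse_eq_divide ac_simps)
 then have "muint (\<lambda>x. G x * av F r x) = muint (\<lambda>y. F y * muint_on (ball y r) ?G)"
  by (simp add: Tonelli_balls[OF F Gm])
 also have "\<dots> \<le> muint (\<lambda>y. F y * (ennreal (D 1) * S y))"
 proof (intro nn_integral_mono mult_left_mono)
  fix y
  have "muint_on (ball y r) ?G \<le> muint_on (ball y r) (\<lambda>x. S y * ennreal (D 1 / m y r))"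
  proof (intro nn_integral_mono)
   fix x
   have "G x * ennreal (1 / m x r) \<le> S y * ennreal (D 1 / m y r)" if "dist y x < r"
   proof (intro mult_mono S that ennreal_leI)
    have "m y r \<le> D 1 * m x r" using r that by (intro m_compare) auto
    then show "1 / m x r \<le> D 1 / m y r" using m_pos[OF r] by (simp add: field_simps)
   qed auto
   then show "?G x * indicator (ball y r) x \<le> S y * ennreal (D 1 / m y r) * indicator (ball y r) x"
    by (auto simp: indicator_def)
  qed
  also have "\<dots> = S y * ennreal (D 1 / m y r) * ennreal (m y r)"
   using r by (subst nn_integral_cmult_indicator) (auto simp: emeasure_ball sets_mu_borel)
  also have "\<dots> = S y * (ennreal (D 1 / m y r) * ennreal (m y r))" by (rule mult.assoc)
  also have "ennreal (D 1 / m y r) * ennreal (m y r) = ennreal (D 1)"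
   using m_pos[OF r, of y] D_pos[of 1] by (simp add: ennreal_mult[symmetric])
  also have "S y * ennreal (D 1) = ennreal (D 1) * S y" by (rule mult.commute)
  finally show "muint_on (ball y r) ?G \<le> ennreal (D 1) * S y" .
 qed simp
 finally show ?thesis .
qed

lemma av_integral_le:
 assumes F: "borel_fun F" and r: "0 < r"
 shows "muint (\<lambda>x. av F r x) \<le> ennreal (D 1) * muint F"
proof -
 have "muint (\<lambda>x. 1 * av F r x) \<le> muint (\<lambda>y. F y * (ennreal (D 1) * 1))" by (rule av_weight[OF F _ r]) auto
 also have "\<dots> = ennreal (D 1) * muint F"
  using F by (subst mult.commute) (simp add: nn_integral_cmult measurable_mu_borel)
 finally show ?thesis by simp
qed

lemma av_add:
 assumes "borel_fun F" "borel_fun G"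
 shows "av (\<lambda>x. F x + G x) r x = av F r x + av G r x"
proof -
 have [measurable]: "F \<in> borel_measurable \<mu>" "G \<in> borel_measurable \<mu>" "ball x r \<in> sets \<mu>"
  using assms by (auto simp: measurable_mu_borel sets_mu_borel)
 show ?thesis unfolding av_def by (simp add: distrib_right nn_integral_add divide_ennreal_def)
qed

lemma av_cmult:
 assumes "borel_fun F"
 shows "av (\<lambda>x. k * F x) r x = k * av F r x"
proof -
 have [measurable]: "F \<in> borel_measurable \<mu>" "ball x r \<in> sets \<mu>"
  using assms by (auto simp: measurable_mu_borel sets_mu_borel)
 show ?thesis unfolding av_def by (simp add: mult.assoc nn_integral_cmult divide_ennreal_def)
qed

definition av_dist :: "('a \<Rightarrow> ennreal) \<Rightarrow> real \<Rightarrow> ennreal" where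
 "av_dist F r = muint (\<lambda>x. ndist (av F r x) (F x))"

lemma av_dist_add:
 assumes m: "borel_fun F" "borel_fun R" and r: "0 < r"
 shows "av_dist (\<lambda>x. F x + R x) r \<le> av_dist F r + ennreal (D 1 + 1) * muint R"
  and "av_dist F r \<le> av_dist (\<lambda>x. F x + R x) r + ennreal (D 1 + 1) * muint R"
  and "av_dist (\<lambda>x. F x + R x) r \<le> av_dist F r + av_dist R r"
proof -
 note [measurable] = m av_borel[OF m(1), of r] av_borel[OF m(2), of r]
 have [measurable]: "F \<in> borel_measurable \<mu>" "R \<in> borel_measurable \<mu>" "av F r \<in> borel_measurable \<mu>" "av R r \<in> borel_measurable \<mu>"
  by (intro measurable_mu_borel av_borel m)+
 let ?S = "\<lambda>x. F x + R x"
 have "muint (\<lambda>x. av R r x) + muint R \<le> ennreal (D 1) * muint R + muint R"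
  by (intro add_right_mono av_integral_le m r)
 also have "\<dots> = ennreal (D 1 + 1) * muint R" using D_pos[of 1] by (simp add: distrib_right)
 finally have R: "muint (\<lambda>x. av R r x) + muint R \<le> ennreal (D 1 + 1) * muint R" .
 have "av_dist ?S r \<le> muint (\<lambda>x. ndist (av F r x) (F x) + (av R r x + R x))"
  unfolding av_dist_def av_add[OF m] by (intro nn_integral_mono ndist_add_le)
 also have "\<dots> = av_dist F r + ((muint (\<lambda>x. av R r x)) + muint R)" by (simp add: nn_integral_add av_dist_def)
 finally show "av_dist ?S r \<le> av_dist F r + ennreal (D 1 + 1) * muint R" using R by (meson add_left_mono order_trans)
 have "av_dist F r \<le> muint (\<lambda>x. ndist (av ?S r x) (?S x) + (av R r x + R x))"
  unfolding av_dist_def av_add[OF m] by (intro nn_integral_mono ndist_le_add)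
 also have "\<dots> = av_dist ?S r + ((muint (\<lambda>x. av R r x)) + muint R)"
  unfolding av_dist_def av_add[OF m] by (simp add: nn_integral_add)
 finally show "av_dist F r \<le> av_dist ?S r + ennreal (D 1 + 1) * muint R" using R by (meson add_left_mono order_trans)
 have "av_dist ?S r \<le> muint (\<lambda>x. ndist (av F r x) (F x) + ndist (av R r x) (R x))"
  unfolding av_dist_def av_add[OF m] by (intro nn_integral_mono ndist_add_le2)
 also have "\<dots> = av_dist F r + av_dist R r" by (simp add: nn_integral_add av_dist_def)
 finally show "av_dist ?S r \<le> av_dist F r + av_dist R r" .
qed

text \<open>The average is 1 at points whose ball lies in \<open>U\<close>. The remaining error
  comes from points of \<open>U\<close> near the boundary, which shrink to the empty set, and from
  points outside \<open>U\<close>, whose averages are charged to the same points of \<open>U\<close>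
  by \<open>av_weight\<close>.\<close>

lemma av_dist_open:
 assumes U: "open U" "emeasure \<mu> U < \<infinity>" and r: "\<And>j. 0 < r j" "r \<longlonglongrightarrow> 0"
 shows "(\<lambda>j. av_dist (indicator U) (r j)) \<longlonglongrightarrow> 0"
proof -
 define S where "S j y = (if ball y (r j) \<subseteq> U then 0 else 1 :: ennreal)" for j y
 have Sm: "borel_fun (S j)" for j
 proof -
  have "{y. \<not> ball y (r j) \<subseteq> U} = (\<Union>z\<in>- U. ball z (r j))" by (auto simp: dist_commute)
  then have "open {y. \<not> ball y (r j) \<subseteq> U}" by auto
  then have [measurable]: "{y. \<not> ball y (r j) \<subseteq> U} \<in> sets borel" by simp
  have "S j = indicator {y. \<not> ball y (r j) \<subseteq> U}" by (auto simp: S_def indicator_def)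
  then show ?thesis by simp
 qed
 have [measurable]: "U \<in> sets borel" "U \<in> sets \<mu>" using U(1) by (auto simp: sets_mu_borel)
 have [measurable]: "S j \<in> borel_measurable \<mu>" "av (indicator U) (r j) \<in> borel_measurable borel"
  "av (indicator U) (r j) \<in> borel_measurable \<mu>" for j
  using Sm measurable_mu_borel av_borel[of "indicator U" "r j"] by auto
 have T0: "(\<lambda>j. \<integral>\<^sup>+y. indicator U y * S j y \<partial>\<mu>) \<longlonglongrightarrow> (muint (\<lambda>y. 0))"
 proof (rule nn_integral_dominated_convergence[where w="indicator U"])
  show "AE x in \<mu>. indicator U x * S j x \<le> indicator U x" for j by (auto simp: S_def indicator_def)
  show "muint (\<lambda>x. indicator U x) < \<infinity>" using U(2) by simp
  show "AE x in \<mu>. (\<lambda>j. indicator U x * S j x) \<longlonglongrightarrow> 0"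
  proof (intro always_eventually allI)
   fix x
   show "(\<lambda>j. indicator U x * S j x) \<longlonglongrightarrow> 0"
   proof (cases "x \<in> U")
    case True
    then obtain e where e: "0 < e" "ball x e \<subseteq> U" using U(1) open_contains_ball by blast
    have "eventually (\<lambda>j. r j < e) sequentially" using order_tendstoD(2)[OF r(2) e(1)] .
    then have "eventually (\<lambda>j. indicator U x * S j x = 0) sequentially"
    proof eventually_elim
     fix j assume "r j < e"
     then have "ball x (r j) \<subseteq> U" using e(2) subset_ball[of "r j" e x] by auto
     then show "indicator U x * S j x = 0" by (simp add: S_def)
    qed
    then show ?thesis by (rule tendsto_eventually)
   qed simp
  qed
 qed auto
 have le: "av_dist (indicator U) (r j) \<le> ennreal (1 + D 1) * muint (\<lambda>y. indicator U y * S j y)" for j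
 proof -
  have av1: "av (indicator U) (r j) x \<le> 1" for x
  proof -
   have "muint_on (ball x (r j)) (\<lambda>y. indicator U y) \<le> muint_on (ball x (r j)) (\<lambda>y. 1)"
    by (intro nn_integral_mono) (auto simp: indicator_def)
   also have "\<dots> = ennreal (m x (r j))" using emeasure_ball[OF r(1)] by (simp add: sets_mu_borel)
   finally show ?thesis unfolding av_def using m_pos[OF r(1)] by (intro divide_le_posI_ennreal) auto
  qed
  have av_in: "av (indicator U) (r j) x = 1" if "ball x (r j) \<subseteq> U" for x
  proof -
   have "muint_on (ball x (r j)) (\<lambda>y. indicator U y) = muint_on (ball x (r j)) (\<lambda>y. 1)"
    using that by (intro nn_integral_cong) (auto simp: indicator_def)
   also have "\<dots> = ennreal (m x (r j))" using emeasure_ball[OF r(1)] by (simp add: sets_mu_borel)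
   finally show ?thesis unfolding av_def using m_pos[OF r(1), of x j] by (simp add: ennreal_divide_self)
  qed
  have pt: "ndist (av (indicator U) (r j) x) (indicator U x) \<le>
    indicator U x * S j x + indicator (- U) x * av (indicator U) (r j) x" for x
  proof (cases "x \<in> U")
   case True
   have "av (indicator U) (r j) x - 1 = 0" using av1[of x] by (intro diff_eq_0_ennreal order_le_less_trans[OF av1[of x]]) auto
   then have "ndist (av (indicator U) (r j) x) 1 \<le> 1" by (simp add: ndist_def diff_le_self_ennreal)
   then show ?thesis using True av_in[of x] by (auto simp: S_def ndist_def)
  qed (simp add: ndist_def)
  have "av_dist (indicator U) (r j) \<le> muint (\<lambda>x. indicator U x * S j x + indicator (- U) x * av (indicator U) (r j) x)"
   unfolding av_dist_def by (intro nn_integral_mono pt)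
  also have "\<dots> = muint (\<lambda>x. indicator U x * S j x) + muint (\<lambda>x. indicator (- U) x * av (indicator U) (r j) x)"
   by (intro nn_integral_add) (auto simp: sets_mu_borel)
  also have "muint (\<lambda>x. indicator (- U) x * av (indicator U) (r j) x) \<le>
    (muint (\<lambda>y. indicator U y * (ennreal (D 1) * S j y)))"
   by (rule av_weight[OF _ _ r(1)]) (auto simp: indicator_def S_def)
  also have "\<dots> = ennreal (D 1) * muint (\<lambda>y. indicator U y * S j y)"
   by (subst nn_integral_cmult[symmetric]) (auto simp: ac_simps)
  finally show ?thesis using D_pos[of 1] by (simp add: distrib_right add_left_mono)
 qed
 show ?thesis
 proof (rule tendsto_sandwich[OF _ _ tendsto_const])
  show "(\<lambda>j. ennreal (1 + D 1) * muint (\<lambda>y. indicator U y * S j y)) \<longlonglongrightarrow> 0"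
   using tendsto_mult_ennreal[OF tendsto_const T0, of "ennreal (1 + D 1)"] by simp
 qed (use le in auto)
qed

lemma ennreal_tendsto_0I:
 fixes f :: "nat \<Rightarrow> ennreal"
 assumes "\<And>e. 0 < e \<Longrightarrow> eventually (\<lambda>j. f j \<le> ennreal e) sequentially"
 shows "f \<longlonglongrightarrow> 0"
proof (rule order_tendstoI)
 fix a :: ennreal assume "0 < a"
 then obtain b where b: "0 < b" "b < a" using dense by blast
 then obtain e where e: "b = ennreal e" "0 < e" by (cases b) (auto simp: less_top[symmetric])
 from assms[OF e(2)] show "eventually (\<lambda>j. f j < a) sequentially"
  by eventually_elim (use e b in \<open>auto elim: order_le_less_trans\<close>)
qed simp

lemma ennreal_tendsto_0D:
 fixes f :: "nat \<Rightarrow> ennreal"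
 assumes "f \<longlonglongrightarrow> 0" "0 < e" shows "eventually (\<lambda>j. f j \<le> ennreal e) sequentially"
 using order_tendstoD(2)[OF assms(1), of "ennreal e"] assms(2) by (auto elim!: eventually_mono)

lemma av_dist_perturb:
 assumes "\<And>e. 0 < e \<Longrightarrow> \<exists>g h. g \<longlonglongrightarrow> 0 \<and> (\<forall>j::nat. f j \<le> g j + ennreal (D 1 + 1) * h) \<and> h \<le> ennreal e"
 shows "f \<longlonglongrightarrow> 0"
proof (rule ennreal_tendsto_0I)
 fix e :: real assume e: "0 < e"
 have "0 < e / 2 / (D 1 + 1)" using e D_pos[of 1] by simp
 from assms[OF this] obtain g h where g: "g \<longlonglongrightarrow> 0" "\<And>j. f j \<le> g j + ennreal (D 1 + 1) * h" "h \<le> ennreal (e / 2 / (D 1 + 1))"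
  by blast
 have "ennreal (D 1 + 1) * h \<le> ennreal (D 1 + 1) * ennreal (e / 2 / (D 1 + 1))" by (intro mult_left_mono g(3)) simp
 also have "\<dots> = ennreal (e / 2)"   proof -
  have "D 1 + 1 \<noteq> 0" using D_pos[of 1] by linarith
  then have "(D 1 + 1) * (e / 2 / (D 1 + 1)) = e / 2" by (metis nonzero_mult_div_cancel_left times_divide_eq_right)
  then show ?thesis using D_pos[of 1] e by (subst ennreal_mult[symmetric]) auto
 qed
 finally have h: "ennreal (D 1 + 1) * h \<le> ennreal (e / 2)" .
 from ennreal_tendsto_0D[OF g(1), of "e / 2"] e
 have "eventually (\<lambda>j. g j \<le> ennreal (e / 2)) sequentially" by simp
 then show "eventually (\<lambda>j. f j \<le> ennreal e) sequentially"
 proof eventually_elim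
  fix j assume "g j \<le> ennreal (e / 2)"
  then have "f j \<le> ennreal (e / 2) + ennreal (e / 2)" using g(2)[of j] h by (meson add_mono order_trans)
  then show "f j \<le> ennreal e" using e by (simp flip: ennreal_plus)
 qed
qed

text \<open>Indicators of open sets pass to Borel sets by outer regularity and then to
  \<open>L1\<close> functions by linear combinations and monotone limits; averaging is bounded in
  L^1 by \<open>D 1\<close> at every step. Convergence in L^1 suffices below, since fast
  subsequences are extracted from it.\<close>

theorem averages_converge:
 assumes F: "L1 F" and r: "\<And>j. 0 < r j" "r \<longlonglongrightarrow> 0"
 shows "(\<lambda>j. av_dist F (r j)) \<longlonglongrightarrow> 0"
proof -
 have "borel_fun F" using F by (simp add: L1_def)
 then have "muint F < \<infinity> \<longrightarrow> (\<lambda>j. av_dist F (r j)) \<longlonglongrightarrow> 0"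
 proof (induction rule: borel_measurable_induct)
  case (cong f g)
  then have "f = g" by auto
  then show ?case using cong by simp
 next
  case (set A)
  show ?case
  proof
   assume fin: "muint (\<lambda>y. indicator A y) < \<infinity>"
   have A[measurable]: "A \<in> sets borel" "A \<in> sets \<mu>" using set by (auto simp: sets_mu_borel)
   show "(\<lambda>j. av_dist (indicator A) (r j)) \<longlonglongrightarrow> 0"
   proof (rule av_dist_perturb)
    fix e :: real assume e: "0 < e"
    obtain U where U: "open U" "A \<subseteq> U" "emeasure N (U - A) \<le> ennreal e"
    proof (rule outer_open[OF sets_N _ A(1) e, of undefined])
     fix n :: nat
     show "emeasure N (ball undefined n) < \<infinity>"
      using ball_finite[of "real n" undefined] by (cases "n = 0") (auto simp: emeasure_N)
    qed blast
    have [measurable]: "U \<in> sets borel" "U \<in> sets \<mu>" using U(1) by (auto simp: sets_mu_borel)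
    have eUA: "emeasure \<mu> (U - A) \<le> ennreal e" using U(3) by (simp add: emeasure_N)
    have "emeasure \<mu> U = emeasure \<mu> A + emeasure \<mu> (U - A)"
     using U(2) by (subst plus_emeasure) (auto simp: Un_absorb1)
    also have "\<dots> < \<infinity>" using fin eUA by (auto simp: nn_integral_indicator elim: order_le_less_trans)
    finally have finU: "emeasure \<mu> U < \<infinity>" .
    have ind: "(\<lambda>x. indicator A x + indicator (U - A) x :: ennreal) = indicator U"
     using U(2) by (auto simp: indicator_def fun_eq_iff)
    have "av_dist (indicator A) (r j) \<le> av_dist (indicator U) (r j) + ennreal (D 1 + 1) * emeasure \<mu> (U - A)" for j
     using av_dist_add(2)[of "indicator A" "indicator (U - A)" "r j"] r(1)[of j] by (simp add: ind)
    then show "\<exists>g h. g \<longlonglongrightarrow> 0 \<and> (\<forall>j. av_dist (indicator A) (r j) \<le> g j + ennreal (D 1 + 1) * h) \<and> h \<le> ennreal e"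
     using av_dist_open[OF U(1) finU r] eUA by blast
   qed
  qed
 next
  case (mult u c)
  have [measurable]: "borel_fun u" "u \<in> borel_measurable \<mu>" using mult by (auto simp: measurable_mu_borel)
  have [measurable]: "av u (r j) \<in> borel_measurable \<mu>" for j by (intro measurable_mu_borel av_borel) fact
  show ?case
  proof
   assume fin: "muint (\<lambda>y. c * u y) < \<infinity>"
   have le: "av_dist (\<lambda>x. c * u x) (r j) \<le> c * av_dist u (r j)" for j
    unfolding av_dist_def av_cmult[OF \<open>u \<in> borel_measurable borel\<close>]
    by (subst nn_integral_cmult[symmetric]) (auto intro!: nn_integral_mono ndist_mult_le mult.hyps(1))
   show "(\<lambda>j. av_dist (\<lambda>x. c * u x) (r j)) \<longlonglongrightarrow> 0"
   proof (cases "c = 0")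
    case True then show ?thesis using le by simp
   next
    case False
    have "c * muint u < \<infinity>" using fin by (simp add: nn_integral_cmult)
    then have "muint u < \<infinity>" using False by (auto simp: ennreal_mult_less_top)
    then have "(\<lambda>j. av_dist u (r j)) \<longlonglongrightarrow> 0" using mult.IH by blast
    then have c: "(\<lambda>j. c * av_dist u (r j)) \<longlonglongrightarrow> 0"
     using tendsto_mult_ennreal[OF tendsto_const, of _ 0 _ c] mult.hyps(1) by auto
    show ?thesis by (rule tendsto_sandwich[OF _ _ tendsto_const c]) (use le in auto)
   qed
  qed
 next
  case (add u v)
  have [measurable]: "u \<in> borel_measurable \<mu>" "v \<in> borel_measurable \<mu>" using add by (auto simp: measurable_mu_borel)
  show ?case
  proof
   assume "muint (\<lambda>y. v y + u y) < \<infinity>"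
   then have "muint v < \<infinity>" "muint u < \<infinity>" by (auto simp: nn_integral_add)
   then have "(\<lambda>j. av_dist v (r j)) \<longlonglongrightarrow> 0" "(\<lambda>j. av_dist u (r j)) \<longlonglongrightarrow> 0" using add.IH by auto
   from tendsto_add[OF this]
   have c: "(\<lambda>j. av_dist v (r j) + av_dist u (r j)) \<longlonglongrightarrow> 0" by simp
   show "(\<lambda>j. av_dist (\<lambda>x. v x + u x) (r j)) \<longlonglongrightarrow> 0" by (rule tendsto_sandwich[OF _ _ tendsto_const c])
      (use av_dist_add(3)[OF \<open>v \<in> borel_measurable borel\<close> \<open>u \<in> borel_measurable borel\<close> r(1)] in auto)
  qed
 next
  case (seq U)
  have Um[measurable]: "borel_fun (U i)" "U i \<in> borel_measurable \<mu>" for i using seq by (auto simp: measurable_mu_borel)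
  have Wm: "borel_fun (SUP i. U i)" "(SUP i. U i) \<in> borel_measurable \<mu>" using Um by (auto simp: SUP_apply[abs_def])
  show ?case
  proof
   assume fin: "muint (\<lambda>y. (SUP i. U i) y) < \<infinity>"
   have Ule: "U i x \<le> (SUP i. U i) x" for i x unfolding SUP_apply by (rule SUP_upper) simp
   have finU: "muint (\<lambda>y. U i y) < \<infinity>" for i
    using fin by (rule order_le_less_trans[rotated]) (intro nn_integral_mono Ule)
   have sup: "muint (\<lambda>y. (SUP i. U i) y) = (SUP i. \<integral>\<^sup>+y. U i y \<partial>\<mu>)"
    unfolding SUP_apply using seq.hyps by (intro nn_integral_monotone_convergence_SUP) auto
   show "(\<lambda>j. av_dist (SUP i. U i) (r j)) \<longlonglongrightarrow> 0"
   proof (rule av_dist_perturb)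
    fix e :: real assume e: "0 < e"
    obtain i where i: "muint (\<lambda>y. (SUP i. U i) y) \<le> muint (\<lambda>y. U i y) + ennreal e"
    proof -
     have "muint (\<lambda>y. (SUP i. U i) y) \<noteq> \<infinity>" using fin by auto
     from SUP_approx_ennreal[OF e _ sup this] obtain i
      where "muint (\<lambda>y. (SUP i. U i) y) < (muint (\<lambda>y. U i y)) + ennreal e" by blast
     then show ?thesis using that less_imp_le by blast
    qed
    let ?R = "\<lambda>x. (SUP i. U i) x - U i x"
    have Rm: "?R \<in> borel_measurable borel" using Wm(1) Um(1)[of i] by measurable
    have split: "(\<lambda>x. U i x + ?R x) = (SUP i. U i)" using Ule by (auto simp: fun_eq_iff add_diff_inverse_ennreal)
    have "muint ?R = (muint (\<lambda>y. (SUP i. U i) y)) - (muint (\<lambda>y. U i y))"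
     using finU[of i] Ule by (intro nn_integral_diff Wm Um) auto
    also have "\<dots> \<le> ennreal e" using i finU[of i] by (auto simp: ennreal_minus_le_iff)
    finally have R: "muint ?R \<le> ennreal e" .
    have "av_dist (SUP i. U i) (r j) \<le> av_dist (U i) (r j) + ennreal (D 1 + 1) * muint ?R" for j
     using av_dist_add(1)[OF Um(1) Rm r(1), of i j] by (simp only: split)
    then show "\<exists>g h. g \<longlonglongrightarrow> 0 \<and> (\<forall>j. av_dist (SUP i. U i) (r j) \<le> g j + ennreal (D 1 + 1) * h) \<and> h \<le> ennreal e"
     using seq.IH finU R by blast
   qed
  qed
 qed
 then show ?thesis using F by (simp add: L1_def)
qed

end

section \<open>Wolff potentials\<close>

lemma powr_diff_le:
 assumes "0 \<le> y" "y \<le> x" "1 < (p::real)"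
 shows "x powr p - y powr p \<le> p * (x - y) * x powr (p - 1)"
proof (cases "y = 0 \<or> x = y")
 case True
 then show ?thesis
 proof
  assume y: "y = 0"
  have "x powr p = x * x powr (p - 1)" using powr_mult_base[of x "p - 1"] assms by simp
  moreover have "1 * (x * x powr (p - 1)) \<le> p * (x * x powr (p - 1))" using assms by (intro mult_right_mono) auto
  ultimately show ?thesis using y by (simp add: mult.assoc)
 next
  assume "x = y"
  then show ?thesis by simp
 qed
next
 case False
 then have yx: "0 < y" "y < x" using assms by auto
 have "\<exists>z>y. z < x \<and> x powr p - y powr p = (x - y) * (p * z powr (p - 1))"
  using yx by (intro MVT2 has_real_derivative_powr) auto
 then obtain z where z: "y < z" "z < x" "x powr p - y powr p = (x - y) * (p * z powr (p - 1))" by blast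
 have "z powr (p - 1) \<le> x powr (p - 1)" using z yx assms by (intro powr_mono2) auto
 then have "(x - y) * (p * z powr (p - 1)) \<le> (x - y) * (p * x powr (p - 1))"
  using yx assms by (intro mult_left_mono) auto
 then show ?thesis using z(3) by (simp add: ac_simps)
qed

text \<open>Each term of the weighted sum is at most the whole, so \<open>c i\<close> decays at
  least like \<open>\<theta> ^ (i - j)\<close> times the q-th root of that sum, and a geometric
  series remains. The argument is the same for \<open>q\<close> below and above 1.\<close>

lemma powr_sum_le_weighted:
 fixes c :: "nat \<Rightarrow> real"
 assumes c: "\<And>i. 0 \<le> c i" and q: "0 < q"
 defines "\<theta> \<equiv> 2 powr (- 1 / q)"
 shows "(\<Sum>i\<in>{j..<n}. c i) powr q \<le> (1 / (1 - \<theta>)) powr q * (\<Sum>i\<in>{j..<n}. 2 ^ (i - j) * c i powr q)"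
proof -
 define T where "T = (\<Sum>i\<in>{j..<n}. 2 ^ (i - j) * c i powr q)"
 have T: "0 \<le> T" unfolding T_def by (intro sum_nonneg) auto
 have \<theta>: "0 < \<theta>" "\<theta> < 1" using q unfolding \<theta>_def by (auto simp: powr_less_one)
 have ci: "c i \<le> T powr (1 / q) * \<theta> ^ (i - j)" if i: "i \<in> {j..<n}" for i
 proof -
  have "2 ^ (i - j) * c i powr q \<le> T" unfolding T_def by (rule member_le_sum[OF i]) auto
  then have "(2 ^ (i - j) * c i powr q) powr (1 / q) \<le> T powr (1 / q)" using q by (intro powr_mono2) auto
  moreover have "(2 ^ (i - j) * c i powr q) powr (1 / q) = 2 powr (real (i - j) / q) * c i"
   using q c[of i] by (simp add: powr_mult powr_powr powr_realpow[symmetric])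
  moreover have "\<theta> ^ (i - j) * 2 powr (real (i - j) / q) = 1"
   unfolding \<theta>_def by (simp add: powr_realpow[symmetric] powr_powr powr_add[symmetric])
  ultimately have "\<theta> ^ (i - j) * (2 powr (real (i - j) / q) * c i) \<le> \<theta> ^ (i - j) * T powr (1 / q)"
   using \<theta> by (intro mult_left_mono) auto
  moreover have "\<theta> ^ (i - j) * (2 powr (real (i - j) / q) * c i) = c i"
   unfolding mult.assoc[symmetric] \<open>\<theta> ^ (i - j) * 2 powr (real (i - j) / q) = 1\<close> by (rule mult_1)
  ultimately show ?thesis by (simp only: mult.commute)
 qed
 have geo: "(\<Sum>i\<in>{j..<n}. \<theta> ^ (i - j)) \<le> 1 / (1 - \<theta>)"
 proof -
  have "(\<Sum>i\<in>{j..<n}. \<theta> ^ (i - j)) = (\<Sum>k<n - j. \<theta> ^ k)"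
   by (rule sum.reindex_bij_witness[where i="\<lambda>k. k + j" and j="\<lambda>i. i - j"]) auto
  also have "\<dots> \<le> (\<Sum>k. \<theta> ^ k)" using \<theta> by (intro sum_le_suminf summable_geometric) auto
  also have "\<dots> = 1 / (1 - \<theta>)" using \<theta> by (intro suminf_geometric) auto
  finally show ?thesis .
 qed
 have "(\<Sum>i\<in>{j..<n}. c i) \<le> (\<Sum>i\<in>{j..<n}. T powr (1 / q) * \<theta> ^ (i - j))" by (intro sum_mono ci)
 also have "\<dots> = T powr (1 / q) * (\<Sum>i\<in>{j..<n}. \<theta> ^ (i - j))" by (simp add: sum_distrib_left)
 also have "\<dots> \<le> T powr (1 / q) * (1 / (1 - \<theta>))" by (intro mult_left_mono geo) auto
 finally have "(\<Sum>i\<in>{j..<n}. c i) powr q \<le> (T powr (1 / q) * (1 / (1 - \<theta>))) powr q"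
  using q c by (intro powr_mono2 sum_nonneg) auto
 also have "\<dots> = (1 / (1 - \<theta>)) powr q * T"
 proof -
  have "(T powr (1 / q) * (1 / (1 - \<theta>))) powr q = (T powr (1 / q)) powr q * (1 / (1 - \<theta>)) powr q"
   by (rule powr_mult)
  also have "(T powr (1 / q)) powr q = T" using q T by (simp add: powr_powr)
  finally show ?thesis by simp
 qed
 finally show ?thesis unfolding T_def .
qed

text \<open>The factor \<open>p\<close> comes from the mean value theorem in
  \<open>powr_diff_le\<close>, the other one from \<open>powr_sum_le_weighted\<close> with exponent
  \<open>p - 1\<close>.\<close>

definition wolff_const :: "real \<Rightarrow> real" where
 "wolff_const p = p * (1 / (1 - 2 powr (- 1 / (p - 1)))) powr (p - 1)"

lemma wolff_const_nonneg: "1 < p \<Longrightarrow> 0 \<le> wolff_const p" by (simp add: wolff_const_def)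

text \<open>Telescoping over the tail sums, so that only pairs with \<open>j \<le> i\<close> occur.\<close>

lemma powr_sum_le_double_sum:
 fixes c :: "nat \<Rightarrow> real"
 assumes c: "\<And>i. 0 \<le> c i" and p: "1 < p"
 shows "(\<Sum>i<n. c i) powr p \<le> wolff_const p * (\<Sum>j<n. \<Sum>i\<in>{j..<n}. 2 ^ (i - j) * (c j * c i powr (p - 1)))"
proof -
 define S where "S j = (\<Sum>i\<in>{j..<n}. c i)" for j
 have S0: "0 \<le> S j" for j unfolding S_def using c by (intro sum_nonneg) auto
 have Sj: "S j = c j + S (Suc j)" if "j < n" for j unfolding S_def using that by (simp add: sum.atLeast_Suc_lessThan)
 have "(\<Sum>i<n. c i) powr p = S 0 powr p - S n powr p" using p by (simp add: S_def lessThan_atLeast0)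
 also have "\<dots> = (\<Sum>j<n. S j powr p - S (Suc j) powr p)" by (rule sum_lessThan_telescope'[symmetric])
 also have "\<dots> \<le> (\<Sum>j<n. p * c j * S j powr (p - 1))"
 proof (intro sum_mono)
  fix j assume j: "j \<in> {..<n}"
  show "S j powr p - S (Suc j) powr p \<le> p * c j * S j powr (p - 1)"
   using powr_diff_le[of "S (Suc j)" "S j" p] Sj[of j] j c[of j] S0 p by auto
 qed
 also have "\<dots> \<le> (\<Sum>j<n. p * c j * ((1 / (1 - 2 powr (- 1 / (p - 1)))) powr (p - 1) * (\<Sum>i\<in>{j..<n}. 2 ^ (i - j) * c i powr (p - 1))))"
  unfolding S_def using c p by (intro sum_mono mult_left_mono powr_sum_le_weighted) auto
 also have "\<dots> = wolff_const p * (\<Sum>j<n. \<Sum>i\<in>{j..<n}. 2 ^ (i - j) * (c j * c i powr (p - 1)))"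
  unfolding wolff_const_def sum_distrib_left by (intro sum.cong refl) (simp add: ac_simps)
 finally show ?thesis .
qed

text \<open>The ratio \<open>K\<close> of consecutive radii is at least 4 for two reasons: three
  radii of one scale must fit into the preceding radius, and the weights \<open>2 ^ k\<close> of the
  double sum must be beaten by \<open>K\<close> to the power \<open>-k\<close> with a summable
  remainder. The bounded support of \<open>F\<close> serves to bound the summand of the first
  scale.\<close>

locale wolff_potential = doubling_measure +
 fixes F :: "'a \<Rightarrow> ennreal" and K :: real and z :: 'a and R :: real
 assumes F: "L1 F" and supp: "\<And>x. x \<notin> ball z R \<Longrightarrow> F x = 0" and K: "4 \<le> K" and R: "0 < R"
begin

definition rad :: "nat \<Rightarrow> real" where "rad j = (1 / K) ^ j"

definition dens :: "nat \<Rightarrow> 'a \<Rightarrow> real" where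
 "dens j x = rad j powr p * nu F x (rad j) / m x (rad j)"

definition b :: "nat \<Rightarrow> 'a \<Rightarrow> real" where
 "b j x = dens j x powr (1 / (p - 1))"

lemma rad_pos: "0 < rad j" using K by (simp add: rad_def)

lemma rad_Suc: "rad j = K * rad (Suc j)" using K by (simp add: rad_def)

lemma rad_antimono: "i \<le> j \<Longrightarrow> rad j \<le> rad i" using K unfolding rad_def by (intro power_decreasing) auto

lemma rad_tendsto: "rad \<longlonglongrightarrow> 0" unfolding rad_def using K by (intro LIMSEQ_power_zero) auto

lemma dens_nonneg: "0 \<le> dens j x" unfolding dens_def using nu_nonneg m_pos[OF rad_pos] by (simp add: less_imp_le)

lemma b_nonneg: "0 \<le> b j x" by (simp add: b_def)

lemma dens_borel [measurable]: "borel_fun (dens j)"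
 unfolding dens_def[abs_def] using nu_borel[of F "rad j"] F by (auto simp: L1_def)

lemma b_borel [measurable]: "borel_fun (b j)" unfolding b_def[abs_def] by measurable

lemma dens_shift:
 assumes "dist x y \<le> 2 * rad (Suc j)" shows "dens (Suc j) y \<le> D K * dens j x"
proof -
 have r: "0 < rad (Suc j)" "0 < rad j" "rad j = K * rad (Suc j)" by (rule rad_pos rad_Suc)+
 have "2 * rad (Suc j) \<le> K * rad (Suc j)" "3 * rad (Suc j) \<le> K * rad (Suc j)" using K r(1) by auto
 moreover have "dist x y \<le> K * rad (Suc j)" using assms \<open>2 * rad (Suc j) \<le> K * rad (Suc j)\<close> by (rule order_trans)
 ultimately have "m x (rad j) \<le> D K * m y (rad (Suc j))" using r by (intro m_compare) auto
 moreover have "nu F y (rad (Suc j)) \<le> nu F x (rad j)"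
  proof (intro nu_mono[OF F] ball_subset_ball)
  show "dist y x + rad (Suc j) \<le> rad j"
   using assms r(3) \<open>3 * rad (Suc j) \<le> K * rad (Suc j)\<close> by (simp add: dist_commute)
 qed
 moreover have "rad (Suc j) powr p \<le> rad j powr p" using r rad_antimono[of j "Suc j"] by (intro powr_mono2) auto
 ultimately have "rad (Suc j) powr p * nu F y (rad (Suc j)) * m x (rad j)
   \<le> rad j powr p * nu F x (rad j) * (D K * m y (rad (Suc j)))"
  using nu_nonneg m_pos[OF r(2), of x] by (intro mult_mono) (auto intro: less_imp_le)
 then show ?thesis unfolding dens_def using m_pos[OF r(1), of y] m_pos[OF r(2), of x] by (simp add: field_simps)
qed

definition A :: real where "A = D K powr (1 / (p - 1))"

lemma A_pos: "0 < A" using D_pos[of K] by (simp add: A_def)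

lemma b_shift:
 assumes "dist x y \<le> 2 * rad (Suc j)" shows "b (Suc j) y \<le> A * b j x"
proof -
 have "b (Suc j) y \<le> (D K * dens j x) powr (1 / (p - 1))"
  unfolding b_def using dens_shift[OF assms] dens_nonneg p_gt_1 by (intro powr_mono2) auto
 also have "\<dots> = A * b j x" by (simp add: powr_mult A_def b_def)
 finally show ?thesis .
qed

text \<open>A Lipschitz substitute for the merely Borel function \<open>b j\<close>: a supremum with
  tent weights at scale \<open>rad j\<close>. For positive index it dominates \<open>b\<close> at
  the same index and is at most \<open>A\<close> times \<open>b\<close> at the preceding
  one.\<close>

definition beta :: "nat \<Rightarrow> 'a \<Rightarrow> real" where
 "beta j x = (SUP y. b j y * max 0 (1 - dist x y / rad j))"

lemma beta_term_le:
 "b (Suc j) y * max 0 (1 - dist x y / rad (Suc j)) \<le> A * b j x"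
proof (cases "dist x y < rad (Suc j)")
 case True
 have "b (Suc j) y * max 0 (1 - dist x y / rad (Suc j)) \<le> b (Suc j) y * 1"
  using rad_pos[of "Suc j"] b_nonneg by (intro mult_left_mono) auto
 also have "\<dots> \<le> A * b j x" using True rad_pos[of "Suc j"] by (simp add: b_shift)
 finally show ?thesis .
next
 case False
 then have "max 0 (1 - dist x y / rad (Suc j)) = 0" using rad_pos[of "Suc j"] by (simp add: field_simps)
 then show ?thesis using A_pos b_nonneg[of j x] by simp
qed

lemma beta_bdd: "bdd_above (range (\<lambda>y. b (Suc j) y * max 0 (1 - dist x y / rad (Suc j))))"
 using beta_term_le by (intro bdd_aboveI) blast

lemma beta_le: "beta (Suc j) x \<le> A * b j x" unfolding beta_def by (intro cSUP_least beta_term_le) auto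

lemma b_le_beta: "b (Suc j) x \<le> beta (Suc j) x"
 unfolding beta_def using cSUP_upper[OF _ beta_bdd[of j x], of x] by simp

lemma beta_nonneg: "0 \<le> beta (Suc j) x" using b_le_beta b_nonneg order_trans by blast

text \<open>Terms centred farther than \<open>2 * rad (Suc j)\<close> from \<open>x\<close> vanish
  at both points; all others have height at most \<open>A * b j x\<close>. The slope is thus bounded
  by the value of \<open>b j\<close> at the single point \<open>x\<close>.\<close>

lemma beta_lipschitz:
 assumes d: "dist x x' \<le> rad (Suc j)"
 shows "\<bar>beta (Suc j) x - beta (Suc j) x'\<bar> \<le> dist x x' * (A * b j x / rad (Suc j))"
proof -
 let ?r = "rad (Suc j)"
 let ?t = "\<lambda>x y. b (Suc j) y * max 0 (1 - dist x y / ?r)"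
 let ?e = "dist x x' * (A * b j x / ?r)"
 have r: "0 < ?r" by (rule rad_pos)
 have e0: "0 \<le> ?e" using A_pos b_nonneg r by (simp add: less_imp_le)
 have t: "\<bar>?t x y - ?t x' y\<bar> \<le> ?e" for y
 proof (cases "dist x y \<le> 2 * ?r")
  case True
  have "\<bar>max 0 (1 - dist x y / ?r) - max 0 (1 - dist x' y / ?r)\<bar> \<le> \<bar>dist x y / ?r - dist x' y / ?r\<bar>" by auto
  also have "\<dots> = \<bar>dist x y - dist x' y\<bar> / ?r" using r by (simp add: diff_divide_distrib[symmetric])
  also have "\<dots> \<le> dist x x' / ?r"
   using r dist_triangle[of x y x'] dist_triangle3[of x' y x] by (intro divide_right_mono) auto
  finally have "b (Suc j) y * \<bar>max 0 (1 - dist x y / ?r) - max 0 (1 - dist x' y / ?r)\<bar> \<le> (A * b j x) * (dist x x' / ?r)"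
   using b_shift[OF True] b_nonneg A_pos r by (intro mult_mono) (auto intro: mult_nonneg_nonneg less_imp_le)
  moreover have "\<bar>?t x y - ?t x' y\<bar> = b (Suc j) y * \<bar>max 0 (1 - dist x y / ?r) - max 0 (1 - dist x' y / ?r)\<bar>"
   using b_nonneg[of "Suc j" y] by (simp add: right_diff_distrib[symmetric] abs_mult)
  ultimately show ?thesis by (simp add: ac_simps)
 next
  case False
  then have "?r < dist x y" "?r \<le> dist x' y" using d r dist_triangle[of x y x'] by linarith+
  then have "max 0 (1 - dist x y / ?r) = 0" "max 0 (1 - dist x' y / ?r) = 0" using r by (auto simp: field_simps)
  then show ?thesis using e0 by simp
 qed
 have "beta (Suc j) x \<le> beta (Suc j) x' + ?e" unfolding beta_def
 proof (rule cSUP_least)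
  fix y
  have "?t x' y \<le> (SUP y. ?t x' y)" by (intro cSUP_upper beta_bdd) simp
  then show "?t x y \<le> (SUP y. ?t x' y) + ?e" using t[of y] by linarith
 qed simp
 moreover have "beta (Suc j) x' \<le> beta (Suc j) x + ?e" unfolding beta_def
 proof (rule cSUP_least)
  fix y
  have "?t x y \<le> (SUP y. ?t x y)" by (intro cSUP_upper beta_bdd) simp
  then show "?t x' y \<le> (SUP y. ?t x y) + ?e" using t[of y] by linarith
 qed simp
 ultimately show ?thesis by linarith
qed

text \<open>\<open>slope j\<close> bounds the slope of the \<open>j\<close>-th summand.\<close>

definition U :: "nat \<Rightarrow> 'a \<Rightarrow> real" where
 "U n x = (\<Sum>j<n. beta (Suc j) x)"

definition slope :: "nat \<Rightarrow> 'a \<Rightarrow> real" where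
 "slope j x = A * b j x / rad (Suc j)"

lemma slope_nonneg: "0 \<le> slope j x" unfolding slope_def using A_pos b_nonneg rad_pos by (simp add: less_imp_le)

lemma slope_borel [measurable]: "borel_fun (slope j)" unfolding slope_def[abs_def] by measurable

lemma U_mono: "i \<le> n \<Longrightarrow> U i x \<le> U n x" unfolding U_def by (intro sum_mono2) (auto simp: beta_nonneg)

text \<open>Applies \<open>chain_bound\<close> with steps no longer than \<open>rad n\<close>, so
  that every summand stays within the range of its local Lipschitz bound.\<close>

lemma U_osc:
 assumes c: "c \<in> curves UNIV"
 shows "osc_le (\<lambda>t. U n (snd c t)) (\<lambda>t. ennreal (\<Sum>j<n. slope j (clamped c t))) 0 (fst c)" unfolding osc_le_def
proof (intro allI impI)
 fix s t assume st: "0 \<le> s" "s \<le> t" "t \<le> fst c"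
 let ?G = "\<lambda>t. ennreal (\<Sum>j<n. slope j (clamped c t))"
 show "ennreal \<bar>U n (snd c s) - U n (snd c t)\<bar> \<le> lint s t ?G"
 proof (cases "s = t")
  case False
  define d where "d = min (rad n) (t - s)"
  show ?thesis
  proof (rule chain_bound)
   have "borel_fun (\<lambda>x. ennreal (\<Sum>j<n. slope j x))" by measurable
   from clamped_comp_measurable[OF c this]
   show "?G \<in> borel_measurable borel" .
   show "0 < d" using False st rad_pos by (simp add: d_def)
   show "s + d \<le> t" by (simp add: d_def)
   fix x y \<tau> assume x: "s \<le> x" "x \<le> \<tau>" "\<tau> \<le> y" "y \<le> t" and yx: "y - x \<le> d"
   have \<tau>: "clamped c \<tau> = snd c \<tau>" using x st by (intro clamped_eq) auto
   have dx: "dist (snd c \<tau>) (snd c x) \<le> \<tau> - x" and dy: "dist (snd c \<tau>) (snd c y) \<le> y - \<tau>"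
    using curves_dist[OF c, of x \<tau>] curves_dist[OF c, of \<tau> y] x st by (auto simp: dist_commute)
   have "\<bar>beta (Suc j) (snd c x) - beta (Suc j) (snd c y)\<bar> \<le> (y - x) * slope j (snd c \<tau>)" if j: "j < n" for j
   proof -
    have rj: "rad n \<le> rad (Suc j)" using j by (intro rad_antimono) auto
    have 1: "dist (snd c \<tau>) (snd c x) \<le> rad (Suc j)" "dist (snd c \<tau>) (snd c y) \<le> rad (Suc j)"
     using dx dy yx x rj by (auto simp: d_def)
    have "\<bar>beta (Suc j) (snd c x) - beta (Suc j) (snd c y)\<bar> \<le>
      dist (snd c \<tau>) (snd c x) * slope j (snd c \<tau>) + dist (snd c \<tau>) (snd c y) * slope j (snd c \<tau>)"
     using beta_lipschitz[OF 1(1)] beta_lipschitz[OF 1(2)] unfolding slope_def by linarith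
    also have "\<dots> \<le> (\<tau> - x) * slope j (snd c \<tau>) + (y - \<tau>) * slope j (snd c \<tau>)"
     using dx dy slope_nonneg by (intro add_mono mult_right_mono) auto
    finally show ?thesis by (simp add: algebra_simps)
   qed
   then have "(\<Sum>j<n. \<bar>beta (Suc j) (snd c x) - beta (Suc j) (snd c y)\<bar>) \<le> (\<Sum>j<n. (y - x) * slope j (snd c \<tau>))"
    by (intro sum_mono) auto
   moreover have "\<bar>U n (snd c x) - U n (snd c y)\<bar> \<le> (\<Sum>j<n. \<bar>beta (Suc j) (snd c x) - beta (Suc j) (snd c y)\<bar>)"
    unfolding U_def sum_subtractf[symmetric] by (rule sum_abs)
   ultimately have "\<bar>U n (snd c x) - U n (snd c y)\<bar> \<le> (y - x) * (\<Sum>j<n. slope j (snd c \<tau>))"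
    by (simp add: sum_distrib_left)
   then have "ennreal \<bar>U n (snd c x) - U n (snd c y)\<bar> \<le> ennreal ((y - x) * (\<Sum>j<n. slope j (snd c \<tau>)))"
    by (rule ennreal_leI)
   also have "\<dots> = ennreal (y - x) * ?G \<tau>" unfolding \<tau> using x by (intro ennreal_mult sum_nonneg slope_nonneg) auto
   finally show "ennreal \<bar>U n (snd c x) - U n (snd c y)\<bar> \<le> ennreal (y - x) * ?G \<tau>" .
  qed
 qed simp
qed

lemma U_continuous: "continuous_on UNIV (U n)"
proof -
 have "continuous_on UNIV (beta (Suc j))" for j unfolding continuous_on_iff
 proof (intro ballI allI impI)
  fix x :: 'a and e :: real assume e: "0 < e"
  define q where "q = slope j x + 1"
  have q: "0 < q" using slope_nonneg[of j x] by (simp add: q_def)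
  show "\<exists>d>0. \<forall>x'\<in>UNIV. dist x' x < d \<longrightarrow> dist (beta (Suc j) x') (beta (Suc j) x) < e"
  proof (intro exI[of _ "min (rad (Suc j)) (e / q)"] conjI ballI impI)
   fix x' assume d: "dist x' x < min (rad (Suc j)) (e / q)"
   have "\<bar>beta (Suc j) x - beta (Suc j) x'\<bar> \<le> dist x x' * slope j x"
    using beta_lipschitz[of x x' j] d unfolding slope_def by (auto simp: dist_commute)
   also have "\<dots> \<le> dist x x' * q" by (intro mult_left_mono) (auto simp: q_def)
   also have "\<dots> < e" using d q by (simp add: field_simps dist_commute)
   finally show "dist (beta (Suc j) x') (beta (Suc j) x) < e" by (simp add: dist_real_def abs_minus_commute)
  qed (use rad_pos q e in auto)
 qed
 then show ?thesis unfolding U_def by (intro continuous_on_sum)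
qed

lemma U_borel [measurable]: "borel_fun (U n)" by (rule borel_measurable_continuous_onI[OF U_continuous])

text \<open>The slope of the summand \<open>j\<close> is switched off once the partial sum that
  includes this summand exceeds \<open>t\<close>; these are the slopes of the potential truncated at
  \<open>t\<close>.\<close>

definition cc :: "real \<Rightarrow> nat \<Rightarrow> 'a \<Rightarrow> real" where
 "cc t j x = (if U (Suc j) x \<le> t then slope j x else 0)"

lemma cc_nonneg: "0 \<le> cc t j x" by (simp add: cc_def slope_nonneg)

lemma cc_borel [measurable]: "borel_fun (cc t j)" unfolding cc_def[abs_def] by measurable

text \<open>An upper gradient of the truncated potential: the p-th root of the double sum that
  dominates the p-th power of the sum of stopped slopes. Grouping by the gap \<open>k\<close> of the
  two indices lets each \<open>k\<close> be integrated by itself.\<close>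

definition grad :: "real \<Rightarrow> 'a \<Rightarrow> ennreal" where
 "grad t x = epowr (ennreal (wolff_const p) * (\<Sum>k. \<Sum>j. 2 ^ k * (ennreal (cc t j x) * ennreal (cc t (j + k) x powr (p - 1))))) (1 / p)"

lemma grad_borel [measurable]: "borel_fun (grad t)" unfolding grad_def[abs_def] by measurable

lemma cc_sum_le_grad: "ennreal (\<Sum>j<n. cc t j x) \<le> grad t x"
proof -
 let ?c = "\<lambda>j k. 2 ^ k * (ennreal (cc t j x) * ennreal (cc t (j + k) x powr (p - 1)))"
 let ?d = "\<lambda>j i. 2 ^ (i - j) * (ennreal (cc t j x) * ennreal (cc t i x powr (p - 1)))"
 let ?T = "\<Sum>j<n. \<Sum>i\<in>{j..<n}. 2 ^ (i - j) * (cc t j x * cc t i x powr (p - 1))"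
 have "epowr (ennreal (\<Sum>j<n. cc t j x)) p = ennreal ((\<Sum>j<n. cc t j x) powr p)"
  by (intro epowr_ennreal sum_nonneg cc_nonneg)
 also have "\<dots> \<le> ennreal (wolff_const p * ?T)"
  using powr_sum_le_double_sum[OF cc_nonneg p_gt_1] by (intro ennreal_leI)
 also have "\<dots> = ennreal (wolff_const p) * ennreal ?T"
  using wolff_const_nonneg[OF p_gt_1] cc_nonneg by (intro ennreal_mult sum_nonneg) auto
 also have "ennreal ?T = (\<Sum>j<n. \<Sum>i\<in>{j..<n}. ?d j i)"
 proof -
  have 2: "ennreal (2 ^ k * (a * b)) = 2 ^ k * (ennreal a * ennreal b)" if "0 \<le> a" "0 \<le> b" for k and a b :: real
   using that by (simp add: ennreal_mult ennreal_power[symmetric])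
  have "ennreal ?T = (\<Sum>j<n. ennreal (\<Sum>i\<in>{j..<n}. 2 ^ (i - j) * (cc t j x * cc t i x powr (p - 1))))"
   using cc_nonneg by (intro sum_ennreal[symmetric] sum_nonneg) auto
  also have "\<dots> = (\<Sum>j<n. \<Sum>i\<in>{j..<n}. ennreal (2 ^ (i - j) * (cc t j x * cc t i x powr (p - 1))))"
   using cc_nonneg by (intro sum.cong refl sum_ennreal[symmetric]) auto
  finally show ?thesis using cc_nonneg by (simp add: 2)
 qed
 also have "\<dots> \<le> (\<Sum>j<n. \<Sum>k. ?c j k)"
 proof (intro sum_mono)
  fix j
  have "(\<Sum>i\<in>{j..<n}. ?d j i) =
    (\<Sum>k<n - j. ?c j k)" by (rule sum.reindex_bij_witness[of _ "\<lambda>k. j + k" "\<lambda>i. i - j"]) auto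
  also have "\<dots> \<le> (\<Sum>k. ?c j k)" by (intro sum_le_suminf) auto
  finally show "(\<Sum>i\<in>{j..<n}. ?d j i) \<le>
   (\<Sum>k. ?c j k)" .
 qed
 also have "\<dots> = (\<Sum>k. \<Sum>j<n. ?c j k)" by (intro suminf_sum[symmetric]) auto
 also have "\<dots> \<le> (\<Sum>k. \<Sum>j. ?c j k)" by (intro suminf_le sum_le_suminf) auto
 finally have "epowr (ennreal (\<Sum>j<n. cc t j x)) p \<le> epowr (grad t x) p"
  by (simp add: grad_def epowr_epowr mult_left_mono)
 then show ?thesis using epowr_le_iff[of p] by simp
qed

text \<open>Since \<open>rad 0 = 1\<close>, the density vanishes at distance above
  \<open>R + 1\<close> from \<open>z\<close>. Closer to \<open>z\<close>, doubling compares
  \<open>m x 1\<close> with \<open>m z 1\<close>.\<close>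

lemma b_0_bounded: "\<exists>M\<ge>0. \<forall>x. b 0 x \<le> M"
proof -
 define T where "T = enn2real (muint F)"
 define M where "M = T * D (R + 1) / m z 1"
 have T: "nu F x 1 \<le> T" for x unfolding nu_def T_def using F
  by (intro enn2real_mono nn_integral_mono) (auto simp: L1_def indicator_def)
 have M: "0 \<le> M" unfolding M_def T_def using m_pos[of 1 z] less_imp_le[OF D_pos[of "R + 1"]]
  by (intro divide_nonneg_pos mult_nonneg_nonneg) auto
 have "dens 0 x \<le> M" for x
 proof (cases "dist x z \<le> R + 1")
  case True
  have mz: "0 < m z 1" and mx: "0 < m x 1" by (simp_all add: m_pos)
  have "m z 1 \<le> D (R + 1) * m x 1" using True R by (intro m_compare) (auto simp: dist_commute)
  then have "nu F x 1 * m z 1 \<le> T * (D (R + 1) * m x 1)"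
   using T[of x] nu_nonneg mz by (intro mult_mono) (auto intro: order_trans)
  then show ?thesis using mz mx by (simp add: dens_def rad_def M_def field_simps)
 next
  case False
  have "F y * indicator (ball x 1) y = 0" for y
  proof (cases "y \<in> ball z R")
   case True
   then have "y \<notin> ball x 1" using False dist_triangle[of x z y] by (auto simp: dist_commute)
   then show ?thesis by simp
  qed (simp add: supp)
  then have "(\<lambda>y. F y * indicator (ball x 1) y) = (\<lambda>y. 0)" by (rule ext)
  then have "nu F x 1 = 0" unfolding nu_def by simp
  then show ?thesis using M by (simp add: dens_def rad_def)
 qed
 then have "b 0 x \<le> M powr (1 / (p - 1))" for x unfolding b_def using dens_nonneg p_gt_1 by (intro powr_mono2) auto
 then show ?thesis by (intro exI[of _ "M powr (1 / (p - 1))"]) auto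
qed

definition M :: real where "M = (SOME M. 0 \<le> M \<and> (\<forall>x. b 0 x \<le> M))"

lemma M_nonneg: "0 \<le> M" and b_0_le: "b 0 x \<le> M" using someI_ex[OF b_0_bounded] unfolding M_def[symmetric] by blast+

lemma slope_bounded: "slope j x \<le> A * (A ^ j * M) / rad (Suc j)"
proof -
 have "b j x \<le> A ^ j * M"
 proof (induction j arbitrary: x)
  case (Suc j)
  have "b (Suc j) x \<le> A * b j x" using rad_pos[of "Suc j"] by (intro b_shift) simp
  also have "\<dots> \<le> A * (A ^ j * M)" using Suc A_pos by (intro mult_left_mono) auto
  finally show ?case by simp
 qed (simp add: b_0_le)
 then show ?thesis unfolding slope_def using A_pos rad_pos by (intro divide_right_mono mult_left_mono) (auto intro: less_imp_le)
qed

text \<open>The truncation is constant on the open set of parameters where \<open>U n\<close>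
  exceeds \<open>t\<close>, so nothing is charged there. Elsewhere all earlier partial sums are at
  most \<open>t\<close> as well and the slopes agree with \<open>cc t\<close>.\<close>

lemma truncated_U_gradient:
 assumes c: "c \<in> curves UNIV" and st: "s \<in> {0..fst c}" "s' \<in> {0..fst c}" and ss: "s \<le> s'"
 shows "ennreal \<bar>min (U n (snd c s)) t - min (U n (snd c s')) t\<bar> \<le> line_integral (grad t) c"
proof -
 let ?f = "\<lambda>r. min (U n (snd c r)) t"
 let ?G = "\<lambda>r. ennreal (\<Sum>j<n. slope j (clamped c r))"
 define W where "W = {r. t < U n (clamped c r)}"
 have Gm: "?G \<in> borel_measurable borel"
 proof -
  have "borel_fun (\<lambda>x. ennreal (\<Sum>j<n. slope j x))" by measurable
  from clamped_comp_measurable[OF c this] show ?thesis .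
 qed
 have cont: "continuous_on UNIV (\<lambda>r. U n (clamped c r))"
  by (rule continuous_on_compose2[OF U_continuous clamped_continuous[OF c]]) simp
 have W: "open W" unfolding W_def by (intro open_Collect_less continuous_intros cont)
 have fin: "lint s s' ?G < \<infinity>"
 proof -
  let ?B = "\<Sum>j<n. A * (A ^ j * M) / rad (Suc j)"
  have "lint s s' ?G \<le> lint s s' (\<lambda>x. ennreal ?B)"
   by (intro nn_integral_mono mult_right_mono ennreal_leI sum_mono slope_bounded) auto
  also have "\<dots> < \<infinity>" using ss by (simp add: nn_integral_cmult_indicator ennreal_mult_less_top)
  finally show ?thesis .
 qed
 have osc: "osc_le ?f ?G s s'" by (rule osc_le_contraction[OF osc_le_subset[OF U_osc[OF c]]]) (use st in auto)
 have "ennreal \<bar>?f s - ?f s'\<bar> \<le> lint s s' (\<lambda>x. if x \<in> W then 0 else ?G x)"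
 proof (rule osc_le_replace_open[OF _ Gm W osc fin _ ss])
  fix a d assume ad: "s \<le> a" "a \<le> d" "d \<le> s'" "{a..d} \<subseteq> W"
  then have "a \<in> W" "d \<in> W" by auto
  then have "?f a = t" "?f d = t" using ad st by (auto simp: W_def clamped_eq min_def)
  then show "ennreal \<bar>?f a - ?f d\<bar> \<le> lint a d (\<lambda>x. 0)" by simp
 qed simp
 also have "\<dots> \<le> lint 0 (fst c) (\<lambda>x. grad t (clamped c x))"
 proof (intro nn_integral_mono)
  fix x
  have "?G x \<le> grad t (clamped c x)" if "x \<notin> W"
  proof -
   have "slope j (clamped c x) = cc t j (clamped c x)" if "j < n" for j
    using \<open>x \<notin> W\<close> U_mono[of "Suc j" n "clamped c x"] that by (auto simp: W_def cc_def)
   then have "?G x = ennreal (\<Sum>j<n. cc t j (clamped c x))" by simp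
   then show ?thesis using cc_sum_le_grad by simp
  qed
  then show "(if x \<in> W then 0 else ?G x) * indicator {s..s'} x \<le> grad t (clamped c x) * indicator {0..fst c} x"
   using st by (auto simp: indicator_def)
 qed
 finally show ?thesis by (simp add: clamped_line_integral)
qed

text \<open>
 For fixed \<open>k\<close> the maximal values of \<open>b\<close> over the balls around \<open>y\<close> are all comparable to values at
 one point where the potential is still at most \<open>t\<close>; hence their sum is bounded.
\<close>

lemma stopped_sum_le:
 assumes t: "0 \<le> t"
 shows "(\<Sum>j. SUP x\<in>{x \<in> ball y (rad (j + k)). U (Suc (j + k)) x \<le> t}. ennreal (b j x)) \<le> ennreal (M + A * (M + t))"
proof (rule suminf_le_const)
 let ?S = "\<lambda>j. {x \<in> ball y (rad (j + k)). U (Suc (j + k)) x \<le> t}"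
 have B0: "0 \<le> M + A * (M + t)" using M_nonneg A_pos t by (auto intro!: add_nonneg_nonneg mult_nonneg_nonneg less_imp_le)
 fix n
 show "(\<Sum>j<n. SUP x\<in>?S j. ennreal (b j x)) \<le> ennreal (M + A * (M + t))"
 proof (cases "\<exists>j<n. ?S j \<noteq> {}")
  case False
  then have "(\<Sum>j<n. SUP x\<in>?S j. ennreal (b j x)) = 0"
  proof (intro sum.neutral ballI)
   fix j assume "j \<in> {..<n}"
   then have "?S j = {}" using False by blast
   then show "(SUP x\<in>?S j. ennreal (b j x)) = 0" by (simp only: image_empty Sup_empty bot_ennreal)
  qed
  then show ?thesis by simp
 next
  case True
  \<comment> \<open>The last nonempty level supplies the comparison point: \<open>w\<close> lies
    within \<open>2 * rad j\<close> of every point used at a level \<open>j <= l\<close>, and the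
    partial sum up to the last of these levels is at most \<open>t\<close> at
    \<open>w\<close>.\<close>
  define l where "l = Max {j. j < n \<and> ?S j \<noteq> {}}"
  have l: "l < n" "?S l \<noteq> {}" and lmax: "\<And>j. j < n \<Longrightarrow> ?S j \<noteq> {} \<Longrightarrow> j \<le> l"
   using Max_in[of "{j. j < n \<and> ?S j \<noteq> {}}"] True unfolding l_def by auto
  obtain w where w: "dist y w < rad (l + k)" "U (Suc (l + k)) w \<le> t" using l(2) by auto
  have bw: "ennreal (b j x) \<le> ennreal (if j = 0 then M else A * b (j - 1) w)"
   if j: "j \<le> l" and x: "x \<in> ?S j" for j x
  proof (cases j)
   case 0 then show ?thesis by (simp add: b_0_le ennreal_leI)
  next
   case (Suc i)
   have "dist y x < rad j" "dist y w < rad j"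
    using x w(1) rad_antimono[of j "j + k"] rad_antimono[of j "l + k"] j by auto
   then have "dist w x \<le> 2 * rad (Suc i)" using dist_triangle3[of w x y] Suc by simp
   from b_shift[OF this] show ?thesis using Suc by (simp add: ennreal_leI)
  qed
  have "(\<Sum>j<n. SUP x\<in>?S j. ennreal (b j x)) = (\<Sum>j<Suc l. SUP x\<in>?S j. ennreal (b j x))"
  proof (rule sum.mono_neutral_right)
   show "\<forall>j\<in>{..<n} - {..<Suc l}. (SUP x\<in>?S j. ennreal (b j x)) = 0"
   proof
    fix j assume "j \<in> {..<n} - {..<Suc l}"
    then have "?S j = {}" using lmax[of j] by auto
    then show "(SUP x\<in>?S j. ennreal (b j x)) = 0" by (simp only: image_empty Sup_empty bot_ennreal)
   qed
  qed (use l in auto)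
  also have "\<dots> \<le> (\<Sum>j<Suc l. ennreal (if j = 0 then M else A * b (j - 1) w))"
   using bw by (intro sum_mono SUP_least) auto
  also have "\<dots> = ennreal (\<Sum>j<Suc l. if j = 0 then M else A * b (j - 1) w)"
   using M_nonneg A_pos b_nonneg by (intro sum_ennreal) (auto intro: mult_nonneg_nonneg less_imp_le)
  also have "(\<Sum>j<Suc l. if j = 0 then M else A * b (j - 1) w) = M + A * (\<Sum>j<l. b j w)"
   by (simp add: sum.lessThan_Suc_shift sum_distrib_left del: sum.lessThan_Suc)
  also have "(\<Sum>j<l. b j w) \<le> M + t"
  proof -
   have "(\<Sum>j<Suc l. b j w) = b 0 w + (\<Sum>j<l. b (Suc j) w)" by (rule sum.lessThan_Suc_shift)
   then have "(\<Sum>j<l. b j w) \<le> b 0 w + (\<Sum>j<l. b (Suc j) w)" using b_nonneg[of l w] by simp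
   also have "(\<Sum>j<l. b (Suc j) w) \<le> U l w" unfolding U_def by (intro sum_mono b_le_beta)
   also have "U l w \<le> U (Suc (l + k)) w" by (intro U_mono) auto
   finally show ?thesis using w(2) b_0_le[of w] by linarith
  qed
  then have "ennreal (M + A * (\<Sum>j<l. b j w)) \<le> ennreal (M + A * (M + t))"
   using A_pos by (intro ennreal_leI add_left_mono mult_left_mono) auto
  finally show ?thesis .
 qed
qed auto

definition top_b :: "real \<Rightarrow> nat \<Rightarrow> nat \<Rightarrow> 'a \<Rightarrow> ennreal" where
 "top_b t k j y = (SUP x\<in>{x \<in> ball y (rad (j + k)). U (Suc (j + k)) x \<le> t}. ennreal (b j x))"

text \<open>The superlevel sets are unions of open balls, whatever the set of admissible
  \<open>x\<close> is.\<close>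

lemma top_b_borel [measurable]: "borel_fun (top_b t k j)"
proof (rule borel_measurableI_greater)
 fix a
 have "{y \<in> space borel. a < top_b t k j y} = (\<Union>x\<in>{x. U (Suc (j + k)) x \<le> t \<and> a < ennreal (b j x)}. ball x (rad (j + k)))"
  by (auto simp: top_b_def less_SUP_iff dist_commute)
 then show "{y \<in> space borel. a < top_b t k j y} \<in> sets borel" by (auto intro!: borel_open open_UN)
qed

text \<open>Since \<open>b i\<close> to the power \<open>p - 1\<close> is \<open>dens i\<close>, the
  slope at scale \<open>i = j + k\<close> raised to \<open>p - 1\<close> is a multiple of
  \<open>rad i\<close> times the average of \<open>F\<close>. The factor \<open>1 / rad j\<close> of
  the other slope leaves \<open>rad i / rad j = (1 / K) ^ k\<close>, and \<open>K >= 4\<close> turns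
  \<open>2 ^ k * (1 / K) ^ k\<close> into at most \<open>(1 / 2) ^ k\<close>.\<close>

lemma cc_product_le:
 "2 ^ k * (ennreal (cc t j x) * ennreal (cc t (j + k) x powr (p - 1)))
  \<le> ennreal ((A * K) powr p * (1 / 2) ^ k) * ((if U (Suc (j + k)) x \<le> t then ennreal (b j x) else 0) * av F (rad (j + k)) x)"
proof (cases "U (Suc (j + k)) x \<le> t")
 case True
 define i where "i = j + k"
 have AK: "0 < A * K" using A_pos K by simp
 have ri: "0 < rad i" "0 < rad j" by (rule rad_pos)+
 have rij: "rad i = (1 / K) ^ k * rad j" by (simp add: rad_def i_def power_add)
 have s: "slope l x = A * K * b l x / rad l" for l
  using rad_pos[of l] rad_pos[of "Suc l"] rad_Suc[of l] K by (simp add: slope_def field_simps)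
 have "slope i x = (A * K / rad i) * b i x" by (simp add: s)
 then have "slope i x powr (p - 1) = (A * K / rad i) powr (p - 1) * b i x powr (p - 1)" by (simp only: powr_mult)
 also have "b i x powr (p - 1) = dens i x" using p_gt_1 dens_nonneg by (simp add: b_def powr_powr)
 also have "(A * K / rad i) powr (p - 1) = (A * K) powr (p - 1) / rad i powr (p - 1)" by (rule powr_divide)
 also have "dens i x = rad i * rad i powr (p - 1) * (nu F x (rad i) / m x (rad i))"
  using ri powr_mult_base[of "rad i" "p - 1"] by (simp add: dens_def)
 also have "(A * K) powr (p - 1) / rad i powr (p - 1) * (rad i * rad i powr (p - 1) * (nu F x (rad i) / m x (rad i)))
   = (A * K) powr (p - 1) * rad i * (nu F x (rad i) / m x (rad i))" using ri by simp
 finally have sp: "slope i x powr (p - 1) = (A * K) powr (p - 1) * rad i * (nu F x (rad i) / m x (rad i))" .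
 have a0: "0 \<le> nu F x (rad i) / m x (rad i)" using nu_nonneg m_pos[OF ri(1), of x] by (simp add: less_imp_le)
 have K2: "2 ^ k * (1 / K) ^ k \<le> (1 / 2) ^ k"
 proof -
  have "2 ^ k * (1 / K) ^ k = (2 / K) ^ k" by (simp add: power_divide)
  also have "\<dots> \<le> (1 / 2) ^ k" using K by (intro power_mono) (auto simp: field_simps)
  finally show ?thesis .
 qed
 have "2 ^ k * (slope j x * slope i x powr (p - 1)) =
   (2 ^ k * (1 / K) ^ k) * ((A * K) powr p * (b j x * (nu F x (rad i) / m x (rad i))))"
 proof -
  have alg: "u * ((v * c / r) * (Q * (q * r) * a)) = (u * q) * ((v * Q) * (c * a))" if "r \<noteq> 0" for u v c r Q q a :: real
   using that by simp
  have "A * K * (A * K) powr (p - 1) = (A * K) powr p" using powr_mult_base[of "A * K" "p - 1"] AK by simp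
  then show ?thesis unfolding sp s[of j] rij using alg[of "rad j" "2 ^ k" "A * K" "b j x"] ri(2) by (simp only: less_imp_neq[symmetric] not_False_eq_True)
 qed
 also have "\<dots> \<le> (1 / 2) ^ k * ((A * K) powr p * (b j x * (nu F x (rad i) / m x (rad i))))"
  using K2 a0 b_nonneg[of j x] by (intro mult_right_mono mult_nonneg_nonneg) auto
 finally have le: "2 ^ k * (slope j x * slope i x powr (p - 1))
   \<le> ((A * K) powr p * (1 / 2) ^ k) * (b j x * (nu F x (rad i) / m x (rad i)))" by (simp add: mult_ac)
 have cj: "cc t j x \<le> slope j x" using slope_nonneg by (simp add: cc_def)
 have "2 ^ k * (ennreal (cc t j x) * ennreal (cc t i x powr (p - 1))) \<le> 2 ^ k * (ennreal (slope j x) * ennreal (slope i x powr (p - 1)))"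
  using cj True by (intro mult_left_mono mult_mono ennreal_leI) (auto simp: cc_def i_def)
 also have "\<dots> = ennreal (2 ^ k * (slope j x * slope i x powr (p - 1)))"
  using slope_nonneg by (simp add: ennreal_mult ennreal_power[symmetric])
 also have "\<dots> \<le> ennreal (((A * K) powr p * (1 / 2) ^ k) * (b j x * (nu F x (rad i) / m x (rad i))))"
  by (rule ennreal_leI[OF le])
 also have "\<dots> = ennreal ((A * K) powr p * (1 / 2) ^ k) * (ennreal (b j x) * ennreal (nu F x (rad i) / m x (rad i)))"
  using a0 b_nonneg[of j x] by (simp only: ennreal_mult mult_nonneg_nonneg powr_ge_zero zero_le_power zero_le_divide_1_iff zero_le_numeral)
 finally show ?thesis using True by (simp add: i_def[symmetric] av_L1[OF F ri(1)])
qed (simp add: cc_def)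

text \<open>For each gap \<open>k\<close>, \<open>av_weight\<close> moves the average onto
  \<open>F\<close>, and the sum over \<open>j\<close> of the maximal values is bounded by
  \<open>stopped_sum_le\<close>; the gaps then sum geometrically. What matters is that the bound
  grows only linearly in \<open>t\<close>.\<close>

lemma grad_energy:
 assumes t: "0 \<le> t"
 shows "pint (\<lambda>x. grad t x)
  \<le> ennreal (wolff_const p * (2 * (A * K) powr p) * D 1 * (M + A * (M + t))) * muint F"
proof -
 have Fm[measurable]: "borel_fun F" using F by (simp add: L1_def)
 note mm = measurable_mu_borel
 define e where "e = 2 * (A * K) powr p"
 define B where "B = M + A * (M + t)"
 define T where "T = muint F"
 have e0: "0 \<le> e" by (simp add: e_def)
 have B0: "0 \<le> B" unfolding B_def using M_nonneg less_imp_le[OF A_pos] t by (intro add_nonneg_nonneg mult_nonneg_nonneg) auto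
 let ?c = "\<lambda>k j x. 2 ^ k * (ennreal (cc t j x) * ennreal (cc t (j + k) x powr (p - 1)))"
 let ?G = "\<lambda>k j x. if U (Suc (j + k)) x \<le> t then ennreal (b j x) else 0"
 have entry: "muint (\<lambda>x. ?c k j x) \<le> ennreal (e * (1/2) ^ Suc k) * muint (\<lambda>y. F y * (ennreal (D 1) * top_b t k j y))" for k j
 proof -
  have "muint (\<lambda>x. ?c k j x) \<le> muint (\<lambda>x. ennreal (e * (1/2) ^ Suc k) * (?G k j x * av F (rad (j + k)) x))"
   using cc_product_le[of k t j] by (intro nn_integral_mono) (simp add: e_def mult_ac)
  also have "\<dots> = ennreal (e * (1/2) ^ Suc k) * muint (\<lambda>x. ?G k j x * av F (rad (j + k)) x)"
  proof (rule nn_integral_cmult)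
   have [measurable]: "av F (rad (j + k)) \<in> borel_measurable borel" by (rule av_borel[OF Fm])
   show "(\<lambda>x. ?G k j x * av F (rad (j + k)) x) \<in> borel_measurable \<mu>" by (rule mm) measurable
  qed
  also have "\<dots> \<le> ennreal (e * (1/2) ^ Suc k) * muint (\<lambda>y. F y * (ennreal (D 1) * top_b t k j y))"
  proof (intro mult_left_mono av_weight Fm rad_pos)
   show "borel_fun (\<lambda>x. ?G k j x)" by measurable
   fix x y :: 'a assume "dist y x < rad (j + k)"
   then show "?G k j x \<le> top_b t k j y" unfolding top_b_def by (auto intro: SUP_upper)
  qed simp
  finally show ?thesis .
 qed
 have row: "(\<Sum>j. \<integral>\<^sup>+x. ?c k j x \<partial>\<mu>) \<le> ennreal (e * (1/2) ^ Suc k) * (ennreal (D 1 * B) * T)" for k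
 proof -
  have "(\<Sum>j. \<integral>\<^sup>+x. ?c k j x \<partial>\<mu>) \<le> (\<Sum>j. ennreal (e * (1/2) ^ Suc k) * muint (\<lambda>y. F y * (ennreal (D 1) * top_b t k j y)))"
   by (intro suminf_le entry) auto
  also have "\<dots> = ennreal (e * (1/2) ^ Suc k) * (\<Sum>j. \<integral>\<^sup>+y. F y * (ennreal (D 1) * top_b t k j y) \<partial>\<mu>)"
   by (rule ennreal_suminf_cmult)
  also have "(\<Sum>j. \<integral>\<^sup>+y. F y * (ennreal (D 1) * top_b t k j y) \<partial>\<mu>) = muint (\<lambda>y. \<Sum>j. F y * (ennreal (D 1) * top_b t k j y))"
   by (intro nn_integral_suminf[symmetric] mm) measurable
  also have "\<dots> \<le> muint (\<lambda>y. ennreal (D 1 * B) * F y)"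
  proof (intro nn_integral_mono)
   fix y :: 'a
   have "(\<Sum>j. F y * (ennreal (D 1) * top_b t k j y)) = F y * (ennreal (D 1) * (\<Sum>j. top_b t k j y))"
    by (simp only: ennreal_suminf_cmult)
   also have "\<dots> \<le> F y * (ennreal (D 1) * ennreal B)"
    unfolding top_b_def B_def by (intro mult_left_mono stopped_sum_le t) auto
   also have "\<dots> = ennreal (D 1 * B) * F y" using B0 less_imp_le[OF D_pos[of 1]] by (simp add: ennreal_mult mult_ac)
   finally show "(\<Sum>j. F y * (ennreal (D 1) * top_b t k j y)) \<le> ennreal (D 1 * B) * F y" .
  qed
  also have "\<dots> = ennreal (D 1 * B) * T" unfolding T_def by (intro nn_integral_cmult mm Fm)
  finally show ?thesis by (simp add: mult_left_mono)
 qed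
 have "pint (\<lambda>x. grad t x) = muint (\<lambda>x. ennreal (wolff_const p) * (\<Sum>k. \<Sum>j. ?c k j x))"
  by (simp add: grad_def epowr_epowr)
 also have "\<dots> = ennreal (wolff_const p) * muint (\<lambda>x. \<Sum>k. \<Sum>j. ?c k j x)" by (intro nn_integral_cmult mm) measurable
 also have "muint (\<lambda>x. \<Sum>k. \<Sum>j. ?c k j x) = (\<Sum>k. \<integral>\<^sup>+x. (\<Sum>j. ?c k j x) \<partial>\<mu>)" by (intro nn_integral_suminf mm) measurable
 also have "\<dots> = (\<Sum>k. \<Sum>j. \<integral>\<^sup>+x. ?c k j x \<partial>\<mu>)" by (intro arg_cong[where f=suminf] ext nn_integral_suminf mm) measurable
 also have "\<dots> \<le> (\<Sum>k. ennreal (e * (1/2) ^ Suc k) * (ennreal (D 1 * B) * T))" by (intro suminf_le row) auto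
 also have "\<dots> = ennreal e * (ennreal (D 1 * B) * T)"
  using sum_half_powers[OF e0] by (simp only: ennreal_suminf_multc)
 finally have "pint (\<lambda>x. grad t x) \<le> ennreal (wolff_const p) * (ennreal e * (ennreal (D 1 * B) * T))"
  by (simp add: mult_left_mono)
 also have "\<dots> = ennreal (wolff_const p * e * D 1 * B) * T"
  using wolff_const_nonneg[OF p_gt_1] e0 B0 less_imp_le[OF D_pos[of 1]] by (simp add: ennreal_mult mult_ac)
 finally show ?thesis by (simp add: e_def B_def T_def)
qed

text \<open>The averages weighted by \<open>rad j\<close> have a summable sequence of integrals, so
  a.e. \<open>rad j\<close> times the average stays bounded.\<close>

lemma AE_dens_le: "AE x in \<mu>. \<exists>C\<ge>0. \<forall>j. dens j x \<le> C * rad j powr (p - 1)"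
proof -
 have Fm[measurable]: "borel_fun F" using F by (simp add: L1_def)
 have [measurable]: "av F (rad j) \<in> borel_measurable borel" for j by (rule av_borel[OF Fm])
 have rs: "summable rad" unfolding rad_def[abs_def] using K by (intro summable_geometric) auto
 have "muint (\<lambda>x. \<Sum>j. ennreal (rad j) * av F (rad j) x) = (\<Sum>j. \<integral>\<^sup>+x. ennreal (rad j) * av F (rad j) x \<partial>\<mu>)"
  by (intro nn_integral_suminf measurable_mu_borel) measurable
 also have "\<dots> = (\<Sum>j. ennreal (rad j) * muint (\<lambda>x. av F (rad j) x))"
  by (intro arg_cong[where f=suminf] ext nn_integral_cmult measurable_mu_borel) measurable
 also have "\<dots> \<le> (\<Sum>j. ennreal (rad j) * (ennreal (D 1) * muint F))"
  by (intro suminf_le mult_left_mono av_integral_le rad_pos Fm) auto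
 also have "\<dots> = (\<Sum>j. ennreal (rad j)) * (ennreal (D 1) * muint F)" by (rule ennreal_suminf_multc)
 also have "(\<Sum>j. ennreal (rad j)) = ennreal (\<Sum>j. rad j)"
  using rs rad_pos by (intro suminf_ennreal2) (auto intro: less_imp_le)
 also have "ennreal (\<Sum>j. rad j) * (ennreal (D 1) * muint F) < \<infinity>" using F by (simp add: L1_def ennreal_mult_less_top)
 finally have "AE x in \<mu>. (\<Sum>j. ennreal (rad j) * av F (rad j) x) \<noteq> \<infinity>"
  by (intro nn_integral_noteq_infinite measurable_mu_borel) auto
 then show ?thesis
 proof (rule AE_mp[OF _ AE_I2], intro impI)
  fix x assume fin: "(\<Sum>j. ennreal (rad j) * av F (rad j) x) \<noteq> \<infinity>"
  then obtain C where C: "(\<Sum>j. ennreal (rad j) * av F (rad j) x) = ennreal C" "0 \<le> C" by (cases rule: ennreal_cases) auto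
  have "dens j x \<le> C * rad j powr (p - 1)" for j
  proof -
   have a0: "0 \<le> nu F x (rad j) / m x (rad j)" using nu_nonneg m_pos[OF rad_pos, of x j] by (simp add: less_imp_le)
   have "ennreal (rad j) * av F (rad j) x \<le> ennreal C"
    unfolding C(1)[symmetric] using sum_le_suminf[of "\<lambda>j. ennreal (rad j) * av F (rad j) x" "{j}"] by simp
   then have "ennreal (rad j * (nu F x (rad j) / m x (rad j))) \<le> ennreal C"
    using a0 rad_pos[of j] by (simp only: av_L1[OF F rad_pos] ennreal_mult less_imp_le)
   then have le: "rad j * (nu F x (rad j) / m x (rad j)) \<le> C" using C(2) by simp
   have "rad j powr p = rad j powr (p - 1) * rad j" using powr_mult_base[of "rad j" "p - 1"] rad_pos[of j] by (simp add: mult.commute)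
   then have "dens j x = rad j powr (p - 1) * (rad j * (nu F x (rad j) / m x (rad j)))" by (simp add: dens_def)
   also have "\<dots> \<le> rad j powr (p - 1) * C" by (intro mult_left_mono le) simp
   finally show ?thesis by (simp add: mult.commute)
  qed
  then show "\<exists>C\<ge>0. \<forall>j. dens j x \<le> C * rad j powr (p - 1)" using C(2) by blast
 qed
qed

lemma summable_rad_powr: "0 < q \<Longrightarrow> summable (\<lambda>j. rad j powr q)"
proof -
 assume q: "0 < q"
 have "rad j powr q = ((1 / K) powr q) ^ j" for j
  using K by (simp add: rad_def powr_realpow[symmetric] powr_powr mult.commute)
 moreover have "(1 / K) powr q < 1" using K q powr_less_mono2[of q "1 / K" 1] by simp
 ultimately show ?thesis by (simp add: summable_geometric)
qed

lemma AE_summable_b: "AE x in \<mu>. summable (\<lambda>j. b j x)" using AE_dens_le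
proof eventually_elim
 case (elim x)
 then obtain C where C: "0 \<le> C" "dens j x \<le> C * rad j powr (p - 1)" for j by blast
 have "b j x \<le> C powr (1 / (p - 1)) * rad j powr 1" for j
 proof -
  have "b j x \<le> (C * rad j powr (p - 1)) powr (1 / (p - 1))"
   unfolding b_def using C(2) dens_nonneg p_gt_1 by (intro powr_mono2) auto
  then show ?thesis using p_gt_1 by (simp add: powr_mult powr_powr)
 qed
 then show ?case
  using b_nonneg by (intro summable_comparison_test'[OF summable_mult[OF summable_rad_powr[of 1]]]) auto
qed

lemma summable_b_iff_bounded: "summable (\<lambda>j. b j x) \<longleftrightarrow> (\<exists>C. \<forall>n. U n x \<le> C)"
proof
 assume s: "summable (\<lambda>j. b j x)"
 have "U n x \<le> A * (\<Sum>j. b j x)" for n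
 proof -
  have "U n x \<le> A * (\<Sum>j<n. b j x)" unfolding U_def sum_distrib_left by (intro sum_mono beta_le)
  also have "\<dots> \<le> A * (\<Sum>j. b j x)" using A_pos by (intro mult_left_mono sum_le_suminf s b_nonneg) auto
  finally show ?thesis .
 qed
 then show "\<exists>C. \<forall>n. U n x \<le> C" by blast
next
 assume "\<exists>C. \<forall>n. U n x \<le> C"
 then obtain C where C: "U n x \<le> C" for n by (rule exE) blast
 have "(\<Sum>j\<le>n. b (Suc j) x) \<le> C" for n
 proof -
  have "(\<Sum>j<Suc n. b (Suc j) x) \<le> U (Suc n) x" unfolding U_def by (intro sum_mono b_le_beta)
  then show ?thesis using C[of "Suc n"] by (simp add: lessThan_Suc_atMost)
 qed
 then have "summable (\<lambda>j. b (Suc j) x)" by (rule bounded_imp_summable[OF b_nonneg])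
 then show "summable (\<lambda>j. b j x)" using summable_Suc_iff[of "\<lambda>j. b j x"] by simp
qed

lemma cSUP_diff_le:
 fixes f g :: "nat \<Rightarrow> real"
 assumes "bdd_above (range f)" "bdd_above (range g)" "\<And>i. \<bar>f i - g i\<bar> \<le> e"
 shows "\<bar>(SUP i. f i) - (SUP i. g i)\<bar> \<le> e"
proof -
 have "(SUP i. f i) \<le> (SUP i. g i) + e"
 proof (rule cSUP_least)
  fix i show "f i \<le> (SUP i. g i) + e" using assms(3)[of i] cSUP_upper[OF _ assms(2), of i] by auto
 qed simp
 moreover have "(SUP i. g i) \<le> (SUP i. f i) + e"
 proof (rule cSUP_least)
  fix i show "g i \<le> (SUP i. f i) + e" using assms(3)[of i] cSUP_upper[OF _ assms(1), of i] by auto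
 qed simp
 ultimately show ?thesis by linarith
qed

text \<open>The test functions are the potential truncated at \<open>t = real (Suc n)\<close> and
  divided by \<open>t\<close>. They are at least 1 where the sum diverges and tend to 0 a.e.; their
  energies are at most \<open>t powr (- p)\<close> times a linear function of \<open>t\<close>,
  which tends to 0 because \<open>p > 1\<close>.\<close>

theorem wolff_exceptional: "exceptional {x. \<not> summable (\<lambda>j. b j x)}"
proof (rule exceptional_criterion)
 define V where "V n x = (SUP j. min (U j x) (real (Suc n))) / real (Suc n)" for n x
 let ?G = "\<lambda>n x. ennreal (1 / real (Suc n)) * grad (real (Suc n)) x"
 have bdd: "bdd_above (range (\<lambda>j. min (U j x) t))" for x t by (intro bdd_aboveI[of _ t]) auto
 show "?G n \<in> borel_measurable borel" for n by measurable
 show "AE x in \<mu>. (\<lambda>n. V n x) \<longlonglongrightarrow> 0" using AE_summable_b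
 proof (rule AE_mp[OF _ AE_I2], intro impI)
  fix x assume "summable (\<lambda>j. b j x)"
  then obtain C where C: "U n x \<le> C" for n unfolding summable_b_iff_bounded by (rule exE) blast
  have U0: "0 \<le> U 0 x" by (simp add: U_def)
  have "0 \<le> V n x \<and> V n x \<le> C * (1 / real (Suc n))" for n
  proof -
   have "0 \<le> (SUP j. min (U j x) (real (Suc n)))" by (rule cSUP_upper2[OF bdd, of 0]) (use U0 in auto)
   moreover have "(SUP j. min (U j x) (real (Suc n))) \<le> C"
    by (rule cSUP_least) (use C in \<open>auto simp: min_le_iff_disj\<close>)
   ultimately show ?thesis unfolding V_def by (auto intro!: divide_right_mono)
  qed
  then have le: "0 \<le> V n x" "V n x \<le> C * (1 / real (Suc n))" for n by auto
  have lim: "(\<lambda>n. C * (1 / real (Suc n))) \<longlonglongrightarrow> 0"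
   by (intro tendsto_mult_right_zero LIMSEQ_inverse_real_of_nat[unfolded inverse_eq_divide])
  show "(\<lambda>n. V n x) \<longlonglongrightarrow> 0"
   by (rule tendsto_sandwich[OF always_eventually always_eventually tendsto_const lim]) (use le in blast)+
 qed
 fix n x assume "x \<in> {x. \<not> summable (\<lambda>j. b j x)}"
 then have "\<not> (\<forall>j. U j x \<le> real (Suc n))" unfolding summable_b_iff_bounded by blast
 then obtain j where "real (Suc n) < U j x" by (auto simp: not_le)
 then have "real (Suc n) \<le> (SUP j. min (U j x) (real (Suc n)))" by (intro cSUP_upper2[OF bdd, of j]) auto
 then show "1 \<le> V n x" unfolding V_def by (simp add: field_simps)
next
 let ?t = "\<lambda>n::nat. real (Suc n)"
 let ?V = "\<lambda>n x. (SUP j. min (U j x) (?t n)) / ?t n"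
 let ?G = "\<lambda>n x. ennreal (1 / ?t n) * grad (?t n) x"
 have bdd: "bdd_above (range (\<lambda>j. min (U j x) t))" for x t by (intro bdd_aboveI[of _ t]) auto
 fix n :: nat
 show "ae_slope_le (?V n) (?G n)"
 proof (intro aec_True ballI)
  fix c :: "real \<times> (real \<Rightarrow> 'a)" and s s' :: real
  assume c: "c \<in> curves UNIV" and s: "s \<in> {0..fst c}" "s' \<in> {0..fst c}"
  show "ennreal \<bar>?V n (snd c s) - ?V n (snd c s')\<bar> \<le> line_integral (?G n) c"
  proof (cases "line_integral (grad (?t n)) c")
   case (real I)
   have "\<bar>min (U j (snd c s)) (?t n) - min (U j (snd c s')) (?t n)\<bar> \<le> I" for j
   proof -
    have "ennreal \<bar>min (U j (snd c s)) (?t n) - min (U j (snd c s')) (?t n)\<bar> \<le> ennreal I"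
     using truncated_U_gradient[OF c s, of j "?t n"] truncated_U_gradient[OF c s(2,1), of j "?t n"] real
     by (cases "s \<le> s'") (auto simp: abs_minus_commute)
    then show ?thesis using real by simp
   qed
   from cSUP_diff_le[OF bdd bdd this]
   have "\<bar>?V n (snd c s) - ?V n (snd c s')\<bar> \<le> (1 / ?t n) * I"
    by (simp add: diff_divide_distrib[symmetric] divide_right_mono)
   then have "ennreal \<bar>?V n (snd c s) - ?V n (snd c s')\<bar> \<le> ennreal ((1 / ?t n) * I)" by (rule ennreal_leI)
   also have "\<dots> = ennreal (1 / ?t n) * line_integral (grad (?t n)) c" using real by (simp add: ennreal_mult[symmetric])
   also have "\<dots> = line_integral (?G n) c" by (rule line_integral_cmult[OF c grad_borel, symmetric])
   finally show ?thesis .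
  next
   case top
   then have "line_integral (?G n) c = top"
    unfolding line_integral_cmult[OF c grad_borel] by (simp add: ennreal_mult_top)
   then show ?thesis by simp
  qed
 qed
next
 let ?t = "\<lambda>n::nat. real (Suc n)"
 let ?G = "\<lambda>n x. ennreal (1 / ?t n) * grad (?t n) x"
 define w where "w = wolff_const p * (2 * (A * K) powr p) * D 1"
 have w: "0 \<le> w" unfolding w_def using wolff_const_nonneg[OF p_gt_1] less_imp_le[OF D_pos[of 1]] by (intro mult_nonneg_nonneg) auto
 define T where "T = enn2real (muint F)"
 have T: "muint F = ennreal T" "0 \<le> T" using F by (auto simp: T_def L1_def)
 have le: "pint (\<lambda>x. ?G n x) \<le> ennreal (?t n powr (- p) * (w * (M + A * (M + ?t n)) * T))" for n
 proof -
  have "pint (\<lambda>x. ?G n x) = muint (\<lambda>x. ennreal ((1 / ?t n) powr p) * epowr (grad (?t n) x) p)"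
   by (intro nn_integral_cong) (simp only: epowr_mult[OF p_pos(1)] epowr_ennreal zero_le_divide_1_iff of_nat_0_le_iff)
  also have "\<dots> = ennreal ((1 / ?t n) powr p) * pint (\<lambda>x. grad (?t n) x)"
   by (intro nn_integral_cmult measurable_mu_borel) measurable
  also have "\<dots> \<le> ennreal ((1 / ?t n) powr p) * (ennreal (w * (M + A * (M + ?t n))) * ennreal T)"
   unfolding w_def T(1)[symmetric] by (intro mult_left_mono grad_energy) auto
  also have "\<dots> = ennreal ((1 / ?t n) powr p * (w * (M + A * (M + ?t n)) * T))"
   using w T(2) M_nonneg less_imp_le[OF A_pos] by (simp add: ennreal_mult)
  also have "(1 / ?t n) powr p = ?t n powr (- p)" by (simp add: powr_minus_divide powr_divide)
  finally show ?thesis .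
 qed
 have "(\<lambda>n. ?t n powr (- p) * (w * (M + A * (M + ?t n)) * T)) \<longlonglongrightarrow> 0"
 proof -
  have lim: "(\<lambda>n. ?t n powr q) \<longlonglongrightarrow> 0" if "q < 0" for q
   by (rule tendsto_neg_powr[OF that filterlim_compose[OF filterlim_real_sequentially filterlim_Suc]])
  have "(\<lambda>n. (w * (M + A * M) * T) * ?t n powr (- p) + (w * A * T) * ?t n powr (1 - p)) \<longlonglongrightarrow> 0"
   using p_gt_1 by (intro tendsto_add_zero tendsto_mult_right_zero lim) auto
  moreover have "?t n powr (- p) * (w * (M + A * (M + ?t n)) * T) =
    (w * (M + A * M) * T) * ?t n powr (- p) + (w * A * T) * ?t n powr (1 - p)" for n
  proof -
   have "?t n powr (1 - p) = ?t n * ?t n powr (- p)" using powr_mult_base[of "?t n" "- p"] by simp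
   then show ?thesis by (simp only:) (simp add: algebra_simps)
  qed
  ultimately show ?thesis by simp
 qed
 from tendsto_ennrealI[OF this]
 have z: "(\<lambda>n. ennreal (?t n powr (- p) * (w * (M + A * (M + ?t n)) * T))) \<longlonglongrightarrow> 0" unfolding ennreal_0 .
 show "(\<lambda>n. \<integral>\<^sup>+x. epowr (?G n x) p \<partial>\<mu>) \<longlonglongrightarrow> 0"
  by (rule tendsto_sandwich[OF always_eventually always_eventually tendsto_const z]) (rule allI le zero_le)+
qed

end

section \<open>Averages of a Newtonian function\<close>

lemma tendsto_realI:
 fixes a :: "nat \<Rightarrow> real"
 assumes q: "0 \<le> q" and e: "\<And>e. 0 < e \<Longrightarrow> eventually (\<lambda>k. \<bar>a k - L\<bar> \<le> q * e) sequentially"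
 shows "a \<longlonglongrightarrow> L"
proof (rule tendstoI)
 fix \<epsilon> :: real assume \<epsilon>: "0 < \<epsilon>"
 have "q * (\<epsilon> / (2 * q + 2)) < \<epsilon>" using q \<epsilon> by (simp add: field_simps add_nonneg_pos)
 moreover have "eventually (\<lambda>k. \<bar>a k - L\<bar> \<le> q * (\<epsilon> / (2 * q + 2))) sequentially" using q \<epsilon> by (intro e) auto
 ultimately show "eventually (\<lambda>k. dist (a k) L < \<epsilon>) sequentially"
  by (auto simp: dist_real_def elim!: eventually_mono)
qed

text \<open>Convergence is known only for almost every parameter, so a whole interval near
  \<open>t\<close> is needed from which a good parameter \<open>s\<close> can be picked. It lies to
  the right of \<open>t\<close>, or to the left if \<open>t\<close> is the right end.\<close>

lemma short_interval:
 fixes G :: "real \<Rightarrow> ennreal"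
 assumes G[measurable]: "borel_fun G" and fin: "lint 0 l G < \<infinity>"
  and l: "0 < l" and t: "t \<in> {0..l}" and e: "0 < e"
 obtains a b where "0 \<le> a" "a < b" "b \<le> l"
  "\<And>s. s \<in> {a..b} \<Longrightarrow> s \<noteq> t \<and> lint (min s t) (max s t) G \<le> ennreal e"
proof -
 define \<Phi> where "\<Phi> s = enn2real (lint 0 s G)" for s
 have fins: "lint s s' G < top" if "0 \<le> s" "s' \<le> l" for s s'
 proof -
  have "lint s s' G \<le> lint 0 l G" using that by (intro nn_integral_mono) (auto simp: indicator_def)
  then show ?thesis using fin by simp
 qed
 have diff: "lint s s' G = ennreal (\<Phi> s' - \<Phi> s)" if s: "0 \<le> s" "s \<le> s'" "s' \<le> l" for s s'
 proof -
  have "ennreal (\<Phi> s') = ennreal (\<Phi> s) + lint s s' G"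
   using fins[of 0 s'] fins[of 0 s] nn_integral_Icc_split[OF G s(1,2)] s by (simp add: \<Phi>_def)
  also have "\<dots> = ennreal (\<Phi> s + enn2real (lint s s' G))" using fins[of s s'] s by (simp add: \<Phi>_def)
  finally have "\<Phi> s' = \<Phi> s + enn2real (lint s s' G)" by (subst (asm) ennreal_inj) (auto simp: \<Phi>_def)
  then show ?thesis using fins[OF s(1,3)] by simp
 qed
 have "osc_le \<Phi> G 0 l" unfolding osc_le_def
 proof (intro allI impI)
  fix s s' assume s: "0 \<le> s" "s \<le> s'" "s' \<le> l"
  have "\<Phi> s \<le> \<Phi> s'" unfolding \<Phi>_def using fins[of 0 s'] s
   by (intro enn2real_mono nn_integral_mono) (auto simp: indicator_def)
  then show "ennreal \<bar>\<Phi> s - \<Phi> s'\<bar> \<le> lint s s' G" using diff[OF s] by simp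
 qed
 from osc_le_continuous[OF G this fin] have "continuous_on {0..l} \<Phi>" .
 then obtain d where d: "0 < d" "\<And>s. s \<in> {0..l} \<Longrightarrow> dist s t < d \<Longrightarrow> dist (\<Phi> s) (\<Phi> t) < e"
  using t e unfolding continuous_on_iff by metis
 have *: "s \<noteq> t \<and> lint (min s t) (max s t) G \<le> ennreal e"
  if "s \<in> {0..l}" "s \<noteq> t" "dist s t < d" for s using that diff[of "min s t" "max s t"] d(2)[OF that(1,3)] t
  by (auto simp: dist_real_def min_def max_def intro!: ennreal_leI)
 show ?thesis
 proof (cases "t < l")
  case True
  define k where "k = min d (l - t)"
  define h where "h = k / 4"
  have "k \<le> d" "k \<le> l - t" "0 < k" using d(1) True by (auto simp: k_def)
  then have h: "0 < h" "2 * h < d" "t + 2 * h \<le> l" by (auto simp: h_def)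
  show ?thesis by (rule that[of "t + h" "t + 2 * h"]; (rule *)?) (use h t in \<open>auto simp: dist_real_def\<close>)
 next
  case False
  define h where "h = min d l / 4"
  have h: "0 < h" "2 * h < d" "2 * h \<le> l" using d l by (auto simp: h_def)
  show ?thesis by (rule that[of "t - 2 * h" "t - h"]; (rule *)?) (use h t False in \<open>auto simp: dist_real_def\<close>)
 qed
qed

context doubling_measure
begin

definition mean :: "('a \<Rightarrow> real) \<Rightarrow> 'a \<Rightarrow> real \<Rightarrow> real" where
 "mean w x r = nu (\<lambda>y. ennreal (w y)) x r / m x r"

end

text \<open>The potential is now that of \<open>g\<close> to the power \<open>p\<close> for one
  bounded function \<open>w\<close>, and the Poincare inequality is assumed for this function alone,
  with radius in place of diameter. The condition \<open>2 * \<Lambda> <= K\<close> lets the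
  \<open>\<Lambda>\<close>-dilate of a doubled ball fit into the ball of the preceding
  scale.\<close>

locale newton_potential = wolff_potential +
 fixes w :: "'a \<Rightarrow> real" and g :: "'a \<Rightarrow> ennreal" and \<Lambda> C1 :: real
 assumes w_measurable: "w \<in> borel_measurable \<mu>" and w_nonneg: "0 \<le> w x" and w_le_1: "w x \<le> 1"
  and w_supp: "x \<notin> ball z R \<Longrightarrow> w x = 0"
  and w_ACC: "ACC UNIV (\<lambda>x. ereal (w x)) g" and g_Lp: "Lp g" and F_eq: "F = (\<lambda>x. epowr (g x) p)"
  and \<Lambda>: "1 \<le> \<Lambda>" "2 * \<Lambda> \<le> K" and C1: "0 \<le> C1"
  and poincare: "0 < r \<Longrightarrow> muint_on (ball x r) (\<lambda>y. ennreal \<bar>w y - mean w x r\<bar>)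
   \<le> ennreal (C1 * r * m x r * (nu F x (\<Lambda> * r) / m x (\<Lambda> * r)) powr (1 / p))"
begin

lemma ball_mu [measurable]: "ball (x::'a) r \<in> sets \<mu>" by (rule sets_mu_borel) simp

lemma ennreal_w_measurable [measurable]: "(\<lambda>y. ennreal (w y)) \<in> borel_measurable \<mu>" using w_measurable by measurable

lemma mean_nonneg: "0 < r \<Longrightarrow> 0 \<le> mean w x r"
 unfolding mean_def using nu_nonneg m_pos[of r x] by (simp add: less_imp_le)

lemma nn_integral_w: "0 < r \<Longrightarrow> muint_on (ball x r) (\<lambda>y. ennreal (w y)) = ennreal (mean w x r * m x r)"
proof -
 assume r: "0 < r"
 have "muint_on (ball x r) (\<lambda>y. ennreal (w y)) \<le> muint (\<lambda>y. indicator (ball x r) y)"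
  using w_le_1 by (intro nn_integral_mono) (auto simp: indicator_def)
 also have "\<dots> < top" using ball_finite[OF r, of x] by simp
 finally show ?thesis using m_pos[OF r, of x] unfolding mean_def nu_def by simp
qed

lemma mean_diff_le:
 assumes r: "0 < r" and a: "0 \<le> a" and I: "0 \<le> I" "muint_on (ball x r) (\<lambda>y. ennreal \<bar>w y - a\<bar>) \<le> ennreal I"
 shows "\<bar>mean w x r - a\<bar> \<le> I / m x r"
proof -
 have [measurable]: "w \<in> borel_measurable \<mu>" by (rule w_measurable)
 let ?J = "\<integral>\<^sup>+y\<in>ball x r. ennreal \<bar>w y - a\<bar> \<partial>\<mu>"
 have mr: "0 < m x r" by (rule m_pos[OF r])
 have a_int: "muint_on (ball x r) (\<lambda>y. ennreal a) = ennreal (a * m x r)"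
  using a r mr by (simp add: nn_integral_cmult_indicator emeasure_ball ennreal_mult)
 have "ennreal (mean w x r * m x r) \<le> muint (\<lambda>y. ennreal a * indicator (ball x r) y + ennreal \<bar>w y - a\<bar> * indicator (ball x r) y)"
  unfolding nn_integral_w[OF r, symmetric] using a w_nonneg
  by (intro nn_integral_mono) (auto simp: indicator_def ennreal_plus[symmetric] simp del: ennreal_plus intro!: ennreal_leI)
 also have "\<dots> = ennreal (a * m x r) + ?J" unfolding a_int[symmetric] by (intro nn_integral_add) measurable
 also have "\<dots> \<le> ennreal (a * m x r) + ennreal I" by (intro add_left_mono I)
 also have "\<dots> = ennreal (a * m x r + I)" using a mr I by (intro ennreal_plus[symmetric]) auto
 finally have 1: "mean w x r * m x r \<le> a * m x r + I" using a mr I by (subst (asm) ennreal_le_iff) auto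
 have "ennreal (a * m x r) \<le> muint (\<lambda>y. ennreal (w y) * indicator (ball x r) y + ennreal \<bar>w y - a\<bar> * indicator (ball x r) y)"
  unfolding a_int[symmetric] using a w_nonneg
  by (intro nn_integral_mono) (auto simp: indicator_def ennreal_plus[symmetric] simp del: ennreal_plus intro!: ennreal_leI)
 also have "\<dots> = ennreal (mean w x r * m x r) + ?J"
  unfolding nn_integral_w[OF r, symmetric] by (intro nn_integral_add) measurable
 also have "\<dots> \<le> ennreal (mean w x r * m x r) + ennreal I" by (intro add_left_mono I)
 also have "\<dots> = ennreal (mean w x r * m x r + I)" using mean_nonneg[OF r] mr I by (intro ennreal_plus[symmetric]) auto
 finally have 2: "a * m x r \<le> mean w x r * m x r + I" using mean_nonneg[OF r, of x] mr I by (subst (asm) ennreal_le_iff) auto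
 have "\<bar>mean w x r - a\<bar> * m x r \<le> I" using 1 2 mr by (auto simp: abs_if algebra_simps)
 then show ?thesis using mr by (simp add: field_simps)
qed

text \<open>The \<open>p\<close>-th root of the density measures the oscillation of the averages at scale \<open>j\<close>.\<close>

definition e :: "nat \<Rightarrow> 'a \<Rightarrow> real" where "e j x = dens j x powr (1 / p)"

lemma e_nonneg: "0 \<le> e j x" by (simp add: e_def)

lemma e_eq: "e j x = rad j * (nu F x (rad j) / m x (rad j)) powr (1 / p)"
proof -
 have "e j x = (rad j powr p * (nu F x (rad j) / m x (rad j))) powr (1 / p)" by (simp add: e_def dens_def)
 also have "\<dots> = (rad j powr p) powr (1 / p) * (nu F x (rad j) / m x (rad j)) powr (1 / p)" by (rule powr_mult)
 finally show ?thesis using rad_pos[of j] by (simp add: powr_powr)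
qed

text \<open>One factor 2 comes from the radius \<open>2 * rad (Suc j)\<close> in the Poincare
  inequality, another from comparing two balls with a third. \<open>D (2 * K)\<close> compares the
  measures of the balls, and the root of \<open>D K\<close> the densities of \<open>F\<close> at two
  radii.\<close>

definition C2 :: real where "C2 = 4 * D (2 * K) * C1 * D K powr (1 / p)"

lemma C2_nonneg: "0 \<le> C2"
 unfolding C2_def using C1 less_imp_le[OF D_pos[of "2 * K"]] by (intro mult_nonneg_nonneg) auto

text \<open>Both averages are compared with the average over
  \<open>ball x (2 * rad (Suc j))\<close>, which contains both balls. The lower bound on
  \<open>s\<close> keeps the measure of the smaller ball comparable.\<close>

lemma mean_step:
 assumes sub: "ball y s \<subseteq> ball x (2 * rad (Suc j))" and s: "rad (Suc (Suc j)) \<le> s"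
 shows "\<bar>mean w y s - mean w x (rad (Suc j))\<bar> \<le> C2 * e j x"
proof -
 let ?\<rho> = "rad (Suc j)" and ?a = "mean w x (2 * rad (Suc j))"
 let ?q = "(nu F x (\<Lambda> * (2 * rad (Suc j))) / m x (\<Lambda> * (2 * rad (Suc j)))) powr (1 / p)"
 have \<rho>: "0 < ?\<rho>" "0 < rad j" "rad j = K * ?\<rho>" "?\<rho> = K * rad (Suc (Suc j))" by (rule rad_pos rad_Suc)+
 have \<Lambda>\<rho>: "0 < \<Lambda> * (2 * ?\<rho>)" "\<Lambda> * (2 * ?\<rho>) \<le> rad j" "?\<rho> \<le> \<Lambda> * (2 * ?\<rho>)" "?\<rho> \<le> rad j"
 proof -
  have "(2 * \<Lambda>) * ?\<rho> \<le> K * ?\<rho>" "1 * ?\<rho> \<le> \<Lambda> * ?\<rho>" using \<Lambda> \<rho>(1) by (intro mult_right_mono; simp)+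
  then show "0 < \<Lambda> * (2 * ?\<rho>)" "\<Lambda> * (2 * ?\<rho>) \<le> rad j" "?\<rho> \<le> \<Lambda> * (2 * ?\<rho>)" "?\<rho> \<le> rad j"
   unfolding \<rho>(3) using \<rho>(1) by linarith+
 qed
 have q: "?q \<le> D K powr (1 / p) * (nu F x (rad j) / m x (rad j)) powr (1 / p)"
 proof -
  have "K * ?\<rho> \<le> K * (\<Lambda> * (2 * ?\<rho>))" using K \<Lambda>\<rho>(3) by (intro mult_left_mono) auto
  then have mm: "m x (rad j) \<le> D K * m x (\<Lambda> * (2 * ?\<rho>))" using \<rho> \<Lambda>\<rho> K by (intro m_compare) auto
  have nn: "nu F x (\<Lambda> * (2 * ?\<rho>)) \<le> nu F x (rad j)" using \<Lambda>\<rho>(2) by (intro nu_mono[OF F] subset_ball)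
  have "nu F x (\<Lambda> * (2 * ?\<rho>)) * m x (rad j) \<le> nu F x (rad j) * (D K * m x (\<Lambda> * (2 * ?\<rho>)))"
   using nn mm nu_nonneg m_pos[OF \<rho>(2), of x] by (intro mult_mono) auto
  then have "nu F x (\<Lambda> * (2 * ?\<rho>)) / m x (\<Lambda> * (2 * ?\<rho>)) \<le> D K * (nu F x (rad j) / m x (rad j))"
   using m_pos[OF \<rho>(2), of x] m_pos[OF \<Lambda>\<rho>(1), of x] by (simp add: field_simps)
  moreover have "0 \<le> nu F x (\<Lambda> * (2 * ?\<rho>)) / m x (\<Lambda> * (2 * ?\<rho>))"
   using nu_nonneg m_pos[OF \<Lambda>\<rho>(1), of x] by (simp add: less_imp_le)
  ultimately have "?q \<le> (D K * (nu F x (rad j) / m x (rad j))) powr (1 / p)" using p_pos by (intro powr_mono2) auto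
  then show ?thesis by (simp only: powr_mult)
 qed
 have close: "\<bar>mean w y' s' - ?a\<bar> \<le> C2 / 2 * e j x"
  if sub': "ball y' s' \<subseteq> ball x (2 * ?\<rho>)" and s': "rad (Suc (Suc j)) \<le> s'" for y' s'
 proof -
  have s0: "0 < s'" using rad_pos[of "Suc (Suc j)"] s' by linarith
  then have "dist x y' < 2 * ?\<rho>" using sub' by (auto simp: subset_iff)
  moreover have "2 * ?\<rho> \<le> 2 * K * s'" using \<rho>(4) s' K by simp
  ultimately have mm: "m x (2 * ?\<rho>) \<le> D (2 * K) * m y' s'" using \<rho> s0 by (intro m_compare) auto
  let ?I = "C1 * (2 * ?\<rho>) * m x (2 * ?\<rho>) * ?q"
  have I0: "0 \<le> ?I" using C1 \<rho> m_pos[of "2 * ?\<rho>" x] by simp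
  have "muint_on (ball y' s') (\<lambda>y. ennreal \<bar>w y - ?a\<bar>) \<le> muint_on (ball x (2 * ?\<rho>)) (\<lambda>y. ennreal \<bar>w y - ?a\<bar>)"
   using sub' by (intro nn_integral_mono) (auto simp: indicator_def)
  also have "\<dots> \<le> ennreal ?I" using \<rho> by (intro poincare) auto
  finally have "\<bar>mean w y' s' - ?a\<bar> \<le> ?I / m y' s'" using \<rho> by (intro mean_diff_le s0 mean_nonneg I0) auto
  also have "\<dots> \<le> D (2 * K) * (C1 * (2 * ?\<rho>) * ?q)"
  proof -
   have "(C1 * (2 * ?\<rho>) * ?q) * m x (2 * ?\<rho>) \<le> (C1 * (2 * ?\<rho>) * ?q) * (D (2 * K) * m y' s')"
    using C1 \<rho> by (intro mult_left_mono mm) auto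
   then show ?thesis using m_pos[OF s0, of y'] by (simp add: field_simps)
  qed
  also have "\<dots> \<le> D (2 * K) * (C1 * (2 * rad j) * (D K powr (1 / p) * (nu F x (rad j) / m x (rad j)) powr (1 / p)))"
   using C1 \<rho> \<Lambda>\<rho> q less_imp_le[OF D_pos[of "2 * K"]] by (intro mult_left_mono mult_mono) auto
  also have "\<dots> = C2 / 2 * e j x" by (simp add: C2_def e_eq)
  finally show ?thesis .
 qed
 have "ball x ?\<rho> \<subseteq> ball x (2 * ?\<rho>)" using \<rho> by (intro subset_ball) simp
 moreover have "rad (Suc (Suc j)) \<le> ?\<rho>" by (rule rad_antimono) simp
 ultimately show ?thesis using close[OF sub s] close[of x ?\<rho>] by linarith
qed

text \<open>At the point \<open>snd c \<tau>\<close>, \<open>mean_step\<close> compares the averages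
  at all points of the curve within one radius. This is control at a single scale only, which is
  what \<open>chain_bound\<close> accepts.\<close>

lemma mean_along_curve:
 assumes c: "c \<in> curves UNIV" and st: "0 \<le> s" "t \<le> fst c" "s + rad (Suc j) \<le> t"
 shows "ennreal \<bar>mean w (snd c s) (rad (Suc j)) - mean w (snd c t) (rad (Suc j))\<bar>
  \<le> lint s t (\<lambda>x. ennreal (4 * K * C2) * epowr (av F (rad j) (clamped c x)) (1 / p))"
proof (rule chain_bound[where d = "rad (Suc j)" and f = "\<lambda>t. mean w (snd c t) (rad (Suc j))"])
 have [measurable]: "av F (rad j) \<in> borel_measurable borel" using F by (intro av_borel) (simp add: L1_def)
 have "borel_fun (\<lambda>x. ennreal (4 * K * C2) * epowr (av F (rad j) x) (1 / p))" by measurable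
 from clamped_comp_measurable[OF c this]
 show "borel_fun (\<lambda>x. ennreal (4 * K * C2) * epowr (av F (rad j) (clamped c x)) (1 / p))" .
 fix x y \<tau> assume x: "s \<le> x" "x \<le> \<tau>" "\<tau> \<le> y" "y \<le> t" and yx: "rad (Suc j) / 2 \<le> y - x" "y - x \<le> rad (Suc j)"
 let ?\<rho> = "rad (Suc j)" and ?f = "\<lambda>t. mean w (snd c t) (rad (Suc j))" and ?a = "nu F (snd c \<tau>) (rad j) / m (snd c \<tau>) (rad j)"
 have \<tau>: "clamped c \<tau> = snd c \<tau>" using x st by (intro clamped_eq) auto
 have a0: "0 \<le> ?a" using nu_nonneg m_pos[OF rad_pos, of "snd c \<tau>" j] by (simp add: less_imp_le)
 have near: "\<bar>?f t' - ?f \<tau>\<bar> \<le> C2 * e j (snd c \<tau>)" if "x \<le> t'" "t' \<le> y" for t'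
 proof (rule mean_step)
  have "dist (snd c t') (snd c \<tau>) \<le> \<bar>t' - \<tau>\<bar>" using that x st by (intro curves_lipschitz[OF c]) auto
  then show "ball (snd c t') ?\<rho> \<subseteq> ball (snd c \<tau>) (2 * ?\<rho>)" using that x yx by (intro ball_subset_ball) auto
 qed (rule rad_antimono, simp)
 have "\<bar>?f x - ?f y\<bar> \<le> 2 * (C2 * e j (snd c \<tau>))" using near[of x] near[of y] x by auto
 also have "\<dots> = 2 * C2 * (?a powr (1 / p)) * rad j" by (simp add: e_eq)
 \<comment> \<open>A step is at least half of \<open>rad (Suc j)\<close>, so \<open>rad j\<close> is
   at most \<open>2 * K * (y - x)\<close>; this converts the oscillation into a slope.\<close>
 also have "\<dots> \<le> 2 * C2 * (?a powr (1 / p)) * (2 * K * (y - x))"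
 proof (rule mult_left_mono)
  have "K * ?\<rho> \<le> K * (2 * (y - x))" using yx K by (intro mult_left_mono) auto
  then show "rad j \<le> 2 * K * (y - x)" by (simp add: rad_Suc[of j] mult_ac)
 qed (use C2_nonneg in simp)
 also have "\<dots> = (y - x) * (4 * K * C2 * ?a powr (1 / p))" by simp
 finally have "ennreal \<bar>?f x - ?f y\<bar> \<le> ennreal ((y - x) * (4 * K * C2 * ?a powr (1 / p)))" by (rule ennreal_leI)
 also have "\<dots> = ennreal (y - x) * (ennreal (4 * K * C2) * epowr (av F (rad j) (clamped c \<tau>)) (1 / p))"
  using a0 x K C2_nonneg by (simp add: \<tau> av_L1[OF F rad_pos] epowr_ennreal ennreal_mult)
 finally show "ennreal \<bar>?f x - ?f y\<bar> \<le> ennreal (y - x) * (ennreal (4 * K * C2) * epowr (av F (rad j) (clamped c \<tau>)) (1 / p))" .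
qed (use rad_pos st in auto)

text \<open>The excess of the root of the average of \<open>F\<close> over \<open>g\<close>, up to a
  constant. The p-th power of its norm is \<open>av_dist F (rad j)\<close> and tends to 0.\<close>

definition h :: "nat \<Rightarrow> 'a \<Rightarrow> ennreal" where
 "h j x = epowr (ndist (av F (rad j) x) (F x)) (1 / p)"

lemma F_borel [measurable]: "borel_fun F" using F by (simp add: L1_def)

lemma av_rad_borel [measurable]: "av F (rad j) \<in> borel_measurable borel" by (rule av_borel[OF F_borel])

lemma h_borel [measurable]: "borel_fun (h j)" unfolding h_def[abs_def] by measurable

lemma av_root_le: "epowr (av F (rad j) x) (1 / p) \<le> ennreal (2 powr (1 / p)) * (g x + h j x)"
proof -
 have "epowr (av F (rad j) x) (1 / p) \<le> epowr (F x + ndist (av F (rad j) x) (F x)) (1 / p)"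
  by (intro epowr_mono le_add_ndist) simp
 also have "\<dots> \<le> ennreal (2 powr (1 / p)) * (epowr (F x) (1 / p) + h j x)"
  unfolding h_def by (intro epowr_add_le) simp
 finally show ?thesis by (simp add: F_eq epowr_epowr)
qed

text \<open>Along a fast subsequence the errors \<open>h\<close> are at most
  \<open>(1/2) ^ k\<close> times one \<open>Lp\<close> density. On almost every curve the averages
  at two parameters then differ by a multiple of the integral of \<open>g\<close> between them plus
  a vanishing term. Every parameter has nearby ones at which the averages converge, and
  \<open>w\<close> is continuous along the curve, so they converge at every point of the
  curve.\<close>

lemma means_converge:
 obtains r where "strict_mono r" "exceptional {x. \<not> (\<lambda>k. mean w x (rad (Suc (r k)))) \<longlonglongrightarrow> w x}"
proof -
 obtain W where W[measurable]: "borel_fun W" and wW: "AE x in \<mu>. ennreal (w x) = W x"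
  by (rule measurable_mu_AE_borel[OF ennreal_w_measurable]) blast
 have nuW: "nu W x s = nu (\<lambda>y. ennreal (w y)) x s" for x s
  unfolding nu_def using wW by (intro arg_cong[where f=enn2real] nn_integral_cong_AE) auto
 have W1: "L1 W"
 proof -
  have "muint W = muint (\<lambda>y. ennreal (w y))" using wW by (intro nn_integral_cong_AE) auto
  also have "\<dots> = muint_on (ball z R) (\<lambda>y. ennreal (w y))"
   using w_supp by (intro nn_integral_cong) (auto simp: indicator_def)
  finally show ?thesis unfolding L1_def by (simp add: nn_integral_w[OF R] W)
 qed
 \<comment> \<open>The power of 2 with exponent \<open>- real k * p\<close> absorbs the factor
   \<open>2 ^ k\<close> placed on the p-th root \<open>h\<close>; the power of \<open>1/2\<close>
   makes the energies summable.\<close>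
 define \<epsilon> where "\<epsilon> k = (1/2) ^ Suc k * 2 powr (- real k * p)" for k :: nat
 have "(\<lambda>j. av_dist F (rad j) + av_dist W (rad (Suc j))) \<longlonglongrightarrow> 0 + 0"
  by (intro tendsto_add averages_converge F W1 rad_pos rad_tendsto LIMSEQ_Suc)
 then have "(\<lambda>j. av_dist F (rad j) + av_dist W (rad (Suc j))) \<longlonglongrightarrow> 0" by simp
 from fast_subseq[OF this, of "\<lambda>k. ennreal (\<epsilon> k)"] obtain r where r: "strict_mono r"
  and le: "\<And>k. av_dist F (rad (r k)) + av_dist W (rad (Suc (r k))) \<le> ennreal (\<epsilon> k)" by (rule) (auto simp: \<epsilon>_def)
 have leF: "av_dist F (rad (r k)) \<le> ennreal (\<epsilon> k)" and leW: "av_dist W (rad (Suc (r k))) \<le> ennreal (\<epsilon> k)" for k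
  using le[of k] by (auto intro: order_trans[rotated])
 let ?a = "\<lambda>k x. mean w x (rad (Suc (r k)))"
 have conv: "AE x in \<mu>. (\<lambda>k. ?a k x) \<longlonglongrightarrow> w x"
 proof -
  have [measurable]: "borel_fun (av W s)" for s by (rule av_borel[OF W])
  have "muint (\<lambda>x. \<Sum>k. ndist (av W (rad (Suc (r k))) x) (W x)) = (\<Sum>k. av_dist W (rad (Suc (r k))))"
   unfolding av_dist_def by (intro nn_integral_suminf measurable_mu_borel) measurable
  also have "\<dots> \<le> (\<Sum>k. ennreal (1 * (1/2) ^ Suc k))"
  proof (intro suminf_le order_trans[OF leW] ennreal_leI)
   fix k :: nat
   have "2 powr (- real k * p) \<le> 2 powr 0" by (intro powr_mono) auto
   then show "\<epsilon> k \<le> 1 * (1/2) ^ Suc k" unfolding \<epsilon>_def by (simp add: field_simps)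
  qed auto
  also have "\<dots> = ennreal 1" by (rule sum_half_powers) simp
  finally have "muint (\<lambda>x. \<Sum>k. ndist (av W (rad (Suc (r k))) x) (W x)) \<noteq> \<infinity>"
   using ennreal_one_less_top by (auto simp: top_unique)
  then have "AE x in \<mu>. (\<Sum>k. ndist (av W (rad (Suc (r k))) x) (W x)) \<noteq> \<infinity>"
   by (intro nn_integral_noteq_infinite measurable_mu_borel) measurable
  then show ?thesis using wW
  proof eventually_elim
   case (elim x)
   have t: "ndist (av W (rad (Suc (r k))) x) (W x) = ennreal \<bar>?a k x - w x\<bar>" for k
    unfolding elim(2)[symmetric] av_L1[OF W1 rad_pos] nuW mean_def[symmetric]
    by (intro ndist_real mean_nonneg rad_pos w_nonneg)
   have "(\<Sum>k. ennreal \<bar>?a k x - w x\<bar>) < \<infinity>" using elim(1) by (simp add: t less_top)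
   from suminf_finite_tendsto_0[OF this] obtain \<delta> where "\<forall>k. ennreal \<bar>?a k x - w x\<bar> = ennreal (\<delta> k) \<and> 0 \<le> \<delta> k" "\<delta> \<longlonglongrightarrow> 0"
    by blast
   then have "\<bar>?a k x - w x\<bar> = \<delta> k" for k by (metis abs_ge_zero ennreal_inj)
   then have "(\<lambda>k. \<bar>?a k x - w x\<bar>) \<longlonglongrightarrow> 0" using \<open>\<delta> \<longlonglongrightarrow> 0\<close> by simp
   then show ?case by (simp only: tendsto_rabs_zero_iff LIM_zero_iff)
  qed
 qed
 have "(\<Sum>k. \<integral>\<^sup>+x. epowr (ennreal (2 ^ k) * h (r k) x) p \<partial>\<mu>) \<le> (\<Sum>k. ennreal (1 * (1/2) ^ Suc k))"
 proof (intro suminf_le)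
  fix k :: nat
  have "pint (\<lambda>x. ennreal (2 ^ k) * h (r k) x) = muint (\<lambda>x. ennreal ((2 ^ k) powr p) * ndist (av F (rad (r k)) x) (F x))"
   by (intro nn_integral_cong) (simp add: epowr_mult epowr_ennreal h_def epowr_epowr)
  also have "\<dots> = ennreal ((2 ^ k) powr p) * av_dist F (rad (r k))"
   unfolding av_dist_def by (intro nn_integral_cmult measurable_mu_borel) measurable
  also have "\<dots> \<le> ennreal ((2 ^ k) powr p) * ennreal (\<epsilon> k)" by (intro mult_left_mono leF) simp
  also have "\<dots> = ennreal (1 * (1/2) ^ Suc k)"
  proof -
   have "(2 ^ k) powr p * \<epsilon> k = (1/2) ^ Suc k * ((2 powr real k) powr p * 2 powr (- real k * p))"
    by (simp add: \<epsilon>_def powr_realpow)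
   also have "(2 powr real k) powr p * 2 powr (- real k * p) = 1" by (simp add: powr_powr powr_add[symmetric])
   finally show ?thesis by (simp add: ennreal_mult[symmetric] \<epsilon>_def)
  qed
  finally show "pint (\<lambda>x. ennreal (2 ^ k) * h (r k) x) \<le> ennreal (1 * (1/2) ^ Suc k)" .
 qed auto
 also have "\<dots> = ennreal 1" by (rule sum_half_powers) simp
 finally have "(\<Sum>k. \<integral>\<^sup>+x. epowr (ennreal (2 ^ k) * h (r k) x) p \<partial>\<mu>) < \<infinity>"
  using ennreal_one_less_top by (auto simp: top_unique intro: le_less_trans)
 note fin = this
 have "borel_fun (\<lambda>x. ennreal (2 ^ k) * h (r k) x)" for k by measurable
 then obtain \<rho> where \<rho>: "Lp \<rho>" "\<And>k x. ennreal (2 ^ k) * h (r k) x \<le> \<rho> x" by (rule Lp_countable_bound[OF _ fin]) blast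
 have "aec UNIV (\<lambda>c. (ac_along (\<lambda>x. ereal (w x)) g c \<and> line_integral \<rho> c < \<infinity>) \<and>
   (ae_along c (\<lambda>x. (\<lambda>k. ?a k x) \<longlonglongrightarrow> w x)))" using w_ACC by (intro aec_conj aec_Lp \<rho> aec_AE conv) (simp add: ACC_def)
 then have "aec UNIV (\<lambda>c. \<forall>t\<in>{0..fst c}. snd c t \<notin> {x. \<not> (\<lambda>k. ?a k x) \<longlonglongrightarrow> w x})"
 proof (rule aec_mp, intro ballI)
  fix c t assume c: "c \<in> curves UNIV" and t: "t \<in> {0..fst c}"
   and P: "(ac_along (\<lambda>x. ereal (w x)) g c \<and> line_integral \<rho> c < \<infinity>) \<and>
    (ae_along c (\<lambda>x. (\<lambda>k. ?a k x) \<longlonglongrightarrow> w x))"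
  define I where "I = enn2real (line_integral \<rho> c)"
  have I: "line_integral \<rho> c = ennreal I" "0 \<le> I" using P by (auto simp: I_def)
  let ?q = "4 * K * C2 * 2 powr (1 / p)"
  have q: "0 \<le> ?q" using K C2_nonneg by simp
  have gm[measurable]: "borel_fun g" using Lp_measurable[OF g_Lp] .
  have gcm[measurable]: "borel_fun (\<lambda>t. g (clamped c t))" by (rule clamped_comp_measurable[OF c gm])
  have hcm[measurable]: "borel_fun (\<lambda>t. h k (clamped c t))" for k by (rule clamped_comp_measurable[OF c h_borel])
  obtain \<phi> where \<phi>: "\<And>t. 0 \<le> t \<Longrightarrow> t \<le> fst c \<Longrightarrow> ereal (w (snd c t)) = ereal (\<phi> t)"
   "osc_le \<phi> (\<lambda>t. g (clamped c t)) 0 (fst c)" and fin: "line_integral g c < \<infinity>"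
   using P by (elim conjE ac_alongE) blast
  have fin': "lint 0 (fst c) (\<lambda>x. g (clamped c x)) < \<infinity>" using fin by (simp add: clamped_line_integral)
  have "(\<lambda>k. ?a k (snd c t)) \<longlonglongrightarrow> w (snd c t)"
  proof (rule tendsto_realI)
   show "0 \<le> ?q + (?q + 2)" using q by simp
   fix \<eta> :: real assume \<eta>: "0 < \<eta>"
   \<comment> \<open>A parameter \<open>s\<close> is taken in this interval. Three errors then add
     up: the averages between \<open>s\<close> and \<open>t\<close>, their convergence at
     \<open>s\<close>, and the oscillation of \<open>w\<close> between \<open>s\<close> and
     \<open>t\<close>.\<close>
   obtain a b where ab: "0 \<le> a" "a < b" "b \<le> fst c"
    and small: "\<And>s. s \<in> {a..b} \<Longrightarrow> s \<noteq> t \<and> lint (min s t) (max s t) (\<lambda>x. g (clamped c x)) \<le> ennreal \<eta>"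
    by (rule short_interval[OF gcm fin' curves_pos[OF c] t \<eta>]) blast
   have "AE t in lborel. t \<in> {a..b} \<longrightarrow> (\<lambda>k. ?a k (snd c t)) \<longlonglongrightarrow> w (snd c t)" using P ab by (auto elim!: AE_mp)
   then obtain s where s: "s \<in> {a..b}" and lim: "(\<lambda>k. ?a k (snd c s)) \<longlonglongrightarrow> w (snd c s)"
    by (rule AE_Icc_ex[OF _ ab(2)]) blast
   define u v where "u = min s t" and "v = max s t"
   have uv: "0 \<le> u" "u < v" "v \<le> fst c" and int: "lint u v (\<lambda>x. g (clamped c x)) \<le> ennreal \<eta>"
    using small[OF s] s ab t by (auto simp: u_def v_def min_def max_def)
   have sym: "\<bar>\<zeta> (snd c t) - \<zeta> (snd c s)\<bar> = \<bar>\<zeta> (snd c u) - \<zeta> (snd c v)\<bar>" for \<zeta> :: "'a \<Rightarrow> real"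
    by (auto simp: u_def v_def min_def max_def abs_minus_commute)
   have w_close: "\<bar>w (snd c t) - w (snd c s)\<bar> \<le> \<eta>"
   proof -
    have "ennreal \<bar>\<phi> u - \<phi> v\<bar> \<le> ennreal \<eta>" using osc_leD[OF \<phi>(2), of u v] uv int by auto
    moreover have "w (snd c u) = \<phi> u" "w (snd c v) = \<phi> v" using \<phi>(1)[of u] \<phi>(1)[of v] uv by auto
    ultimately show ?thesis unfolding sym using \<eta> by simp
   qed
   have ev1: "eventually (\<lambda>k. rad (Suc (r k)) < v - u) sequentially"
   proof -
    have "(\<lambda>k. rad (Suc (r k))) \<longlonglongrightarrow> 0"
     using LIMSEQ_subseq_LIMSEQ[OF LIMSEQ_Suc[OF rad_tendsto] r] by (simp add: o_def)
    then show ?thesis using uv by (intro order_tendstoD(2)) auto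
   qed
   have ev2: "eventually (\<lambda>k. \<bar>?a k (snd c s) - w (snd c s)\<bar> < \<eta>) sequentially"
    using tendstoD[OF lim \<eta>] by (simp add: dist_real_def)
   have ev3: "eventually (\<lambda>k. (1/2) ^ k * I < \<eta>) sequentially"
   proof -
    have "(\<lambda>k. (1/2) ^ k * I) \<longlonglongrightarrow> 0" by (intro tendsto_mult_left_zero LIMSEQ_power_zero) auto
    then show ?thesis using \<eta> by (rule order_tendstoD(2))
   qed
   show "eventually (\<lambda>k. \<bar>?a k (snd c t) - w (snd c t)\<bar> \<le> (?q + (?q + 2)) * \<eta>) sequentially" using ev1 ev2 ev3
   proof eventually_elim
    case (elim k)
    have hk: "lint u v (\<lambda>x. h (r k) (clamped c x)) \<le> ennreal \<eta>"
    proof -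
     have hle: "h (r k) x \<le> ennreal ((1/2) ^ k) * \<rho> x" for x
     proof -
      have "h (r k) x = ennreal ((1/2) ^ k) * (ennreal (2 ^ k) * h (r k) x)"
       by (simp add: mult.assoc[symmetric] ennreal_mult[symmetric] power_mult_distrib[symmetric])
      also have "\<dots> \<le> ennreal ((1/2) ^ k) * \<rho> x" by (intro mult_left_mono \<rho>) simp
      finally show ?thesis .
     qed
     have "lint u v (\<lambda>x. h (r k) (clamped c x)) \<le> lint 0 (fst c) (\<lambda>x. ennreal ((1/2) ^ k) * \<rho> (clamped c x))"
      using uv hle by (intro nn_integral_mono) (auto simp: indicator_def)
     also have "\<dots> = line_integral (\<lambda>x. ennreal ((1/2) ^ k) * \<rho> x) c" by (rule clamped_line_integral)
     also have "\<dots> = ennreal ((1/2) ^ k) * line_integral \<rho> c" by (rule line_integral_cmult[OF c Lp_measurable[OF \<rho>(1)]])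
     also have "\<dots> = ennreal ((1/2) ^ k * I)" using I by (simp add: ennreal_mult)
     also have "\<dots> \<le> ennreal \<eta>" using elim(3) by (intro ennreal_leI) simp
     finally show ?thesis .
    qed
    have "ennreal \<bar>?a k (snd c u) - ?a k (snd c v)\<bar>
      \<le> lint u v (\<lambda>x. ennreal (4 * K * C2) * epowr (av F (rad (r k)) (clamped c x)) (1 / p))"
     using uv elim(1) by (intro mean_along_curve[OF c]) auto
    also have "\<dots> \<le> lint u v (\<lambda>x. ennreal ?q * g (clamped c x) + ennreal ?q * h (r k) (clamped c x))"
    proof (intro nn_integral_mono mult_right_mono)
     fix x
     have "ennreal (4 * K * C2) * epowr (av F (rad (r k)) (clamped c x)) (1 / p) \<le>
       ennreal (4 * K * C2) * (ennreal (2 powr (1 / p)) * (g (clamped c x) + h (r k) (clamped c x)))"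
      by (intro mult_left_mono av_root_le) simp
     also have "\<dots> = ennreal ?q * g (clamped c x) + ennreal ?q * h (r k) (clamped c x)"
      using K C2_nonneg by (simp add: ennreal_mult distrib_left mult.assoc)
     finally show "ennreal (4 * K * C2) * epowr (av F (rad (r k)) (clamped c x)) (1 / p) \<le> \<dots>" .
    qed simp
    also have "\<dots> = ennreal ?q * lint u v (\<lambda>x. g (clamped c x)) + ennreal ?q * lint u v (\<lambda>x. h (r k) (clamped c x))"
     by (rule nn_integral_lincomb[OF gcm hcm])
    also have "\<dots> \<le> ennreal ?q * ennreal \<eta> + ennreal ?q * ennreal \<eta>" by (intro add_mono mult_left_mono int hk) auto
    also have "\<dots> = ennreal (2 * ?q * \<eta>)"
    proof -
     have "2 * ?q * \<eta> = ?q * \<eta> + ?q * \<eta>" by simp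
     moreover have "0 \<le> ?q * \<eta>" by (rule mult_nonneg_nonneg[OF q less_imp_le[OF \<eta>]])
     moreover have "0 \<le> K" using K by simp
     ultimately show ?thesis using C2_nonneg q \<eta> by (simp only: ennreal_plus ennreal_mult less_imp_le)
    qed
    finally have "\<bar>?a k (snd c u) - ?a k (snd c v)\<bar> \<le> 2 * ?q * \<eta>" using q \<eta> by (subst (asm) ennreal_le_iff) auto
    then have "\<bar>?a k (snd c t) - ?a k (snd c s)\<bar> \<le> 2 * ?q * \<eta>" using sym[of "?a k"] by simp
    then show ?case using w_close elim(2) by (simp add: algebra_simps)
   qed
  qed
  then show "snd c t \<notin> {x. \<not> (\<lambda>k. ?a k x) \<longlonglongrightarrow> w x}" by simp
 qed
 then show ?thesis using conv r by (intro that[of r]) (auto simp: exceptional_def null_mu_AE)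
qed

end

section \<open>Convergence of the averages outside exceptional sets\<close>

context doubling_measure
begin

lemma vitali_sequence:
 fixes S :: "'a set" and r :: "'a \<Rightarrow> real"
 assumes r: "\<And>x. x \<in> S \<Longrightarrow> 0 < r x" "\<And>x. x \<in> S \<Longrightarrow> r x \<le> R"
 obtains y :: "nat \<Rightarrow> 'a" and I where "\<And>i. i \<in> I \<Longrightarrow> y i \<in> S"
  "\<And>i j. i \<in> I \<Longrightarrow> j \<in> I \<Longrightarrow> i \<noteq> j \<Longrightarrow> ball (y i) (r (y i)) \<inter> ball (y j) (r (y j)) = {}"
  "S \<subseteq> (\<Union>i\<in>I. ball (y i) (3 * r (y i)))"
proof -
 obtain T where T: "T \<subseteq> S" "countable T" "\<And>x y. x \<in> T \<Longrightarrow> y \<in> T \<Longrightarrow> x \<noteq> y \<Longrightarrow> ball x (r x) \<inter> ball y (r y) = {}"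
  "S \<subseteq> (\<Union>x\<in>T. ball x (3 * r x))" by (rule vitali[OF r]) auto
 show ?thesis
 proof (rule that[of "to_nat_on T ` T" "from_nat_into T"])
  fix i j assume ij: "i \<in> to_nat_on T ` T" "j \<in> to_nat_on T ` T" "i \<noteq> j"
  show "ball (from_nat_into T i) (r (from_nat_into T i)) \<inter> ball (from_nat_into T j) (r (from_nat_into T j)) = {}"
   using ij T(2) by (intro T(3)) auto
 next
  fix i assume "i \<in> to_nat_on T ` T"
  then show "from_nat_into T i \<in> S" using T(1,2) by auto
 next
  show "S \<subseteq> (\<Union>i\<in>to_nat_on T ` T. ball (from_nat_into T i) (3 * r (from_nat_into T i)))" using T(2,4) by auto
 qed
qed

lemma disjoint_balls_sum_le:
 fixes y :: "nat \<Rightarrow> 'a" and r :: "nat \<Rightarrow> real"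
 assumes F: "borel_fun F" and U: "U \<in> sets borel" and sub: "\<And>i. i \<in> I \<Longrightarrow> ball (y i) (r i) \<subseteq> U"
  and disj: "\<And>i j. i \<in> I \<Longrightarrow> j \<in> I \<Longrightarrow> i \<noteq> j \<Longrightarrow> ball (y i) (r i) \<inter> ball (y j) (r j) = {}"
 shows "(\<Sum>i. if i \<in> I then (muint_on (ball (y i) (r i)) F) else 0) \<le> muint_on U F"
proof -
 define A where "A i = (if i \<in> I then ball (y i) (r i) else {})" for i
 have A: "A i \<in> sets borel" "A i \<subseteq> U" for i using sub by (auto simp: A_def)
 have "disjoint_family A" using disj by (auto simp: disjoint_family_on_def A_def)
 then have "(\<Sum>i. emeasure (density N F) (A i)) = emeasure (density N F) (\<Union>i. A i)"
  using A by (intro suminf_emeasure) (auto simp: sets_N)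
 also have "\<dots> \<le> emeasure (density N F) U" using A U by (intro emeasure_mono) (auto simp: sets_N)
 finally have "(\<Sum>i. \<integral>\<^sup>+x\<in>A i. F x \<partial>\<mu>) \<le> muint_on U F" using A U F by (simp add: emeasure_density_ball)
 moreover have "muint_on (A i) F = (if i \<in> I then (muint_on (ball (y i) (r i)) F) else 0)" for i by (simp add: A_def)
 ultimately show ?thesis by simp
qed

text \<open>The covering lemma is applied to balls of large density; \<open>D 3\<close> pays for
  tripling them, and all of them lie in the ball of radius \<open>2 * \<rho>\<close>. A Borel
  superset is returned, so the measurability of the level set is not an issue.\<close>

lemma maximal_weak_type:
 assumes F: "L1 F" and l: "0 < l" and \<rho>: "0 < \<rho>"
 obtains B where "B \<in> sets borel" "{y \<in> ball x \<rho>. \<exists>s. 0 < s \<and> s \<le> \<rho> \<and> l * m y s < nu F y s} \<subseteq> B"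
  "emeasure \<mu> B \<le> ennreal (D 3 / l * nu F x (2 * \<rho>))"
proof -
 define S where "S = {y \<in> ball x \<rho>. \<exists>s. 0 < s \<and> s \<le> \<rho> \<and> l * m y s < nu F y s}"
 have "\<forall>y. \<exists>s. y \<in> S \<longrightarrow> 0 < s \<and> s \<le> \<rho> \<and> l * m y s < nu F y s" by (auto simp: S_def)
 from choice[OF this] obtain s where s: "\<forall>y. y \<in> S \<longrightarrow> 0 < s y \<and> s y \<le> \<rho> \<and> l * m y (s y) < nu F y (s y)" by (rule exE)
 obtain y :: "nat \<Rightarrow> 'a" and I where y: "\<And>i. i \<in> I \<Longrightarrow> y i \<in> S"
  and disj: "\<And>i j. i \<in> I \<Longrightarrow> j \<in> I \<Longrightarrow> i \<noteq> j \<Longrightarrow> ball (y i) (s (y i)) \<inter> ball (y j) (s (y j)) = {}"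
  and cov: "S \<subseteq> (\<Union>i\<in>I. ball (y i) (3 * s (y i)))" by (rule vitali_sequence[of S s \<rho>]) (use s in auto)
 define A where "A i = (if i \<in> I then ball (y i) (3 * s (y i)) else {})" for i
 have A: "A i \<in> sets \<mu>" for i unfolding A_def by (auto intro: sets_mu_borel)
 have lm: "0 \<le> D 3 / l" using D_pos[of 3] l by simp
 have Fb: "borel_fun F" using F by (simp add: L1_def)
 have one: "emeasure \<mu> (A i) \<le> ennreal (D 3 / l) * (if i \<in> I then (muint_on (ball (y i) (s (y i))) F) else 0)" for i
 proof (cases "i \<in> I")
  case True
  then have si: "0 < s (y i)" "l * m (y i) (s (y i)) < nu F (y i) (s (y i))" using s y by auto
  have "m (y i) (3 * s (y i)) \<le> D 3 * m (y i) (s (y i))" using si by (intro m_compare) auto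
  also have "\<dots> \<le> D 3 * (nu F (y i) (s (y i)) / l)" using si l D_pos[of 3] by (intro mult_left_mono) (auto simp: field_simps)
  finally have "ennreal (m (y i) (3 * s (y i))) \<le> ennreal (D 3 / l * nu F (y i) (s (y i)))" by (intro ennreal_leI) simp
  also have "\<dots> = ennreal (D 3 / l) * ennreal (nu F (y i) (s (y i)))" using lm nu_nonneg by (rule ennreal_mult)
  finally show ?thesis using True si by (simp add: A_def emeasure_ball L1_ball[OF F])
 qed (simp add: A_def)
 have "emeasure \<mu> (\<Union>i. A i) \<le> (\<Sum>i. emeasure \<mu> (A i))" using A by (intro emeasure_subadditive_countably) auto
 also have "\<dots> \<le> (\<Sum>i. ennreal (D 3 / l) * (if i \<in> I then (muint_on (ball (y i) (s (y i))) F) else 0))"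
  by (intro suminf_le one) auto
 also have "\<dots> = ennreal (D 3 / l) * (\<Sum>i. if i \<in> I then (muint_on (ball (y i) (s (y i))) F) else 0)"
  by (rule ennreal_suminf_cmult)
 also have "\<dots> \<le> ennreal (D 3 / l) * muint_on (ball x (2 * \<rho>)) F"
 proof (intro mult_left_mono disjoint_balls_sum_le Fb disj)
  fix i assume "i \<in> I"
  then have "dist x (y i) < \<rho>" "s (y i) \<le> \<rho>" using y[of i] s by (auto simp: S_def)
  then show "ball (y i) (s (y i)) \<subseteq> ball x (2 * \<rho>)" by (intro ball_subset_ball) (simp add: dist_commute)
 qed auto
 also have "\<dots> = ennreal (D 3 / l * nu F x (2 * \<rho>))" unfolding L1_ball[OF F] by (rule ennreal_mult[OF lm nu_nonneg, symmetric])
 finally have "emeasure \<mu> (\<Union>i. A i) \<le> ennreal (D 3 / l * nu F x (2 * \<rho>))" .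
 moreover have "(\<Union>i. A i) \<in> sets borel" by (auto simp: A_def)
 moreover have "S \<subseteq> (\<Union>i. A i)" using cov by (auto simp: A_def)
 ultimately show ?thesis using that unfolding S_def by blast
qed

end

section \<open>Weak type bound for the oscillation, cutoff functions and doubling scales\<close>

context newton_potential
begin

lemma rad_le_half: "rad (Suc j) \<le> rad j / 2"
proof -
 have "2 * rad (Suc j) \<le> K * rad (Suc j)" using K rad_pos[of "Suc j"] by (intro mult_right_mono) auto
 then show ?thesis using rad_Suc[of j] by simp
qed

text \<open>The radii at least halve, so \<open>rad i <= 2 * (rad i - rad (Suc i))\<close>, and the
  geometric sum of the steps is bounded by a telescoping one.\<close>

lemma mean_telescope:
 assumes "\<And>i. j \<le> i \<Longrightarrow> e i y \<le> rad i * c"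
 shows "\<bar>mean w y (rad (Suc (j + n))) - mean w y (rad (Suc j))\<bar> \<le> 2 * C2 * c * (rad j - rad (j + n))"
proof (induction n)
 case (Suc n)
 have "\<bar>mean w y (rad (Suc (Suc (j + n)))) - mean w y (rad (Suc (j + n)))\<bar> \<le> C2 * e (j + n) y"
 proof (rule mean_step)
  show "ball y (rad (Suc (Suc (j + n)))) \<subseteq> ball y (2 * rad (Suc (j + n)))"
   using rad_antimono[of "Suc (j + n)" "Suc (Suc (j + n))"] rad_pos[of "Suc (j + n)"] by (intro subset_ball) auto
 qed simp
 also have "\<dots> \<le> C2 * (rad (j + n) * c)" using C2_nonneg assms[of "j + n"] by (intro mult_left_mono) auto
 also have "\<dots> \<le> C2 * ((2 * (rad (j + n) - rad (Suc (j + n)))) * c)"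
 proof -
  have "0 \<le> rad (j + n) * c" using assms[of "j + n"] e_nonneg[of "j + n" y] by simp
  then have "0 \<le> c" using rad_pos[of "j + n"] by (simp add: zero_le_mult_iff)
  then show ?thesis using rad_le_half[of "j + n"] C2_nonneg by (intro mult_left_mono mult_right_mono) auto
 qed
 finally show ?case using Suc by (simp add: algebra_simps abs_if split: if_splits)
qed simp

definition Cw :: real where "Cw = D 3 * (32 * (C2 + 1)) powr p"

lemma Cw_nonneg: "0 \<le> Cw" unfolding Cw_def using less_imp_le[OF D_pos[of 3]] by (intro mult_nonneg_nonneg) auto

text \<open>Outside the set where the maximal density of \<open>F\<close> is large, the averages at
  \<open>y\<close> telescope to \<open>w y\<close> with small total error, and moving the centre
  from \<open>y\<close> to \<open>x\<close> costs one more \<open>mean_step\<close>. The exceptional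
  set is controlled by \<open>maximal_weak_type\<close>.\<close>

lemma oscillation_weak_type:
 "emeasure \<mu> {y \<in> ball x (rad (Suc (Suc j))). 1 / 8 < \<bar>w y - mean w x (rad (Suc (Suc j)))\<bar>}
  \<le> ennreal (Cw * rad j powr p * nu F x (rad j))"
proof -
 let ?\<rho> = "rad (Suc j)" and ?\<sigma> = "rad (Suc (Suc j))"
 \<comment> \<open>Chosen so that \<open>C2 * c * ?\<rho>\<close> is at most 1/32: the telescoped
   sum then costs at most 1/16 and the change of centre 1/32, together less than 1/8.\<close>
 define c where "c = 1 / (32 * (C2 + 1) * ?\<rho>)"
 have \<rho>: "0 < ?\<rho>" "0 < ?\<sigma>" by (rule rad_pos)+
 have c: "0 < c" using C2_nonneg \<rho> by (simp add: c_def)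
 have "c * ?\<rho> = 1 / (32 * (C2 + 1))" using \<rho> by (simp add: c_def)
 moreover have "C2 * (1 / (32 * (C2 + 1))) \<le> 1 / 32" using C2_nonneg by (simp add: field_simps)
 ultimately have "C2 * (c * ?\<rho>) \<le> 1 / 32" by (simp only:)
 then have Cc: "C2 * c * ?\<rho> \<le> 1 / 32" by (simp only: mult.assoc)
 obtain r where r: "strict_mono r" "exceptional {x. \<not> (\<lambda>k. mean w x (rad (Suc (r k)))) \<longlonglongrightarrow> w x}"
  by (rule means_converge)
 obtain B where B: "B \<in> sets borel" "{y \<in> ball x ?\<rho>. \<exists>s. 0 < s \<and> s \<le> ?\<rho> \<and> c powr p * m y s < nu F y s} \<subseteq> B"
  "emeasure \<mu> B \<le> ennreal (D 3 / c powr p * nu F x (2 * ?\<rho>))"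
  by (rule maximal_weak_type[OF F _ \<rho>(1), of "c powr p" x]) (use c in auto)
 have good: "\<bar>w y - mean w x ?\<sigma>\<bar> \<le> 1 / 8"
  if y: "y \<in> ball x ?\<sigma>" "y \<notin> B" and lim: "(\<lambda>k. mean w y (rad (Suc (r k)))) \<longlonglongrightarrow> w y" for y
 proof -
  have sub: "?\<sigma> \<le> ?\<rho>" by (rule rad_antimono) simp
  have ei: "e i y \<le> rad i * c" if "Suc j \<le> i" for i
  proof -
   have "y \<in> ball x ?\<rho>" using y(1) sub by auto
   then have "\<not> c powr p * m y (rad i) < nu F y (rad i)"
    using subsetD[OF B(2), of y] y(2) that rad_pos[of i] rad_antimono[of "Suc j" i] by blast
   then have "nu F y (rad i) / m y (rad i) \<le> c powr p" using m_pos[OF rad_pos, of y i] by (simp add: field_simps)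
   then have "(nu F y (rad i) / m y (rad i)) powr (1 / p) \<le> (c powr p) powr (1 / p)"
    using nu_nonneg[of F y "rad i"] m_pos[OF rad_pos, of y i] by (intro powr_mono2) auto
   then show ?thesis unfolding e_eq using c rad_pos[of i] by (simp add: powr_powr)
  qed
  have tele: "\<bar>mean w y (rad (Suc k)) - mean w y ?\<sigma>\<bar> \<le> 1 / 16" if "Suc j \<le> k" for k
  proof -
   have "\<bar>mean w y (rad (Suc (Suc j + (k - Suc j)))) - mean w y ?\<sigma>\<bar> \<le> 2 * C2 * c * (?\<rho> - rad (Suc j + (k - Suc j)))"
    by (rule mean_telescope[OF ei])
   also have "\<dots> \<le> 2 * C2 * c * ?\<rho>" using C2_nonneg c rad_pos[of "Suc j + (k - Suc j)"] by (intro mult_left_mono) auto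
   also have "\<dots> \<le> 1 / 16" using Cc by simp
   finally show ?thesis using that by simp
  qed
  have "(\<lambda>k. \<bar>mean w y (rad (Suc (r k))) - mean w y ?\<sigma>\<bar>) \<longlonglongrightarrow> \<bar>w y - mean w y ?\<sigma>\<bar>" by (intro tendsto_intros lim)
  then have "\<bar>w y - mean w y ?\<sigma>\<bar> \<le> 1 / 16"
  proof (rule LIMSEQ_le_const2, intro exI allI impI)
   fix k assume "Suc j \<le> k"
   then show "\<bar>mean w y (rad (Suc (r k))) - mean w y ?\<sigma>\<bar> \<le> 1 / 16"
    using seq_suble[OF r(1), of k] by (intro tele) simp
  qed
  moreover have "\<bar>mean w x ?\<sigma> - mean w y ?\<sigma>\<bar> \<le> C2 * e (Suc j) y"
   using y(1) by (intro mean_step ball_subset_ball rad_antimono) auto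
  moreover have "C2 * e (Suc j) y \<le> C2 * (?\<rho> * c)" using C2_nonneg ei[of "Suc j"] by (intro mult_left_mono) auto
  moreover have "C2 * (?\<rho> * c) \<le> 1 / 32" using Cc by (simp add: mult_ac)
  ultimately show ?thesis by linarith
 qed
 define Z where "Z = {x. \<not> (\<lambda>k. mean w x (rad (Suc (r k)))) \<longlonglongrightarrow> w x}"
 have Z: "Z \<in> null_sets \<mu>" using exceptional_null[OF r(2)] by (simp add: Z_def)
 have "emeasure \<mu> {y \<in> ball x ?\<sigma>. 1 / 8 < \<bar>w y - mean w x ?\<sigma>\<bar>} \<le> emeasure \<mu> (B \<union> Z)"
  using good Z B(1) by (intro emeasure_mono) (force simp: Z_def, auto intro: sets_mu_borel)
 also have "\<dots> = emeasure \<mu> B" using Z B(1) by (intro emeasure_Un_null_set) (auto intro: sets_mu_borel)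
 also have "\<dots> \<le> ennreal (D 3 / c powr p * nu F x (2 * ?\<rho>))" by (rule B(3))
 also have "\<dots> \<le> ennreal (Cw * rad j powr p * nu F x (rad j))"
 proof (rule ennreal_leI)
  have n: "nu F x (2 * ?\<rho>) \<le> nu F x (rad j)" using rad_le_half[of j] by (intro nu_mono[OF F] subset_ball) simp
  have "1 / c powr p = (32 * (C2 + 1) * ?\<rho>) powr p" by (simp add: c_def powr_divide)
  also have "\<dots> = (32 * (C2 + 1)) powr p * ?\<rho> powr p" by (rule powr_mult)
  also have "\<dots> \<le> (32 * (C2 + 1)) powr p * rad j powr p"
   using rad_antimono[of j "Suc j"] \<rho> by (intro mult_left_mono powr_mono2) auto
  finally have "D 3 * (1 / c powr p) \<le> D 3 * ((32 * (C2 + 1)) powr p * rad j powr p)"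
   using D_pos[of 3] by (intro mult_left_mono) auto
  then have "D 3 / c powr p \<le> Cw * rad j powr p" by (simp add: Cw_def mult_ac)
  then show "D 3 / c powr p * nu F x (2 * ?\<rho>) \<le> Cw * rad j powr p * nu F x (rad j)"
   using n nu_nonneg Cw_nonneg by (intro mult_mono) auto
 qed
 finally show ?thesis .
qed

text \<open>The product has gradient \<open>8 * g\<close> plus the slope of the radial cutoff, and
  by \<open>ACC_nonzero\<close> this counts only where the product is nonzero. The cutoff term is
  therefore charged only to the part of the ball where \<open>\<psi> (w y)\<close> is nonzero, a set
  to which the weak type bound applies.\<close>

lemma cutoff_test:
 fixes \<psi> :: "real \<Rightarrow> real" and x0 :: 'a
 assumes lip: "\<And>s t. \<bar>\<psi> s - \<psi> t\<bar> \<le> 8 * \<bar>s - t\<bar>" and \<psi>: "\<And>t. 0 \<le> \<psi> t" "\<And>t. 0 \<le> t \<Longrightarrow> t \<le> 1 \<Longrightarrow> \<psi> t \<le> 1"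
  and ab: "0 < \<alpha>" "\<alpha> < \<beta>"
 defines "\<eta> \<equiv> \<lambda>y. max 0 (min 1 ((\<beta> - dist x0 y) / (\<beta> - \<alpha>)))"
 obtains G where "ACC UNIV (\<lambda>y. ereal (\<psi> (w y) * \<eta> y)) G" "Lp G" "(\<lambda>y. \<psi> (w y) * \<eta> y) \<in> borel_measurable \<mu>"
  "pint G \<le> ennreal (2 powr p) * (ennreal (8 powr p) * ennreal (nu F x0 \<beta>)
   + ennreal ((1 / (\<beta> - \<alpha>)) powr p) * emeasure \<mu> {y \<in> ball x0 \<beta>. \<psi> (w y) \<noteq> 0})"
  "\<And>y. 0 \<le> \<psi> (w y) * \<eta> y" "\<And>y. \<psi> (w y) * \<eta> y \<le> 1"
  "\<And>y. dist x0 y \<le> \<alpha> \<Longrightarrow> \<eta> y = 1" "\<And>y. y \<notin> ball x0 \<beta> \<Longrightarrow> \<eta> y = 0"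
proof -
 define k where "k = 1 / (\<beta> - \<alpha>)"
 have k: "0 < k" using ab by (simp add: k_def)
 have \<eta>01: "0 \<le> \<eta> y" "\<eta> y \<le> 1" for y by (auto simp: \<eta>_def)
 have \<psi>w: "0 \<le> \<psi> (w y)" "\<psi> (w y) \<le> 1" for y using \<psi> w_nonneg w_le_1 by auto
 have \<eta>lip: "\<bar>\<eta> y - \<eta> y'\<bar> \<le> k * dist y y'" for y y'
 proof -
  have "\<bar>\<eta> y - \<eta> y'\<bar> \<le> \<bar>(\<beta> - dist x0 y) / (\<beta> - \<alpha>) - (\<beta> - dist x0 y') / (\<beta> - \<alpha>)\<bar>" unfolding \<eta>_def by auto
  also have "\<dots> = k * \<bar>dist x0 y' - dist x0 y\<bar>" using ab by (simp add: diff_divide_distrib[symmetric] k_def)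
  also have "\<dots> \<le> k * dist y y'" using k dist_triangle[of x0 y y'] dist_triangle[of x0 y' y]
   by (intro mult_left_mono) (auto simp: dist_commute)
  finally show ?thesis .
 qed
 have \<eta>ACC: "ACC UNIV (\<lambda>y. ereal (\<eta> y)) (\<lambda>y. ennreal k)" unfolding ACC_def
 proof (intro conjI aec_True)
  fix c :: "real \<times> (real \<Rightarrow> 'a)" assume c: "c \<in> curves UNIV"
  show "ac_along (\<lambda>y. ereal (\<eta> y)) (\<lambda>y. ennreal k) c"
  proof (rule ac_alongI[where f="\<lambda>t. \<eta> (snd c t)"])
   show "line_integral (\<lambda>y. ennreal k) c < \<infinity>"
    using curves_pos[OF c] by (simp add: line_integral_lborel nn_integral_cmult_indicator ennreal_mult_less_top)
   show "osc_le (\<lambda>t. \<eta> (snd c t)) (\<lambda>t. ennreal k) 0 (fst c)" unfolding osc_le_def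
   proof (intro allI impI)
    fix s t assume st: "0 \<le> s" "s \<le> t" "t \<le> fst c"
    have "\<bar>\<eta> (snd c s) - \<eta> (snd c t)\<bar> \<le> k * dist (snd c s) (snd c t)" by (rule \<eta>lip)
    also have "\<dots> \<le> k * (t - s)" using k curves_dist[OF c st] by (intro mult_left_mono) auto
    finally have "ennreal \<bar>\<eta> (snd c s) - \<eta> (snd c t)\<bar> \<le> ennreal (k * (t - s))" by (rule ennreal_leI)
    then show "ennreal \<bar>\<eta> (snd c s) - \<eta> (snd c t)\<bar> \<le> lint s t (\<lambda>x. ennreal k)"
     using st k by (simp add: nn_integral_cmult_indicator ennreal_mult)
   qed
  qed simp
 qed simp
 let ?v = "\<lambda>y. \<psi> (w y) * \<eta> y" and ?h = "\<lambda>y. ennreal 8 * g y + ennreal 1 * ennreal k"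
 have vACC: "ACC UNIV (\<lambda>y. ereal (?v y)) ?h"
 proof (rule ACC_combine[OF w_ACC \<eta>ACC _ _ exceptional_empty])
  fix P Q x x' y y' assume "ereal (w P) = ereal x" "ereal (w Q) = ereal x'" "ereal (\<eta> P) = ereal y" "ereal (\<eta> Q) = ereal y'"
  then have eq: "x = w P" "x' = w Q" "y = \<eta> P" "y' = \<eta> Q" by auto
  have "\<bar>?v P - ?v Q\<bar> \<le> \<bar>\<psi> x - \<psi> x'\<bar> * y + \<psi> x' * \<bar>y - y'\<bar>"
  proof -
   have "?v P - ?v Q = (\<psi> x - \<psi> x') * y + \<psi> x' * (y - y')" by (simp add: eq algebra_simps)
   also have "\<bar>\<dots>\<bar> \<le> \<bar>(\<psi> x - \<psi> x') * y\<bar> + \<bar>\<psi> x' * (y - y')\<bar>" by (rule abs_triangle_ineq)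
   finally show ?thesis using \<eta>01[of P] \<psi>(1)[of x'] by (simp add: abs_mult eq)
  qed
  also have "\<dots> \<le> (8 * \<bar>x - x'\<bar>) * 1 + 1 * \<bar>y - y'\<bar>"
   using lip[of x x'] \<eta>01[of P] \<psi>w[of Q] by (intro add_mono mult_mono) (auto simp: eq)
  finally show "\<exists>r r'. ereal (?v P) = ereal r \<and> ereal (?v Q) = ereal r' \<and> \<bar>r - r'\<bar> \<le> 8 * \<bar>x - x'\<bar> + 1 * \<bar>y - y'\<bar>" by auto
 qed auto
 have \<psi>m[measurable]: "borel_fun \<psi>"
 proof (rule borel_measurable_continuous_onI, unfold continuous_on_iff, intro ballI allI impI)
  fix x \<epsilon> :: real assume \<epsilon>: "0 < \<epsilon>"
  show "\<exists>d>0. \<forall>x'\<in>UNIV. dist x' x < d \<longrightarrow> dist (\<psi> x') (\<psi> x) < \<epsilon>"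
  proof (intro exI[of _ "\<epsilon> / 8"] conjI ballI impI)
   fix x' assume "dist x' x < \<epsilon> / 8"
   then show "dist (\<psi> x') (\<psi> x) < \<epsilon>" using lip[of x' x] by (simp add: dist_real_def)
  qed (use \<epsilon> in simp)
 qed
 have wm[measurable]: "w \<in> borel_measurable \<mu>" by (rule w_measurable)
 have \<eta>m[measurable]: "\<eta> \<in> borel_measurable \<mu>"
  unfolding \<eta>_def by (intro measurable_mu_borel borel_measurable_continuous_onI continuous_intros) (use ab in auto)
 have vm: "?v \<in> borel_measurable \<mu>" by measurable
 have "(\<lambda>y. ereal (?v y)) \<in> borel_measurable (restrict_space \<mu> UNIV)"
  unfolding measurable_restrict_UNIV using vm by measurable
 from this obtain S where S[measurable]: "S \<in> sets borel"
  and Sv: "AE y in \<mu>. y \<in> UNIV \<longrightarrow> (ereal (?v y) = 0 \<longleftrightarrow> y \<in> S)"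
  and acc: "ACC UNIV (\<lambda>y. ereal (?v y)) (\<lambda>y. if y \<in> S then 0 else ?h y)"
  by (rule ACC_nonzero[OF UNIV_mu _ vACC]) blast
 define G where "G y = (if y \<in> S then 0 else ?h y)" for y
 define M where "M = {y \<in> ball x0 \<beta>. \<psi> (w y) \<noteq> 0}"
 have M: "M \<in> sets \<mu>" unfolding M_def by measurable
 have gm[measurable]: "borel_fun g" by (rule Lp_measurable[OF g_Lp])
 have Gm[measurable]: "borel_fun G" unfolding G_def[abs_def] by measurable
 have \<eta>\<alpha>: "\<eta> y = 1" if "dist x0 y \<le> \<alpha>" for y
 proof -
  have "1 \<le> (\<beta> - dist x0 y) / (\<beta> - \<alpha>)" using that ab by (simp add: field_simps)
  then show ?thesis by (simp add: \<eta>_def)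
 qed
 have \<eta>\<beta>: "\<eta> y = 0" if "y \<notin> ball x0 \<beta>" for y
 proof -
  have "(\<beta> - dist x0 y) / (\<beta> - \<alpha>) \<le> 0" using that ab by (intro divide_nonpos_pos) auto
  then show ?thesis by (simp add: \<eta>_def)
 qed
 have energy: "pint G \<le> ennreal (2 powr p) * (ennreal (8 powr p) * ennreal (nu F x0 \<beta>)
   + ennreal (k powr p) * emeasure \<mu> M)"
 proof -
  have "pint G \<le> muint (\<lambda>y. ennreal (2 powr p) * (ennreal (8 powr p) * (F y * indicator (ball x0 \<beta>) y)
    + ennreal (k powr p) * indicator M y))"
  proof (intro nn_integral_mono_AE)
   show "AE y in \<mu>. epowr (G y) p \<le> ennreal (2 powr p) * (ennreal (8 powr p) * (F y * indicator (ball x0 \<beta>) y)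
     + ennreal (k powr p) * indicator M y)" using Sv
   proof eventually_elim
    case (elim y)
    show ?case
    proof (cases "y \<in> S")
     case False
     then have "?v y \<noteq> 0" using elim by simp
     then have y: "y \<in> ball x0 \<beta>" "y \<in> M" using \<eta>\<beta>[of y] by (auto simp: M_def)
     have "epowr (G y) p \<le> ennreal (2 powr p) * (epowr (ennreal 8 * g y) p + epowr (ennreal k) p)"
      using False unfolding G_def by (simp add: epowr_add_le del: ennreal_numeral)
     also have "epowr (ennreal 8 * g y) p = ennreal (8 powr p) * F y"
      by (simp add: epowr_mult F_eq epowr_ennreal del: ennreal_numeral)
     also have "epowr (ennreal k) p = ennreal (k powr p)" using k by (simp add: epowr_ennreal)
     finally show ?thesis using y by simp
    qed (simp add: G_def)
   qed
  qed
  also have "\<dots> = ennreal (2 powr p) * (ennreal (8 powr p) * muint_on (ball x0 \<beta>) F + ennreal (k powr p) * emeasure \<mu> M)"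
  proof -
   have [measurable]: "F \<in> borel_measurable \<mu>" "M \<in> sets \<mu>" by (rule measurable_mu_borel[OF F_borel] M)+
   show ?thesis by (simp add: nn_integral_cmult nn_integral_add)
  qed
  finally show ?thesis by (simp add: L1_ball[OF F])
 qed
 moreover have "Lp G"
 proof -
  have "emeasure \<mu> M \<le> emeasure \<mu> (ball x0 \<beta>)" by (intro emeasure_mono) (auto simp: M_def)
  then have "emeasure \<mu> M < top" using ball_finite[of \<beta> x0] ab by simp
  then show ?thesis unfolding Lp_def using energy by (auto simp: ennreal_mult_less_top intro: le_less_trans)
 qed
 ultimately show ?thesis using acc vm \<psi>w \<eta>01 \<eta>\<alpha> \<eta>\<beta>
  by (intro that[of G]) (auto simp: G_def[abs_def] k_def M_def mult_le_one)
qed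

lemma e_tendsto_0:
 assumes "summable (\<lambda>j. b j x)" shows "(\<lambda>j. e j x) \<longlonglongrightarrow> 0"
proof -
 have "e j x = b j x powr ((p - 1) / p)" for j using p_gt_1 by (simp add: e_def b_def powr_powr)
 moreover have "(\<lambda>j. b j x powr ((p - 1) / p)) \<longlonglongrightarrow> 0"
  using p_gt_1 b_nonneg by (intro tendsto_zero_powrI[OF summable_LIMSEQ_zero[OF assms] tendsto_const]) auto
 ultimately show ?thesis by simp
qed

text \<open>The factor \<open>8 powr p\<close> makes the failure of doubling over three scales
  shrink \<open>e\<close> by 1/8; \<open>D (K ^ 3)\<close> compares the measures of the two
  balls.\<close>

definition C3 :: real where "C3 = 8 powr p * D (K ^ 3)"

text \<open>
 If every small scale with a small average failed to be doubling, the numbers \<open>e j x\<close> would decay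
 geometrically and the averages could not return to values near \<open>1\<close>.
\<close>

lemma doubling_scale:
 assumes s: "summable (\<lambda>j. b j x)" and r: "strict_mono r" "(\<lambda>k. mean w x (rad (Suc (r k)))) \<longlonglongrightarrow> 1"
  and freq: "\<forall>J. \<exists>j\<ge>J. mean w x (rad j) < 1 / 2"
 obtains j where "J \<le> j" "mean w x (rad (j + 2)) \<le> 3 / 4" "nu F x (rad j) \<le> C3 * nu F x (rad (j + 3))"
proof (rule ccontr)
 note found = that
 assume no: "\<not> thesis"
 \<comment> \<open>Five terms of this size, multiplied by \<open>C2\<close>, stay below the gap of
   1/4 between 1/2 and 3/4.\<close>
 define \<epsilon> where "\<epsilon> = 1 / (20 * (C2 + 1))"
 have \<epsilon>: "0 < \<epsilon>" "C2 * (5 * \<epsilon>) < 1 / 4" using C2_nonneg by (auto simp: \<epsilon>_def field_simps)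
 have dec: "e (j + 3) x \<le> e j x / 8" if "J \<le> j" "mean w x (rad (j + 2)) \<le> 3 / 4" for j
 proof -
  have C3: "0 < C3" unfolding C3_def using D_pos by simp
  have n: "C3 * nu F x (rad (j + 3)) \<le> nu F x (rad j)" using found[OF that] no by linarith
  have rj: "rad j = K ^ 3 * rad (j + 3)" using K by (simp add: rad_def power_add power_divide)
  have mm: "m x (rad j) \<le> D (K ^ 3) * m x (rad (j + 3))" using rj rad_pos K by (intro m_compare) (auto intro: less_imp_le)
  have mp: "0 < m x (rad j)" "0 < m x (rad (j + 3))" by (simp_all add: m_pos rad_pos)
  have "8 powr p * dens (j + 3) x * (D (K ^ 3) * m x (rad (j + 3))) = rad (j + 3) powr p * (C3 * nu F x (rad (j + 3)))"
   using mp by (simp add: dens_def C3_def)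
  also have "\<dots> \<le> rad j powr p * nu F x (rad j)"
   using n rad_antimono[of j "j + 3"] rad_pos C3 nu_nonneg by (intro mult_mono powr_mono2) (auto intro: less_imp_le)
  also have "\<dots> = dens j x * m x (rad j)" using mp by (simp add: dens_def)
  also have "\<dots> \<le> dens j x * (D (K ^ 3) * m x (rad (j + 3)))" using mm dens_nonneg by (intro mult_left_mono) auto
  finally have "8 powr p * dens (j + 3) x \<le> dens j x" using mp D_pos[of "K ^ 3"] by (simp add: mult_le_cancel_right)
  then have "(8 powr p * dens (j + 3) x) powr (1 / p) \<le> dens j x powr (1 / p)"
   using dens_nonneg by (intro powr_mono2) auto
  then show ?thesis by (simp add: e_def powr_mult powr_powr)
 qed
 have "eventually (\<lambda>j. e j x < \<epsilon>) sequentially" using e_tendsto_0[OF s] \<epsilon>(1) by (rule order_tendstoD(2))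
 then obtain J1 where J1: "\<And>j. J1 \<le> j \<Longrightarrow> e j x < \<epsilon>" unfolding eventually_sequentially by blast
 from freq obtain j0' where j0': "max J J1 + 2 \<le> j0'" "mean w x (rad j0') < 1 / 2" by blast
 define j0 where "j0 = j0' - 2"
 have j0: "J \<le> j0" "J1 \<le> j0" "mean w x (rad (j0 + 2)) < 1 / 2" using j0' le_add_diff_inverse2[of 2 j0'] by (auto simp: j0_def simp del: add_2_eq_Suc')
 have "eventually (\<lambda>k. 3 / 4 < mean w x (rad (Suc (r k)))) sequentially" using r(2) by (rule order_tendstoD(1)) simp
 then obtain k0 where k0: "\<And>k. k0 \<le> k \<Longrightarrow> 3 / 4 < mean w x (rad (Suc (r k)))" unfolding eventually_sequentially by blast
 have "j0 + 2 \<le> r (max k0 (j0 + 2))" using seq_suble[OF r(1), of "max k0 (j0 + 2)"] by linarith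
 then have "\<exists>n. 3 / 4 < mean w x (rad (j0 + n + 2))"
  using k0[of "max k0 (j0 + 2)"] by (intro exI[of _ "Suc (r (max k0 (j0 + 2))) - j0 - 2"]) auto
 \<comment> \<open>The first scale from \<open>j0 + 2\<close> on at which the average exceeds 3/4.
   At all earlier ones it is at most 3/4, so the decay of \<open>e\<close> applies to them.\<close>
 define n where "n = (LEAST n. 3 / 4 < mean w x (rad (j0 + n + 2)))"
 have n: "3 / 4 < mean w x (rad (j0 + n + 2))" and least: "\<And>i. i < n \<Longrightarrow> mean w x (rad (j0 + i + 2)) \<le> 3 / 4"
  using LeastI_ex[OF \<open>\<exists>n. _\<close>] not_less_Least[of _ "\<lambda>n. 3 / 4 < mean w x (rad (j0 + n + 2))"] by (auto simp: n_def not_less)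
 define S where "S = (\<Sum>i<n. e (j0 + i) x)"
 have S0: "0 \<le> S" unfolding S_def by (intro sum_nonneg e_nonneg)
 have shift: "(\<Sum>i<n. e (j0 + i + 3) x) \<le> S / 8"
  unfolding S_def sum_divide_distrib using dec[of "j0 + i" for i] least j0 by (intro sum_mono) auto
 \<comment> \<open>The first three terms are below \<open>\<epsilon>\<close>, and the terms shifted
   by three are at most an eighth of the originals. Hence \<open>S\<close> is below
   \<open>4 * \<epsilon>\<close>, and the last increment adds less than one more
   \<open>\<epsilon>\<close>.\<close>
 have S: "S \<le> 3 * \<epsilon> + S / 8"
 proof -
  have "S \<le> (\<Sum>i<n + 3. e (j0 + i) x)" unfolding S_def by (intro sum_mono2 e_nonneg) auto
  also have "\<dots> = (\<Sum>i<3 + n. e (j0 + i) x)" by (simp only: add.commute)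
  also have "\<dots> = (\<Sum>i<3. e (j0 + i) x) + (\<Sum>i<n. e (j0 + i + 3) x)"
  proof -
   have "(\<Sum>i<3 + k. f i) = (\<Sum>i<3. f i) + (\<Sum>i<k. f (i + 3))" for f :: "nat \<Rightarrow> real" and k
   proof (induction k)
    case (Suc k)
    show ?case unfolding add_Suc_right sum.lessThan_Suc Suc.IH by (simp only: add.assoc add.commute[of 3 k])
   qed simp
   from this[of "\<lambda>i. e (j0 + i) x" n] show ?thesis by (simp only: add.assoc)
  qed
  also have "(\<Sum>i<3. e (j0 + i) x) \<le> (\<Sum>i<3::nat. \<epsilon>)" using J1 j0 by (intro sum_mono less_imp_le) auto
  finally show ?thesis using shift by simp
 qed
 have "1 / 4 < mean w x (rad (j0 + n + 2)) - mean w x (rad (j0 + 2))" using n j0 by simp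
 also have "\<dots> = (\<Sum>i<n. mean w x (rad (j0 + Suc i + 2)) - mean w x (rad (j0 + i + 2)))"
  using sum_lessThan_telescope[of "\<lambda>i. mean w x (rad (j0 + i + 2))" n] by simp
 also have "\<dots> \<le> (\<Sum>i<n. C2 * e (j0 + Suc i) x)"
 proof (rule sum_mono)
  fix i
  have "\<bar>mean w x (rad (Suc (Suc (Suc (j0 + i))))) - mean w x (rad (Suc (Suc (j0 + i))))\<bar> \<le> C2 * e (Suc (j0 + i)) x"
   using rad_antimono[of "Suc (Suc (j0 + i))" "Suc (Suc (Suc (j0 + i)))"] rad_pos[of "Suc (Suc (j0 + i))"]
   by (intro mean_step subset_ball) auto
  then show "mean w x (rad (j0 + Suc i + 2)) - mean w x (rad (j0 + i + 2)) \<le> C2 * e (j0 + Suc i) x" by simp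
 qed
 also have "\<dots> \<le> C2 * (S + e (j0 + n) x)"
 proof -
  have "S + e (j0 + n) x = e j0 x + (\<Sum>i<n. e (j0 + Suc i) x)"
   unfolding S_def using sum.lessThan_Suc_shift[of "\<lambda>i. e (j0 + i) x" n] by simp
  then have "(\<Sum>i<n. e (j0 + Suc i) x) \<le> S + e (j0 + n) x" using e_nonneg[of j0 x] by linarith
  then show ?thesis using C2_nonneg by (simp add: sum_distrib_left[symmetric] mult_left_mono)
 qed
 also have "\<dots> \<le> C2 * (5 * \<epsilon>)" using S J1[of "j0 + n"] j0 C2_nonneg \<epsilon>(1) by (intro mult_left_mono) auto
 finally show False using \<epsilon> by linarith
qed

end

section \<open>Points where the averages drop below 1/2 infinitely often\<close>

context newton_potential
begin

text \<open>Almost everywhere the increments of the averages decay geometrically, so the full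
  sequence converges, and the subsequence from \<open>means_converge\<close> identifies its limit.
  This shows that the bad set is at least null.\<close>

lemma AE_means_converge: "AE x in \<mu>. (\<lambda>j. mean w x (rad (Suc j))) \<longlonglongrightarrow> w x"
proof -
 obtain r where r: "strict_mono r" "exceptional {x. \<not> (\<lambda>k. mean w x (rad (Suc (r k)))) \<longlonglongrightarrow> w x}"
  by (rule means_converge)
 show ?thesis using exceptional_AE[OF r(2)] AE_dens_le
 proof eventually_elim
  case (elim x)
  from elim(2) obtain C where C: "0 \<le> C" "\<And>j. dens j x \<le> C * rad j powr (p - 1)" by blast
  let ?a = "\<lambda>j. mean w x (rad (Suc j))"
  have "summable (\<lambda>j. ?a (Suc j) - ?a j)"
  proof (rule summable_comparison_test')
   show "summable (\<lambda>j. C2 * (C powr (1 / p) * rad j powr ((p - 1) / p)))"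
    using p_gt_1 by (intro summable_mult summable_rad_powr) auto
   fix j :: nat
   have "e j x \<le> (C * rad j powr (p - 1)) powr (1 / p)"
    unfolding e_def using C(2) dens_nonneg by (intro powr_mono2) auto
   also have "\<dots> = C powr (1 / p) * rad j powr ((p - 1) / p)" by (simp add: powr_mult powr_powr)
   finally have "C2 * e j x \<le> C2 * (C powr (1 / p) * rad j powr ((p - 1) / p))"
    using C2_nonneg by (intro mult_left_mono) auto
   moreover have "\<bar>?a (Suc j) - ?a j\<bar> \<le> C2 * e j x"
    using rad_antimono[of "Suc j" "Suc (Suc j)"] rad_pos[of "Suc j"] by (intro mean_step subset_ball) auto
   ultimately show "norm (?a (Suc j) - ?a j) \<le> C2 * (C powr (1 / p) * rad j powr ((p - 1) / p))" by simp
  qed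
  from summable_LIMSEQ[OF this] have "(\<lambda>n. ?a 0 + (\<Sum>j<n. ?a (Suc j) - ?a j)) \<longlonglongrightarrow> ?a 0 + (\<Sum>j. ?a (Suc j) - ?a j)"
   by (intro tendsto_add tendsto_const)
  moreover have "?a 0 + (\<Sum>j<n. ?a (Suc j) - ?a j) = ?a n" for n using sum_lessThan_telescope[of ?a n] by simp
  ultimately obtain L where L: "?a \<longlonglongrightarrow> L" by auto
  have "(\<lambda>k. ?a (r k)) \<longlonglongrightarrow> L" using LIMSEQ_subseq_LIMSEQ[OF L r(1)] by (simp add: o_def)
  then have "L = w x" using elim(1) LIMSEQ_unique by blast
  then show ?case using L by simp
 qed
qed

text \<open>At each bad point a doubling scale with its ball inside \<open>W\<close> is chosen. A
  cutoff of \<open>w\<close> there has energy at most \<open>Q\<close> times the mass of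
  \<open>F\<close> on a smaller concentric ball, and these smaller balls can be made disjoint in
  \<open>W\<close>, so the supremum of the cutoffs is paid for by the mass of \<open>F\<close> on
  \<open>W\<close>.\<close>

lemma small_means_test:
 assumes W: "open W" and r: "strict_mono r" and S: "S \<subseteq> W"
  and S': "\<And>x. x \<in> S \<Longrightarrow> w x = 1 \<and> summable (\<lambda>j. b j x) \<and> (\<lambda>k. mean w x (rad (Suc (r k)))) \<longlonglongrightarrow> w x
   \<and> (\<forall>J. \<exists>j\<ge>J. mean w x (rad j) < 1 / 2)"
 defines "Q \<equiv> 2 powr p * (8 powr p + (4 * K ^ 2) powr p * Cw) * C3"
 shows "\<exists>V G. borel_fun G \<and> (\<forall>x\<in>S. 1 \<le> V x) \<and> (\<forall>x. x \<notin> W \<longrightarrow> V x = (0::real)) \<and>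
  ae_slope_le V G \<and>
  pint G \<le> ennreal Q * muint_on W F"
proof -
 let ?P = "\<lambda>x j. x \<in> S \<longrightarrow> ball x (rad (j + 2)) \<subseteq> W \<and> mean w x (rad (j + 2)) \<le> 3 / 4 \<and> nu F x (rad j) \<le> C3 * nu F x (rad (j + 3))"
 have "\<forall>x. \<exists>j. ?P x j"
 proof
  fix x
  show "\<exists>j. ?P x j"
  proof (cases "x \<in> S")
   case True
   then obtain \<epsilon> where \<epsilon>: "0 < \<epsilon>" "ball x \<epsilon> \<subseteq> W" using W S open_contains_ball by blast
   have "eventually (\<lambda>j. rad j < \<epsilon>) sequentially" using rad_tendsto \<epsilon>(1) by (rule order_tendstoD(2))
   then obtain J where J: "\<And>j. J \<le> j \<Longrightarrow> rad j < \<epsilon>" unfolding eventually_sequentially by blast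
   obtain j where j: "J \<le> j" "mean w x (rad (j + 2)) \<le> 3 / 4" "nu F x (rad j) \<le> C3 * nu F x (rad (j + 3))"
    by (rule doubling_scale[of x r J]) (use r S'[OF True] in auto)
   then show ?thesis using J[of "j + 2"] \<epsilon>(2) subset_ball[of "rad (j + 2)" \<epsilon> x] by (intro exI[of _ j]) auto
  qed simp
 qed
 from choice[OF this] obtain \<iota> where \<iota>: "\<forall>x. ?P x (\<iota> x)" by (rule exE)
 \<comment> \<open>A quarter of the radius: the tripled balls of the covering lemma stay inside the
   ball of radius \<open>4 * \<rho> x\<close> carrying the cutoff, while \<open>\<rho> x\<close> is
   still at least \<open>rad (\<iota> x + 3)\<close> because \<open>K >= 4\<close>, so doubling
   bounds the mass of the large ball by that of the small one.\<close>
 define \<rho> where "\<rho> x = rad (\<iota> x + 2) / 4" for x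
 have \<rho>0: "0 < \<rho> x" for x by (simp add: \<rho>_def rad_pos)
 obtain y :: "nat \<Rightarrow> 'a" and I where y: "\<And>i. i \<in> I \<Longrightarrow> y i \<in> S"
  and disj: "\<And>i j. i \<in> I \<Longrightarrow> j \<in> I \<Longrightarrow> i \<noteq> j \<Longrightarrow> ball (y i) (\<rho> (y i)) \<inter> ball (y j) (\<rho> (y j)) = {}"
  and cov: "S \<subseteq> (\<Union>i\<in>I. ball (y i) (3 * \<rho> (y i)))"
 proof (rule vitali_sequence[of S \<rho> 1])
  fix x show "\<rho> x \<le> 1" using rad_antimono[of 0 "\<iota> x + 2"] by (simp add: \<rho>_def rad_def)
 qed (use \<rho>0 in auto)
 \<comment> \<open>Equal to 1 at \<open>t = 1\<close> and 0 for \<open>t\<close> at most 7/8. Where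
   it is nonzero, \<open>w\<close> differs from an average of at most 3/4 by more than 1/8, as in
   \<open>oscillation_weak_type\<close>.\<close>
 define \<psi> where "\<psi> t = max 0 (8 * t - 7)" for t :: real
 have \<psi>_lip: "\<bar>\<psi> s - \<psi> t\<bar> \<le> 8 * \<bar>s - t\<bar>" for s t by (auto simp: \<psi>_def max_def abs_if)
 have \<psi>01: "0 \<le> \<psi> t" "0 \<le> t \<Longrightarrow> t \<le> 1 \<Longrightarrow> \<psi> t \<le> 1" for t by (auto simp: \<psi>_def)
 define \<eta> where "\<eta> i x = max 0 (min 1 ((4 * \<rho> (y i) - dist (y i) x) / (4 * \<rho> (y i) - 3 * \<rho> (y i))))" for i x
 define v where "v i x = (if i \<in> I then \<psi> (w x) * \<eta> i x else 0)" for i x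
 let ?T = "\<lambda>i G. ACC UNIV (\<lambda>x. ereal (v i x)) G \<and> Lp G \<and> (\<forall>x. 0 \<le> v i x \<and> v i x \<le> 1) \<and>
   (\<forall>x\<in>ball (y i) (3 * \<rho> (y i)). i \<in> I \<longrightarrow> v i x = \<psi> (w x)) \<and> (\<forall>x. x \<notin> W \<longrightarrow> v i x = 0) \<and>
   pint G \<le> ennreal Q * (if i \<in> I then (muint_on (ball (y i) (\<rho> (y i))) F) else 0)"
 have "\<exists>G. ?T i G" for i
 proof (cases "i \<in> I")
  case False
  then show ?thesis by (intro exI[of _ "\<lambda>x. 0"]) (use ACC_zero Lp_zero in \<open>simp add: v_def zero_ereal_def[symmetric]\<close>)
 next
  case True
  define j where "j = \<iota> (y i)"
  have sc: "4 * \<rho> (y i) = rad (j + 2)" "0 < \<rho> (y i)" using \<rho>0 by (auto simp: \<rho>_def j_def)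
  have yi: "ball (y i) (rad (j + 2)) \<subseteq> W" "mean w (y i) (rad (j + 2)) \<le> 3 / 4"
   "nu F (y i) (rad j) \<le> C3 * nu F (y i) (rad (j + 3))" using \<iota> y[OF True] by (auto simp: j_def)
  obtain G where G: "ACC UNIV (\<lambda>x. ereal (\<psi> (w x) * \<eta> i x)) G" "Lp G"
   and en: "pint G \<le> ennreal (2 powr p) * (ennreal (8 powr p) * ennreal (nu F (y i) (4 * \<rho> (y i)))
    + ennreal ((1 / (4 * \<rho> (y i) - 3 * \<rho> (y i))) powr p) * emeasure \<mu> {x \<in> ball (y i) (4 * \<rho> (y i)). \<psi> (w x) \<noteq> 0})"
   and G': "\<And>x. 0 \<le> \<psi> (w x) * \<eta> i x" "\<And>x. \<psi> (w x) * \<eta> i x \<le> 1" "\<And>x. dist (y i) x \<le> 3 * \<rho> (y i) \<Longrightarrow> \<eta> i x = 1"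
    "\<And>x. x \<notin> ball (y i) (4 * \<rho> (y i)) \<Longrightarrow> \<eta> i x = 0" unfolding \<eta>_def
   by (rule cutoff_test[of \<psi> "3 * \<rho> (y i)" "4 * \<rho> (y i)" "y i", OF \<psi>_lip \<psi>01]) (use sc(2) in auto)
  let ?n = "nu F (y i) (\<rho> (y i))"
  have n3: "nu F (y i) (rad j) \<le> C3 * ?n"
  proof -
   have "rad (j + 3) \<le> \<rho> (y i)"
   proof -
    have "4 * rad (Suc (j + 2)) \<le> K * rad (Suc (j + 2))" using K rad_pos by (intro mult_right_mono) (auto intro: less_imp_le)
    then show ?thesis using rad_Suc[of "j + 2"] sc(1) by (simp add: eval_nat_numeral)
   qed
   then have "nu F (y i) (rad (j + 3)) \<le> ?n" by (intro nu_mono[OF F] subset_ball)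
   moreover have "0 \<le> C3" unfolding C3_def using D_pos[of "K ^ 3"] by simp
   ultimately have "C3 * nu F (y i) (rad (j + 3)) \<le> C3 * ?n" by (rule mult_left_mono)
   then show ?thesis using yi(3) by simp
  qed
  have n1: "nu F (y i) (rad (j + 2)) \<le> nu F (y i) (rad j)"
   using rad_antimono[of j "j + 2"] by (intro nu_mono[OF F] subset_ball) auto
  have rj: "rad j = (4 * K ^ 2) * \<rho> (y i)" using K by (simp add: rad_def power_add \<rho>_def j_def[symmetric] power2_eq_square)
  have "{x \<in> ball (y i) (rad (j + 2)). \<psi> (w x) \<noteq> 0} \<subseteq> {x \<in> ball (y i) (rad (Suc (Suc j))). 1 / 8 < \<bar>w x - mean w (y i) (rad (Suc (Suc j)))\<bar>}"
   using yi(2) by (auto simp: \<psi>_def max_def split: if_splits)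
  then have "emeasure \<mu> {x \<in> ball (y i) (rad (j + 2)). \<psi> (w x) \<noteq> 0} \<le> ennreal (Cw * rad j powr p * nu F (y i) (rad j))"
   by (intro order_trans[OF emeasure_mono oscillation_weak_type]) (use w_measurable in measurable)
  then have "pint G \<le> ennreal (2 powr p) * (ennreal (8 powr p) * ennreal (nu F (y i) (rad (j + 2)))
    + ennreal ((1 / \<rho> (y i)) powr p) * ennreal (Cw * rad j powr p * nu F (y i) (rad j)))"
  proof -
   assume M: "emeasure \<mu> {x \<in> ball (y i) (rad (j + 2)). \<psi> (w x) \<noteq> 0} \<le> ennreal (Cw * rad j powr p * nu F (y i) (rad j))"
   have "4 * \<rho> (y i) - 3 * \<rho> (y i) = \<rho> (y i)" by simp
   note en' = en[unfolded this, unfolded sc(1)]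
   show ?thesis by (rule order_trans[OF en']) (intro mult_left_mono add_left_mono M zero_le)
  qed
  also have "\<dots> = ennreal (2 powr p * (8 powr p * nu F (y i) (rad (j + 2)) + (1 / \<rho> (y i)) powr p * (Cw * rad j powr p * nu F (y i) (rad j))))"
   using nu_nonneg Cw_nonneg by (simp add: ennreal_mult[symmetric] ennreal_plus[symmetric] del: ennreal_plus)
  also have "\<dots> \<le> ennreal (Q * ?n)"
  proof (rule ennreal_leI)
   have "(1 / \<rho> (y i)) powr p * rad j powr p = (4 * K ^ 2) powr p"
    using sc(2) K by (simp add: powr_mult[symmetric] rj)
   then have "2 powr p * (8 powr p * nu F (y i) (rad (j + 2)) + (1 / \<rho> (y i)) powr p * (Cw * rad j powr p * nu F (y i) (rad j)))
     = 2 powr p * (8 powr p * nu F (y i) (rad (j + 2)) + (4 * K ^ 2) powr p * Cw * nu F (y i) (rad j))" by (simp add: mult_ac)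
   also have "\<dots> \<le> 2 powr p * (8 powr p * nu F (y i) (rad j) + (4 * K ^ 2) powr p * Cw * nu F (y i) (rad j))"
    using n1 by (intro mult_left_mono add_right_mono) auto
   also have "\<dots> = 2 powr p * (8 powr p + (4 * K ^ 2) powr p * Cw) * nu F (y i) (rad j)" by (simp add: algebra_simps)
   also have "\<dots> \<le> 2 powr p * (8 powr p + (4 * K ^ 2) powr p * Cw) * (C3 * ?n)"
    using n3 Cw_nonneg by (intro mult_left_mono) auto
   finally show "2 powr p * (8 powr p * nu F (y i) (rad (j + 2)) + (1 / \<rho> (y i)) powr p * (Cw * rad j powr p * nu F (y i) (rad j))) \<le> Q * ?n"
    by (simp add: Q_def)
  qed
  also have "\<dots> = ennreal Q * ennreal ?n"
   using nu_nonneg by (intro ennreal_mult) (auto simp: Q_def C3_def Cw_nonneg intro!: mult_nonneg_nonneg add_nonneg_nonneg less_imp_le[OF D_pos])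
  finally have fin: "pint G \<le> ennreal Q * ennreal ?n" .
  have out: "\<eta> i x = 0" if "x \<notin> W" for x by (rule G'(4)) (use that yi(1) sc in auto)
  show ?thesis using G G'(1-3) out fin True sc by (intro exI[of _ G]) (auto simp: v_def L1_ball[OF F])
 qed
 then have "\<forall>i. \<exists>G. ?T i G" by (rule allI)
 from choice[OF this] obtain G where G: "\<forall>i. ?T i (G i)" by (rule exE)
 have Gm[measurable]: "borel_fun (G i)" for i using G Lp_measurable by blast
 define V where "V x = (SUP i. v i x)" for x
 \<comment> \<open>The p-th root of the sum of p-th powers dominates every \<open>G i\<close>, hence
   serves the supremum, and its energy is the sum of their energies.\<close>
 define H where "H x = epowr (\<Sum>i. epowr (G i x) p) (1 / p)" for x
 have bdd: "bdd_above (range (\<lambda>i. v i x))" for x using G by (intro bdd_aboveI[of _ 1]) auto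
 have GH: "G i x \<le> H x" for i x
 proof -
  have "epowr (G i x) p \<le> (\<Sum>i. epowr (G i x) p)" using sum_le_suminf[of "\<lambda>i. epowr (G i x) p" "{i}"] by simp
  then have "epowr (G i x) p \<le> epowr (H x) p" by (simp add: H_def epowr_epowr)
  then show ?thesis using epowr_le_iff[of p] by simp
 qed
 have "aec UNIV (\<lambda>c. \<forall>i. ac_along (\<lambda>x. ereal (v i x)) (G i) c)" using G by (intro aec_all) (simp add: ACC_def)
 then have "ae_slope_le V H"
 proof (rule aec_mp, intro ballI)
  fix c :: "real \<times> (real \<Rightarrow> 'a)" and s t
  assume ac: "\<forall>i. ac_along (\<lambda>x. ereal (v i x)) (G i) c" and st: "s \<in> {0..fst c}" "t \<in> {0..fst c}"
  have le: "ennreal \<bar>v i (snd c s) - v i (snd c t)\<bar> \<le> line_integral H c" for i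
  proof -
   obtain f where f: "\<And>t. 0 \<le> t \<Longrightarrow> t \<le> fst c \<Longrightarrow> ereal (v i (snd c t)) = ereal (f t)"
    "osc_le f (\<lambda>t. G i (clamped c t)) 0 (fst c)" using ac by (elim allE[of _ i] ac_alongE) blast
   have *: "ennreal \<bar>f s' - f t'\<bar> \<le> line_integral H c" if "0 \<le> s'" "s' \<le> t'" "t' \<le> fst c" for s' t'
   proof -
    have "ennreal \<bar>f s' - f t'\<bar> \<le> lint s' t' (\<lambda>x. G i (clamped c x))" using osc_leD[OF f(2)] that by auto
    also have "\<dots> \<le> lint 0 (fst c) (\<lambda>x. H (clamped c x))"
     using that GH by (intro nn_integral_mono) (auto simp: indicator_def)
    finally show ?thesis by (simp add: clamped_line_integral)
   qed
   show ?thesis using *[of s t] *[of t s] st f(1)[of s] f(1)[of t] by (cases "s \<le> t") (auto simp: abs_minus_commute)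
  qed
  show "ennreal \<bar>V (snd c s) - V (snd c t)\<bar> \<le> line_integral H c"
  proof (cases "line_integral H c")
   case (real l)
   then have "\<bar>v i (snd c s) - v i (snd c t)\<bar> \<le> l" for i using le[of i] by simp
   from cSUP_diff_le[OF bdd bdd this] show ?thesis unfolding V_def using real by (simp add: ennreal_leI)
  qed simp
 qed
 moreover have "pint H \<le> ennreal Q * muint_on W F"
 proof -
  have "pint H = (\<Sum>i. \<integral>\<^sup>+x. epowr (G i x) p \<partial>\<mu>)"
   unfolding H_def epowr_epowr by (simp, intro nn_integral_suminf measurable_mu_borel) measurable
  also have "\<dots> \<le> (\<Sum>i. ennreal Q * (if i \<in> I then (muint_on (ball (y i) (\<rho> (y i))) F) else 0))"
   using G by (intro suminf_le) auto
  also have "\<dots> = ennreal Q * (\<Sum>i. if i \<in> I then (muint_on (ball (y i) (\<rho> (y i))) F) else 0)"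
   by (rule ennreal_suminf_cmult)
  also have "\<dots> \<le> ennreal Q * muint_on W F"
  proof (intro mult_left_mono disjoint_balls_sum_le F_borel disj)
   show "W \<in> sets borel" using W by simp
   fix i assume i: "i \<in> I"
   have "ball (y i) (\<rho> (y i)) \<subseteq> ball (y i) (rad (\<iota> (y i) + 2))" using rad_pos by (intro subset_ball) (simp add: \<rho>_def less_imp_le)
   then show "ball (y i) (\<rho> (y i)) \<subseteq> W" using \<iota> y[OF i] by blast
  qed auto
  finally show ?thesis .
 qed
 moreover have "borel_fun H" unfolding H_def[abs_def] by measurable
 moreover have "1 \<le> V x" if x: "x \<in> S" for x
 proof -
  obtain i where i: "i \<in> I" "x \<in> ball (y i) (3 * \<rho> (y i))" using cov x by blast
  have "1 \<le> v i x" using G i S'[OF x] by (simp add: \<psi>_def)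
  also have "\<dots> \<le> V x" unfolding V_def by (rule cSUP_upper[OF _ bdd]) simp
  finally show ?thesis .
 qed
 moreover have "V x = 0" if "x \<notin> W" for x using G that by (simp add: V_def)
 ultimately show ?thesis by blast
qed

text \<open>The set is null, so it has open neighbourhoods of arbitrarily small measure and
  arbitrarily small mass of \<open>F\<close>. The functions of \<open>small_means_test\<close> then
  have vanishing energies; they vanish outside the neighbourhoods and thus tend to 0 a.e. by the
  Borel-Cantelli lemma.\<close>

lemma small_means_exceptional:
 assumes r: "strict_mono r"
 shows "exceptional {x. w x = 1 \<and> summable (\<lambda>j. b j x) \<and> (\<lambda>k. mean w x (rad (Suc (r k)))) \<longlonglongrightarrow> w x
   \<and> (\<forall>J. \<exists>j\<ge>J. mean w x (rad j) < 1 / 2)}" (is "exceptional ?S")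
proof -
 have "AE x in \<mu>. x \<notin> ?S" using AE_means_converge
 proof eventually_elim
  case (elim x)
  show ?case
  proof
   assume x: "x \<in> ?S"
   then have "eventually (\<lambda>j. 1 / 2 < mean w x (rad (Suc j))) sequentially"
    using elim by (intro order_tendstoD(1)[of _ "w x"]) auto
   then obtain J where J: "\<And>j. J \<le> j \<Longrightarrow> 1 / 2 < mean w x (rad (Suc j))" unfolding eventually_sequentially by blast
   obtain j where "Suc J \<le> j" "mean w x (rad j) < 1 / 2" using x by blast
   then show False using J[of "j - 1"] by (cases j) auto
  qed
 qed
 then have "?S \<in> null_sets \<mu>" by (simp only: null_mu_AE not_not Collect_mem_eq)
 then obtain B where B: "B \<in> sets borel" "?S \<subseteq> B" "emeasure \<mu> B = 0" by (rule null_mu_borel)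
 \<comment> \<open>Outer regularity of the sum of both measures makes \<open>\<mu>\<close> and the
   mass of \<open>F\<close> small on the same open set.\<close>
 define M where "M = density N (\<lambda>x. 1 + F x)"
 have sM: "sets M = sets borel" by (simp add: M_def sets_N)
 have eM: "emeasure M A = emeasure \<mu> A + muint_on A F" if A: "A \<in> sets borel" for A
 proof -
  have [measurable]: "A \<in> sets \<mu>" "F \<in> borel_measurable \<mu>" using A by (auto intro: sets_mu_borel measurable_mu_borel)
  have "emeasure M A = muint (\<lambda>x. indicator A x + F x * indicator A x)"
   unfolding M_def using A by (subst emeasure_density_ball) (auto simp: distrib_right)
  also have "\<dots> = emeasure \<mu> A + muint_on A F" by (subst nn_integral_add) auto
  finally show ?thesis .
 qed
 have finM: "emeasure M (ball z (real n)) < \<infinity>" for n :: nat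
  using ball_finite[of "real n" z] by (cases "n = 0") (auto simp: eM L1_ball[OF F])
 have "emeasure M B = 0"
 proof -
  have "muint_on B F = muint (\<lambda>x. 0)"
   using B AE_not_in[of B \<mu>] by (intro nn_integral_cong_AE) (auto simp: null_sets_def sets_mu_borel)
  then show ?thesis using B by (simp add: eM)
 qed
 have "\<exists>W. open W \<and> B \<subseteq> W \<and> emeasure M W \<le> ennreal ((1 / 2) ^ n)" for n :: nat
 proof -
  obtain W where W: "open W" "B \<subseteq> W" "emeasure M (W - B) \<le> ennreal ((1 / 2) ^ n)"
   by (rule outer_open[OF sM finM B(1), of "(1/2) ^ n"]) auto
  have "emeasure M W \<le> emeasure M (W - B) + emeasure M B"
   using B(1) W by (intro order_trans[OF emeasure_mono emeasure_subadditive]) (auto simp: sM)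
  then show ?thesis using W \<open>emeasure M B = 0\<close> by auto
 qed
 from choice[OF allI[OF this]] obtain W where W: "\<forall>n. open (W n) \<and> B \<subseteq> W n \<and> emeasure M (W n) \<le> ennreal ((1 / 2) ^ n)" by (rule exE)
 have mU: "emeasure \<mu> (W n) \<le> ennreal ((1 / 2) ^ n)" and nU: "muint_on (W n) F \<le> ennreal ((1 / 2) ^ n)" for n
  using W eM[of "W n"] by (auto intro: order_trans[rotated])
 define Q where "Q = 2 powr p * (8 powr p + (4 * K ^ 2) powr p * Cw) * C3"
 have Q: "0 \<le> Q" unfolding Q_def C3_def using Cw_nonneg less_imp_le[OF D_pos[of "K ^ 3"]]
  by (intro mult_nonneg_nonneg add_nonneg_nonneg) auto
 let ?P = "\<lambda>n V G. borel_fun G \<and> (\<forall>x\<in>?S. 1 \<le> V x) \<and> (\<forall>x. x \<notin> W n \<longrightarrow> V x = (0::real)) \<and>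
  ae_slope_le V G \<and> pint G \<le> ennreal Q * muint_on (W n) F"
 have "\<forall>n. \<exists>V G. ?P n V G" unfolding Q_def using W B(2) r by (intro allI small_means_test) auto
 from choice[OF this] obtain V where "\<forall>n. \<exists>G. ?P n (V n) G" by (rule exE)
 from choice[OF this] obtain G where VG: "\<forall>n. ?P n (V n) (G n)" by (rule exE)
 show ?thesis
 proof (rule exceptional_criterion)
  show "borel_fun (G n)" for n using VG by blast
  show "1 \<le> V n x" if "x \<in> ?S" for n x using VG that by blast
  show "ae_slope_le (V n) (G n)" for n using VG by blast
  have "AE x in \<mu>. eventually (\<lambda>n. x \<in> space \<mu> - W n) sequentially"
  proof (rule borel_cantelli_AE1)
   show "W n \<in> sets \<mu>" for n using W by (intro sets_mu_borel) simp
   show "emeasure \<mu> (W n) < \<infinity>" for n using mU[of n] by (auto intro: le_less_trans)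
   show "summable (\<lambda>n. measure \<mu> (W n))"
   proof (rule summable_comparison_test')
    show "summable (\<lambda>n. (1 / 2 :: real) ^ n)" by (intro summable_geometric) simp
    show "norm (measure \<mu> (W n)) \<le> (1 / 2) ^ n" for n using mU[of n] by (simp add: measure_def enn2real_leI)
   qed
  qed
  then show "AE x in \<mu>. (\<lambda>n. V n x) \<longlonglongrightarrow> 0"
  proof eventually_elim
   case (elim x)
   have "eventually (\<lambda>n. V n x = 0) sequentially" using elim by (rule eventually_mono) (use VG in auto)
   then show ?case by (rule tendsto_eventually)
  qed
  have lim: "(\<lambda>n. ennreal (Q * (1 / 2) ^ n)) \<longlonglongrightarrow> 0"
  proof -
   have "(\<lambda>n. Q * (1 / 2) ^ n) \<longlonglongrightarrow> 0" by (intro tendsto_mult_right_zero LIMSEQ_power_zero) auto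
   from tendsto_ennrealI[OF this] show ?thesis unfolding ennreal_0 .
  qed
  have le: "pint (\<lambda>x. G n x) \<le> ennreal (Q * (1 / 2) ^ n)" for n
  proof -
   have "pint (\<lambda>x. G n x) \<le> ennreal Q * muint_on (W n) F" using VG by blast
   also have "\<dots> \<le> ennreal Q * ennreal ((1 / 2) ^ n)" by (intro mult_left_mono nU) simp
   also have "\<dots> = ennreal (Q * (1 / 2) ^ n)" using Q by (simp add: ennreal_mult)
   finally show ?thesis .
  qed
  show "(\<lambda>n. \<integral>\<^sup>+x. epowr (G n x) p \<partial>\<mu>) \<longlonglongrightarrow> 0"
   by (rule tendsto_sandwich[OF always_eventually always_eventually tendsto_const lim]) (rule allI le zero_le)+
 qed
qed

theorem large_means_qe:
 "exceptional {x. w x = 1 \<and> \<not> (summable (\<lambda>j. b j x) \<and> (\<exists>J. \<forall>j\<ge>J. 1 / 2 \<le> mean w x (rad j)))}"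
proof -
 obtain r where r: "strict_mono r" "exceptional {x. \<not> (\<lambda>k. mean w x (rad (Suc (r k)))) \<longlonglongrightarrow> w x}"
  by (rule means_converge)
 show ?thesis
  by (rule exceptional_subset[OF exceptional_Un[OF exceptional_Un[OF r(2) wolff_exceptional] small_means_exceptional[OF r(1)]]])
   (auto simp: not_le)
qed

end

section \<open>Capacities under a Poincare inequality\<close>

lemma diameter_ball_le:
 assumes r: "0 < r" shows "diameter (ball (x::'a::metric_space) r) \<le> 2 * r"
proof -
 have "(SUP (y, y') \<in> ball x r \<times> ball x r. dist y y') \<le> 2 * r"
 proof (rule cSUP_least)
  fix yy assume "yy \<in> ball x r \<times> ball x r"
  then show "(case yy of (y, y') \<Rightarrow> dist y y') \<le> 2 * r"
   using dist_triangle3[of "fst yy" "snd yy" x] by (auto simp: split_beta)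
 qed (use r in auto)
 then show ?thesis using r by (simp add: diameter_def)
qed

locale poincare_space = doubling_measure +
 assumes poincare_inequality: "poincare_inequality p \<mu>"
begin

abbreviation energy :: "('a \<Rightarrow> ereal) \<Rightarrow> 'a set \<Rightarrow> ennreal" where
 "energy u A \<equiv> \<integral>\<^sup>+y\<in>A. epowr (min_grad UNIV u y) p \<partial>\<mu>"

text \<open>The inequality cleared of its left denominator, with the radius in place of the diameter
  (a factor 2 goes into \<open>C\<close>) and restricted to functions with a globally p-integrable
  gradient.\<close>

definition poincare_constants :: "real \<Rightarrow> real \<Rightarrow> bool" where
 "poincare_constants C \<Lambda> \<longleftrightarrow> 0 < C \<and> 1 \<le> \<Lambda> \<and>
   (\<forall>x r. \<forall>u \<in> dirichlet UNIV. 0 < r \<longrightarrow> (muint (\<lambda>y. e2ennreal \<bar>u y\<bar>)) < \<infinity> \<longrightarrow>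
    (muint_on (ball x r) (\<lambda>y. e2ennreal \<bar>u y - ereal (mean_value \<mu> (ball x r) u)\<bar>))
    \<le> ennreal (C * r * m x r) * epowr (energy u (ball x (\<Lambda> * r)) / ennreal (m x (\<Lambda> * r))) (1 / p))"

lemma poincare_constantsD:
 assumes "poincare_constants C \<Lambda>" "u \<in> dirichlet UNIV" "muint (\<lambda>y. e2ennreal \<bar>u y\<bar>) < \<infinity>" "0 < r"
 shows "muint_on (ball x r) (\<lambda>y. e2ennreal \<bar>u y - ereal (mean_value \<mu> (ball x r) u)\<bar>)
  \<le> ennreal (C * r * m x r) * epowr (energy u (ball x (\<Lambda> * r)) / ennreal (m x (\<Lambda> * r))) (1 / p)"
 using assms unfolding poincare_constants_def by simp

lemma ex_poincare_constants: "\<exists>C \<Lambda>. poincare_constants C \<Lambda>"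
proof -
 obtain C \<Lambda> where C: "0 < C" "1 \<le> \<Lambda>" and P: "\<And>x r u. u \<in> dirichlet_space_loc p \<mu> UNIV \<Longrightarrow>
    0 < r \<Longrightarrow> u \<in> borel_measurable \<mu> \<Longrightarrow> muint (\<lambda>y. e2ennreal \<bar>u y\<bar>) < \<infinity> \<Longrightarrow>
    (muint_on (ball x r) (\<lambda>y. e2ennreal \<bar>u y - ereal (mean_value \<mu> (ball x r) u)\<bar>)) / emeasure \<mu> (ball x r)
    \<le> ennreal (C * diameter (ball x r)) *
      epowr ((pint_on (ball x (\<Lambda> * r)) (\<lambda>y. min_grad UNIV u y)) / emeasure \<mu> (ball x (\<Lambda> * r))) (1 / p)"
  using poincare_inequality unfolding poincare_inequality_def by blast
 have "poincare_constants (2 * C) \<Lambda>" unfolding poincare_constants_def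
 proof (intro conjI allI ballI impI)
  fix x :: 'a and r :: real and u assume u: "u \<in> dirichlet UNIV" "muint (\<lambda>y. e2ennreal \<bar>u y\<bar>) < \<infinity>" and r: "0 < r"
  let ?I = "\<integral>\<^sup>+y\<in>ball x r. e2ennreal \<bar>u y - ereal (mean_value \<mu> (ball x r) u)\<bar> \<partial>\<mu>"
  let ?e = "epowr (energy u (ball x (\<Lambda> * r)) / ennreal (m x (\<Lambda> * r))) (1 / p)"
  have loc: "u \<in> dirichlet_space_loc p \<mu> UNIV" unfolding dirichlet_space_loc_def
  proof (intro CollectI ballI exI conjI)
   fix y :: 'a
   show "u \<in> dirichlet (UNIV \<inter> ball y 1)"
    by (rule dirichlet_space_subset[OF UNIV_mu _ _ u(1)]) (auto intro: sets_mu_borel)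
  qed simp
  have meas: "u \<in> borel_measurable \<mu>" using u(1) by (simp add: dirichlet_space_def measurable_restrict_UNIV)
  have \<Lambda>r: "0 < \<Lambda> * r" using C r by simp
  have mr: "0 < m x r" by (rule m_pos[OF r])
  have le: "?I / ennreal (m x r) \<le> ennreal (C * diameter (ball x r)) * ?e"
   using P[OF loc r meas u(2), of x] by (simp add: emeasure_ball r \<Lambda>r)
  have "?I = ?I / ennreal (m x r) * ennreal (m x r)"
   using mr by (simp add: ennreal_divide_times ennreal_divide_self)
  also have "\<dots> \<le> ennreal (C * diameter (ball x r)) * ?e * ennreal (m x r)" by (intro mult_right_mono le) simp
  also have "\<dots> \<le> ennreal (2 * C * r) * ?e * ennreal (m x r)"
   using C diameter_ball_le[OF r, of x] by (intro mult_right_mono ennreal_leI) auto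
  also have "\<dots> = ennreal (2 * C * r * m x r) * ?e" using C r mr by (simp add: ennreal_mult mult_ac)
  finally show "?I \<le> ennreal (2 * C * r * m x r) * ?e" .
 qed (use C in auto)
 then show ?thesis by blast
qed

lemma energy_le:
 assumes "ACC UNIV u G" "Lp G" shows "energy u A \<le> pint_on A G" using min_gradient_le[OF UNIV_mu assms]
 by (intro nn_integral_mono_AE) (auto elim!: eventually_mono intro!: mult_right_mono epowr_mono)

lemma mean_value_real:
 assumes w: "w \<in> borel_measurable \<mu>" "\<And>x. 0 \<le> w x" and r: "0 < r"
 shows "mean_value \<mu> (ball x r) (\<lambda>y. ereal (w y)) = mean w x r"
proof -
 have "(LINT y:ball x r|\<mu>. w y) = enn2real (muint (\<lambda>y. ennreal (indicator (ball x r) y *\<^sub>R w y)))"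
  unfolding set_lebesgue_integral_def using w
  by (intro integral_eq_nn_integral borel_measurable_scaleR borel_measurable_indicator sets_mu_borel) auto
 also have "muint (\<lambda>y. ennreal (indicator (ball x r) y *\<^sub>R w y)) = muint_on (ball x r) (\<lambda>y. ennreal (w y))"
  by (intro nn_integral_cong) (auto simp: indicator_def)
 finally show ?thesis by (simp add: mean_value_def mean_def nu_def m_def)
qed

lemma e2ennreal_abs_diff: "e2ennreal \<bar>ereal a - ereal b\<bar> = ennreal \<bar>a - b\<bar>" by simp

text \<open>The mean value is at least \<open>1 / 2\<close> away from \<open>u\<close> on one of the two small balls.\<close>

lemma separated_energy:
 assumes C: "poincare_constants C \<Lambda>" and u: "u \<in> dirichlet UNIV" "muint (\<lambda>y. e2ennreal \<bar>u y\<bar>) < \<infinity>"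
  and s: "0 < s" "0 < L" and x: "\<And>q. q \<in> ball x s \<Longrightarrow> 1 \<le> u q" and y: "\<And>q. q \<in> ball y s \<Longrightarrow> u q = 0"
  and sub: "ball x s \<subseteq> ball x L" "ball y s \<subseteq> ball x L"
 shows "ennreal (min (m x s) (m y s) / 2)
  \<le> ennreal (C * L * m x L) * epowr (energy u UNIV / ennreal (m x (\<Lambda> * L))) (1 / p)"
proof -
 define a where "a = mean_value \<mu> (ball x L) u"
 have half: "\<exists>q. ball q s \<subseteq> ball x L \<and> min (m x s) (m y s) \<le> m q s \<and> (\<forall>t\<in>ball q s. ennreal (1 / 2) \<le> e2ennreal \<bar>u t - ereal a\<bar>)"
 proof (cases "a \<le> 1 / 2")
  case True
  have "ennreal (1 / 2) \<le> e2ennreal \<bar>u t - ereal a\<bar>" if "t \<in> ball x s" for t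
  proof (cases "u t")
   case (real v)
   then have "1 / 2 \<le> \<bar>v - a\<bar>" using x[OF that] True by (simp add: one_ereal_def)
   then have "ennreal (1 / 2) \<le> ennreal \<bar>v - a\<bar>" by (rule ennreal_leI)
   then show ?thesis using real by simp
  qed (use x[OF that] in auto)
  then show ?thesis using sub(1) by (intro exI[of _ x]) auto
 next
  case False
  have "ennreal (1 / 2) \<le> e2ennreal \<bar>u t - ereal a\<bar>" if "t \<in> ball y s" for t
  proof -
   have "ennreal (1 / 2) \<le> ennreal \<bar>0 - a\<bar>" using False by (intro ennreal_leI) auto
   moreover have "e2ennreal \<bar>u t - ereal a\<bar> = ennreal \<bar>0 - a\<bar>" using y[OF that] by (simp add: zero_ereal_def)
   ultimately show ?thesis by simp
  qed
  then show ?thesis using sub(2) by (intro exI[of _ y]) auto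
 qed
 then obtain q where q': "ball q s \<subseteq> ball x L \<and> min (m x s) (m y s) \<le> m q s \<and> (\<forall>t\<in>ball q s. ennreal (1 / 2) \<le> e2ennreal \<bar>u t - ereal a\<bar>)"
  by (rule exE)
 note q = conjunct1[OF q'] conjunct1[OF conjunct2[OF q']] conjunct2[OF conjunct2[OF q']]
 have "ennreal (min (m x s) (m y s) / 2) \<le> ennreal (1 / 2 * m q s)" using q(2) by (intro ennreal_leI) simp
 also have "\<dots> = ennreal (1 / 2) * ennreal (m q s)" using m_pos[OF s(1), of q] by (intro ennreal_mult) auto
 also have "\<dots> = muint_on (ball q s) (\<lambda>t. ennreal (1 / 2))"
  using s by (subst nn_integral_cmult_indicator) (auto simp: emeasure_ball intro: sets_mu_borel)
 also have "\<dots> \<le> muint_on (ball x L) (\<lambda>t. e2ennreal \<bar>u t - ereal a\<bar>)"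
  using q by (intro nn_integral_mono) (auto simp: indicator_def)
 also have "\<dots> \<le> ennreal (C * L * m x L) * epowr (energy u (ball x (\<Lambda> * L)) / ennreal (m x (\<Lambda> * L))) (1 / p)"
  unfolding a_def by (rule poincare_constantsD[OF C u s(2)])
 also have "\<dots> \<le> ennreal (C * L * m x L) * epowr (energy u UNIV / ennreal (m x (\<Lambda> * L))) (1 / p)"
  by (intro mult_left_mono epowr_mono divide_right_mono_ennreal nn_integral_mono) (auto simp: indicator_def)
 finally show ?thesis .
qed

text \<open>Over an empty annulus a curve could not change between inside and outside, since its
  distance to \<open>x\<close> would take the value \<open>3 * r\<close>. The indicator of the ball
  would then have zero energy, which contradicts the Poincare inequality in a ball reaching
  \<open>y\<close>.\<close>

lemma annulus_nonempty:
 fixes x y :: 'a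
 assumes r: "0 < r" and y: "3 * r \<le> dist x y"
 obtains q where "3 * r \<le> dist x q" "dist x q < 6 * r"
proof (rule ccontr)
 assume "\<not> thesis"
 then have no: "dist x q < 3 * r \<or> 6 * r \<le> dist x q" for q using that[of q] by linarith
 define u :: "'a \<Rightarrow> ereal" where "u = indicator (ball x (3 * r))"
 have [measurable]: "ball x (3 * r) \<in> sets \<mu>" by (intro sets_mu_borel) simp
 have "ACC UNIV u (\<lambda>x. 0)" unfolding ACC_def
 proof (intro conjI aec_True)
  fix c :: "real \<times> (real \<Rightarrow> 'a)" assume c: "c \<in> curves UNIV"
  have same: "u (snd c t) = u (snd c 0)" if t: "0 \<le> t" "t \<le> fst c" for t
  proof (rule ccontr)
   assume ne: "u (snd c t) \<noteq> u (snd c 0)"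
   let ?I = "(\<lambda>t. dist x (snd c t)) ` {0..fst c}"
   have con: "connected ?I"
    by (intro connected_continuous_image[OF _ connected_Icc] continuous_intros curves_continuous[OF c])
   have mem: "dist x (snd c t) \<in> ?I" "dist x (snd c 0) \<in> ?I" using t by auto
   have "(dist x (snd c t) \<le> 3 * r \<and> 3 * r \<le> dist x (snd c 0)) \<or> (dist x (snd c 0) \<le> 3 * r \<and> 3 * r \<le> dist x (snd c t))"
    using ne by (auto simp: u_def indicator_def split: if_splits)
   then have "3 * r \<in> ?I"
    using connectedD_interval[OF con mem] connectedD_interval[OF con mem(2,1)] by (elim disjE conjE) blast+
   then obtain \<tau> where "dist x (snd c \<tau>) = 3 * r" by auto
   then show False using no[of "snd c \<tau>"] r by simp
  qed
  obtain v where v: "u (snd c 0) = ereal v"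
   by (cases "snd c 0 \<in> ball x (3 * r)") (auto simp: u_def zero_ereal_def one_ereal_def)
  show "ac_along u (\<lambda>x. 0) c"
   by (intro ac_alongI[where f="\<lambda>t. v"]) (simp_all add: same v line_integral_def osc_le_def)
 qed simp
 moreover have "u \<in> borel_measurable (restrict_space \<mu> UNIV)" unfolding measurable_restrict_UNIV u_def by measurable
 ultimately have u: "u \<in> dirichlet UNIV" and E: "energy u UNIV = 0"
  using Lp_zero energy_le[of u "\<lambda>x. 0" UNIV] by (auto simp: dirichlet_space_iff)
 obtain C \<Lambda> where C: "poincare_constants C \<Lambda>" using ex_poincare_constants by blast
 have d6: "6 * r \<le> dist x y" using no[of y] y by auto
 have "muint (\<lambda>y. e2ennreal \<bar>u y\<bar>) = muint (\<lambda>y. indicator (ball x (3 * r)) y)"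
  by (intro nn_integral_cong) (auto simp: u_def indicator_def one_ereal_def e2ennreal_neg)
 then have fin: "muint (\<lambda>y. e2ennreal \<bar>u y\<bar>) < \<infinity>" using ball_finite[of "3 * r" x] r by simp
 have "ennreal (min (m x r) (m y r) / 2)
   \<le> ennreal (C * (dist x y + r) * m x (dist x y + r)) * epowr (energy u UNIV / ennreal (m x (\<Lambda> * (dist x y + r)))) (1 / p)"
 proof (rule separated_energy[OF C u fin r])
  show "1 \<le> u q" if "q \<in> ball x r" for q using that r by (simp add: u_def)
  show "u q = 0" if "q \<in> ball y r" for q using that r d6 dist_triangle[of x y q] by (auto simp: u_def dist_commute)
  show "ball y r \<subseteq> ball x (dist x y + r)" by (rule ball_subset_ball) (simp add: dist_commute)
  show "ball x r \<subseteq> ball x (dist x y + r)" by (intro subset_ball) simp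
 qed (use r in \<open>simp add: add_nonneg_pos\<close>)
 then show False using E m_pos[OF r, of x] m_pos[OF r, of y] by (simp add: min_def split: if_splits)
qed

lemma newton_space0_UNIV:
 assumes "u \<in> newton_space0 p \<mu> G" "\<And>x. x \<notin> G \<Longrightarrow> u x = 0"
 shows "u \<in> newton UNIV"
proof -
 obtain h where h: "h \<in> newton UNIV" "\<forall>x. x \<notin> G \<longrightarrow> h x = 0" "\<forall>x\<in>G. u x = h x"
  using assms(1) unfolding newton_space0_def by blast
 then have "u = h" using assms(2) by (intro ext) metis
 then show ?thesis using h by simp
qed

lemma newton_dirichlet: "u \<in> newton UNIV \<Longrightarrow> u \<in> dirichlet UNIV"
 by (simp add: newton_space_iff dirichlet_space_iff measurable_restrict_UNIV)

text \<open>An admissible function is at least 1 on \<open>ball x r\<close> and 0 on a ball of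
  radius \<open>r\<close> centred in the annulus, both inside \<open>ball x (7 * r)\<close>, so
  \<open>separated_energy\<close> applies. The point \<open>y\<close> guarantees the annulus for
  small \<open>r\<close>.\<close>

lemma capacity_lower_bound:
 fixes x y :: 'a
 assumes ne: "y \<noteq> x"
 obtains c where "0 < c" "\<And>r. 0 < r \<Longrightarrow> 3 * r \<le> dist x y \<Longrightarrow>
  ennreal (c * (r powr (- p) * m x r)) \<le> vcap (ball x r) (ball x (2 * r))"
proof -
 obtain C \<Lambda> where C: "poincare_constants C \<Lambda>" using ex_poincare_constants by blast
 then have C0: "0 < C" "1 \<le> \<Lambda>" by (auto simp: poincare_constants_def)
 have D7: "0 < D 7" by (rule D_pos)
 \<comment> \<open>Here 14 is the product of the radius factor 7 and the 2 from the halved measure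
   in \<open>separated_energy\<close>; \<open>D 7\<close> compares \<open>ball x (7 * r)\<close>
   with the two small balls.\<close>
 define c where "c = (1 / (14 * C * D 7)) powr p"
 show ?thesis
 proof (rule that)
  show "0 < c" using C0 D7 by (simp add: c_def)
  fix r assume r: "0 < r" "3 * r \<le> dist x y"
  show "ennreal (c * (r powr (- p) * m x r)) \<le> vcap (ball x r) (ball x (2 * r))" unfolding variational_capacity_def
  proof (rule INF_greatest)
   fix u assume "u \<in> {u \<in> newton_space0 p \<mu> (ball x (2 * r)). (\<forall>q. q \<notin> ball x (2 * r) \<longrightarrow> u q = 0) \<and> (\<forall>q\<in>ball x r. 1 \<le> u q)}"
   then have u: "u \<in> newton UNIV" "\<And>q. q \<notin> ball x (2 * r) \<Longrightarrow> u q = 0" "\<And>q. q \<in> ball x r \<Longrightarrow> 1 \<le> u q"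
    using newton_space0_UNIV[of u "ball x (2 * r)"] by auto
   have int: "muint (\<lambda>q. e2ennreal \<bar>u q\<bar>) < \<infinity>"
   proof -
    \<comment> \<open>The 1 is needed only on the ball \<open>ball x (2 * r)\<close> of finite
      measure; outside it \<open>u\<close> vanishes.\<close>
    have pw: "a \<le> 1 + epowr a p" for a :: ennreal
    proof (cases "a \<le> 1")
     case False
     have "a \<le> epowr a p"
     proof (cases a)
      case (real t)
      then have "t powr 1 \<le> t powr p" using False p_gt_1 by (intro powr_mono) auto
      then show ?thesis using real by (simp add: epowr_ennreal ennreal_leI)
     qed simp
     then show ?thesis by (simp add: add_increasing)
    qed (simp add: add_increasing2)
    have "muint (\<lambda>q. e2ennreal \<bar>u q\<bar>) \<le> muint (\<lambda>q. indicator (ball x (2 * r)) q + epowr (e2ennreal \<bar>u q\<bar>) p)"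
    proof (intro nn_integral_mono)
     fix q show "e2ennreal \<bar>u q\<bar> \<le> indicator (ball x (2 * r)) q + epowr (e2ennreal \<bar>u q\<bar>) p"
      using pw[of "e2ennreal \<bar>u q\<bar>"] u(2)[of q] by (cases "q \<in> ball x (2 * r)") (auto simp: e2ennreal_neg)
    qed
    also have "\<dots> = emeasure \<mu> (ball x (2 * r)) + pint (\<lambda>q. e2ennreal \<bar>u q\<bar>)"
    proof -
     have [measurable]: "u \<in> borel_measurable \<mu>" "ball x (2 * r) \<in> sets \<mu>"
      using u(1) by (auto simp: newton_space_iff intro: sets_mu_borel)
     show ?thesis by (subst nn_integral_add) auto
    qed
    also have "\<dots> < \<infinity>" using u(1) ball_finite[of "2 * r" x] r by (simp add: newton_space_iff)
    finally show ?thesis .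
   qed
   obtain q where q: "3 * r \<le> dist x q" "dist x q < 6 * r" by (rule annulus_nonempty[OF r])
   have \<Lambda>7: "0 < \<Lambda> * (7 * r)" using C0 r by simp
   have sep: "ennreal (min (m x r) (m q r) / 2)
     \<le> ennreal (C * (7 * r) * m x (7 * r)) * epowr (energy u UNIV / ennreal (m x (\<Lambda> * (7 * r)))) (1 / p)"
   proof (rule separated_energy[OF C newton_dirichlet[OF u(1)] int r(1)])
    show "1 \<le> u t" if "t \<in> ball x r" for t using u(3) that .
    show "u t = 0" if "t \<in> ball q r" for t
     using that q dist_triangle[of x q t] by (intro u(2)) (auto simp: dist_commute)
    show "ball q r \<subseteq> ball x (7 * r)" using q by (intro ball_subset_ball) (simp add: dist_commute)
    show "ball x r \<subseteq> ball x (7 * r)" using r by (intro subset_ball) simp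
   qed (use r in simp)
   have "ennreal (c * (r powr (- p) * m x r)) \<le> energy u UNIV"
   proof (cases "energy u UNIV")
    case (real E)
    let ?M = "m x (\<Lambda> * (7 * r))"
    have M: "0 < ?M" "0 < m x (7 * r)" "0 < m x r" using r \<Lambda>7 by (auto intro: m_pos)
    have "m x (7 * r) \<le> D 7 * m x r" "m x (7 * r) \<le> D 7 * m q r" using r q by (auto intro!: m_compare)
    then have min: "m x (7 * r) \<le> D 7 * min (m x r) (m q r)" by (simp add: min_def)
    have "ennreal (min (m x r) (m q r) / 2) \<le> ennreal (C * (7 * r) * m x (7 * r) * (E / ?M) powr (1 / p))"
     using sep real M C0 r by (simp add: divide_ennreal epowr_ennreal ennreal_mult)
    then have "min (m x r) (m q r) / 2 \<le> C * (7 * r) * m x (7 * r) * (E / ?M) powr (1 / p)"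
     using C0 r M by (subst (asm) ennreal_le_iff) auto
    then have "D 7 * min (m x r) (m q r) \<le> D 7 * (2 * (C * (7 * r) * m x (7 * r) * (E / ?M) powr (1 / p)))"
     using D7 by (intro mult_left_mono) auto
    then have "1 * m x (7 * r) \<le> (14 * C * D 7 * r * (E / ?M) powr (1 / p)) * m x (7 * r)"
     using min by (simp add: mult_ac)
    then have "1 \<le> 14 * C * D 7 * r * (E / ?M) powr (1 / p)" using M by (simp only: mult_le_cancel_right_pos)
    then have "1 / (14 * C * D 7) / r \<le> (E / ?M) powr (1 / p)" using C0 D7 r by (simp add: field_simps)
    then have "(1 / (14 * C * D 7) / r) powr p \<le> ((E / ?M) powr (1 / p)) powr p"
     using C0 D7 r by (intro powr_mono2) auto
    moreover have "((E / ?M) powr (1 / p)) powr p = E / ?M" using real M by (simp add: powr_powr)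
    moreover have "(1 / (14 * C * D 7) / r) powr p = c * r powr (- p)"
     by (simp only: powr_divide[of "1 / (14 * C * D 7)" r] c_def powr_minus_divide) simp
    ultimately have "c * r powr (- p) * ?M \<le> E" using M by (simp add: field_simps)
    moreover have "c * (r powr (- p) * m x r) \<le> c * r powr (- p) * ?M"
    proof -
     have "1 * r \<le> \<Lambda> * (7 * r)" using C0 r by (intro mult_mono) auto
     then have "m x r \<le> ?M" using r by (intro m_mono subset_ball) auto
     then have "c * r powr (- p) * m x r \<le> c * r powr (- p) * ?M" by (intro mult_left_mono) (auto simp: c_def)
     then show ?thesis by (simp only: mult.assoc)
    qed
    ultimately show ?thesis using real by (simp add: ennreal_leI)
   qed simp
   then show "ennreal (c * (r powr (- p) * m x r)) \<le> pint (\<lambda>q. min_grad UNIV u q)" by simp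
  qed
 qed
qed

text \<open>A test function need be 1 on \<open>A\<close> only off an exceptional set: redefining it
  as 1 there changes neither membership in the Newtonian space nor the minimal gradient.\<close>

lemma capacity_upper_bound:
 fixes v :: "'a \<Rightarrow> real"
 assumes v: "ACC UNIV (\<lambda>y. ereal (v y)) G" "Lp G" "v \<in> borel_measurable \<mu>" "\<And>y. 0 \<le> v y" "\<And>y. v y \<le> 1"
  and r: "0 < r" and out: "\<And>y. y \<notin> ball x r \<Longrightarrow> v y = 0"
  and Z: "exceptional Z" and A: "\<And>y. y \<in> A \<Longrightarrow> y \<in> ball x r \<and> (y \<in> Z \<or> v y = 1)"
 shows "vcap A (ball x r) \<le> pint G"
proof -
 define u where "u y = (if y \<in> Z \<inter> ball x r then 1 else ereal (v y))" for y
 have "pint (\<lambda>y. e2ennreal \<bar>ereal (v y)\<bar>) \<le> muint (\<lambda>y. indicator (ball x r) y)"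
 proof (intro nn_integral_mono)
  fix y
  have "v y powr p \<le> 1 powr p" using v(4,5) by (intro powr_mono2) auto
  then show "epowr (e2ennreal \<bar>ereal (v y)\<bar>) p \<le> indicator (ball x r) y"
   using v(4)[of y] out[of y] by (cases "y \<in> ball x r") (auto simp: epowr_ennreal)
 qed
 also have "\<dots> < \<infinity>" using ball_finite[OF r, of x] by (simp add: sets_mu_borel)
 finally have vN: "(\<lambda>y. ereal (v y)) \<in> newton UNIV" using v(1-3) by (auto simp: newton_space_iff)
 have eq: "ereal (v y) = u y" if "y \<notin> Z" for y using that by (simp add: u_def)
 have uN: "u \<in> newton UNIV" by (rule newton_space_cong[OF vN Z eq])
 have out': "u y = 0" if "y \<notin> ball x r" for y using out[OF that] that by (simp add: u_def)
 then have "u \<in> newton_space0 p \<mu> (ball x r)" using uN unfolding newton_space0_def by blast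
 moreover have "1 \<le> u y" if "y \<in> A" for y using A[OF that] by (auto simp: u_def one_ereal_def)
 ultimately have "vcap A (ball x r) \<le> pint (\<lambda>y. min_grad UNIV u y)"
  unfolding variational_capacity_def using out' by (intro INF_lower) auto
 also have "min_grad UNIV u = min_grad UNIV (\<lambda>y. ereal (v y))"
  by (rule min_gradient_cong[OF UNIV_mu Z eq[symmetric]])
 finally show ?thesis using energy_le[OF v(1,2), of UNIV] by simp
qed

lemma capacity_mono: "A \<subseteq> B \<Longrightarrow> vcap A G \<le> vcap B G"
 unfolding variational_capacity_def by (intro INF_superset_mono) auto

end

section \<open>Finely open sets\<close>

context poincare_space
begin

definition thin_integrand :: "'a set \<Rightarrow> 'a \<Rightarrow> real \<Rightarrow> ennreal" where
 "thin_integrand A x r = (if vcap (ball x r) (ball x (2 * r)) = 0 then 1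
   else epowr (vcap (A \<inter> ball x r) (ball x (2 * r))
    / vcap (ball x r) (ball x (2 * r))) (1 / (p - 1)))"

lemma thin_integrand_le_1: "thin_integrand A x r \<le> 1"
proof (cases "vcap (ball x r) (ball x (2 * r)) = 0")
 case False
 have "vcap (A \<inter> ball x r) (ball x (2 * r)) \<le> vcap (ball x r) (ball x (2 * r))" by (intro capacity_mono) auto
 then have "vcap (A \<inter> ball x r) (ball x (2 * r)) / vcap (ball x r) (ball x (2 * r)) \<le> 1"
  using False by (intro divide_le_posI_ennreal) (auto simp: zero_less_iff_neq_zero)
 then have "epowr (vcap (A \<inter> ball x r) (ball x (2 * r)) / vcap (ball x r) (ball x (2 * r))) (1 / (p - 1))
   \<le> epowr 1 (1 / (p - 1))" using p_gt_1 by (intro epowr_mono) auto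
 then show ?thesis using False by (simp add: thin_integrand_def)
qed (simp add: thin_integrand_def)

lemma thin_atI:
 fixes x y :: 'a
 assumes ne: "y \<noteq> x" and K: "1 < K" and q: "0 < q" and c: "summable c" "\<And>j. 0 \<le> c j"
  and cap: "\<And>j r. J \<le> j \<Longrightarrow> q / K ^ Suc j < r \<Longrightarrow> r \<le> q / K ^ j \<Longrightarrow>
   vcap (A \<inter> ball x r) (ball x (2 * r)) \<le> ennreal (c j powr (p - 1) * (r powr (- p) * m x r))"
 shows "thin_at p \<mu> A x"
proof -
 obtain k where k: "0 < k" "\<And>r. 0 < r \<Longrightarrow> 3 * r \<le> dist x y \<Longrightarrow>
  ennreal (k * (r powr (- p) * m x r)) \<le> vcap (ball x r) (ball x (2 * r))"
  by (rule capacity_lower_bound[OF ne]) blast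
 have "(\<lambda>j. q * (1 / K) ^ j) \<longlonglongrightarrow> 0" using K by (intro tendsto_mult_right_zero LIMSEQ_power_zero) auto
 moreover have "0 < min 1 (dist x y / 3)" using ne by simp
 ultimately have "eventually (\<lambda>j. q * (1 / K) ^ j < min 1 (dist x y / 3)) sequentially" by (rule order_tendstoD(2))
 then obtain J1 where J1: "\<And>j. J1 \<le> j \<Longrightarrow> q * (1 / K) ^ j < min 1 (dist x y / 3)" unfolding eventually_sequentially by blast
 define j1 where "j1 = max J J1"
 define t where "t = q / K ^ j1"
 have "t = q * (1 / K) ^ j1" by (simp add: t_def power_divide)
 then have t: "0 < t" "t < 1" "3 * t < dist x y" using J1[of j1] q K by (auto simp: j1_def)
 define L where "L = (1 / k) powr (1 / (p - 1))"
 define S where "S j = {q / K ^ Suc (j1 + j) <.. q / K ^ (j1 + j)}" for j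
 have len: "0 \<le> q / K ^ (j1 + j) - q / K ^ Suc (j1 + j)" for j using K q by (simp add: field_simps)
 have bound: "thin_integrand A x r \<le> ennreal (L * c (j1 + j))" if r: "r \<in> S j" for r j
 proof -
  have r0: "0 < r" using r q K by (auto simp: S_def intro: less_trans[rotated])
  have "q / K ^ (j1 + j) \<le> t" unfolding t_def using K q by (intro divide_left_mono power_increasing) auto
  then have r3: "3 * r \<le> dist x y" using r t by (auto simp: S_def)
  define M where "M = r powr (- p) * m x r"
  have M: "0 < M" using m_pos[OF r0, of x] r0 by (simp add: M_def)
  let ?B = "vcap (ball x r) (ball x (2 * r))"
  let ?A = "vcap (A \<inter> ball x r) (ball x (2 * r))"
  have B: "ennreal (k * M) \<le> ?B" using k(2)[OF r0 r3] by (simp add: M_def)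
  have kM: "0 < k * M" using k(1) M by simp
  then have B0: "?B \<noteq> 0" using B by (metis ennreal_eq_0_iff le_zero_eq not_le)
  have "?A \<le> ennreal (c (j1 + j) powr (p - 1) * M)" unfolding M_def using r by (intro cap) (auto simp: S_def j1_def)
  then have "?A / ?B \<le> ennreal (c (j1 + j) powr (p - 1) * M) / ennreal (k * M)"
   using B unfolding divide_ennreal_def by (intro mult_mono ennreal_inverse_antimono) auto
  also have "\<dots> = ennreal (c (j1 + j) powr (p - 1) / k)" using kM M by (subst divide_ennreal) auto
  finally have "epowr (?A / ?B) (1 / (p - 1)) \<le> epowr (ennreal (c (j1 + j) powr (p - 1) / k)) (1 / (p - 1))"
   using p_gt_1 by (intro epowr_mono) auto
  also have "\<dots> = ennreal (((1 / k) * c (j1 + j) powr (p - 1)) powr (1 / (p - 1)))" using k(1) by (simp add: epowr_ennreal)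
  also have "((1 / k) * c (j1 + j) powr (p - 1)) powr (1 / (p - 1)) = L * c (j1 + j)"
   unfolding powr_mult L_def using p_gt_1 c(2)[of "j1 + j"] by (simp add: powr_powr)
  finally show ?thesis using B0 by (simp add: thin_integrand_def)
 qed
 have cover: "\<exists>j. r \<in> S j" if r: "0 < r" "r < t" for r
 proof -
  have "\<exists>n. q / K ^ n < r"
  proof -
   have "(\<lambda>j. q * (1 / K) ^ j) \<longlonglongrightarrow> 0" using K by (intro tendsto_mult_right_zero LIMSEQ_power_zero) auto
   then have "eventually (\<lambda>j. q * (1 / K) ^ j < r) sequentially" using r(1) by (rule order_tendstoD(2))
   then show ?thesis unfolding eventually_sequentially by (auto simp: power_divide)
  qed
  define n where "n = (LEAST n. q / K ^ n < r)"
  have n: "q / K ^ n < r" unfolding n_def using \<open>\<exists>n. _\<close> by (rule LeastI_ex)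
  have "j1 < n"
  proof (rule ccontr)
   assume "\<not> j1 < n"
   then have "t \<le> q / K ^ n" unfolding t_def using K q by (intro divide_left_mono power_increasing) auto
   then show False using n r by simp
  qed
  then obtain j where j: "n = Suc (j1 + j)" using less_imp_Suc_add by blast
  have "\<not> q / K ^ (j1 + j) < r" using not_less_Least[of "j1 + j" "\<lambda>n. q / K ^ n < r"] j by (auto simp: n_def)
  then show ?thesis using n j by (auto simp: S_def)
 qed
 \<comment> \<open>The last factor is the bound for \<open>1 / r\<close> at the lower end of the
   shell.\<close>
 let ?s = "\<lambda>j. ennreal (L * c (j1 + j) * (K ^ Suc (j1 + j) / q))"
 have pointwise: "thin_integrand A x r * ennreal (1 / r) * indicator {0<..<1} r
   \<le> ennreal (1 / t) * indicator {t..1} r + (\<Sum>j. ?s j * indicator (S j) r)" for r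
 proof (cases "0 < r \<and> r < 1")
  case True
  show ?thesis
  proof (cases "t \<le> r")
   case le: True
   have "thin_integrand A x r * ennreal (1 / r) \<le> 1 * ennreal (1 / t)"
    using le t by (intro mult_mono thin_integrand_le_1 ennreal_leI) (auto simp: frac_le)
   then show ?thesis using True le by (simp add: add_increasing2)
  next
   case False
   then obtain j where j: "r \<in> S j" using cover[of r] True by auto
   have "1 / r \<le> K ^ Suc (j1 + j) / q" using j True q K by (auto simp: S_def field_simps)
   then have "thin_integrand A x r * ennreal (1 / r) \<le> ennreal (L * c (j1 + j)) * ennreal (K ^ Suc (j1 + j) / q)"
    by (intro mult_mono bound[OF j] ennreal_leI) auto
   also have "\<dots> = ?s j * indicator (S j) r" using j c(2) K q by (simp add: L_def ennreal_mult[symmetric])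
   also have "\<dots> \<le> (\<Sum>j. ?s j * indicator (S j) r)"
   proof -
    have "f j \<le> suminf f" for f :: "nat \<Rightarrow> ennreal" using sum_le_suminf[of f "{j}"] by simp
    then show ?thesis .
   qed
   finally show ?thesis using True by (simp add: add_increasing)
  qed
 qed auto
 have "(\<integral>\<^sup>+r\<in>{0<..<1}. thin_integrand A x r * ennreal (1 / r) \<partial>lebesgue)
   \<le> (\<integral>\<^sup>+r. ennreal (1 / t) * indicator {t..1} r + (\<Sum>j. ?s j * indicator (S j) r) \<partial>lebesgue)"
  by (intro nn_integral_mono pointwise)
 also have "\<dots> = ennreal (1 / t) * emeasure lebesgue {t..1} + (\<Sum>j. ?s j * emeasure lebesgue (S j))"
 proof -
  have [measurable]: "S j \<in> sets lebesgue" "{t..1} \<in> sets lebesgue" for j by (auto simp: S_def)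
  show ?thesis by (simp add: nn_integral_add nn_integral_suminf nn_integral_cmult_indicator)
 qed
 also have "(\<Sum>j. ?s j * emeasure lebesgue (S j)) = (\<Sum>j. ennreal (L * (K - 1) * c (j1 + j)))"
 proof (intro arg_cong[where f=suminf] ext)
  fix j
  have "?s j * emeasure lebesgue (S j) = ennreal (L * c (j1 + j) * (K ^ Suc (j1 + j) / q) * (q / K ^ (j1 + j) - q / K ^ Suc (j1 + j)))"
   using len[of j] c(2) K q by (simp add: S_def L_def ennreal_mult[symmetric])
  also have "(L * c (j1 + j) * (K ^ Suc (j1 + j) / q) * (q / K ^ (j1 + j) - q / K ^ Suc (j1 + j))) = L * (K - 1) * c (j1 + j)"
   using K q by (simp add: field_simps)
  finally show "?s j * emeasure lebesgue (S j) = ennreal (L * (K - 1) * c (j1 + j))" .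
 qed
 also have "\<dots> = ennreal (\<Sum>j. L * (K - 1) * c (j1 + j))"
  using c K by (intro suminf_ennreal2 summable_mult) (auto simp: L_def summable_iff_shift[of c j1] add.commute[of j1])
 also have "ennreal (1 / t) * emeasure lebesgue {t..1} + ennreal (\<Sum>j. L * (K - 1) * c (j1 + j)) < \<infinity>"
  using t by (simp add: ennreal_mult_less_top)
 finally show ?thesis unfolding thin_at_def thin_integrand_def .
qed

text \<open>Near a point of \<open>V\<close> the complement is empty and has zero capacity, so the
  shells contribute nothing. A second point is needed for the lower capacity bound behind
  \<open>thin_atI\<close>.\<close>

lemma open_finely_open:
 fixes x y :: 'a
 assumes V: "open V" and ne: "x \<noteq> y"
 shows "finely_open p \<mu> V" unfolding finely_open_def
proof
 fix q assume q: "q \<in> V"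
 obtain q' where q': "q' \<noteq> q" using ne by metis
 obtain \<epsilon> where \<epsilon>: "0 < \<epsilon>" "ball q \<epsilon> \<subseteq> V" using V q open_contains_ball by blast
 show "thin_at p \<mu> (- V) q"
 proof (rule thin_atI[where K=2 and q=\<epsilon> and c="\<lambda>j. 0" and J=0, OF q'])
  fix j :: nat and r assume r: "\<epsilon> / 2 ^ Suc j < r" "r \<le> \<epsilon> / 2 ^ j"
  have r0: "0 < r" using r(1) \<epsilon>(1) by (auto intro: less_trans[rotated])
  have "\<epsilon> / 2 ^ j \<le> \<epsilon> / 1" using \<epsilon>(1) by (intro divide_left_mono) auto
  then have "ball q r \<subseteq> ball q \<epsilon>" using r by (intro subset_ball) simp
  then have "- V \<inter> ball q r = {}" using \<epsilon>(2) by auto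
  moreover have "vcap {} (ball q (2 * r)) \<le> pint (\<lambda>y. 0)" using ACC_zero Lp_zero r0
   by (intro capacity_upper_bound[where v="\<lambda>y. 0" and G="\<lambda>y. 0", OF _ _ _ _ _ _ _ exceptional_empty])
    (auto simp: zero_ereal_def[symmetric])
  ultimately show "vcap (- V \<inter> ball q r) (ball q (2 * r)) \<le> ennreal (0 powr (p - 1) * (r powr (- p) * m q r))"
   by simp
 qed (use \<epsilon> in auto)
qed

end

section \<open>Thinness of the zero set at points with large averages\<close>

context newton_potential
begin

lemma zero_set_capacity:
 assumes pi: "poincare_inequality p \<mu>" and J: "\<And>j. J \<le> j \<Longrightarrow> 1 / 2 \<le> mean w x (rad j)" and Z: "exceptional Z"
  and Y: "\<And>y. y \<in> Y \<Longrightarrow> w y = 0 \<or> y \<in> Z"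
  and r: "J \<le> j" "rad (j + 3) / 2 < r" "r \<le> rad (j + 2) / 2"
 shows "vcap (Y \<inter> ball x r) (ball x (2 * r))
  \<le> ennreal (2 powr p * (8 powr p + (2 * K ^ 3) powr p * Cw) * D (2 * K ^ 3) * dens j x * (r powr (- p) * m x r))"
proof -
 interpret P: poincare_space by unfold_locales (rule pi)
 define \<psi> where "\<psi> t = max 0 (1 - 4 * t)" for t :: real
 have \<psi>_lip: "\<bar>\<psi> s - \<psi> t\<bar> \<le> 8 * \<bar>s - t\<bar>" for s t by (auto simp: \<psi>_def max_def abs_if)
 have \<psi>01: "0 \<le> \<psi> t" "0 \<le> t \<Longrightarrow> t \<le> 1 \<Longrightarrow> \<psi> t \<le> 1" for t by (auto simp: \<psi>_def)
 have rj: "rad j = K ^ 3 * rad (j + 3)" using K by (simp add: rad_def power_add power_divide)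
 have r0: "0 < r" using r(2) rad_pos[of "j + 3"] by linarith
 have rr: "2 * r \<le> rad (j + 2)" "r \<le> rad j" "rad j \<le> 2 * K ^ 3 * r"
 proof -
  show "2 * r \<le> rad (j + 2)" using r by simp
  then show "r \<le> rad j" using rad_antimono[of j "j + 2"] r0 by linarith
  have "K ^ 3 * rad (j + 3) \<le> K ^ 3 * (2 * r)" using r K by (intro mult_left_mono) auto
  then show "rad j \<le> 2 * K ^ 3 * r" by (simp add: rj mult_ac)
 qed
 define \<eta> where "\<eta> y = max 0 (min 1 ((2 * r - dist x y) / (2 * r - r)))" for y
 obtain G where G: "ACC UNIV (\<lambda>y. ereal (\<psi> (w y) * \<eta> y)) G" "Lp G" "(\<lambda>y. \<psi> (w y) * \<eta> y) \<in> borel_measurable \<mu>"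
  and en: "pint G \<le> ennreal (2 powr p) * (ennreal (8 powr p) * ennreal (nu F x (2 * r))
   + ennreal ((1 / (2 * r - r)) powr p) * emeasure \<mu> {y \<in> ball x (2 * r). \<psi> (w y) \<noteq> 0})"
  and G': "\<And>y. 0 \<le> \<psi> (w y) * \<eta> y" "\<And>y. \<psi> (w y) * \<eta> y \<le> 1" "\<And>y. dist x y \<le> r \<Longrightarrow> \<eta> y = 1" "\<And>y. y \<notin> ball x (2 * r) \<Longrightarrow> \<eta> y = 0"
  unfolding \<eta>_def by (rule cutoff_test[of \<psi> r "2 * r" x, OF \<psi>_lip \<psi>01]) (use r0 in auto)
 have mean2: "1 / 2 \<le> mean w x (rad (Suc (Suc j)))" using r(1) by (intro J) simp
 \<comment> \<open>Where the cutoff function is nonzero \<open>w\<close> is below 1/4, while the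
   average is at least 1/2, so the deviation exceeds the 1/8 of the weak type bound.\<close>
 have "{y \<in> ball x (2 * r). \<psi> (w y) \<noteq> 0} \<subseteq> {y \<in> ball x (rad (Suc (Suc j))). 1 / 8 < \<bar>w y - mean w x (rad (Suc (Suc j)))\<bar>}"
  using mean2 rr(1) by (auto simp: \<psi>_def max_def split: if_splits)
 then have M: "emeasure \<mu> {y \<in> ball x (2 * r). \<psi> (w y) \<noteq> 0} \<le> ennreal (Cw * rad j powr p * nu F x (rad j))"
  by (intro order_trans[OF emeasure_mono oscillation_weak_type]) (use w_measurable in measurable)
 have n: "nu F x (2 * r) \<le> nu F x (rad j)"
  using rr(1) rad_antimono[of j "j + 2"] by (intro nu_mono[OF F] subset_ball) simp
 have "vcap (Y \<inter> ball x r) (ball x (2 * r)) \<le> pint G"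
 proof (rule P.capacity_upper_bound[OF G G'(1,2) _ _ Z])
  fix y assume y: "y \<in> Y \<inter> ball x r"
  then have "\<eta> y = 1" "dist x y < 2 * r" using r0 by (auto intro: G'(3))
  then show "y \<in> ball x (2 * r) \<and> (y \<in> Z \<or> \<psi> (w y) * \<eta> y = 1)" using Y[of y] y by (auto simp: \<psi>_def)
 qed (use r0 G'(4) in auto)
 also have "\<dots> \<le> ennreal (2 powr p) * (ennreal (8 powr p) * ennreal (nu F x (rad j))
   + ennreal ((1 / r) powr p) * ennreal (Cw * rad j powr p * nu F x (rad j)))"
 proof -
  have "2 * r - r = r" by simp
  note en' = en[unfolded this]
  show ?thesis by (rule order_trans[OF en']) (intro mult_left_mono add_mono M ennreal_leI n zero_le)
 qed
 also have "\<dots> = ennreal (2 powr p * (8 powr p * nu F x (rad j) + (1 / r) powr p * (Cw * rad j powr p * nu F x (rad j))))"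
  using nu_nonneg Cw_nonneg by (simp add: ennreal_mult[symmetric] ennreal_plus[symmetric] del: ennreal_plus)
 also have "\<dots> \<le> ennreal (2 powr p * (8 powr p + (2 * K ^ 3) powr p * Cw) * D (2 * K ^ 3) * dens j x * (r powr (- p) * m x r))"
 proof (rule ennreal_leI)
  let ?B = "2 powr p * (8 powr p + (2 * K ^ 3) powr p * Cw)"
  have B0: "0 \<le> ?B" using Cw_nonneg by simp
  have "(1 / r) powr p * rad j powr p = (1 / r * rad j) powr p" by (rule powr_mult[symmetric])
  also have "\<dots> \<le> (2 * K ^ 3) powr p" using rr(3) r0 rad_pos[of j] by (intro powr_mono2) (auto simp: field_simps)
  finally have "((1 / r) powr p * rad j powr p) * (Cw * nu F x (rad j)) \<le> (2 * K ^ 3) powr p * (Cw * nu F x (rad j))"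
   using Cw_nonneg nu_nonneg by (intro mult_right_mono) auto
  then have "2 powr p * (8 powr p * nu F x (rad j) + (1 / r) powr p * (Cw * rad j powr p * nu F x (rad j)))
    \<le> 2 powr p * (8 powr p * nu F x (rad j) + (2 * K ^ 3) powr p * (Cw * nu F x (rad j)))"
   by (intro mult_left_mono add_left_mono) (auto simp: mult_ac)
  also have "\<dots> = ?B * nu F x (rad j)" by (simp add: algebra_simps)
  also have "\<dots> \<le> ?B * (D (2 * K ^ 3) * dens j x * (r powr (- p) * m x r))"
  proof (intro mult_left_mono B0)
   have "m x (rad j) \<le> D (2 * K ^ 3) * m x r" using rr(3) r0 rad_pos K by (intro m_compare) auto
   moreover have "rad j powr (- p) \<le> r powr (- p)" using rr(2) r0 by (intro powr_mono2') auto
   ultimately have "dens j x * (rad j powr (- p) * m x (rad j)) \<le> dens j x * (r powr (- p) * (D (2 * K ^ 3) * m x r))"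
    using dens_nonneg m_pos[OF rad_pos, of x j] by (intro mult_left_mono mult_mono) (auto intro: less_imp_le)
   moreover have "dens j x * (rad j powr (- p) * m x (rad j)) = nu F x (rad j)"
    using rad_pos[of j] m_pos[OF rad_pos, of x j] by (simp add: dens_def powr_minus_divide)
   ultimately show "nu F x (rad j) \<le> D (2 * K ^ 3) * dens j x * (r powr (- p) * m x r)" by (simp add: mult_ac)
  qed
  finally show "2 powr p * (8 powr p * nu F x (rad j) + (1 / r) powr p * (Cw * rad j powr p * nu F x (rad j)))
    \<le> ?B * D (2 * K ^ 3) * dens j x * (r powr (- p) * m x r)" by (simp only: mult.assoc)
 qed
 finally show ?thesis .
qed

lemma zero_set_thin:
 assumes pi: "poincare_inequality p \<mu>" and ne: "y \<noteq> x" and s: "summable (\<lambda>j. b j x)"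
  and J: "\<And>j. J \<le> j \<Longrightarrow> 1 / 2 \<le> mean w x (rad j)" and Z: "exceptional Z" and Y: "\<And>y. y \<in> Y \<Longrightarrow> w y = 0 \<or> y \<in> Z"
 shows "thin_at p \<mu> Y x"
proof -
 interpret P: poincare_space by unfold_locales (rule pi)
 define B where "B = 2 powr p * (8 powr p + (2 * K ^ 3) powr p * Cw) * D (2 * K ^ 3)"
 have B: "0 \<le> B" unfolding B_def using Cw_nonneg less_imp_le[OF D_pos[of "2 * K ^ 3"]] by (intro mult_nonneg_nonneg) auto
 show ?thesis
 \<comment> \<open>The starting radius \<open>rad 2 / 2\<close> makes the shells end at
   \<open>rad (j + 2) / 2\<close>, as in \<open>zero_set_capacity\<close>. The power
   \<open>1 / (p - 1)\<close> of the capacity constant turns \<open>dens j x\<close> into the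
   summable \<open>b j x\<close>.\<close>
 proof (rule P.thin_atI[where K=K and q="rad 2 / 2" and c="\<lambda>j. B powr (1 / (p - 1)) * b j x" and J=J, OF ne])
  fix j r assume j: "J \<le> j" and r: "rad 2 / 2 / K ^ Suc j < r" "r \<le> rad 2 / 2 / K ^ j"
  have "rad 2 / 2 / K ^ Suc j = rad (j + 3) / 2" "rad 2 / 2 / K ^ j = rad (j + 2) / 2"
   by (simp_all add: rad_def power_add power_divide eval_nat_numeral)
  then have r': "rad (j + 3) / 2 < r" "r \<le> rad (j + 2) / 2" using r by auto
  have "(B powr (1 / (p - 1)) * b j x) powr (p - 1) = B * dens j x"
   unfolding powr_mult using B dens_nonneg p_gt_1 by (simp add: b_def powr_powr)
  then show "vcap (Y \<inter> ball x r) (ball x (2 * r))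
    \<le> ennreal ((B powr (1 / (p - 1)) * b j x) powr (p - 1) * (r powr (- p) * m x r))"
   using zero_set_capacity[OF pi J Z Y j r'] by (simp add: B_def)
 qed (use K rad_pos[of 2] s b_nonneg in \<open>auto intro: summable_mult\<close>)
qed

end

section \<open>Zeros of Newtonian functions outside the fine interior\<close>

context poincare_space
begin

lemma ex_newton_potential:
 assumes h: "h \<in> newton UNIV" "\<And>x. x \<notin> E \<Longrightarrow> h x = 0" and E: "bounded E" and k: "0 < k"
 obtains F K z R g \<Lambda> C1 where
  "newton_potential \<mu> N p F K z R (\<lambda>x. if \<bar>h x\<bar> = \<infinity> then 1 else min (k * \<bar>real_of_ereal (h x)\<bar>) 1) g \<Lambda> C1"
proof -
 \<comment> \<open>Points where \<open>h\<close> is infinite count as nonzero points, so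
   \<open>w\<close> is 1 there.\<close>
 define w where "w x = (if \<bar>h x\<bar> = \<infinity> then 1 else min (k * \<bar>real_of_ereal (h x)\<bar>) 1)" for x
 obtain C \<Lambda> where C: "poincare_constants C \<Lambda>" using ex_poincare_constants by blast
 then have C0: "0 < C" "1 \<le> \<Lambda>" by (auto simp: poincare_constants_def)
 obtain z :: 'a and R where R: "0 < R" "E \<subseteq> ball z R" using bounded_subset_ballD[OF E, of undefined] by blast
 have hm[measurable]: "h \<in> borel_measurable \<mu>" using h(1) by (simp add: newton_space_iff)
 have wm[measurable]: "w \<in> borel_measurable \<mu>" unfolding w_def[abs_def] by measurable
 have w01: "0 \<le> w x" "w x \<le> 1" for x using k by (auto simp: w_def)
 have w_out: "w x = 0" if "x \<notin> ball z R" for x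
 proof -
  have "x \<notin> E" using that R(2) by blast
  then show ?thesis by (simp add: h(2) w_def)
 qed
 obtain g0 where g0: "Lp g0" "ACC UNIV h g0" using h(1) by (auto simp: newton_space_iff)
 have acc: "ACC UNIV (\<lambda>x. ereal (w x)) (\<lambda>x. ennreal k * g0 x)"
 proof (rule ACC_lipschitz_comp[OF g0(2) _ exceptional_empty])
  fix P Q x x' assume "h P = ereal x" "h Q = ereal x'"
  then have "w P = min (k * \<bar>x\<bar>) 1" "w Q = min (k * \<bar>x'\<bar>) 1" by (auto simp: w_def)
  moreover have "\<bar>k * \<bar>x\<bar> - k * \<bar>x'\<bar>\<bar> = k * \<bar>\<bar>x\<bar> - \<bar>x'\<bar>\<bar>" using k by (simp add: right_diff_distrib[symmetric] abs_mult)
  moreover have "k * \<bar>\<bar>x\<bar> - \<bar>x'\<bar>\<bar> \<le> k * \<bar>x - x'\<bar>" using k by (intro mult_left_mono) auto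
  moreover have "\<bar>min s 1 - min t 1\<bar> \<le> \<bar>s - t\<bar>" for s t :: real by auto
  note this[of "k * \<bar>x\<bar>" "k * \<bar>x'\<bar>"]
  ultimately have "\<bar>w P - w Q\<bar> \<le> k * \<bar>x - x'\<bar>" by simp
  then show "\<exists>r r'. ereal (w P) = ereal r \<and> ereal (w Q) = ereal r' \<and> \<bar>r - r'\<bar> \<le> k * \<bar>x - x'\<bar>" by auto
 qed (use k in auto)
 have "(\<lambda>x. ereal (w x)) \<in> borel_measurable (restrict_space \<mu> UNIV)" unfolding measurable_restrict_UNIV by measurable
 then obtain S where S[measurable]: "S \<in> sets borel" and Sw: "AE x in \<mu>. x \<in> UNIV \<longrightarrow> (ereal (w x) = 0 \<longleftrightarrow> x \<in> S)"
  and acc': "ACC UNIV (\<lambda>x. ereal (w x)) (\<lambda>x. if x \<in> S then 0 else ennreal k * g0 x)"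
  by (rule ACC_nonzero[OF UNIV_mu _ acc]) blast
 \<comment> \<open>The gradient is set to 0 on the zero set of \<open>w\<close> and outside
   \<open>ball z R\<close>, where \<open>w\<close> vanishes anyway, because the potential needs a
   density supported in that ball.\<close>
 define g where "g x = (if x \<in> S \<union> - ball z R then 0 else ennreal k * g0 x)" for x
 have [measurable]: "borel_fun g0" by (rule Lp_measurable[OF g0(1)])
 have gm[measurable]: "borel_fun g" unfolding g_def[abs_def] by measurable
 have gACC: "ACC UNIV (\<lambda>x. ereal (w x)) g"
 proof (rule ACC_change_gradient[OF acc' gm])
  show "AE x in \<mu>. x \<in> UNIV \<longrightarrow> (if x \<in> S then 0 else ennreal k * g0 x) = g x"
   using Sw by eventually_elim (use w_out in \<open>auto simp: g_def\<close>)
 qed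
 have gLp: "Lp g" by (rule Lp_mono[OF Lp_cmult[OF g0(1), of "ennreal k"] gm]) (auto simp: g_def)
 define F where "F x = epowr (g x) p" for x
 have "borel_fun F" unfolding F_def[abs_def] by measurable
 then have F: "L1 F" using gLp by (simp add: L1_def Lp_def F_def)
 \<comment> \<open>The ratio is the least one allowed by both locales: 4 for the potential and twice
   the dilation constant for the averages.\<close>
 have "newton_potential \<mu> N p F (max 4 (2 * \<Lambda>)) z R w g \<Lambda> C"
 proof unfold_locales
  show "0 < r \<Longrightarrow> muint_on (ball x r) (\<lambda>y. ennreal \<bar>w y - mean w x r\<bar>)
   \<le> ennreal (C * r * m x r * (nu F x (\<Lambda> * r) / m x (\<Lambda> * r)) powr (1 / p))" for x r
  proof -
   assume r: "0 < r"
   have \<Lambda>r: "0 < \<Lambda> * r" using C0 r by simp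
   have uD: "(\<lambda>x. ereal (w x)) \<in> dirichlet UNIV"
    using gACC gLp by (auto simp: dirichlet_space_iff measurable_restrict_UNIV)
   have "muint (\<lambda>y. e2ennreal \<bar>ereal (w y)\<bar>) \<le> muint (\<lambda>y. indicator (ball z R) y)"
   proof (intro nn_integral_mono)
    fix y show "e2ennreal \<bar>ereal (w y)\<bar> \<le> indicator (ball z R) y"
     using w_out[of y] w01[of y] by (cases "y \<in> ball z R") auto
   qed
   also have "\<dots> < \<infinity>" using ball_finite[OF R(1), of z] by (simp add: sets_mu_borel)
   finally have fin: "muint (\<lambda>y. e2ennreal \<bar>ereal (w y)\<bar>) < \<infinity>" .
   have "muint_on (ball x r) (\<lambda>y. e2ennreal \<bar>ereal (w y) - ereal (mean_value \<mu> (ball x r) (\<lambda>y. ereal (w y)))\<bar>)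
     \<le> ennreal (C * r * m x r) * epowr (energy (\<lambda>x. ereal (w x)) (ball x (\<Lambda> * r)) / ennreal (m x (\<Lambda> * r))) (1 / p)"
    by (rule poincare_constantsD[OF C uD fin r])
   also have "\<dots> \<le> ennreal (C * r * m x r) * epowr (ennreal (nu F x (\<Lambda> * r)) / ennreal (m x (\<Lambda> * r))) (1 / p)"
    using energy_le[OF gACC gLp, of "ball x (\<Lambda> * r)"] L1_ball[OF F, of x "\<Lambda> * r"]
    by (intro mult_left_mono epowr_mono divide_right_mono_ennreal) (auto simp: F_def)
   also have "\<dots> = ennreal (C * r * m x r * (nu F x (\<Lambda> * r) / m x (\<Lambda> * r)) powr (1 / p))"
    using C0 r m_pos[OF r, of x] m_pos[OF \<Lambda>r, of x] nu_nonneg[of F x "\<Lambda> * r"]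
    by (simp add: divide_ennreal epowr_ennreal ennreal_mult[symmetric])
   finally show ?thesis unfolding mean_value_real[OF wm w01(1) r] e2ennreal_abs_diff .
  qed
 qed (use F wm w01 w_out gACC gLp C0 R in \<open>auto simp: F_def g_def\<close>)
 then show ?thesis using that unfolding w_def[abs_def] by blast
qed

text \<open>Up to an exceptional set, \<open>{h \<noteq> 0}\<close> is the union of the sets where \<open>min (k |h|) 1 = 1\<close>.\<close>

lemma newton_zero_off_fine_interior:
 fixes x0 y0 :: 'a
 assumes h: "h \<in> newton UNIV" "\<And>x. x \<notin> E \<Longrightarrow> h x = 0" and E: "bounded E" and ne: "x0 \<noteq> y0"
 shows "\<exists>Z. exceptional Z \<and> (\<forall>x. x \<notin> fine_interior p \<mu> E \<longrightarrow> x \<notin> Z \<longrightarrow> h x = 0)"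
proof -
 define w where "w n x = (if \<bar>h x\<bar> = \<infinity> then 1 else min (real (Suc n) * \<bar>real_of_ereal (h x)\<bar>) 1)" for n x
 \<comment> \<open>The set \<open>Z\<close> is fixed before \<open>A\<close> and \<open>Z'\<close>.
   This permits taking the union over \<open>n\<close> first and then choosing \<open>A\<close> as
   the complement of a set from which that union has been removed.\<close>
 let ?P = "\<lambda>n Z. exceptional Z \<and> (\<forall>x Z' A. w n x = 1 \<longrightarrow> x \<notin> Z \<longrightarrow> exceptional Z' \<longrightarrow>
   (\<forall>y\<in>A. w n y = 0 \<or> y \<in> Z') \<longrightarrow> thin_at p \<mu> A x)"
 have "\<exists>Z. ?P n Z" for n
 proof -
  obtain F K z R g \<Lambda> C1 where "newton_potential \<mu> N p F K z R (w n) g \<Lambda> C1"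
   unfolding w_def[abs_def] by (rule ex_newton_potential[OF h E, of "real (Suc n)"]) auto
  then interpret I: newton_potential \<mu> N p F K z R "w n" g \<Lambda> C1 .
  show ?thesis
  proof (intro exI conjI allI impI)
   fix x Z' A assume x: "w n x = 1" "x \<notin> {x. w n x = 1 \<and> \<not> (summable (\<lambda>j. I.b j x) \<and> (\<exists>J. \<forall>j\<ge>J. 1 / 2 \<le> mean (w n) x (I.rad j)))}"
    and Z': "exceptional Z'" "\<forall>y\<in>A. w n y = 0 \<or> y \<in> Z'"
   then obtain J where J: "\<forall>j\<ge>J. 1 / 2 \<le> mean (w n) x (I.rad j)" by blast
   obtain y where y: "y \<noteq> x" using ne by metis
   show "thin_at p \<mu> A x" using x Z' J by (intro I.zero_set_thin[OF poincare_inequality y _ _ Z'(1), of J]) auto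
  qed (rule I.large_means_qe)
 qed
 then have "\<forall>n. \<exists>Z. ?P n Z" by (rule allI)
 from choice[OF this] obtain Z where Z: "\<forall>n. ?P n (Z n)" by (rule exE)
 have Zx: "exceptional (\<Union>n. Z n)" using Z by (intro exceptional_UN) simp
 \<comment> \<open>Removing the bad points enlarges the complement of \<open>V\<close> by an
   exceptional set only, which thinness tolerates.\<close>
 define V where "V = {x. h x \<noteq> 0} - (\<Union>n. Z n)"
 have "finely_open p \<mu> V" unfolding finely_open_def
 proof
  fix x assume x: "x \<in> V"
  have "\<exists>n. w n x = 1"
  proof (cases "h x")
   case (real t)
   then have "t \<noteq> 0" using x by (auto simp: V_def)
   then obtain n :: nat where "1 / \<bar>t\<bar> < real n" using reals_Archimedean2 by blast
   then have "1 \<le> real (Suc n) * \<bar>t\<bar>" using \<open>t \<noteq> 0\<close> by (simp add: field_simps)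
   then show ?thesis using real by (intro exI[of _ n]) (simp add: w_def)
  qed (auto simp: w_def)
  then obtain n where "w n x = 1" by blast
  moreover have "\<forall>y\<in>- V. w n y = 0 \<or> y \<in> (\<Union>n. Z n)" by (auto simp: V_def w_def)
  ultimately show "thin_at p \<mu> (- V) x" using Z Zx x by (auto simp: V_def)
 qed
 moreover have "V \<subseteq> E" using h(2) by (auto simp: V_def)
 ultimately have "V \<subseteq> fine_interior p \<mu> E" by (auto simp: fine_interior_def)
 then show ?thesis using Zx by (intro exI[of _ "\<Union>n. Z n"]) (auto simp: V_def)
qed

end

theorem theorem8p3:
  fixes \<mu> :: "'a::metric_space measure"
    and p :: real
    and E E0 :: "'a set"
    and f \<psi>1 \<psi>2 :: "'a \<Rightarrow> ereal"
  assumes "metric_measure \<mu>"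
    and "complete (UNIV :: 'a set)"
    and "1 < p"
    and "poincare_inequality p \<mu>"
    and "doubling \<mu>"
    and "bounded E" and "E \<in> sets \<mu>"
    and "sobolev_capacity p \<mu> (- E) > 0"
    and "path_almost_open p \<mu> E0" and "E0 \<in> sets \<mu>"
    and "fine_interior p \<mu> E \<subseteq> E0" and "E0 \<subseteq> E"
    and "f \<in> dirichlet_space p \<mu> E"
    and "obstacle_class p \<mu> \<psi>1 \<psi>2 f E \<noteq> {}"
  shows
    "coincide_qe p \<mu> E
       (obstacle_solutions p \<mu> \<psi>1 \<psi>2 f E)
       (extend_by f E0 ` obstacle_solutions p \<mu> \<psi>1 \<psi>2 f E0)
     \<and> (emeasure \<mu> (E - E0) = 0 \<longrightarrow>
         (\<forall>u \<in> obstacle_class p \<mu> \<psi>1 \<psi>2 f E. p_energy p \<mu> E u = p_energy p \<mu> E0 u))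
     \<and> (emeasure \<mu> (frontier E) = 0 \<longrightarrow>
         (\<forall>u \<in> obstacle_class p \<mu> \<psi>1 \<psi>2 f E. p_energy p \<mu> E u = p_energy p \<mu> E0 u))
     \<and> (\<forall>\<Omega>. open \<Omega> \<and> E \<subseteq> \<Omega> \<and> f \<in> dirichlet_space p \<mu> \<Omega> \<longrightarrow>
         coincide_qe p \<mu> \<Omega>
           (extend_by f E ` obstacle_solutions p \<mu> \<psi>1 \<psi>2 f E)
           (obstacle_solutions' p \<mu> \<psi>1 \<psi>2 f \<Omega> E)
         \<and> coincide_qe p \<mu> \<Omega>
           (extend_by f E0 ` obstacle_solutions p \<mu> \<psi>1 \<psi>2 f E0)
           (obstacle_solutions' p \<mu> \<psi>1 \<psi>2 f \<Omega> E))"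
proof -
 obtain N where N: "sets N = sets borel" "\<mu> = completion N"
  and balls: "\<And>x r. 0 < r \<Longrightarrow> 0 < emeasure \<mu> (ball x r) \<and> emeasure \<mu> (ball x r) < \<infinity>"
  using assms(1) unfolding metric_measure_def by blast
 interpret poincare_space \<mu> N p using N balls assms(3-5) by unfold_locales auto
 \<comment> \<open>The capacity estimates need two distinct points. In a one-point space the
   positive capacity of the complement forces \<open>E\<close> to be empty.\<close>
 have trivial: "E = {}" if "\<not> (\<exists>x0 y0 :: 'a. x0 \<noteq> y0)"
 proof -
  have "- E \<noteq> {}"
  proof
   assume "- E = {}"
   then have "sobolev_capacity p \<mu> (- E) = 0" by (simp only: sobolev_capacity_0_iff exceptional_empty)
   then show False using assms(8) by simp
  qed
  then obtain a where a: "a \<notin> E" by blast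
  have eq: "\<forall>x0 y0 :: 'a. x0 = y0" using that unfolding not_ex not_not .
  show ?thesis
  proof (rule equals0I)
   fix x assume "x \<in> E"
   moreover have "x = a" by (rule eq[rule_format])
   ultimately show False using a by simp
  qed
 qed
 have vanish: "\<exists>Z. exceptional Z \<and> (\<forall>x. x \<notin> E0 \<longrightarrow> x \<notin> Z \<longrightarrow> h x = 0)"
  if h: "h \<in> newton_space p \<mu> UNIV" "\<And>x. x \<notin> E \<Longrightarrow> h x = 0" for h
 proof (cases "\<exists>x0 y0 :: 'a. x0 \<noteq> y0")
  case True
  then obtain x0 y0 :: 'a where ne: "x0 \<noteq> y0" by blast
  from newton_zero_off_fine_interior[OF h assms(6) ne] show ?thesis using assms(11) by blast
 next
  case False
  then show ?thesis using trivial h(2) by (intro exI[of _ "{}"]) auto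
 qed
 have corr: "coincide_qe p \<mu> \<Omega> (extend_by f E0 ` obstacle_solutions p \<mu> \<psi>1 \<psi>2 f E0) (obstacle_solutions' p \<mu> \<psi>1 \<psi>2 f \<Omega> E)"
  if "\<Omega> \<in> sets \<mu>" "E \<subseteq> \<Omega>" "f \<in> dirichlet_space p \<mu> \<Omega>" for \<Omega>
  by (rule obstacle_correspondence[OF assms(10,7) that(1) assms(12) that(2) assms(9) vanish that(3) assms(14)])
 \<comment> \<open>The problems on \<open>E\<close> and \<open>E0\<close> are compared by taking
   \<open>E\<close> itself as the ambient set.\<close>
 have E0: "coincide_qe p \<mu> E (obstacle_solutions p \<mu> \<psi>1 \<psi>2 f E) (extend_by f E0 ` obstacle_solutions p \<mu> \<psi>1 \<psi>2 f E0)"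
  using corr[OF assms(7) order_refl assms(13)] unfolding obstacle_class_self by (rule coincide_qe_sym)
 have energies: "\<forall>u\<in>obstacle_class p \<mu> \<psi>1 \<psi>2 f E. p_energy p \<mu> E u = p_energy p \<mu> E0 u" if "E - E0 \<in> null_sets \<mu>"
  using p_energy_path_almost_open[OF assms(7,10,12,9) that] by (simp add: obstacle_class_def)
 have "E - E0 \<in> null_sets \<mu>" if "emeasure \<mu> (frontier E) = 0"
 proof (rule null_mu_subset)
  show "frontier E \<in> null_sets \<mu>" using that by (intro null_setsI sets_mu_borel) auto
  \<comment> \<open>Open sets are finely open, so the interior lies in the fine interior, and
    \<open>E - E0\<close> is contained in the boundary of \<open>E\<close>.\<close>
  have "interior E \<subseteq> E0"
  proof (cases "\<exists>x0 y0 :: 'a. x0 \<noteq> y0")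
   case True
   then have "finely_open p \<mu> (interior E)" using open_finely_open[OF open_interior] by blast
   then have "interior E \<subseteq> fine_interior p \<mu> E" unfolding fine_interior_def using interior_subset by blast
   then show ?thesis using assms(11) by simp
  qed (use trivial in simp)
  then show "E - E0 \<subseteq> frontier E" unfolding frontier_def using closure_subset by blast
 qed
 moreover have "E - E0 \<in> null_sets \<mu>" if "emeasure \<mu> (E - E0) = 0"
  using that assms(7,10) by (intro null_setsI sets.Diff)
 moreover have "coincide_qe p \<mu> \<Omega> (extend_by f E ` obstacle_solutions p \<mu> \<psi>1 \<psi>2 f E) (obstacle_solutions' p \<mu> \<psi>1 \<psi>2 f \<Omega> E) \<and>
   coincide_qe p \<mu> \<Omega> (extend_by f E0 ` obstacle_solutions p \<mu> \<psi>1 \<psi>2 f E0) (obstacle_solutions' p \<mu> \<psi>1 \<psi>2 f \<Omega> E)"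
  if \<Omega>: "open \<Omega> \<and> E \<subseteq> \<Omega> \<and> f \<in> dirichlet_space p \<mu> \<Omega>" for \<Omega>
 proof -
  have "coincide_qe p \<mu> \<Omega> (extend_by f E0 ` obstacle_solutions p \<mu> \<psi>1 \<psi>2 f E0) (obstacle_solutions' p \<mu> \<psi>1 \<psi>2 f \<Omega> E)"
   using \<Omega> by (intro corr sets_mu_borel) auto
  then show ?thesis using coincide_qe_extend_trans[OF E0 _ assms(12)] \<Omega> by blast
 qed
 ultimately show ?thesis using E0 energies by (intro conjI impI allI) auto
qed

end
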